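(* Let $2<p\le 6$. There exists $\overline{\alpha}_3\in(0,e)$ such that for all $0<\alpha\le\overline{\alpha}_3$ and all $v\in C_c^\infty(\mathbb{H}^3)$ there holds $$\int_{\mathbb{H}^3}|\nabla_{\mathbb{H}^3}v|^2dV\ \ge\ \int_{\mathbb{H}^3}v^2dV+\frac14\int_{\mathbb{H}^3}\frac{v^2}{\sinh^2\rho}dV+S_{3,p}\Big(\int_{\mathbb{H}^3}(\sinh\rho)^{\frac{p-6}{2}}X^{\frac{p+2}{2}}\big(\alpha\tanh(\rho/2)\big)|v|^p\,dV\Big)^{2/p}.$$ Moreover the constant $S_{3,p}$ is sharp for all $0<\alpha\le\overline{\alpha}_3$.
   Context: $\mathbb{H}^3$ is the $3$-dimensional hyperbolic space (curvature $-1$) with Riemannian gradient $\nabla_{\mathbb{H}^3}$ and volume element $dV$; $\rho=\rho(x)$ is the hyperbolic distance from $x$ to a fixed point $x_0\in\mathbb{H}^3$. Functions are real-valued. $X(t)=\frac{1}{1-\ln t}$ for $t\in(0,e)$, and $X^{q}(t)=(X(t))^q$. $S_{3,p}$ denotes the best (largest) constant in the inequality $\int_{\mathbb{R}^3}|\nabla u|^2dx\ge S_{3,p}\big(\int_{\mathbb{R}^3}|x|^{\frac{p-6}{2}}|u|^pdx\big)^{2/p}$ for all $u\in C_c^\infty(\mathbb{R}^3)$. "Sharp" means that the constant cannot be replaced by a larger one. *)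

theory Defs
  imports "HOL-Analysis.Analysis"
begin

section \<open>Test functions\<close>

text \<open>\<open>Ck k f\<close>: \<open>f\<close> is \<open>k\<close> times continuously differentiable on the whole space.\<close>

primrec Ck :: "nat \<Rightarrow> ('a::euclidean_space \<Rightarrow> real) \<Rightarrow> bool" where
  "Ck 0 f \<longleftrightarrow> continuous_on UNIV f"
| "Ck (Suc k) f \<longleftrightarrow>
     (\<forall>x. f differentiable (at x)) \<and> (\<forall>h. Ck k (\<lambda>x. frechet_derivative f (at x) h))"

definition smooth :: "('a::euclidean_space \<Rightarrow> real) \<Rightarrow> bool" where
  "smooth f \<longleftrightarrow> (\<forall>k. Ck k f)"

text \<open>\<open>C\<^sub>c\<^sup>\<infinity>(U)\<close> for open \<open>U\<close>, its members being extended by zero outside \<open>U\<close>.\<close>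

definition Cc_smooth :: "'a::euclidean_space set \<Rightarrow> ('a \<Rightarrow> real) set" where
  "Cc_smooth U = {f. smooth f \<and> compact (closure {x. f x \<noteq> 0}) \<and> closure {x. f x \<noteq> 0} \<subseteq> U}"

definition grad :: "('a::euclidean_space \<Rightarrow> real) \<Rightarrow> 'a \<Rightarrow> 'a" where
  "grad f x = (\<Sum>b\<in>Basis. frechet_derivative f (at x) b *\<^sub>R b)"

lemma grad_inner:
  assumes "f differentiable (at x)"
  shows "grad f x \<bullet> h = frechet_derivative f (at x) h"
proof -
  have lin: "linear (frechet_derivative f (at x))"
    using assms by (rule linear_frechet_derivative)
  have "frechet_derivative f (at x) h =
      frechet_derivative f (at x) (\<Sum>b\<in>Basis. (h \<bullet> b) *\<^sub>R b)"
    by (simp add: euclidean_representation)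
  also have "\<dots> = (\<Sum>b\<in>Basis. (h \<bullet> b) * frechet_derivative f (at x) b)"
    by (simp add: linear_sum[OF lin] linear_scale[OF lin])
  finally show ?thesis
    by (simp add: grad_def inner_sum_left inner_commute[of h] mult.commute)
qed


section \<open>Hyperbolic space: the Poincare ball model\<close>

text \<open>
  \<open>\<H>\<^sup>3\<close> is the open unit ball of \<open>\<real>\<^sup>3\<close> with the metric
  \<open>(2 / (1 - \<bar>x\<bar>\<^sup>2))\<^sup>2 \<bar>dx\<bar>\<^sup>2\<close>, which has constant curvature \<open>-1\<close>.
\<close>

abbreviation hspace :: "(real^3) set" where
  "hspace \<equiv> ball 0 1"

definition hfactor :: "real^3 \<Rightarrow> real" where
  "hfactor x = 2 / (1 - (norm x)\<^sup>2)"

definition hmetric :: "real^3 \<Rightarrow> real^3 \<Rightarrow> real^3 \<Rightarrow> real" where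
  "hmetric x \<xi> \<eta> = (hfactor x)\<^sup>2 * (\<xi> \<bullet> \<eta>)"

definition hgrad :: "(real^3 \<Rightarrow> real) \<Rightarrow> real^3 \<Rightarrow> real^3" where
  "hgrad f x = (1 / (hfactor x)\<^sup>2) *\<^sub>R grad f x"

lemma hmetric_hgrad:
  assumes "x \<in> hspace" "f differentiable (at x)"
  shows "hmetric x (hgrad f x) \<xi> = frechet_derivative f (at x) \<xi>"
proof -
  have "(norm x)\<^sup>2 < 1"
    using assms(1) by (simp add: power_less_one_iff)
  then have "hfactor x \<noteq> 0"
    by (simp add: hfactor_def)
  then show ?thesis
    using grad_inner[OF assms(2)] by (simp add: hmetric_def hgrad_def)
qed

text \<open>The density is \<open>sqrt (det g)\<close> for the metric \<open>g\<close> above.\<close>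

definition hvol :: "(real^3) measure" where
  "hvol = density (restrict_space lborel hspace) (\<lambda>x. ennreal ((hfactor x) ^ 3))"

text \<open>Closed form of the geodesic distance of the metric above.\<close>

definition hdist :: "real^3 \<Rightarrow> real^3 \<Rightarrow> real" where
  "hdist x y = arcosh (1 + 2 * (norm (x - y))\<^sup>2 / ((1 - (norm x)\<^sup>2) * (1 - (norm y)\<^sup>2)))"

lemma hdist_0:
  assumes "x \<in> hspace"
  shows "hdist 0 x = ln ((1 + norm x) / (1 - norm x))"
proof -
  define r where "r = norm x"
  have r: "0 \<le> r" "r < 1"
    using assms by (auto simp: r_def)
  have r2: "1 - r\<^sup>2 > 0"
    using r by (simp add: power_less_one_iff)
  define t where "t = ln ((1 + r) / (1 - r))"
  have t: "t \<ge> 0" "exp t = (1 + r) / (1 - r)"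
    using r by (auto simp: t_def field_simps)
  have "cosh t = ((1 + r) / (1 - r) + (1 - r) / (1 + r)) / 2"
    using r by (simp add: cosh_def exp_minus t(2))
  also have "\<dots> = 1 + 2 * r\<^sup>2 / (1 - r\<^sup>2)"
  proof -
    have "(1 + r) * (1 - r) = 1 - r\<^sup>2"
      by (simp add: power2_eq_square algebra_simps)
    then have "(1 + r) / (1 - r) + (1 - r) / (1 + r) = ((1 + r)\<^sup>2 + (1 - r)\<^sup>2) / (1 - r\<^sup>2)"
      using r by (simp add: add_frac_eq power2_eq_square mult.commute)
    then show ?thesis
      using r2 by (simp add: field_simps power2_eq_square)
  qed
  finally have "arcosh (1 + 2 * r\<^sup>2 / (1 - r\<^sup>2)) = t"
    using arcosh_cosh_real[OF t(1)] by simp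
  then show ?thesis
    by (simp add: hdist_def t_def r_def)
qed


section \<open>The logarithmic weight and the best constant\<close>

definition X :: "real \<Rightarrow> real" where
  "X t = 1 / (1 - ln t)"

text \<open>
  The defining inequality is preserved under limits in \<open>S\<close>, so for \<open>2 < p \<le> 6\<close> the supremum is
  the largest admissible constant. For these \<open>p\<close> the weight is locally integrable, since
  \<open>(p - 6) / 2 > -2\<close>; its value \<open>0\<close> at the origin (also for \<open>p = 6\<close>) only affects a null set.
\<close>

definition S3 :: "real \<Rightarrow> real" where
  "S3 p = Sup {S. \<forall>u \<in> Cc_smooth (UNIV :: (real^3) set).
     (LINT x|lborel. (norm (grad u x))\<^sup>2)
       \<ge> S * (LINT x|lborel. norm x powr ((p - 6) / 2) * \<bar>u x\<bar> powr p) powr (2 / p)}"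

end

theory Submission
  imports Defs "HOL-Complex_Analysis.Great_Picard"
begin

text \<open>
  In the ball model centred at the origin the substitution
  \<open>\<psi> = sqrt (2r) / (1 - r\<^sup>2) v\<close>, with \<open>r = \<bar>x\<bar>\<close>, turns the energy minus the two Hardy terms into
  \<open>\<integral> (1 - r\<^sup>2) / r \<bar>\<nabla>\<psi>\<bar>\<^sup>2 + \<psi>\<^sup>2 / r\<close>. The radial map \<open>Y x = (1 / \<Sigma>(r)) x / r\<close> with
  \<open>\<Sigma>(r) = A - ln r - a r\<^sup>2\<close>, \<open>A = 1 - ln \<alpha>\<close> and \<open>a = A / 2\<close>, sends the punctured ball to a
  punctured ball of \<open>\<real>\<^sup>3\<close>. Applying the Euclidean inequality with constant \<open>S3 p\<close> to the function
  \<open>u\<close> given by \<open>u \<circ> Y = (1 - r\<^sup>4) \<psi>\<close> controls the weighted norm of \<open>\<psi>\<close> away from the unit sphere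
  and leaves a third of \<open>\<integral> r (1 - r\<^sup>2) \<bar>\<nabla>\<psi>\<bar>\<^sup>2 + \<psi>\<^sup>2 / r\<close> unused. What is missing near the sphere is
  bounded by this remainder, through a weighted Sobolev inequality of Gagliardo-Nirenberg type; here \<open>A\<close>
  must be large, that is, \<open>\<alpha>\<close> small. A cut-off removes the condition \<open>v = 0\<close> near the origin, and an
  isometric inversion moves \<open>x0\<close> to the origin.

  For sharpness, the energy of a radial function only involves its radial derivative, and on such
  functions \<open>Y\<close> with \<open>a = 0\<close> carries the Euclidean quotient exactly to the hyperbolic one, up to a term
  of favourable sign. So it suffices that \<open>S3 p\<close> is approached by radial functions. Among the Lipschitz
  functions satisfying bounds that survive every polarization, one minimising the second moment is fixed
  by all polarizations towards the origin, hence radial; mollifying it and cutting it off near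
  the origin gives a radial test function. The Dirichlet energy is encoded by the quantities \<open>Jh h\<close>, which are
  monotone under polarization and convolution and make sense without derivatives.
\<close>

subsection \<open>Smooth functions on open sets\<close>

text \<open>The substitution that fits radial functions exactly is
  \<open>\<phi> = sqrt (1 - r^2) \<psi>\<close>, but for test functions on the punctured ball the
  integral of (1 - r^2)/r |grad \<psi>|^2 + \<psi>^2/r equals that of |grad \<phi>|^2/r minus that
  of \<phi>^2/(r (1 - r^2)^2). The last term helps sharpness and hurts the inequality, so the
  inequality needs another transplantation with room to spare. The factor 1 - r^4 is flatter at the
  origin than sqrt (1 - r^2) and dominates it for r^2 \<le> 1/2, so \<open>S3 p\<close> is kept
  without loss there. The term a r^2 multiplies the radial stretching of \<open>Y\<close> by k = 1 +
  2 a r^2: radial energy is divided by k, the norm gains a factor k, and this pays for all errors.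
  The price is a factor k on the tangential energy, affordable because that energy also carries
  1/\<Sigma>^2 and \<Sigma> exceeds A - a = a. The same factor 1/\<Sigma>^2 forces radial
  competitors in the sharpness part: on other functions the transported Euclidean energy undercounts
  the tangential derivatives.\<close>

primrec Ck_on :: "nat \<Rightarrow> 'a::euclidean_space set \<Rightarrow> ('a \<Rightarrow> real) \<Rightarrow> bool" where
  "Ck_on 0 U f \<longleftrightarrow> continuous_on U f"
| "Ck_on (Suc k) U f \<longleftrightarrow>
     (\<forall>x\<in>U. f differentiable (at x)) \<and> (\<forall>h. Ck_on k U (\<lambda>x. frechet_derivative f (at x) h))"

definition smooth_on :: "'a::euclidean_space set \<Rightarrow> ('a \<Rightarrow> real) \<Rightarrow> bool" where
  "smooth_on U f \<longleftrightarrow> (\<forall>k. Ck_on k U f)"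

lemma Ck_on_UNIV: "Ck_on k UNIV f \<longleftrightarrow> Ck k f"
  by (induction k arbitrary: f) auto

lemma smooth_on_UNIV: "smooth_on UNIV f \<longleftrightarrow> smooth f"
  by (simp add: smooth_on_def smooth_def Ck_on_UNIV)

lemma Ck_on_cong:
  assumes "open U" "\<And>x. x \<in> U \<Longrightarrow> f x = g x" "Ck_on k U f"
  shows "Ck_on k U g"
  using assms(2,3)
proof (induction k arbitrary: f g)
  case 0
  then show ?case by (auto cong: continuous_on_cong)
next
  case (Suc k)
  have d: "f differentiable (at x)" if "x \<in> U" for x using Suc that by auto
  have d': "g differentiable (at x)" if "x \<in> U" for x
    using d[OF that] Suc.prems(1)
    unfolding differentiable_def
    by (metis assms(1) has_derivative_transform_within_open that)
  have eq: "frechet_derivative f (at x) = frechet_derivative g (at x)" if "x \<in> U" for x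
    using frechet_derivative_transform_within_open[OF d[OF that] assms(1) that] Suc.prems(1) by blast
  show ?case
    using d' Suc.IH[of "\<lambda>x. frechet_derivative f (at x) h" "\<lambda>x. frechet_derivative g (at x) h" for h]
      Suc.prems(2) eq by auto
qed

text \<open>Any explicit family \<open>D\<close> of derivatives may replace the chosen
  \<open>frechet_derivative\<close>: uniqueness of derivatives identifies the two on the open set
  \<open>U\<close>, and \<open>Ck_on_cong\<close> transfers the regularity.\<close>

lemma Ck_on_SucI:
  assumes "open U" "\<And>x. x \<in> U \<Longrightarrow> (f has_derivative D x) (at x)" "\<And>h. Ck_on k U (\<lambda>x. D x h)"
  shows "Ck_on (Suc k) U f"
proof -
  have "f differentiable (at x)" if "x \<in> U" for x
    using assms(2)[OF that] differentiable_def by blast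
  moreover have "frechet_derivative f (at x) = D x" if "x \<in> U" for x
    using frechet_derivative_at[OF assms(2)[OF that]] by simp
  ultimately show ?thesis
    using Ck_on_cong[OF assms(1) _ assms(3)] by auto
qed

lemma Ck_on_SucD_deriv:
  "Ck_on (Suc k) U f \<Longrightarrow> x \<in> U \<Longrightarrow> (f has_derivative frechet_derivative f (at x)) (at x)"
  by (simp add: frechet_derivative_works)

lemma Ck_on_SucD: "Ck_on (Suc k) U f \<Longrightarrow> Ck_on k U f"
proof (induction k arbitrary: f)
  case 0
  then show ?case
    by (auto intro!: differentiable_imp_continuous_on differentiable_at_imp_differentiable_on)
next
  case (Suc k)
  then show ?case by (metis Ck_on.simps(2))
qed

lemma Ck_on_subset: "V \<subseteq> U \<Longrightarrow> Ck_on k U f \<Longrightarrow> Ck_on k V f"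
  by (induction k arbitrary: f) (auto intro: continuous_on_subset)

lemma Ck_on_Un: "open U \<Longrightarrow> open V \<Longrightarrow> Ck_on k U f \<Longrightarrow> Ck_on k V f \<Longrightarrow> Ck_on k (U \<union> V) f"
  by (induction k arbitrary: f) (auto intro: continuous_on_open_Un)

lemma Ck_on_const: "Ck_on k U (\<lambda>x. c)"
  by (induction k arbitrary: c) auto

lemma Ck_on_inner: 
  assumes "open U" shows "Ck_on k U (\<lambda>x. x \<bullet> b)"
proof (cases k)
  case (Suc m)
  show ?thesis unfolding Suc
    by (rule Ck_on_SucI[OF assms, where D="\<lambda>x h. h \<bullet> b"])
      (auto intro!: derivative_eq_intros Ck_on_const)
qed (auto intro!: continuous_intros)

lemma Ck_on_add:
  assumes "open U" shows "Ck_on k U f \<Longrightarrow> Ck_on k U g \<Longrightarrow> Ck_on k U (\<lambda>x. f x + g x)"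
proof (induction k arbitrary: f g)
  case (Suc k)
  show ?case
    by (rule Ck_on_SucI[OF assms, OF has_derivative_add[OF Ck_on_SucD_deriv[OF Suc.prems(1)] Ck_on_SucD_deriv[OF Suc.prems(2)]]])
      (use Suc in auto)
qed (auto intro!: continuous_intros)

lemma Ck_on_mult:
  assumes "open U" shows "Ck_on k U f \<Longrightarrow> Ck_on k U g \<Longrightarrow> Ck_on k U (\<lambda>x. f x * g x)"
proof (induction k arbitrary: f g)
  case (Suc k)
  show ?case
    by (rule Ck_on_SucI[OF assms, OF has_derivative_mult[OF Ck_on_SucD_deriv[OF Suc.prems(1)] Ck_on_SucD_deriv[OF Suc.prems(2)]]])
      (use Suc in \<open>auto intro!: Ck_on_add[OF assms] Suc.IH dest!: Ck_on_SucD simp del: Ck_on.simps, auto\<close>)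
qed (auto intro!: continuous_intros)

lemma Ck_on_sum:
  assumes "open U" "\<And>i. i \<in> I \<Longrightarrow> Ck_on k U (f i)"
  shows "Ck_on k U (\<lambda>x. \<Sum>i\<in>I. f i x)"
  using assms(2) by (induction I rule: infinite_finite_induct) (auto intro!: Ck_on_const Ck_on_add[OF assms(1)])

text \<open>Induction on the order through the chain rule. The derivative of the composition is
  expanded over \<open>Basis\<close>, which turns it into a sum of products of real functions of
  order k. \<open>T\<close> enters through its components because \<open>Ck_on\<close> speaks of
  real-valued functions.\<close>

lemma Ck_on_compose_vec:
  fixes f :: "'b::euclidean_space \<Rightarrow> real" and T :: "'a::euclidean_space \<Rightarrow> 'b"
  assumes "open U" "open V" "T ` U \<subseteq> V"
  shows "Ck_on k V f \<Longrightarrow> (\<And>b. b \<in> Basis \<Longrightarrow> Ck_on k U (\<lambda>x. T x \<bullet> b)) \<Longrightarrow> Ck_on k U (\<lambda>x. f (T x))"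
proof (induction k arbitrary: f)
  case 0
  have "continuous_on U T"
    using 0(2) by (subst continuous_on_componentwise) auto
  then show ?case using 0(1) assms(3) by (auto intro: continuous_on_compose2)
next
  case (Suc k)
  define D where "D x h = (\<Sum>b\<in>Basis. frechet_derivative f (at (T x)) b * frechet_derivative (\<lambda>x. T x \<bullet> b) (at x) h)" for x h
  have dT: "(T has_derivative (\<lambda>h. \<Sum>b\<in>Basis. frechet_derivative (\<lambda>x. T x \<bullet> b) (at x) h *\<^sub>R b)) (at x)" if "x \<in> U" for x
    using Ck_on_SucD_deriv[OF Suc.prems(2) that] by (subst has_derivative_componentwise_within) (simp add: inner_sum_left_Basis)
  show ?case
  proof (rule Ck_on_SucI[OF assms(1), where D=D])
    fix x assume x: "x \<in> U"
    then have "T x \<in> V" using assms(3) by auto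
    note df = Ck_on_SucD_deriv[OF Suc.prems(1) this]
    have lin: "linear (frechet_derivative f (at (T x)))"
      using df has_derivative_linear by blast
    show "((\<lambda>x. f (T x)) has_derivative D x) (at x)"
      using diff_chain_at[OF dT[OF x] df]
      by (simp add: o_def D_def[abs_def] linear_sum[OF lin] linear_scale[OF lin] mult.commute)
  next
    fix h
    have "Ck_on k V (\<lambda>y. frechet_derivative f (at y) b)" for b
      using Suc.prems(1) by simp
    then have "Ck_on k U (\<lambda>x. frechet_derivative f (at (T x)) b)" for b
      by (rule Suc.IH) (use Suc.prems(2) Ck_on_SucD in blast)
    then show "Ck_on k U (\<lambda>x. D x h)"
      unfolding D_def using Suc.prems(2) by (auto intro!: Ck_on_sum Ck_on_mult assms(1))
  qed
qed

lemma smooth_on_cong: "open U \<Longrightarrow> (\<And>x. x \<in> U \<Longrightarrow> f x = g x) \<Longrightarrow> smooth_on U f \<Longrightarrow> smooth_on U g"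
  unfolding smooth_on_def using Ck_on_cong by blast

lemma smooth_on_subset: "V \<subseteq> U \<Longrightarrow> smooth_on U f \<Longrightarrow> smooth_on V f"
  unfolding smooth_on_def using Ck_on_subset by blast

lemma smooth_on_Un: "open U \<Longrightarrow> open V \<Longrightarrow> smooth_on U f \<Longrightarrow> smooth_on V f \<Longrightarrow> smooth_on (U \<union> V) f"
  unfolding smooth_on_def using Ck_on_Un by blast

lemma smooth_on_const: "smooth_on U (\<lambda>x. c)"
  unfolding smooth_on_def using Ck_on_const by blast

lemma smooth_on_inner: "open U \<Longrightarrow> smooth_on U (\<lambda>x. x \<bullet> b)"
  unfolding smooth_on_def using Ck_on_inner by blast

lemma smooth_on_id: "open U \<Longrightarrow> smooth_on U (\<lambda>x::real. x)"
  using smooth_on_inner[of U "1::real"] by simp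

lemma smooth_on_add: "open U \<Longrightarrow> smooth_on U f \<Longrightarrow> smooth_on U g \<Longrightarrow> smooth_on U (\<lambda>x. f x + g x)"
  unfolding smooth_on_def using Ck_on_add by blast

lemma smooth_on_mult: "open U \<Longrightarrow> smooth_on U f \<Longrightarrow> smooth_on U g \<Longrightarrow> smooth_on U (\<lambda>x. f x * g x)"
  unfolding smooth_on_def using Ck_on_mult by blast

lemma smooth_on_minus: "open U \<Longrightarrow> smooth_on U f \<Longrightarrow> smooth_on U (\<lambda>x. - f x)"
  using smooth_on_mult[of U "\<lambda>x. - 1" f] smooth_on_const[of U "- 1"] by simp

lemma smooth_on_diff: "open U \<Longrightarrow> smooth_on U f \<Longrightarrow> smooth_on U g \<Longrightarrow> smooth_on U (\<lambda>x. f x - g x)"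
  using smooth_on_add[OF _ _ smooth_on_minus, of U f g] by simp

lemma smooth_on_power: "open U \<Longrightarrow> smooth_on U f \<Longrightarrow> smooth_on U (\<lambda>x. f x ^ n)"
  by (induction n) (auto intro: smooth_on_const smooth_on_mult)

lemma smooth_on_sum: "open U \<Longrightarrow> (\<And>i. i \<in> I \<Longrightarrow> smooth_on U (f i)) \<Longrightarrow> smooth_on U (\<lambda>x. \<Sum>i\<in>I. f i x)"
  unfolding smooth_on_def by (auto intro: Ck_on_sum)

lemma smooth_on_compose_vec:
  fixes f :: "'b::euclidean_space \<Rightarrow> real" and T :: "'a::euclidean_space \<Rightarrow> 'b"
  assumes "open U" "open V" "T ` U \<subseteq> V" "smooth_on V f" "\<And>b. b \<in> Basis \<Longrightarrow> smooth_on U (\<lambda>x. T x \<bullet> b)"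
  shows "smooth_on U (\<lambda>x. f (T x))"
  using assms(4,5) Ck_on_compose_vec[OF assms(1-3)] unfolding smooth_on_def by auto

lemma smooth_on_compose:
  fixes f :: "real \<Rightarrow> real" and T :: "'a::euclidean_space \<Rightarrow> real"
  assumes "open U" "open V" "smooth_on V f" "smooth_on U T" "T ` U \<subseteq> V"
  shows "smooth_on U (\<lambda>x. f (T x))"
  using smooth_on_compose_vec[of U V T f] assms by simp

text \<open>
Autonomous equations \<open>g' = \<Phi>(g)\<close> bootstrap regularity; this covers \<open>exp\<close>, \<open>ln\<close>, \<open>inverse\<close>, powers and
  inverse functions without computing higher derivatives.
\<close>

lemma smooth_on_ode:
  fixes g :: "real \<Rightarrow> real"
  assumes "open U" "open V" "g ` U \<subseteq> V" "smooth_on V \<Phi>"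
    and "\<And>x. x \<in> U \<Longrightarrow> (g has_real_derivative \<Phi> (g x)) (at x)"
  shows "smooth_on U g"
proof -
  have "Ck_on k U g" for k
  proof (induction k)
    case 0
    then show ?case using assms(5) by (auto intro!: continuous_at_imp_continuous_on DERIV_isCont)
  next
    case (Suc k)
    have "Ck_on k U (\<lambda>x. \<Phi> (g x))"
      using Ck_on_compose_vec[of U V g k \<Phi>] Suc assms(1-4) unfolding smooth_on_def by simp
    then show ?case
      by (intro Ck_on_SucI[OF assms(1), where D="\<lambda>x h. \<Phi> (g x) * h"])
        (use assms(5) in \<open>auto simp: has_field_derivative_def intro!: Ck_on_mult[OF assms(1)] Ck_on_const\<close>)
  qed
  then show ?thesis by (simp add: smooth_on_def)
qed

text \<open>Counterpart of \<open>smooth_on_ode\<close> for a derivative known as a function of the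
  argument: every positive order of \<open>g\<close> reduces to one order less of
  \<open>\<Phi>\<close>.\<close>

lemma smooth_on_SucI:
  fixes g :: "real \<Rightarrow> real"
  assumes "open U" "smooth_on U \<Phi>"
    and "\<And>x. x \<in> U \<Longrightarrow> (g has_real_derivative \<Phi> x) (at x)"
  shows "smooth_on U g"
proof -
  have "Ck_on k U g" for k
  proof (cases k)
    case 0
    then show ?thesis using assms(3) by (auto intro!: continuous_at_imp_continuous_on DERIV_isCont)
  next
    case (Suc m)
    show ?thesis unfolding Suc
      by (intro Ck_on_SucI[OF assms(1), where D="\<lambda>x h. \<Phi> x * h"])
        (use assms in \<open>auto simp: has_field_derivative_def smooth_on_def intro!: Ck_on_mult[OF assms(1)] Ck_on_const\<close>)
  qed
  then show ?thesis by (simp add: smooth_on_def)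
qed

section \<open>Smoothness of elementary functions and of the norm\<close>

lemma smooth_on_exp: "smooth_on UNIV (exp :: real \<Rightarrow> real)"
  by (rule smooth_on_ode[of _ UNIV _ "\<lambda>x. x"]) (auto intro!: smooth_on_id DERIV_exp)

lemma smooth_on_inverse: "smooth_on (- {0}) (inverse :: real \<Rightarrow> real)"
  by (rule smooth_on_ode[of _ UNIV _ "\<lambda>x. - (x * x)"])
    (auto intro!: smooth_on_minus smooth_on_mult smooth_on_id derivative_eq_intros)

lemma smooth_on_ln: "smooth_on {0<..} (ln :: real \<Rightarrow> real)"
  by (rule smooth_on_SucI[of _ "inverse"])
    (auto intro!: smooth_on_subset[OF _ smooth_on_inverse] derivative_eq_intros simp: field_simps)

lemma smooth_on_powr: "smooth_on {0<..} (\<lambda>x::real. x powr a)"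
proof -
  have "smooth_on {0<..} (\<lambda>x::real. exp (a * ln x))"
    by (rule smooth_on_compose[of _ UNIV])
      (auto intro!: smooth_on_exp smooth_on_mult smooth_on_const smooth_on_ln)
  then show ?thesis
    by (rule smooth_on_cong[rotated 2]) (auto simp: powr_def)
qed

lemma smooth_on_sqrt: "smooth_on {0<..} sqrt"
  by (rule smooth_on_cong[OF _ _ smooth_on_powr[of "1/2"]]) (auto simp: powr_half_sqrt)

lemma smooth_on_norm_sq:
  "open U \<Longrightarrow> smooth_on U (\<lambda>x::'a::euclidean_space. (norm x)\<^sup>2)"
proof -
  assume U: "open U"
  have eq: "(norm x)\<^sup>2 = (\<Sum>b\<in>Basis. (x \<bullet> b) ^ 2)" for x :: 'a
    unfolding power2_norm_eq_inner euclidean_inner[of x x] by (simp add: power2_eq_square)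
  show ?thesis
    unfolding eq using U by (auto intro!: smooth_on_sum smooth_on_power smooth_on_inner)
qed

lemma smooth_on_norm: "smooth_on (- {0}) (norm :: 'a::euclidean_space \<Rightarrow> real)"
proof -
  have "smooth_on (- {0}) (\<lambda>x::'a. sqrt ((norm x)\<^sup>2))"
    by (rule smooth_on_compose[OF _ _ smooth_on_sqrt]) (auto intro!: smooth_on_norm_sq)
  then show ?thesis by simp
qed

lemma smooth_on_divide:
  "open U \<Longrightarrow> smooth_on U f \<Longrightarrow> smooth_on U g \<Longrightarrow> (\<And>x. x \<in> U \<Longrightarrow> g x \<noteq> 0) \<Longrightarrow> smooth_on U (\<lambda>x. f x / g x)"
  unfolding divide_inverse
  by (rule smooth_on_mult, assumption, assumption) (rule smooth_on_compose[OF _ _ smooth_on_inverse], auto)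

text \<open>The whole space is the union of the open sets \<open>U\<close> and \<open>- K\<close>;
  on the second one the function vanishes, so smoothness has to be checked on \<open>U\<close>
  alone.\<close>

lemma Cc_smoothI:
  assumes U: "open U" and K: "compact K" "K \<subseteq> U" and f: "smooth_on U f" "\<And>x. x \<notin> K \<Longrightarrow> f x = 0"
  shows "f \<in> Cc_smooth U"
proof -
  have cK: "closed K" using K by (simp add: compact_imp_closed)
  have "smooth_on (U \<union> - K) f"
    by (intro smooth_on_Un U f smooth_on_cong[OF _ _ smooth_on_const[of _ 0]]) (use cK f in auto)
  moreover have "U \<union> - K = UNIV" using K by auto
  ultimately have "smooth f" by (simp add: smooth_on_UNIV)
  moreover have "closure {x. f x \<noteq> 0} \<subseteq> K"
    by (rule closure_minimal) (use f cK in auto)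
  moreover have "bounded {x. f x \<noteq> 0}"
    by (rule bounded_subset[OF compact_imp_bounded[OF K(1)]]) (use f in auto)
  ultimately show ?thesis using K
    by (auto simp: Cc_smooth_def dest: subsetD)
qed

lemma Cc_smoothD:
  assumes "f \<in> Cc_smooth U"
  obtains K where "compact K" "K \<subseteq> U" "\<And>x. x \<notin> K \<Longrightarrow> f x = 0"
  using assms closure_subset[of "{x. f x \<noteq> 0}"] unfolding Cc_smooth_def by blast

lemma Cc_smooth_smooth: "f \<in> Cc_smooth U \<Longrightarrow> smooth_on V f"
  by (simp add: Cc_smooth_def smooth_on_UNIV[symmetric] smooth_on_subset[OF subset_UNIV])

lemma smooth_on_differentiable: "smooth_on U f \<Longrightarrow> x \<in> U \<Longrightarrow> f differentiable (at x)"
  unfolding smooth_on_def using Ck_on.simps(2) by blast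

lemma smooth_on_continuous: "smooth_on U f \<Longrightarrow> continuous_on U f"
  unfolding smooth_on_def using Ck_on.simps(1) by blast

lemma smooth_on_frechet: "smooth_on U f \<Longrightarrow> smooth_on U (\<lambda>x. frechet_derivative f (at x) h)"
  unfolding smooth_on_def using Ck_on.simps(2) by blast

text \<open>
The polynomial factor makes this family closed under differentiation, see \<open>flat_deriv\<close>.
\<close>

definition flat :: "real poly \<Rightarrow> real \<Rightarrow> real" where
  "flat P t = (if t > 0 then poly P (1 / t) * exp (- 1 / t) else 0)"

lemma flat_tendsto_0: "(flat P \<longlongrightarrow> 0) (at 0)"
proof -
  have "((\<lambda>x. \<Sum>i\<le>degree P. coeff P i * (x ^ i / exp x)) \<longlongrightarrow> (\<Sum>i\<le>degree P. coeff P i * 0)) at_top"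
    by (intro tendsto_sum tendsto_mult tendsto_const tendsto_power_div_exp_0)
  then have "((\<lambda>x. poly P x * exp (- x)) \<longlongrightarrow> 0) at_top"
    by (simp add: poly_altdef sum_distrib_right exp_minus divide_inverse mult.assoc)
  then have "((\<lambda>t. poly P (inverse t) * exp (- inverse t)) \<longlongrightarrow> 0) (at_right 0)"
    by (rule filterlim_compose) (rule filterlim_inverse_at_top_right)
  then have "(flat P \<longlongrightarrow> 0) (at_right 0)"
    by (rule Lim_transform_eventually)
      (auto simp: flat_def eventually_at_filter divide_inverse intro!: always_eventually)
  moreover have "(flat P \<longlongrightarrow> 0) (at_left 0)"
    by (rule Lim_transform_eventually[OF tendsto_const])
      (auto simp: flat_def eventually_at_filter intro!: always_eventually)
  ultimately show ?thesis
    by (simp add: filterlim_split_at)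
qed

lemma flat_deriv:
  "(flat P has_real_derivative flat ([:0, 0, 1:] * (P - pderiv P)) t) (at t)"
proof -
  consider "t > 0" | "t < 0" | "t = 0" by linarith
  then show ?thesis
  proof cases
    case 1
    have "((\<lambda>t. poly P (1 / t) * exp (- 1 / t)) has_real_derivative flat ([:0, 0, 1:] * (P - pderiv P)) t) (at t)"
      using 1 by (auto intro!: derivative_eq_intros poly_DERIV[THEN DERIV_chain2] simp: flat_def field_simps power2_eq_square)
    then show ?thesis
      by (rule has_field_derivative_transform_within_open[of _ _ _ "{0<..}"]) (use 1 in \<open>auto simp: flat_def\<close>)
  next
    case 2
    have "((\<lambda>t. 0) has_real_derivative flat ([:0, 0, 1:] * (P - pderiv P)) t) (at t)"
      using 2 by (simp add: flat_def)
    then show ?thesis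
      by (rule has_field_derivative_transform_within_open[of _ _ _ "{..<0}"]) (use 2 in \<open>auto simp: flat_def\<close>)
  next
    case 3
    \<comment> \<open>Dividing by y multiplies the polynomial in 1/y by its variable, so the
      difference quotient at 0 is again a member of the family and tends to 0.\<close>
    have "((\<lambda>y. (flat P y - flat P 0) / (y - 0)) \<longlongrightarrow> 0) (at 0)"
      by (rule Lim_transform_eventually[OF flat_tendsto_0[of "[:0, 1:] * P"]])
        (auto simp: flat_def eventually_at_filter field_simps intro!: always_eventually)
    then show ?thesis
      using 3 by (simp add: has_field_derivative_iff flat_def)
  qed
qed

lemma smooth_on_flat: "smooth_on UNIV (flat P)"
proof -
  have "Ck_on k UNIV (flat P)" for k
  proof (induction k arbitrary: P)
    case 0
    then show ?case
      using flat_deriv by (auto intro!: continuous_at_imp_continuous_on DERIV_isCont)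
  next
    case (Suc k)
    show ?case
      by (rule Ck_on_SucI[where D="\<lambda>t h. flat ([:0, 0, 1:] * (P - pderiv P)) t * h"])
        (use Suc flat_deriv[unfolded has_field_derivative_def, of P] in \<open>auto intro!: Ck_on_mult Ck_on_const simp del: mult_pCons_left\<close>)
  qed
  then show ?thesis by (simp add: smooth_on_def)
qed

text \<open>The quotient gives exactly 0 for t \<le> 0 and exactly 1 for t \<ge> 1. The denominator
  is positive because t or 1 - t is.\<close>

definition smooth_step :: "real \<Rightarrow> real" where
  "smooth_step t = flat 1 t / (flat 1 t + flat 1 (1 - t))"

lemma flat_1_nonneg: "0 \<le> flat 1 t" and flat_1_pos: "0 < t \<Longrightarrow> 0 < flat 1 t" and flat_1_0: "t \<le> 0 \<Longrightarrow> flat 1 t = 0"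
  by (auto simp: flat_def)

lemma smooth_step_denom: "flat 1 t + flat 1 (1 - t) > 0"
  using flat_1_pos[of t] flat_1_pos[of "1 - t"] flat_1_nonneg[of t] flat_1_nonneg[of "1 - t"]
  by (cases "t > 0") auto

lemma smooth_on_smooth_step: "smooth_on UNIV smooth_step"
proof -
  have *: "smooth_on UNIV (\<lambda>t. flat 1 (1 - t))"
    by (rule smooth_on_compose[OF _ _ smooth_on_flat])
      (auto intro!: smooth_on_diff smooth_on_const smooth_on_id)
  show ?thesis
    unfolding smooth_step_def[abs_def]
    by (rule smooth_on_divide)
      (use smooth_step_denom in \<open>auto intro!: smooth_on_add smooth_on_flat * simp: less_imp_neq[symmetric]\<close>)
qed

lemma smooth_step_0: "t \<le> 0 \<Longrightarrow> smooth_step t = 0"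
  by (simp add: smooth_step_def flat_1_0)

lemma smooth_step_1: "t \<ge> 1 \<Longrightarrow> smooth_step t = 1"
  using smooth_step_denom[of t] by (simp add: smooth_step_def flat_1_0)

lemma smooth_step_bounds: "0 \<le> smooth_step t" "smooth_step t \<le> 1"
  using smooth_step_denom[of t] flat_1_nonneg[of t] flat_1_nonneg[of "1 - t"]
  by (auto simp: smooth_step_def)

subsection \<open>Integration of compactly supported functions\<close>

lemma lborel_integral_translate:
  fixes f :: "'a::euclidean_space \<Rightarrow> real"
  assumes "f \<in> borel_measurable borel"
  shows "(LINT x|lborel. f (x + c)) = (LINT x|lborel. f x)"
proof -
  have "(LINT x|lborel. f x) = (LINT x|distr lborel borel ((+) c). f x)"
    by (simp add: lborel_distr_plus)
  also have "\<dots> = (LINT x|lborel. f (c + x))"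
    by (rule integral_distr) (use assms in auto)
  finally show ?thesis by (simp add: add.commute)
qed

lemma integrable_compact_support:
  fixes f :: "'a::euclidean_space \<Rightarrow> real"
  assumes "compact K" "continuous_on K f" "\<And>x. x \<notin> K \<Longrightarrow> f x = 0"
  shows "integrable lborel f"
proof -
  have "integrable lborel (\<lambda>x. indicator K x *\<^sub>R f x)"
    by (rule borel_integrable_compact[OF assms(1,2)])
  also have "(\<lambda>x. indicator K x *\<^sub>R f x) = f"
    using assms(3) by (auto simp: indicator_def fun_eq_iff)
  finally show ?thesis .
qed

lemma compact_support_bounded:
  fixes f :: "'a::euclidean_space \<Rightarrow> real"
  assumes "compact K" "continuous_on K f" "\<And>x. x \<notin> K \<Longrightarrow> f x = 0"
  obtains M where "0 < M" "\<And>x. \<bar>f x\<bar> \<le> M"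
proof -
  have "bounded (f ` K)"
    using assms compact_continuous_image compact_imp_bounded by blast
  then obtain M where "M > 0" "\<And>x. x \<in> K \<Longrightarrow> \<bar>f x\<bar> \<le> M"
    unfolding bounded_pos by auto
  then show ?thesis using that[of M] assms(3) by (metis abs_zero less_imp_le)
qed

lemma deriv_zero_outside:
  fixes f :: "'a::euclidean_space \<Rightarrow> real"
  assumes "closed K" "\<And>x. x \<notin> K \<Longrightarrow> f x = 0" "x \<notin> K"
  shows "frechet_derivative f (at x) = (\<lambda>h. 0)"
proof -
  have "(f has_derivative (\<lambda>h. 0)) (at x)"
    by (rule has_derivative_transform_within_open[where f="\<lambda>x. 0" and s="- K"]) (use assms in auto)
  then show ?thesis using frechet_derivative_at by metis
qed

lemma line_bound:
  fixes f :: "'a::euclidean_space \<Rightarrow> real"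
  assumes "\<And>x. f differentiable (at x)" "\<And>x. \<bar>frechet_derivative f (at x) h\<bar> \<le> M" "0 \<le> t"
  shows "\<bar>f (x + t *\<^sub>R h) - f x\<bar> \<le> M * t"
proof -
  have "((\<lambda>s. f (x + s *\<^sub>R h)) has_derivative (\<lambda>r. r * frechet_derivative f (at (x + s *\<^sub>R h)) h)) (at s within {0..t})" for s
  proof -
    have d: "(f has_derivative frechet_derivative f (at (x + s *\<^sub>R h))) (at (x + s *\<^sub>R h))"
      using assms(1) by (simp add: frechet_derivative_works)
    then have "linear (frechet_derivative f (at (x + s *\<^sub>R h)))"
      using has_derivative_linear by blast
    moreover have "((\<lambda>s. x + s *\<^sub>R h) has_derivative (\<lambda>r. r *\<^sub>R h)) (at s within {0..t})"
      by (auto intro!: derivative_eq_intros)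
    from has_derivative_compose[OF this d]
    have "((\<lambda>s. f (x + s *\<^sub>R h)) has_derivative (\<lambda>r. frechet_derivative f (at (x + s *\<^sub>R h)) (r *\<^sub>R h))) (at s within {0..t})" .
    ultimately show ?thesis by (simp add: linear_scale)
  qed
  moreover have "onorm (\<lambda>r. r * frechet_derivative f (at (x + s *\<^sub>R h)) h) \<le> M" for s
    by (rule onorm_le) (use assms(2)[of "x + s *\<^sub>R h"] in \<open>simp add: abs_mult mult.commute[of M] mult_left_mono\<close>)
  ultimately have "norm (f (x + t *\<^sub>R h) - f (x + 0 *\<^sub>R h)) \<le> M * norm (t - 0)"
    using assms(3) by (intro differentiable_bound[of "{0..t}"]) auto
  then show ?thesis using assms(3) by simp
qed

text \<open>By translation invariance every difference quotient has integral zero. The quotients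
  converge to the derivative, bounded by its maximum (\<open>line_bound\<close>) on one fixed ball,
  so dominated convergence applies.\<close>

lemma integral_derivative_0:
  fixes f :: "'a::euclidean_space \<Rightarrow> real"
  assumes K: "compact K" "\<And>x. x \<notin> K \<Longrightarrow> f x = 0"
    and d: "\<And>x. f differentiable (at x)"
    and c: "continuous_on UNIV (\<lambda>x. frechet_derivative f (at x) h)"
  shows "(LINT x|lborel. frechet_derivative f (at x) h) = 0"
proof -
  define D where "D x = frechet_derivative f (at x) h" for x
  define g where "g n x = (f (x + (1 / real (Suc n)) *\<^sub>R h) - f x) / (1 / real (Suc n))" for n x
  have contf: "continuous_on A f" for A
    using d by (simp add: differentiable_at_imp_differentiable_on differentiable_imp_continuous_on)
  then have fm[measurable]: "f \<in> borel_measurable borel"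
    by (simp add: borel_measurable_continuous_onI)
  have "D x = 0" if "x \<notin> K" for x
    using deriv_zero_outside[OF compact_imp_closed[OF K(1)] K(2) that] by (simp add: D_def)
  moreover have "continuous_on K D" unfolding D_def by (rule continuous_on_subset[OF c]) auto
  ultimately obtain M where M: "M > 0" "\<And>x. \<bar>D x\<bar> \<le> M"
    using compact_support_bounded[OF K(1), of D] by metis
  obtain R where R: "\<And>x. x \<in> K \<Longrightarrow> norm x \<le> R"
    using compact_imp_bounded[OF K(1)] bounded_iff by blast
  have fi: "integrable lborel f" using integrable_compact_support[OF K(1) contf K(2)] .
  then have fi': "integrable lborel (\<lambda>x. f (x + a))" for a
  proof -
    have "compact ((\<lambda>x. x - a) ` K)" by (intro compact_continuous_image continuous_intros K)
    moreover have "continuous_on A (\<lambda>x. f (x + a))" for A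
      by (rule continuous_on_compose2[OF contf[of UNIV]]) (auto intro!: continuous_intros)
    moreover have "f (x + a) = 0" if "x \<notin> (\<lambda>x. x - a) ` K" for x
      using that K(2)[of "x + a"] by (metis add_diff_cancel_right' image_eqI)
    ultimately show ?thesis by (rule integrable_compact_support)
  qed
  have "(\<lambda>n. LINT x|lborel. g n x) \<longlonglongrightarrow> (LINT x|lborel. D x)"
  proof (rule integral_dominated_convergence[where w="\<lambda>x. M * indicator (cball 0 (R + norm h)) x"])
    show "AE x in lborel. (\<lambda>n. g n x) \<longlonglongrightarrow> D x"
    proof (rule AE_I2)
      fix x
      have *: "((\<lambda>t. (f (x + t *\<^sub>R h) - f x) / t) \<longlongrightarrow> D x) (at 0)"
      proof -
        have df: "(f has_derivative frechet_derivative f (at x)) (at (x + 0 *\<^sub>R h))"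
          using d[of x] by (simp add: frechet_derivative_works)
        then have lin: "linear (frechet_derivative f (at x))"
          using has_derivative_linear by blast
        have dl: "((\<lambda>s. x + s *\<^sub>R h) has_derivative (\<lambda>r. r *\<^sub>R h)) (at 0)"
          by (auto intro!: derivative_eq_intros)
        have "((\<lambda>s. f (x + s *\<^sub>R h)) has_real_derivative D x) (at 0)"
        proof -
          have "(\<lambda>r. frechet_derivative f (at x) (r *\<^sub>R h)) = (*) (D x)"
            by (auto simp: linear_scale[OF lin] D_def)
          then show ?thesis
            using has_derivative_compose[OF dl df]
            by (simp add: has_field_derivative_def)
        qed
        then show ?thesis by (simp add: has_field_derivative_iff)
      qed
      have **: "filterlim (\<lambda>n. 1 / real (Suc n)) (at 0) sequentially"
        unfolding filterlim_at using LIMSEQ_Suc[OF lim_1_over_n] by (auto intro: always_eventually)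
      show "(\<lambda>n. g n x) \<longlonglongrightarrow> D x"
        unfolding g_def by (rule filterlim_compose[OF * **])
    qed
    show "AE x in lborel. norm (g n x) \<le> M * indicator (cball 0 (R + norm h)) x" for n
    proof (rule AE_I2)
      fix x
      define t where "t = 1 / real (Suc n)"
      have t: "0 < t" "t \<le> 1" by (auto simp: t_def)
      have "\<bar>f (x + t *\<^sub>R h) - f x\<bar> \<le> M * t"
        using line_bound[of f h M t x] d M t by (auto simp: D_def)
      then have "\<bar>g n x\<bar> \<le> M"
        unfolding g_def t_def[symmetric] using t by (simp add: field_simps abs_if split: if_splits)
      moreover have "g n x = 0" if "norm x > R + norm h"
      proof -
        have "norm (x + t *\<^sub>R h) \<ge> norm x - t * norm h"
          using norm_diff_ineq[of x "t *\<^sub>R h"] t by simp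
        moreover have "t * norm h \<le> norm h" using t by (simp add: mult_left_le_one_le)
        moreover have "norm h \<ge> 0" by simp
        ultimately have "norm (x + t *\<^sub>R h) > R" "norm x > R" using that by linarith+
        then have "x \<notin> K" "x + t *\<^sub>R h \<notin> K" using R by force+
        then show ?thesis using K(2) by (simp add: g_def t_def)
      qed
      ultimately show "norm (g n x) \<le> M * indicator (cball 0 (R + norm h)) x"
        using M by (auto simp: indicator_def not_le)
    qed
    show "integrable lborel (\<lambda>x. M * indicator (cball 0 (R + norm h)) x :: real)"
      by (intro integrable_mult_right integrable_real_indicator)
        (use emeasure_lborel_cball_finite[of 0 "R + norm h"] in auto)
    show "D \<in> borel_measurable lborel" unfolding D_def using borel_measurable_continuous_onI[OF c] by simp
    show "g n \<in> borel_measurable lborel" for n unfolding g_def[abs_def] by measurable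
  qed
  moreover have "(LINT x|lborel. g n x) = 0" for n
    unfolding g_def
    by (subst integral_divide_zero, subst Bochner_Integration.integral_diff[OF fi' fi])
      (simp add: lborel_integral_translate[OF fm])
  ultimately have "(\<lambda>n. 0) \<longlonglongrightarrow> (LINT x|lborel. D x)" by simp
  then show ?thesis unfolding D_def using LIMSEQ_unique[OF tendsto_const] by metis
qed

text \<open>\<open>J\<close> is a closed form of the Jacobian; its continuity makes the right-hand
  integrand Borel measurable, so that the statement for the completed measure descends to
  \<open>lborel\<close>. Since \<open>f\<close> vanishes outside the image, integrals over the image
  become integrals over the whole space. The integrability equivalence also covers the case where
  both integrals are 0 by convention.\<close>

lemma change_of_variables_lborel:
  fixes f :: "real^3 \<Rightarrow> real" and g :: "real^3 \<Rightarrow> real^3"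
  assumes S: "open S" and der: "\<And>x. x \<in> S \<Longrightarrow> (g has_derivative g' x) (at x)"
    and inj: "inj_on g S" and fm: "f \<in> borel_measurable borel"
    and f0: "\<And>y. y \<notin> g ` S \<Longrightarrow> f y = 0"
    and J: "\<And>x. x \<in> S \<Longrightarrow> \<bar>det (matrix (g' x))\<bar> = J x" "continuous_on S J"
  shows "integrable lborel f \<longleftrightarrow> integrable lborel (\<lambda>x. indicator S x * (J x * f (g x)))"
    and "(LINT y|lborel. f y) = (LINT x|lborel. indicator S x * (J x * f (g x)))"
proof -
  define H where "H x = indicator S x * (J x * f (g x))" for x
  have contg: "continuous_on S g"
    using der by (meson continuous_at_imp_continuous_on has_derivative_continuous)
  have Hm: "H \<in> borel_measurable borel"
  proof -
    have [measurable]: "g \<in> measurable (restrict_space borel S) borel" "J \<in> measurable (restrict_space borel S) borel"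
      using contg J(2) by (auto intro: borel_measurable_continuous_on_restrict)
    have "(\<lambda>x. J x * f (g x)) \<in> borel_measurable (restrict_space borel S)"
      using fm by measurable
    then show ?thesis
      unfolding H_def[abs_def] using S by (subst (asm) borel_measurable_restrict_space_iff) auto
  qed
  define F where "F x = \<bar>det (matrix (g' x))\<bar> * f (g x)" for x
  have cov: "F absolutely_integrable_on S \<and> integral S F = b
     \<longleftrightarrow> f absolutely_integrable_on (g ` S) \<and> integral (g ` S) f = b" for b
  proof -
    \<comment> \<open>The change of variables theorem has vector-valued integrands, so the real
      function is embedded into \<open>real^1\<close> and recovered afterwards.\<close>
    have "(\<lambda>x. \<bar>det (matrix (g' x))\<bar> *\<^sub>R vec (f (g x)) :: real^1) absolutely_integrable_on S \<and>
        integral S (\<lambda>x. \<bar>det (matrix (g' x))\<bar> *\<^sub>R vec (f (g x)) :: real^1) = vec b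
       \<longleftrightarrow> (\<lambda>y. vec (f y) :: real^1) absolutely_integrable_on (g ` S) \<and> integral (g ` S) (\<lambda>y. vec (f y) :: real^1) = vec b"
      by (rule has_absolute_integral_change_of_variables)
        (use S der inj in \<open>auto intro: has_derivative_at_withinI simp: lborelD\<close>)
    then show ?thesis
      by (simp add: absolutely_integrable_on_1_iff integral_on_1_eq F_def[abs_def])
  qed
  have *: "integrable lebesgue (\<lambda>y. indicator (g ` S) y *\<^sub>R f y) \<longleftrightarrow> integrable lborel f"
    "(LINT y|lebesgue. indicator (g ` S) y *\<^sub>R f y) = (LINT y|lborel. f y)"
  proof -
    have eq: "(\<lambda>y. indicator (g ` S) y *\<^sub>R f y) = f"
      using f0 by (auto simp: indicator_def fun_eq_iff)
    show "integrable lebesgue (\<lambda>y. indicator (g ` S) y *\<^sub>R f y) \<longleftrightarrow> integrable lborel f"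
      "(LINT y|lebesgue. indicator (g ` S) y *\<^sub>R f y) = (LINT y|lborel. f y)"
      unfolding eq using fm by (auto simp: integrable_completion integral_completion)
  qed
  have **: "integrable lebesgue (\<lambda>x. indicator S x *\<^sub>R F x) \<longleftrightarrow> integrable lborel H"
    "(LINT x|lebesgue. indicator S x *\<^sub>R F x) = (LINT x|lborel. H x)"
  proof -
    have eq: "(\<lambda>x. indicator S x *\<^sub>R F x) = H"
      using J by (auto simp: indicator_def F_def H_def)
    show "integrable lebesgue (\<lambda>x. indicator S x *\<^sub>R F x) \<longleftrightarrow> integrable lborel H"
      "(LINT x|lebesgue. indicator S x *\<^sub>R F x) = (LINT x|lborel. H x)"
      unfolding eq using Hm by (auto simp: integrable_completion integral_completion)
  qed
  have int: "integrable lborel f \<longleftrightarrow> integrable lborel H"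
    using cov * ** unfolding set_integrable_def by blast
  then show "integrable lborel f \<longleftrightarrow> integrable lborel (\<lambda>x. indicator S x * (J x * f (g x)))"
    by (simp add: H_def[abs_def])
  show "(LINT y|lborel. f y) = (LINT x|lborel. indicator S x * (J x * f (g x)))"
  proof (cases "integrable lborel f")
    case True
    then have "f absolutely_integrable_on g ` S" "F absolutely_integrable_on S"
      using int * ** by (auto simp: set_integrable_def)
    then show ?thesis
      using cov[of "integral (g ` S) f"] * ** set_lebesgue_integral_eq_integral(2)
      unfolding set_lebesgue_integral_def H_def[symmetric] by metis
  next
    case False
    then have "\<not> integrable lborel H" using int by simp
    then show ?thesis using False by (simp add: not_integrable_integral_eq H_def[abs_def])
  qed
qed

text \<open>The map has eigenvalue \<open>\<alpha>\<close> on the plane orthogonal to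
  \<open>v\<close> and \<open>\<alpha> + \<beta> * (v \<bullet> v)\<close> along \<open>v\<close>.
  All Jacobians below have this shape: the radial map, the inversion and the reflections.\<close>

lemma det_rank_one:
  fixes v :: "real^3"
  shows "det (matrix (\<lambda>h. \<alpha> *\<^sub>R h + (\<beta> * (v \<bullet> h)) *\<^sub>R v)) = \<alpha>\<^sup>2 * (\<alpha> + \<beta> * (v \<bullet> v))"
  by (simp add: det_3 matrix_def inner_vec_def sum_3 axis_def power2_eq_square) algebra

section \<open>Calculus of gradients\<close>

lemma grad_eqI: "GDERIV f x :> G \<Longrightarrow> grad f x = G"
proof -
  assume G: "GDERIV f x :> G"
  then have "frechet_derivative f (at x) = (\<lambda>h. h \<bullet> G)"
    unfolding gderiv_def using frechet_derivative_at by metis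
  then show ?thesis
    by (simp add: grad_def inner_commute[of _ G] euclidean_representation)
qed

lemma GDERIV_grad: "f differentiable (at x) \<Longrightarrow> GDERIV f x :> grad f x"
  unfolding gderiv_def using grad_inner[of f x] frechet_derivative_works
  by (metis (no_types, lifting) ext inner_commute)

lemma smooth_on_grad_continuous:
  assumes "smooth_on U f" shows "continuous_on U (grad f)"
  unfolding grad_def[abs_def]
  by (intro continuous_intros smooth_on_continuous smooth_on_frechet assms)

lemma grad_zero_outside:
  "closed K \<Longrightarrow> (\<And>x. x \<notin> K \<Longrightarrow> f x = 0) \<Longrightarrow> x \<notin> K \<Longrightarrow> grad f x = 0"
  by (simp add: grad_def deriv_zero_outside)

lemma smooth_on_div_integral_0:
  fixes f :: "'a::euclidean_space \<Rightarrow> real"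
  assumes "smooth_on UNIV f" "compact K" "\<And>x. x \<notin> K \<Longrightarrow> f x = 0"
  shows "(LINT x|lborel. grad f x \<bullet> h) = 0"
proof -
  have "(LINT x|lborel. frechet_derivative f (at x) h) = 0"
    using assms by (intro integral_derivative_0)
      (auto intro: smooth_on_differentiable smooth_on_continuous smooth_on_frechet)
  then show ?thesis
    using grad_inner[OF smooth_on_differentiable[OF assms(1)], of _ h] by simp
qed

subsection \<open>Gagliardo-Nirenberg inequality in dimension three\<close>

text \<open>A square root on \<open>ennreal\<close> with value \<open>top\<close> at
  \<open>top\<close>, so that Cauchy-Schwarz can be iterated with no finiteness assumption.\<close>

definition esqrt :: "ennreal \<Rightarrow> ennreal" where
  "esqrt x = (if x = top then top else ennreal (sqrt (enn2real x)))"

lemma esqrt_power2: "(esqrt x)\<^sup>2 = x"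
  by (cases x) (auto simp: esqrt_def ennreal_power power2_eq_square ennreal_mult[symmetric])

lemma borel_measurable_esqrt[measurable]: "esqrt \<in> borel_measurable borel"
  unfolding esqrt_def[abs_def] by measurable

lemma ennreal_power2_le_iff: "(x::ennreal)\<^sup>2 \<le> y\<^sup>2 \<longleftrightarrow> x \<le> y"
proof
  assume "x\<^sup>2 \<le> y\<^sup>2"
  show "x \<le> y"
  proof (rule ccontr)
    assume "\<not> x \<le> y"
    then have "y < x" by simp
    then obtain a where a: "y = ennreal a" "a \<ge> 0"
      by (cases y) (auto simp: top_unique)
    show False
    proof (cases x)
      case (real b)
      then have "a < b" "b\<^sup>2 \<le> a\<^sup>2" using a \<open>y < x\<close> \<open>x\<^sup>2 \<le> y\<^sup>2\<close>
        by (auto simp: ennreal_power ennreal_less_iff)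
      then show False using a by (simp add: power2_le_iff_abs_le)
    next
      case top
      then show False using a \<open>x\<^sup>2 \<le> y\<^sup>2\<close> by (simp add: ennreal_power power2_eq_square ennreal_mult[symmetric] top_unique)
    qed
  qed
qed (simp add: power_mono)

lemma nn_integral_lborel_pair:
  fixes g :: "'a::euclidean_space \<times> 'b::euclidean_space \<Rightarrow> ennreal"
  assumes "g \<in> borel_measurable borel"
  shows "(\<integral>\<^sup>+x. g x \<partial>lborel) = (\<integral>\<^sup>+a. \<integral>\<^sup>+b. g (a, b) \<partial>lborel \<partial>lborel)"
    and "(\<integral>\<^sup>+x. g x \<partial>lborel) = (\<integral>\<^sup>+b. \<integral>\<^sup>+a. g (a, b) \<partial>lborel \<partial>lborel)"
proof -
  have g: "g \<in> borel_measurable (lborel \<Otimes>\<^sub>M lborel)"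
    using assms by (simp add: lborel_prod)
  show "(\<integral>\<^sup>+x. g x \<partial>lborel) = (\<integral>\<^sup>+a. \<integral>\<^sup>+b. g (a, b) \<partial>lborel \<partial>lborel)"
    using lborel.nn_integral_fst[OF g] by (simp add: lborel_prod)
  show "(\<integral>\<^sup>+x. g x \<partial>lborel) = (\<integral>\<^sup>+b. \<integral>\<^sup>+a. g (a, b) \<partial>lborel \<partial>lborel)"
    using lborel_pair.nn_integral_snd[OF g] by (simp add: lborel_prod)
qed

text \<open>Cauchy-Schwarz twice. On each slice with fixed \<open>c\<close> it separates
  \<open>h3\<close> from the product of \<open>h1\<close> and \<open>h2\<close>, whose square
  integrates to \<open>H1 c * H2 c\<close>; then it is applied in \<open>c\<close> to the square
  roots of \<open>H1\<close> and \<open>H2\<close>.\<close>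

lemma loomis_whitney:
  fixes h1 h2 h3 :: "real \<times> real \<Rightarrow> ennreal"
  assumes [measurable]: "h1 \<in> borel_measurable borel" "h2 \<in> borel_measurable borel" "h3 \<in> borel_measurable borel"
  shows "(\<integral>\<^sup>+c. \<integral>\<^sup>+x. h1 (snd x, c) * h2 (fst x, c) * h3 x \<partial>lborel \<partial>lborel)\<^sup>2
    \<le> (\<integral>\<^sup>+x. (h1 x)\<^sup>2 \<partial>lborel) * (\<integral>\<^sup>+x. (h2 x)\<^sup>2 \<partial>lborel) * (\<integral>\<^sup>+x. (h3 x)\<^sup>2 \<partial>lborel)"
proof -
  define H1 where "H1 c = (\<integral>\<^sup>+b. (h1 (b, c))\<^sup>2 \<partial>lborel)" for c
  define H2 where "H2 c = (\<integral>\<^sup>+a. (h2 (a, c))\<^sup>2 \<partial>lborel)" for c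
  define K where "K = (\<integral>\<^sup>+x. (h3 x)\<^sup>2 \<partial>lborel)"
  have [measurable]: "H1 \<in> borel_measurable borel" "H2 \<in> borel_measurable borel"
    unfolding H1_def[abs_def] H2_def[abs_def] by measurable
  have m: "(\<lambda>x::real \<times> real. (snd x, c)) \<in> borel_measurable borel" "(\<lambda>x::real \<times> real. (fst x, c)) \<in> borel_measurable borel" for c :: real
    by (auto intro!: borel_measurable_continuous_onI continuous_intros)
  have [measurable]: "(\<lambda>x::real \<times> real. h1 (snd x, c)) \<in> borel_measurable borel" "(\<lambda>x::real \<times> real. h2 (fst x, c)) \<in> borel_measurable borel" for c
    using m assms by (auto intro: measurable_compose)
  have J: "(\<integral>\<^sup>+x. h1 (snd x, c) * h2 (fst x, c) * h3 x \<partial>lborel) \<le> esqrt (H1 c) * esqrt (H2 c) * esqrt K" for c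
  proof -
    have "(\<integral>\<^sup>+x. h1 (snd x, c) * h2 (fst x, c) * h3 x \<partial>lborel)\<^sup>2 \<le> (\<integral>\<^sup>+x. (h1 (snd x, c) * h2 (fst x, c))\<^sup>2 \<partial>lborel) * K"
      unfolding K_def by (rule Cauchy_Schwarz_nn_integral) measurable
    also have "(\<integral>\<^sup>+x. (h1 (snd x, c) * h2 (fst x, c))\<^sup>2 \<partial>lborel)
      = (\<integral>\<^sup>+x. (h1 (snd x, c) * h2 (fst x, c))\<^sup>2 \<partial>(lborel \<Otimes>\<^sub>M lborel))"
      by (simp add: lborel_prod)
    also have "\<dots> = (\<integral>\<^sup>+a. \<integral>\<^sup>+b. (h1 (b, c) * h2 (a, c))\<^sup>2 \<partial>lborel \<partial>lborel)"
      by (subst lborel.nn_integral_fst[symmetric]) auto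
    also have "\<dots> = (\<integral>\<^sup>+a. H1 c * (h2 (a, c))\<^sup>2 \<partial>lborel)"
      unfolding H1_def power_mult_distrib by (simp add: nn_integral_multc)
    also have "\<dots> = H1 c * H2 c"
      unfolding H2_def by (simp add: nn_integral_cmult)
    finally have *: "(\<integral>\<^sup>+x. h1 (snd x, c) * h2 (fst x, c) * h3 x \<partial>lborel)\<^sup>2 \<le> H1 c * H2 c * K" .
    show ?thesis
      by (rule ennreal_power2_le_iff[THEN iffD1]) (use * in \<open>simp add: power_mult_distrib esqrt_power2\<close>)
  qed
  have "(\<integral>\<^sup>+c. \<integral>\<^sup>+x. h1 (snd x, c) * h2 (fst x, c) * h3 x \<partial>lborel \<partial>lborel)
    \<le> (\<integral>\<^sup>+c. esqrt (H1 c) * esqrt (H2 c) * esqrt K \<partial>lborel)"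
    by (intro nn_integral_mono J)
  also have "\<dots> = (\<integral>\<^sup>+c. esqrt (H1 c) * esqrt (H2 c) \<partial>lborel) * esqrt K"
    by (simp add: nn_integral_multc)
  finally have "(\<integral>\<^sup>+c. \<integral>\<^sup>+x. h1 (snd x, c) * h2 (fst x, c) * h3 x \<partial>lborel \<partial>lborel)\<^sup>2
    \<le> ((\<integral>\<^sup>+c. esqrt (H1 c) * esqrt (H2 c) \<partial>lborel) * esqrt K)\<^sup>2"
    by (rule power_mono) simp
  also have "\<dots> = (\<integral>\<^sup>+c. esqrt (H1 c) * esqrt (H2 c) \<partial>lborel)\<^sup>2 * K"
    by (simp add: power_mult_distrib esqrt_power2)
  also have "(\<integral>\<^sup>+c. esqrt (H1 c) * esqrt (H2 c) \<partial>lborel)\<^sup>2 \<le> (\<integral>\<^sup>+c. (esqrt (H1 c))\<^sup>2 \<partial>lborel) * (\<integral>\<^sup>+c. (esqrt (H2 c))\<^sup>2 \<partial>lborel)"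
    by (rule Cauchy_Schwarz_nn_integral) measurable
  also have "(\<integral>\<^sup>+c. (esqrt (H1 c))\<^sup>2 \<partial>lborel) = (\<integral>\<^sup>+x. (h1 x)\<^sup>2 \<partial>lborel)"
    unfolding esqrt_power2 H1_def by (rule nn_integral_lborel_pair(2)[symmetric]) measurable
  also have "(\<integral>\<^sup>+c. (esqrt (H2 c))\<^sup>2 \<partial>lborel) = (\<integral>\<^sup>+x. (h2 x)\<^sup>2 \<partial>lborel)"
    unfolding esqrt_power2 H2_def by (rule nn_integral_lborel_pair(2)[symmetric]) measurable
  finally show ?thesis by (simp add: K_def mult_right_mono)
qed

section \<open>Coordinates on \<open>real^3\<close> and Tonelli's theorem\<close>

definition mk3 :: "(real \<times> real) \<times> real \<Rightarrow> real^3" where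
  "mk3 x = vector [fst (fst x), snd (fst x), snd x]"

lemma mk3_nth [simp]: "mk3 ((a, b), c) $ 1 = a" "mk3 ((a, b), c) $ 2 = b" "mk3 ((a, b), c) $ 3 = c"
  by (auto simp: mk3_def)

lemma mk3_measurable[measurable]: "mk3 \<in> borel_measurable borel"
proof (rule borel_measurable_continuous_onI)
  show "continuous_on UNIV mk3"
    by (subst continuous_on_componentwise)
      (auto simp: Basis_vec_def inner_axis forall_3 mk3_def intro!: continuous_intros)
qed

lemma Basis_real3: "(Basis :: (real^3) set) = {axis 1 1, axis 2 1, axis 3 1}"
  by (auto simp: Basis_vec_def UNIV_3)

lemma Basis_real_prod3: "(Basis :: ((real \<times> real) \<times> real) set) = {((1, 0), 0), ((0, 1), 0), ((0, 0), 1)}"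
  by (auto simp: Basis_prod_def zero_prod_def)

lemma mk3_lborel: "(lborel :: (real^3) measure) = distr lborel borel mk3"
proof (rule lborel_eqI)
  fix l u :: "real^3"
  assume lu: "\<And>b. b \<in> Basis \<Longrightarrow> l \<bullet> b \<le> u \<bullet> b"
  have le: "l $ i \<le> u $ i" for i
    using lu[of "axis i 1"] by (simp add: inner_axis axis_in_Basis_iff)
  have "emeasure (distr lborel borel mk3) (box l u) = emeasure lborel (mk3 -` box l u)"
    by (subst emeasure_distr) auto
  also have "mk3 -` box l u = box ((l $ 1, l $ 2), l $ 3) ((u $ 1, u $ 2), u $ 3)"
    by (auto simp: mem_box_cart forall_3 box_prod mk3_def box_real)
  also have "emeasure lborel \<dots> = ennreal ((u $ 1 - l $ 1) * (u $ 2 - l $ 2) * (u $ 3 - l $ 3))"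
    using le by (subst emeasure_lborel_box) (auto simp: Basis_real_prod3 mult.assoc)
  also have "\<dots> = (\<Prod>b\<in>Basis. (u - l) \<bullet> b)"
    by (simp add: Basis_real3 inner_axis axis_eq_axis mult.assoc)
  finally show "emeasure (distr lborel borel mk3) (box l u) = (\<Prod>b\<in>Basis. (u - l) \<bullet> b)" .
qed auto

lemma borel_measurable_nn_integral_lborel:
  fixes F :: "'a::euclidean_space \<times> 'b::euclidean_space \<Rightarrow> ennreal"
  assumes "F \<in> borel_measurable borel"
  shows "(\<lambda>x. \<integral>\<^sup>+y. F (x, y) \<partial>lborel) \<in> borel_measurable borel"
proof -
  have "F \<in> borel_measurable (lborel \<Otimes>\<^sub>M lborel)"
    using assms by (simp add: lborel_prod)
  from lborel.borel_measurable_nn_integral_fst[OF this] show ?thesis by simp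
qed

text \<open>The last three forms make each coordinate in turn the innermost variable; they identify
  the integrals of the three line integrals of one function.\<close>

lemma nn_integral_mk3:
  fixes f :: "real^3 \<Rightarrow> ennreal"
  assumes [measurable]: "f \<in> borel_measurable borel"
  shows "(\<integral>\<^sup>+x. f x \<partial>lborel) = (\<integral>\<^sup>+c. \<integral>\<^sup>+x. f (mk3 (x, c)) \<partial>lborel \<partial>lborel)"
    and "(\<integral>\<^sup>+x. f x \<partial>lborel) = (\<integral>\<^sup>+x. \<integral>\<^sup>+c. f (mk3 (x, c)) \<partial>lborel \<partial>lborel)"
    and "(\<integral>\<^sup>+x. f x \<partial>lborel) = (\<integral>\<^sup>+x. \<integral>\<^sup>+b. f (mk3 ((fst x, b), snd x)) \<partial>lborel \<partial>lborel)"
    and "(\<integral>\<^sup>+x. f x \<partial>lborel) = (\<integral>\<^sup>+x. \<integral>\<^sup>+a. f (mk3 ((a, fst x), snd x)) \<partial>lborel \<partial>lborel)"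
proof -
  have "(\<integral>\<^sup>+x. f x \<partial>lborel) = (\<integral>\<^sup>+x. f (mk3 x) \<partial>lborel)"
    by (subst mk3_lborel) (simp add: nn_integral_distr)
  also have "\<dots> = (\<integral>\<^sup>+x. f (mk3 x) \<partial>(lborel \<Otimes>\<^sub>M lborel))"
    by (simp add: lborel_prod)
  also have "\<dots> = (\<integral>\<^sup>+x. \<integral>\<^sup>+c. f (mk3 (x, c)) \<partial>lborel \<partial>lborel)"
    by (subst lborel.nn_integral_fst) (simp_all add: lborel_prod)
  finally show 1: "(\<integral>\<^sup>+x. f x \<partial>lborel) = (\<integral>\<^sup>+x. \<integral>\<^sup>+c. f (mk3 (x, c)) \<partial>lborel \<partial>lborel)" .
  also have "\<dots> = (\<integral>\<^sup>+c. \<integral>\<^sup>+x. f (mk3 (x, c)) \<partial>lborel \<partial>lborel)"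
    by (rule lborel_pair.Fubini'[symmetric]) measurable
  finally show 2: "(\<integral>\<^sup>+x. f x \<partial>lborel) = (\<integral>\<^sup>+c. \<integral>\<^sup>+x. f (mk3 (x, c)) \<partial>lborel \<partial>lborel)" .
  note p = nn_integral_lborel_pair(1) and q = nn_integral_lborel_pair(2)
  have m: "continuous_on UNIV (\<lambda>x::(real \<times> real) \<times> real. ((fst (fst x), snd x), snd (fst x)))"
    "continuous_on UNIV (\<lambda>x::(real \<times> real) \<times> real. ((snd x, fst (fst x)), snd (fst x)))"
    by (auto intro!: continuous_intros)
  have m1: "(\<lambda>x. \<integral>\<^sup>+b. f (mk3 ((fst x, b), snd x)) \<partial>lborel) \<in> borel_measurable borel"
    using measurable_compose[OF borel_measurable_continuous_onI[OF m(1)], of "\<lambda>x. f (mk3 x)"]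
    by (intro borel_measurable_nn_integral_lborel[of "\<lambda>x. f (mk3 ((fst (fst x), snd x), snd (fst x)))", simplified]) simp
  have m2: "(\<lambda>x. \<integral>\<^sup>+a. f (mk3 ((a, fst x), snd x)) \<partial>lborel) \<in> borel_measurable borel"
    using measurable_compose[OF borel_measurable_continuous_onI[OF m(2)], of "\<lambda>x. f (mk3 x)"]
    by (intro borel_measurable_nn_integral_lborel[of "\<lambda>x. f (mk3 ((snd x, fst (fst x)), snd (fst x)))", simplified]) simp
  have "(\<lambda>x. f (mk3 (x, c))) \<in> borel_measurable borel" for c
    by (rule measurable_compose[OF borel_measurable_continuous_onI]) (auto intro!: continuous_intros)
  note m3 = this
  have "(\<integral>\<^sup>+x. f x \<partial>lborel) = (\<integral>\<^sup>+c. \<integral>\<^sup>+a. \<integral>\<^sup>+b. f (mk3 ((a, b), c)) \<partial>lborel \<partial>lborel \<partial>lborel)"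
    unfolding 2 p[OF m3] ..
  also have "\<dots> = (\<integral>\<^sup>+x. \<integral>\<^sup>+b. f (mk3 ((fst x, b), snd x)) \<partial>lborel \<partial>lborel)"
    unfolding q[OF m1] by simp
  finally show "(\<integral>\<^sup>+x. f x \<partial>lborel) = (\<integral>\<^sup>+x. \<integral>\<^sup>+b. f (mk3 ((fst x, b), snd x)) \<partial>lborel \<partial>lborel)" .
  have "(\<integral>\<^sup>+x. f x \<partial>lborel) = (\<integral>\<^sup>+c. \<integral>\<^sup>+b. \<integral>\<^sup>+a. f (mk3 ((a, b), c)) \<partial>lborel \<partial>lborel \<partial>lborel)"
    unfolding 2 q[OF m3] ..
  also have "\<dots> = (\<integral>\<^sup>+x. \<integral>\<^sup>+a. f (mk3 ((a, fst x), snd x)) \<partial>lborel \<partial>lborel)"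
    unfolding q[OF m2] by simp
  finally show "(\<integral>\<^sup>+x. f x \<partial>lborel) = (\<integral>\<^sup>+x. \<integral>\<^sup>+a. f (mk3 ((a, fst x), snd x)) \<partial>lborel \<partial>lborel)" .
qed

section \<open>Restriction to lines and the endpoint Sobolev inequality\<close>

lemma DERIV_line:
  fixes f :: "'a::euclidean_space \<Rightarrow> real"
  assumes "f differentiable (at (x + s *\<^sub>R h))"
  shows "((\<lambda>s. f (x + s *\<^sub>R h)) has_real_derivative (grad f (x + s *\<^sub>R h) \<bullet> h)) (at s within A)"
proof -
  have df: "(f has_derivative (\<lambda>k. k \<bullet> grad f (x + s *\<^sub>R h))) (at (x + s *\<^sub>R h))"
    using GDERIV_grad[OF assms] by (simp add: gderiv_def)
  have "((\<lambda>s. x + s *\<^sub>R h) has_derivative (\<lambda>r. r *\<^sub>R h)) (at s within A)"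
    by (auto intro!: derivative_eq_intros)
  from has_derivative_compose[OF this df]
  show ?thesis
    by (simp add: has_field_derivative_def inner_commute mult.commute[of _ "h \<bullet> _"])
qed

lemma ftc_bound:
  fixes \<phi> :: "real \<Rightarrow> real"
  assumes d: "\<And>s. (\<phi> has_real_derivative \<phi>' s) (at s)" and c: "continuous_on UNIV \<phi>'"
    and z: "\<And>s. \<bar>s\<bar> > R \<Longrightarrow> \<phi> s = 0"
  shows "ennreal \<bar>\<phi> a\<bar> \<le> (\<integral>\<^sup>+s. ennreal \<bar>\<phi>' s\<bar> \<partial>lborel)"
proof -
  \<comment> \<open>A point to the left of \<open>a\<close> and beyond the support, from which the
    derivative is integrated.\<close>
  define L where "L = - \<bar>R\<bar> - \<bar>a\<bar> - 1"
  have L: "L \<le> a" "\<phi> L = 0" using z[of L] by (auto simp: L_def)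
  have cc: "continuous_on {L..a} \<phi>'" using c continuous_on_subset by blast
  have i: "integrable lborel (\<lambda>x. indicator {L..a} x *\<^sub>R \<phi>' x)"
    using cc by (intro borel_integrable_compact) auto
  have "integral\<^sup>L lborel (\<lambda>x. indicator {L..a} x *\<^sub>R \<phi>' x) = \<phi> a - \<phi> L"
    by (rule integral_FTC_Icc[OF L(1) _ cc])
      (use d in \<open>auto simp: has_real_derivative_iff_has_vector_derivative intro: has_vector_derivative_at_within\<close>)
  then have "\<phi> a = integral\<^sup>L lborel (\<lambda>x. indicator {L..a} x *\<^sub>R \<phi>' x)" using L by simp
  then have "ennreal \<bar>\<phi> a\<bar> \<le> (\<integral>\<^sup>+x. ennreal (norm (indicator {L..a} x *\<^sub>R \<phi>' x)) \<partial>lborel)"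
    using integral_norm_bound_ennreal[OF i] by simp
  also have "\<dots> \<le> (\<integral>\<^sup>+s. ennreal \<bar>\<phi>' s\<bar> \<partial>lborel)"
    by (intro nn_integral_mono) (auto simp: indicator_def)
  finally show ?thesis .
qed

text \<open>This is the bound of the norm of \<open>f\<close> in L^(3/2) by that of its gradient in
  L^1, cubed. At each point |f| is at most each of the line integrals \<open>g1\<close>,
  \<open>g2\<close>, \<open>g3\<close> of |grad f| in the coordinate directions, so |f|^(3/2) is at
  most the product of their square roots and \<open>loomis_whitney\<close> applies. Passing
  \<open>w\<close> for the square root of |f| avoids real exponents; in the application it is a
  polynomial expression.\<close>

lemma sobolev_L1:
  fixes f w :: "real^3 \<Rightarrow> real"
  assumes f: "f \<in> Cc_smooth UNIV" and w: "w \<in> borel_measurable borel" "\<And>x. 0 \<le> w x" "\<And>x. (w x)\<^sup>2 = \<bar>f x\<bar>"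
  shows "(\<integral>\<^sup>+x. ennreal (w x ^ 3) \<partial>lborel)\<^sup>2 \<le> (\<integral>\<^sup>+x. ennreal (norm (grad f x)) \<partial>lborel) ^ 3"
proof -
  have sm: "smooth_on UNIV f" using f by (rule Cc_smooth_smooth)
  have df: "f differentiable (at x)" for x using smooth_on_differentiable[OF sm] by auto
  have cg: "continuous_on UNIV (grad f)" using smooth_on_grad_continuous[OF sm] .
  obtain K where K: "compact K" "\<And>x. x \<notin> K \<Longrightarrow> f x = 0" using Cc_smoothD[OF f] by metis
  obtain R where R: "\<And>x. x \<in> K \<Longrightarrow> norm x \<le> R"
    using compact_imp_bounded[OF K(1)] bounded_iff by blast
  define G where "G x = ennreal (norm (grad f x))" for x
  have Gm[measurable]: "G \<in> borel_measurable borel"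
    unfolding G_def[abs_def] using borel_measurable_continuous_onI[OF cg] by measurable
  have line: "ennreal \<bar>f (x + a *\<^sub>R axis i 1)\<bar> \<le> (\<integral>\<^sup>+s. G (x + s *\<^sub>R axis i 1) \<partial>lborel)" for x a i
  proof -
    have "ennreal \<bar>f (x + a *\<^sub>R axis i 1)\<bar> \<le> (\<integral>\<^sup>+s. ennreal \<bar>grad f (x + s *\<^sub>R axis i 1) \<bullet> axis i 1\<bar> \<partial>lborel)"
    proof (rule ftc_bound[where R="R + norm x" and \<phi>="\<lambda>s. f (x + s *\<^sub>R axis i 1)" and a=a])
      show "((\<lambda>s. f (x + s *\<^sub>R axis i 1)) has_real_derivative (grad f (x + s *\<^sub>R axis i 1) \<bullet> axis i 1)) (at s)" for s
        using DERIV_line[OF df] .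
      show "continuous_on UNIV (\<lambda>s. grad f (x + s *\<^sub>R axis i 1) \<bullet> axis i 1)"
        by (intro continuous_intros continuous_on_compose2[OF cg]) auto
      fix s :: real assume s: "\<bar>s\<bar> > R + norm x"
      have "\<bar>s\<bar> - norm x \<le> norm (x + s *\<^sub>R axis i 1)"
        using norm_triangle_ineq2[of "s *\<^sub>R axis i 1" "- x"] by (simp add: norm_axis_1 add.commute)
      then have "x + s *\<^sub>R axis i 1 \<notin> K" using R s by force
      then show "f (x + s *\<^sub>R axis i 1) = 0" using K by simp
    qed
    also have "\<dots> \<le> (\<integral>\<^sup>+s. G (x + s *\<^sub>R axis i 1) \<partial>lborel)"
    proof (intro nn_integral_mono)
      fix s
      have "\<bar>grad f (x + s *\<^sub>R axis i 1) \<bullet> axis i 1\<bar> \<le> norm (grad f (x + s *\<^sub>R axis i 1))"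
        using Cauchy_Schwarz_ineq2[of "grad f (x + s *\<^sub>R axis i 1)" "axis i 1"] by (simp add: norm_axis_1)
      then show "ennreal \<bar>grad f (x + s *\<^sub>R axis i 1) \<bullet> axis i 1\<bar> \<le> G (x + s *\<^sub>R axis i 1)"
        by (simp add: G_def)
    qed
    finally show ?thesis .
  qed
  define g1 where "g1 x = (\<integral>\<^sup>+a. G (mk3 ((a, fst x), snd x)) \<partial>lborel)" for x
  define g2 where "g2 x = (\<integral>\<^sup>+b. G (mk3 ((fst x, b), snd x)) \<partial>lborel)" for x
  define g3 where "g3 x = (\<integral>\<^sup>+c. G (mk3 (x, c)) \<partial>lborel)" for x
  have m: "continuous_on UNIV (\<lambda>x::(real \<times> real) \<times> real. ((fst (fst x), snd x), snd (fst x)))"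
    "continuous_on UNIV (\<lambda>x::(real \<times> real) \<times> real. ((snd x, fst (fst x)), snd (fst x)))"
    by (auto intro!: continuous_intros)
  have gm[measurable]: "g1 \<in> borel_measurable borel" "g2 \<in> borel_measurable borel" "g3 \<in> borel_measurable borel"
  proof -
    have Gm3: "(\<lambda>x. G (mk3 x)) \<in> borel_measurable borel" by measurable
    show "g1 \<in> borel_measurable borel"
      using borel_measurable_nn_integral_lborel[OF measurable_compose[OF borel_measurable_continuous_onI[OF m(2)] Gm3]]
      by (simp add: g1_def[abs_def])
    show "g2 \<in> borel_measurable borel"
      using borel_measurable_nn_integral_lborel[OF measurable_compose[OF borel_measurable_continuous_onI[OF m(1)] Gm3]]
      by (simp add: g2_def[abs_def])
    show "g3 \<in> borel_measurable borel"
      using borel_measurable_nn_integral_lborel[OF Gm3]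
      by (simp add: g3_def[abs_def])
  qed
  have mk: "mk3 ((a, b), c) = mk3 ((0, b), c) + a *\<^sub>R axis 1 1"
    "mk3 ((a, b), c) = mk3 ((a, 0), c) + b *\<^sub>R axis 2 1"
    "mk3 ((a, b), c) = mk3 ((a, b), 0) + c *\<^sub>R axis 3 1" for a b c
    by (auto simp: vec_eq_iff forall_3 axis_def)
  have bnd: "ennreal (w (mk3 ((a, b), c))) \<le> esqrt (g1 (b, c))"
    "ennreal (w (mk3 ((a, b), c))) \<le> esqrt (g2 (a, c))"
    "ennreal (w (mk3 ((a, b), c))) \<le> esqrt (g3 (a, b))" for a b c
  proof -
    have *: "ennreal (w y) \<le> esqrt z" if "ennreal \<bar>f y\<bar> \<le> z" for y z
      by (rule ennreal_power2_le_iff[THEN iffD1]) (use that w in \<open>simp add: esqrt_power2 ennreal_power\<close>)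
    show "ennreal (w (mk3 ((a, b), c))) \<le> esqrt (g1 (b, c))"
      using line[of "mk3 ((0, b), c)" a 1]
      unfolding mk(1)[symmetric] by (intro *) (simp add: g1_def)
    show "ennreal (w (mk3 ((a, b), c))) \<le> esqrt (g2 (a, c))"
      using line[of "mk3 ((a, 0), c)" b 2]
      unfolding mk(2)[symmetric] by (intro *) (simp add: g2_def)
    show "ennreal (w (mk3 ((a, b), c))) \<le> esqrt (g3 (a, b))"
      using line[of "mk3 ((a, b), 0)" c 3]
      unfolding mk(3)[symmetric] by (intro *) (simp add: g3_def)
  qed
  have "(\<integral>\<^sup>+x. ennreal (w x ^ 3) \<partial>lborel) = (\<integral>\<^sup>+c. \<integral>\<^sup>+x. ennreal (w (mk3 (x, c)) ^ 3) \<partial>lborel \<partial>lborel)"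
    using w(1) by (intro nn_integral_mk3(1)) measurable
  also have "\<dots> \<le> (\<integral>\<^sup>+c. \<integral>\<^sup>+x. esqrt (g1 (snd x, c)) * esqrt (g2 (fst x, c)) * esqrt (g3 x) \<partial>lborel \<partial>lborel)"
  proof (intro nn_integral_mono)
    fix c :: real and x :: "real \<times> real"
    obtain a b where x: "x = (a, b)" by (cases x)
    have "ennreal (w (mk3 (x, c)) ^ 3) = ennreal (w (mk3 (x, c))) * ennreal (w (mk3 (x, c))) * ennreal (w (mk3 (x, c)))"
      using w(2) by (simp add: power3_eq_cube ennreal_mult)
    also have "\<dots> \<le> esqrt (g1 (snd x, c)) * esqrt (g2 (fst x, c)) * esqrt (g3 x)"
      unfolding x using bnd by (intro mult_mono) auto
    finally show "ennreal (w (mk3 (x, c)) ^ 3) \<le> esqrt (g1 (snd x, c)) * esqrt (g2 (fst x, c)) * esqrt (g3 x)" .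
  qed
  finally have "(\<integral>\<^sup>+x. ennreal (w x ^ 3) \<partial>lborel)\<^sup>2 \<le> (\<integral>\<^sup>+c. \<integral>\<^sup>+x. esqrt (g1 (snd x, c)) * esqrt (g2 (fst x, c)) * esqrt (g3 x) \<partial>lborel \<partial>lborel)\<^sup>2"
    by (rule power_mono) simp
  also have "\<dots> \<le> (\<integral>\<^sup>+x. (esqrt (g1 x))\<^sup>2 \<partial>lborel) * (\<integral>\<^sup>+x. (esqrt (g2 x))\<^sup>2 \<partial>lborel) * (\<integral>\<^sup>+x. (esqrt (g3 x))\<^sup>2 \<partial>lborel)"
    by (rule loomis_whitney) measurable
  also have "\<dots> = (\<integral>\<^sup>+x. G x \<partial>lborel) * (\<integral>\<^sup>+x. G x \<partial>lborel) * (\<integral>\<^sup>+x. G x \<partial>lborel)"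
    unfolding esqrt_power2 g1_def g2_def g3_def
    using nn_integral_mk3(2-4)[OF Gm] by simp
  finally show ?thesis by (simp add: G_def power3_eq_cube)
qed

subsection \<open>A weighted Sobolev inequality on the ball\<close>

text \<open>The integrand is the divergence of the field \<open>g x *\<^sub>R x\<close>. Every
  integration by parts below, in the weighted Sobolev inequality and in both ground state
  computations, is an instance.\<close>

lemma integral_radial_divergence:
  fixes g :: "'a::euclidean_space \<Rightarrow> real"
  assumes "g \<in> Cc_smooth UNIV"
  shows "(LINT x|lborel. real DIM('a) * g x + grad g x \<bullet> x) = 0"
proof -
  have sm: "smooth_on UNIV g" using assms by (rule Cc_smooth_smooth)
  obtain K where K: "compact K" "\<And>x. x \<notin> K \<Longrightarrow> g x = 0" using Cc_smoothD[OF assms] by metis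
  define f where "f b x = (x \<bullet> b) * g x" for b x
  have smf: "smooth_on UNIV (f b)" for b
    unfolding f_def[abs_def] by (intro smooth_on_mult smooth_on_inner sm) auto
  have gf: "grad (f b) x = (x \<bullet> b) *\<^sub>R grad g x + g x *\<^sub>R b" for b x
  proof (rule grad_eqI)
    have "GDERIV (\<lambda>x. x \<bullet> b) x :> b" unfolding gderiv_def by (auto intro!: derivative_eq_intros)
    from GDERIV_mult[OF this GDERIV_grad[OF smooth_on_differentiable[OF sm]]]
    show "GDERIV (f b) x :> (x \<bullet> b) *\<^sub>R grad g x + g x *\<^sub>R b" by (simp add: f_def[abs_def])
  qed
  have z: "(LINT x|lborel. grad (f b) x \<bullet> b) = 0" for b
    by (rule smooth_on_div_integral_0[OF smf K(1)]) (simp add: f_def K(2))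
  have i: "integrable lborel (\<lambda>x. grad (f b) x \<bullet> b)" for b
  proof (rule integrable_compact_support[OF K(1)])
    show "continuous_on K (\<lambda>x. grad (f b) x \<bullet> b)"
      by (intro continuous_intros continuous_on_subset[OF smooth_on_grad_continuous[OF smf]]) auto
    show "grad (f b) x \<bullet> b = 0" if "x \<notin> K" for x
      using grad_zero_outside[OF compact_imp_closed[OF K(1)], of "f b" x] that K(2) by (simp add: f_def)
  qed
  have "real DIM('a) * g x + grad g x \<bullet> x = (\<Sum>b\<in>Basis. grad (f b) x \<bullet> b)" for x
    unfolding euclidean_inner[of "grad g x" x]
    by (simp add: gf inner_add_left sum.distrib mult.commute)
  then have "(LINT x|lborel. real DIM('a) * g x + grad g x \<bullet> x) = (\<Sum>b\<in>Basis. LINT x|lborel. grad (f b) x \<bullet> b)"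
    using i by simp
  then show ?thesis using z by simp
qed

lemma GDERIV_normsq: "GDERIV (\<lambda>x. (norm x)\<^sup>2) x :> 2 *\<^sub>R x"
  unfolding power2_norm_eq_inner gderiv_def
  by (auto intro!: derivative_eq_intros simp: inner_commute)

lemma GDERIV_compose_normsq:
  assumes "(g has_real_derivative g') (at ((norm x)\<^sup>2))"
  shows "GDERIV (\<lambda>x. g ((norm x)\<^sup>2)) x :> (2 * g') *\<^sub>R x"
  using GDERIV_DERIV_compose[OF GDERIV_normsq assms] by (simp add: mult.commute)

lemma GDERIV_power:
  assumes "GDERIV f x :> G"
  shows "GDERIV (\<lambda>x. f x ^ n) x :> (real n * f x ^ (n - 1)) *\<^sub>R G"
  by (rule GDERIV_DERIV_compose[OF assms]) (auto intro!: derivative_eq_intros)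

text \<open>
The bound comes from \<open>sobolev_L1\<close> applied to \<open>(1 - \<bar>x\<bar>\<^sup>2)\<^sup>2 \<theta>\<^sup>4\<close>.
\<close>

lemma weighted_sobolev_ball:
  fixes \<theta> :: "real^3 \<Rightarrow> real"
  assumes "\<theta> \<in> Cc_smooth (ball 0 1)"
  defines "F \<equiv> LINT x|lborel. (1 - (norm x)\<^sup>2) ^ 3 * \<theta> x ^ 6"
    and "Q \<equiv> LINT x|lborel. (1 - (norm x)\<^sup>2) * (norm (grad \<theta> x))\<^sup>2 + (\<theta> x)\<^sup>2"
  shows "F \<le> (144 * Q) ^ 3" "integrable lborel (\<lambda>x. (1 - (norm x)\<^sup>2) ^ 3 * \<theta> x ^ 6)"
proof -
  have sm: "smooth_on UNIV \<theta>" using assms(1) by (rule Cc_smooth_smooth)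
  have c\<theta>[continuous_intros]: "continuous_on A \<theta>" for A
    using smooth_on_continuous[OF sm] continuous_on_subset by blast
  have cg[continuous_intros]: "continuous_on A (grad \<theta>)" for A
    using smooth_on_grad_continuous[OF sm] continuous_on_subset by blast
  obtain K where K: "compact K" "K \<subseteq> ball 0 1" "\<And>x. x \<notin> K \<Longrightarrow> \<theta> x = 0" using Cc_smoothD[OF assms(1)] by metis
  have gK: "grad \<theta> x = 0" if "x \<notin> K" for x
    using grad_zero_outside[OF compact_imp_closed[OF K(1)]] K(3) that by blast
  have pos: "0 < 1 - (norm x)\<^sup>2" if "x \<in> K" for x
    using that K(2) by (auto simp: power_less_one_iff)
  define q where "q x = (norm x)\<^sup>2" for x :: "real^3"
  have cq[continuous_intros]: "continuous_on A q" for A unfolding q_def by (intro continuous_intros)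
  have q0: "q x \<ge> 0" for x by (simp add: q_def)
  define f where "f x = (1 - q x) ^ 2 * \<theta> x ^ 4" for x
  define a where "a x = (1 - q x) ^ 2 * \<bar>\<theta> x\<bar> ^ 3 * norm (grad \<theta> x)" for x
  \<comment> \<open>\<open>w\<close> is the square root of |f|, and its cube is the integrand of
    \<open>F\<close> on the ball.\<close>
  define w where "w x = \<bar>1 - q x\<bar> * (\<theta> x)\<^sup>2" for x
  note int = integrable_compact_support[OF K(1)]
  have smf: "smooth_on UNIV f"
    unfolding f_def[abs_def] q_def
    by (intro smooth_on_mult smooth_on_power smooth_on_diff smooth_on_const smooth_on_norm_sq sm) auto
  have fC: "f \<in> Cc_smooth UNIV"
    by (rule Cc_smoothI[OF _ K(1)]) (use smf K(3) in \<open>auto simp: f_def\<close>)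
  have gf: "grad f x = (4 * (1 - q x)^2 * \<theta> x ^ 3) *\<^sub>R grad \<theta> x - (4 * (1 - q x) * \<theta> x ^ 4) *\<^sub>R x" for x
  proof (rule grad_eqI)
    have 1: "GDERIV (\<lambda>x. (1 - q x)^2) x :> (2 * (- 2 * (1 - q x))) *\<^sub>R x"
      unfolding q_def by (rule GDERIV_compose_normsq[of "\<lambda>t. (1 - t)^2"]) (auto intro!: derivative_eq_intros)
    have 2: "GDERIV (\<lambda>x. \<theta> x ^ 4) x :> (4 * \<theta> x ^ 3) *\<^sub>R grad \<theta> x"
      using GDERIV_power[OF GDERIV_grad[OF smooth_on_differentiable[OF sm]], of x 4] by simp
    show "GDERIV f x :> (4 * (1 - q x)^2 * \<theta> x ^ 3) *\<^sub>R grad \<theta> x - (4 * (1 - q x) * \<theta> x ^ 4) *\<^sub>R x"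
      unfolding f_def[abs_def]
      by (rule GDERIV_subst[OF GDERIV_mult[OF 1 2]]) (simp add: algebra_simps)
  qed
  have I1: "integrable lborel (\<lambda>x. (1 - q x) ^ 3 * \<theta> x ^ 6)"
    by (rule int) (auto intro!: continuous_intros simp: K(3))
  then show "integrable lborel (\<lambda>x. (1 - (norm x)\<^sup>2) ^ 3 * \<theta> x ^ 6)" by (simp add: q_def)
  have I2: "integrable lborel (\<lambda>x. (1 - q x) * (norm (grad \<theta> x))\<^sup>2 + (\<theta> x)\<^sup>2)"
    by (rule int) (auto intro!: continuous_intros simp: K(3) gK)
  have Ia: "integrable lborel a" unfolding a_def[abs_def]
    by (rule int) (auto intro!: continuous_intros simp: K(3) gK)
  have If: "integrable lborel f" unfolding f_def[abs_def]
    by (rule int) (auto intro!: continuous_intros simp: K(3) gK)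
  have Iq: "integrable lborel (\<lambda>x. (1 - q x) * q x * \<theta> x ^ 4)"
    by (rule int) (auto intro!: continuous_intros simp: K(3) gK)
  have IG: "integrable lborel (\<lambda>x. norm (grad f x))" unfolding gf
    by (rule int) (auto intro!: continuous_intros simp: K(3) gK)
  have Iw: "integrable lborel (\<lambda>x. w x ^ 3)" unfolding w_def
    by (rule int) (auto intro!: continuous_intros simp: K(3) gK)
  define G where "G = (LINT x|lborel. norm (grad f x))"
  have F0: "F \<ge> 0" unfolding F_def
    by (rule integral_nonneg_AE, rule AE_I2) (metis K(3) pos less_imp_le zero_le_power zero_le_even_power' mult_nonneg_nonneg mult_zero_right power_zero_numeral even_numeral order_refl zero_le_even_power)
  have Q0: "Q \<ge> 0" unfolding Q_def
    by (rule integral_nonneg_AE, rule AE_I2) (metis K(3) gK pos less_imp_le add_nonneg_nonneg mult_nonneg_nonneg mult_zero_right norm_zero power_zero_numeral order_refl zero_le_power2 add_0)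
  have G0: "G \<ge> 0" unfolding G_def by simp
  have FG: "F\<^sup>2 \<le> G ^ 3"
  proof -
    have "(\<integral>\<^sup>+x. ennreal (w x ^ 3) \<partial>lborel)\<^sup>2 \<le> (\<integral>\<^sup>+x. ennreal (norm (grad f x)) \<partial>lborel) ^ 3"
    proof (rule sobolev_L1[OF fC])
      show "w \<in> borel_measurable borel" unfolding w_def[abs_def]
        by (intro borel_measurable_continuous_onI continuous_intros)
      show "0 \<le> w x" "(w x)\<^sup>2 = \<bar>f x\<bar>" for x
        by (auto simp: w_def f_def power_mult_distrib abs_mult power_abs)
    qed
    moreover have "(\<integral>\<^sup>+x. ennreal (w x ^ 3) \<partial>lborel) = ennreal (LINT x|lborel. w x ^ 3)"
      by (rule nn_integral_eq_integral[OF Iw]) (simp add: w_def)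
    moreover have "(\<integral>\<^sup>+x. ennreal (norm (grad f x)) \<partial>lborel) = ennreal G"
      unfolding G_def by (rule nn_integral_eq_integral[OF IG]) simp
    moreover have "(LINT x|lborel. w x ^ 3) = F"
      unfolding F_def
    proof (rule Bochner_Integration.integral_cong[OF refl])
      fix x
      show "w x ^ 3 = (1 - (norm x)\<^sup>2) ^ 3 * \<theta> x ^ 6"
        using pos[of x] K(3)[of x] by (cases "x \<in> K") (auto simp: w_def q_def power_mult_distrib power_mult[symmetric])
    qed
    ultimately show ?thesis using F0 G0
      by (simp add: ennreal_power)
  qed
  \<comment> \<open>Differentiating the weight produces the term (1 - q) q \<theta>^4, which has a
    weaker weight than \<open>f\<close>. The divergence identity for \<open>f\<close> bounds this
    term by \<open>f\<close> and \<open>a\<close>.\<close>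
  have div: "4 * (LINT x|lborel. (1 - q x) * q x * \<theta> x ^ 4) \<le> 3 * (LINT x|lborel. f x) + 4 * (LINT x|lborel. a x)"
  proof -
    have "0 = (LINT x|lborel. 3 * f x + grad f x \<bullet> x)"
      using integral_radial_divergence[OF fC] by simp
    also have "\<dots> \<le> (LINT x|lborel. 3 * f x + 4 * a x - 4 * ((1 - q x) * q x * \<theta> x ^ 4))"
    proof (rule integral_mono)
      have "continuous_on K (grad f)"
        by (rule continuous_on_subset[OF smooth_on_grad_continuous[OF smf]]) auto
      then show "integrable lborel (\<lambda>x. 3 * f x + grad f x \<bullet> x)"
        by (intro int) (auto intro!: continuous_intros simp: f_def K(3) gK gf)
      show "integrable lborel (\<lambda>x. 3 * f x + 4 * a x - 4 * ((1 - q x) * q x * \<theta> x ^ 4))"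
        using If Ia Iq by simp
      fix x
      show "3 * f x + grad f x \<bullet> x \<le> 3 * f x + 4 * a x - 4 * ((1 - q x) * q x * \<theta> x ^ 4)"
      proof (cases "x \<in> K")
        case True
        then have "norm x \<le> 1" using K(2) by auto
        have "\<theta> x ^ 3 * (grad \<theta> x \<bullet> x) \<le> \<bar>\<theta> x ^ 3\<bar> * \<bar>grad \<theta> x \<bullet> x\<bar>"
          by (metis abs_ge_self abs_mult)
        also have "\<bar>grad \<theta> x \<bullet> x\<bar> \<le> norm (grad \<theta> x) * norm x" by (rule Cauchy_Schwarz_ineq2)
        also have "norm (grad \<theta> x) * norm x \<le> norm (grad \<theta> x)"
          using \<open>norm x \<le> 1\<close> by (simp add: mult_left_le)
        finally have "\<theta> x ^ 3 * (grad \<theta> x \<bullet> x) \<le> \<bar>\<theta> x\<bar> ^ 3 * norm (grad \<theta> x)"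
          by (simp add: mult_left_mono power_abs)
        from mult_left_mono[OF this, of "(1 - q x)^2"]
        have "(1 - q x)^2 * \<theta> x ^ 3 * (grad \<theta> x \<bullet> x) \<le> a x"
          by (simp add: a_def mult.assoc)
        moreover have "x \<bullet> x = q x" by (simp add: q_def power2_norm_eq_inner)
        ultimately show ?thesis by (simp add: gf inner_diff_left algebra_simps)
      qed (simp add: f_def a_def gf K(3) gK)
    qed
    also have "\<dots> = 3 * (LINT x|lborel. f x) + 4 * (LINT x|lborel. a x) - 4 * (LINT x|lborel. (1 - q x) * q x * \<theta> x ^ 4)"
      using If Ia Iq by simp
    finally show ?thesis by simp
  qed
  have G1: "G \<le> 8 * (LINT x|lborel. a x) + 7 * (LINT x|lborel. f x)"
  proof -
    have "G \<le> (LINT x|lborel. 4 * a x + 4 * f x + 4 * ((1 - q x) * q x * \<theta> x ^ 4))"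
      unfolding G_def
    proof (rule integral_mono[OF IG])
      show "integrable lborel (\<lambda>x. 4 * a x + 4 * f x + 4 * ((1 - q x) * q x * \<theta> x ^ 4))"
        using If Ia Iq by simp
      fix x
      show "norm (grad f x) \<le> 4 * a x + 4 * f x + 4 * ((1 - q x) * q x * \<theta> x ^ 4)"
      proof (cases "x \<in> K")
        case True
        then have "norm x \<le> 1" "0 < 1 - q x" using K(2) pos by (auto simp: q_def)
        have "norm (grad f x) \<le> norm ((4 * (1 - q x)^2 * \<theta> x ^ 3) *\<^sub>R grad \<theta> x) + norm ((4 * (1 - q x) * \<theta> x ^ 4) *\<^sub>R x)"
          unfolding gf by (rule norm_triangle_ineq4)
        also have "norm ((4 * (1 - q x)^2 * \<theta> x ^ 3) *\<^sub>R grad \<theta> x) = 4 * a x"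
          by (simp add: a_def abs_mult power_abs)
        also have "norm ((4 * (1 - q x) * \<theta> x ^ 4) *\<^sub>R x) \<le> 4 * (1 - q x) * \<theta> x ^ 4"
          using \<open>norm x \<le> 1\<close> \<open>0 < 1 - q x\<close> by (simp add: abs_mult mult_left_le)
        also have "4 * (1 - q x) * \<theta> x ^ 4 = 4 * f x + 4 * ((1 - q x) * q x * \<theta> x ^ 4)"
          by (simp add: f_def power2_eq_square algebra_simps)
        finally show ?thesis by simp
      qed (simp add: f_def a_def gf K(3) gK)
    qed
    also have "\<dots> = 4 * (LINT x|lborel. a x) + 4 * (LINT x|lborel. f x) + 4 * (LINT x|lborel. (1 - q x) * q x * \<theta> x ^ 4)"
      using If Ia Iq by simp
    finally show ?thesis using div by simp
  qed
  \<comment> \<open>Young's inequality splits both \<open>a\<close> and \<open>f\<close> into the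
    density of \<open>F\<close> and a density of \<open>Q\<close>. The parameter \<open>l\<close>
    stays free; its value sqrt Q / sqrt F balances the two terms and gives G \<le> 12 sqrt (F
    Q).\<close>
  have G2: "G \<le> 8 * l * F + 4 * Q / l" if l: "l > 0" for l
  proof -
    have "8 * (LINT x|lborel. a x) + 7 * (LINT x|lborel. f x) = (LINT x|lborel. 8 * a x + 7 * f x)"
      using Ia If by simp
    also have "\<dots> \<le> (LINT x|lborel. 8 * l * ((1 - q x) ^ 3 * \<theta> x ^ 6) + (4 / l) * ((1 - q x) * (norm (grad \<theta> x))\<^sup>2 + (\<theta> x)\<^sup>2))"
    proof (rule integral_mono)
      show "integrable lborel (\<lambda>x. 8 * a x + 7 * f x)" using Ia If by simp
      show "integrable lborel (\<lambda>x. 8 * l * ((1 - q x) ^ 3 * \<theta> x ^ 6) + (4 / l) * ((1 - q x) * (norm (grad \<theta> x))\<^sup>2 + (\<theta> x)\<^sup>2))"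
        by (rule Bochner_Integration.integrable_add[OF integrable_mult_right[OF I1] integrable_mult_right[OF I2]])
      fix x
      show "8 * a x + 7 * f x \<le> 8 * l * ((1 - q x) ^ 3 * \<theta> x ^ 6) + (4 / l) * ((1 - q x) * (norm (grad \<theta> x))\<^sup>2 + (\<theta> x)\<^sup>2)"
      proof (cases "x \<in> K")
        case True
        then have s: "0 < 1 - q x" "1 - q x \<le> 1" using pos q0 by (auto simp: q_def)
        define s where "s = sqrt (1 - q x)"
        have s2: "1 - q x = s\<^sup>2" "0 < s" using s by (auto simp: s_def)
        define A where "A = s ^ 3 * \<bar>\<theta> x\<bar> ^ 3"
        define B where "B = s * norm (grad \<theta> x)"
        define C where "C = s * \<bar>\<theta> x\<bar>"
        have young: "2 * (A * Y) \<le> l * A\<^sup>2 + Y\<^sup>2 / l" for Y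
        proof -
          have "0 \<le> (l * A - Y)\<^sup>2 / l" using l by simp
          also have "\<dots> = l * A\<^sup>2 + Y\<^sup>2 / l - 2 * (A * Y)"
            using l by (simp add: field_simps power2_eq_square)
          finally show ?thesis by simp
        qed
        have e: "a x = A * B" "f x = A * C" "(1 - q x) ^ 3 * \<theta> x ^ 6 = A\<^sup>2" "(1 - q x) * (norm (grad \<theta> x))\<^sup>2 = B\<^sup>2"
          unfolding a_def f_def A_def B_def C_def s2(1)
          by (auto simp: power_mult_distrib power_mult[symmetric] power_abs eval_nat_numeral)
        have "C\<^sup>2 = (1 - q x) * (\<theta> x)\<^sup>2" unfolding C_def s2 by (simp add: power_mult_distrib)
        also have "\<dots> \<le> (\<theta> x)\<^sup>2" using s by (simp add: mult_left_le_one_le)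
        finally have C: "C\<^sup>2 / l \<le> (\<theta> x)\<^sup>2 / l" using l by (simp add: divide_right_mono)
        have f0: "f x \<ge> 0" by (simp add: f_def)
        have "8 * a x + 7 * f x \<le> 4 * (2 * (A * B)) + 4 * (2 * (A * C))" using f0 unfolding e by simp
        also have "\<dots> \<le> 4 * (l * A\<^sup>2 + B\<^sup>2 / l) + 4 * (l * A\<^sup>2 + C\<^sup>2 / l)"
          by (intro add_mono mult_left_mono young) auto
        also have "\<dots> \<le> 8 * l * A\<^sup>2 + (4 / l) * (B\<^sup>2 + (\<theta> x)\<^sup>2)"
          using C by (simp add: distrib_left add_divide_distrib)
        finally show ?thesis unfolding e .
      qed (simp add: f_def a_def K(3) gK)
    qed
    also have "\<dots> = 8 * l * F + (4 / l) * Q"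
      by (subst Bochner_Integration.integral_add[OF integrable_mult_right[OF I1] integrable_mult_right[OF I2]])
        (simp only: integral_mult_right_zero F_def Q_def q_def)
    finally show ?thesis using G1 by simp
  qed
  show "F \<le> (144 * Q) ^ 3"
  proof (cases "F = 0")
    case True
    then show ?thesis using Q0 by simp
  next
    case False
    then have F: "F > 0" using F0 by simp
    have "G > 0"
    proof (rule ccontr)
      assume "\<not> G > 0"
      then have "F\<^sup>2 \<le> 0" using G0 FG by simp
      then show False using F by simp
    qed
    have "Q > 0"
    proof (rule ccontr)
      assume "\<not> Q > 0"
      then have "Q = 0" using Q0 by simp
      then show False using G2[of "G / (16 * F)"] \<open>G > 0\<close> F by simp
    qed
    have "G \<le> 12 * (sqrt F * sqrt Q)"
    proof -
      define l where "l = sqrt Q / sqrt F"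
      have "l * F = sqrt Q * sqrt F" "Q / l = sqrt Q * sqrt F"
        using F \<open>Q > 0\<close> unfolding l_def by (auto simp: field_simps)
      moreover have "l > 0" using F \<open>Q > 0\<close> by (simp add: l_def)
      moreover have "8 * l * F + 4 * Q / l = 8 * (l * F) + 4 * (Q / l)" by simp
      ultimately have "G \<le> 8 * (sqrt Q * sqrt F) + 4 * (sqrt Q * sqrt F)" using G2[of l] by metis
      then show ?thesis by (simp add: mult.commute)
    qed
    then have "G ^ 3 \<le> (12 * (sqrt F * sqrt Q)) ^ 3" using G0 by (rule power_mono)
    then have "F\<^sup>2 \<le> (12 * (sqrt F * sqrt Q)) ^ 3" using FG by linarith
    \<comment> \<open>From F^2 \<le> (144 F Q)^(3/2), squaring gives F^4 \<le> (144 F Q)^3, and a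
      factor F^3 cancels.\<close>
    then have "(F\<^sup>2)\<^sup>2 \<le> ((12 * (sqrt F * sqrt Q)) ^ 3)\<^sup>2" by (rule power_mono) simp
    also have "((12 * (sqrt F * sqrt Q)) ^ 3)\<^sup>2 = ((12 * (sqrt F * sqrt Q))\<^sup>2) ^ 3"
      by (simp add: power_mult[symmetric])
    also have "(12 * (sqrt F * sqrt Q))\<^sup>2 = 144 * F * Q"
      using F \<open>Q > 0\<close> by (simp add: power_mult_distrib)
    finally have "F ^ 3 * F \<le> F ^ 3 * (144 * Q) ^ 3"
      by (simp add: power_mult_distrib eval_nat_numeral mult.assoc mult.left_commute)
    then show ?thesis using F by simp
  qed
qed

subsection \<open>The radial map to Euclidean space\<close>

text \<open>A derivative of this shape is self-adjoint, so the same linear map acts on the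
  gradient.\<close>

lemma GDERIV_compose_rank_one:
  assumes "(g has_derivative (\<lambda>h. \<alpha> *\<^sub>R h + (\<beta> * (v \<bullet> h)) *\<^sub>R v)) (at x)" "u differentiable (at (g x))"
  shows "GDERIV (\<lambda>x. u (g x)) x :> \<alpha> *\<^sub>R grad u (g x) + (\<beta> * (v \<bullet> grad u (g x))) *\<^sub>R v"
proof -
  have "((\<lambda>x. u (g x)) has_derivative (\<lambda>h. (\<alpha> *\<^sub>R h + (\<beta> * (v \<bullet> h)) *\<^sub>R v) \<bullet> grad u (g x))) (at x)"
    using has_derivative_compose[OF assms(1)] GDERIV_grad[OF assms(2)] unfolding gderiv_def by blast
  then show ?thesis
    unfolding gderiv_def
    by (rule has_derivative_eq_rhs) (auto simp: inner_add_left inner_add_right inner_commute)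
qed

text \<open>\<open>D\<close> is the pulled back gradient and \<open>\<alpha>\<^sup>2 * l\<close> the
  Jacobian. The part of \<open>G\<close> orthogonal to \<open>v\<close> is that of \<open>D\<close>
  divided by \<open>\<alpha>\<close>, and the part along \<open>v\<close> is divided by the other
  eigenvalue \<open>l\<close>; multiplying by the Jacobian leaves the factors \<open>l\<close> and
  \<open>\<alpha>\<^sup>2 / l\<close>.\<close>

lemma rank_one_energy:
  fixes G v :: "'a::real_inner"
  assumes "D = \<alpha> *\<^sub>R G + (\<beta> * (v \<bullet> G)) *\<^sub>R v" "t = v \<bullet> v" "t \<noteq> 0" "l = \<alpha> + \<beta> * t" "l \<noteq> 0"
  shows "\<alpha>\<^sup>2 * l * (norm G)\<^sup>2 = l * ((norm D)\<^sup>2 - (v \<bullet> D)\<^sup>2 / t) + \<alpha>\<^sup>2 / l * ((v \<bullet> D)\<^sup>2 / t)"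
proof -
  define m where "m = v \<bullet> G"
  have vD: "v \<bullet> D = l * m"
    unfolding assms(1,4) m_def by (simp add: inner_add_right assms(2) algebra_simps)
  have "(norm D)\<^sup>2 = \<alpha>\<^sup>2 * (norm G)\<^sup>2 + (2 * \<alpha> * \<beta> + \<beta>\<^sup>2 * t) * m\<^sup>2"
    unfolding assms(1) power2_norm_eq_inner m_def
    by (simp add: inner_add_left inner_add_right inner_commute[of G v] assms(2)[symmetric] power2_eq_square algebra_simps)
  then have "l * ((norm D)\<^sup>2 - (v \<bullet> D)\<^sup>2 / t) + \<alpha>\<^sup>2 / l * ((v \<bullet> D)\<^sup>2 / t)
    = \<alpha>\<^sup>2 * l * (norm G)\<^sup>2 + l * m\<^sup>2 * (2 * \<alpha> * \<beta> + \<beta>\<^sup>2 * t - (l\<^sup>2 - \<alpha>\<^sup>2) / t)"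
    unfolding vD using assms(3,5) by (simp add: field_simps power2_eq_square)
  also have "2 * \<alpha> * \<beta> + \<beta>\<^sup>2 * t - (l\<^sup>2 - \<alpha>\<^sup>2) / t = 0"
    unfolding assms(4) using assms(3) by (simp add: field_simps power2_eq_square)
  finally show ?thesis by simp
qed

section \<open>The punctured ball and the logarithmic radius\<close>

abbreviation pball :: "(real^3) set" where
  "pball \<equiv> ball 0 1 - {0}"

lemma open_pball: "open pball" by (simp add: open_delete)

text \<open>For \<open>a = 0\<close> and \<open>A = 1 - ln \<alpha>\<close> this is the reciprocal
  of \<open>X (\<alpha> * r)\<close>; the quadratic term is a perturbation that vanishes at the
  origin.\<close>

definition Sig :: "real \<Rightarrow> real \<Rightarrow> real \<Rightarrow> real" where
  "Sig A a r = A - ln r - a * r\<^sup>2"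

text \<open>The scale \<open>L\<close> is 1 in the inequality. For sharpness it is taken large, so
  that the image, a punctured ball of radius \<open>L / (A - a)\<close>, contains the support of a
  given Euclidean test function.\<close>

definition Ymap :: "real \<Rightarrow> real \<Rightarrow> real \<Rightarrow> real^3 \<Rightarrow> real^3" where
  "Ymap L A a x = (L / (norm x * Sig A a (norm x))) *\<^sub>R x"

lemma Sig_pos: "0 \<le> a \<Longrightarrow> a \<le> A \<Longrightarrow> 0 < r \<Longrightarrow> r < 1 \<Longrightarrow> A - a < Sig A a r"
  unfolding Sig_def using ln_less_zero[of r] mult_left_le[of "r\<^sup>2" a] power_le_one[of r 2] by linarith

lemma Sig_DERIV: "0 < r \<Longrightarrow> (Sig A a has_real_derivative - ((1 + 2 * a * r\<^sup>2) / r)) (at r)"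
  unfolding Sig_def[abs_def] by (auto intro!: derivative_eq_intros simp: field_simps power2_eq_square)

lemma Sig_strict_decreasing:
  assumes "0 \<le> a" "0 < r" "r < r'"
  shows "Sig A a r' < Sig A a r"
proof -
  have "ln r < ln r'" using assms by simp
  moreover have "a * r\<^sup>2 \<le> a * r'\<^sup>2" using assms by (intro mult_left_mono power_mono) auto
  ultimately show ?thesis by (simp add: Sig_def)
qed

lemma Sig_inj: "0 \<le> a \<Longrightarrow> 0 < r \<Longrightarrow> 0 < r' \<Longrightarrow> Sig A a r = Sig A a r' \<Longrightarrow> r = r'"
  using Sig_strict_decreasing[of a r r' A] Sig_strict_decreasing[of a r' r A] by (cases r r' rule: linorder_cases) auto

lemma Sig_surj:
  assumes "0 \<le> a" "A - a < \<sigma>"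
  obtains r where "0 < r" "r < 1" "Sig A a r = \<sigma>"
proof -
  \<comment> \<open>At \<open>r0\<close> the logarithm gives A - ln r0 = \<sigma> + a, and the
    quadratic term takes off at most a. This provides the upper end for the intermediate value
    theorem.\<close>
  define r0 where "r0 = exp (A - a - \<sigma>)"
  have r0: "0 < r0" "r0 < 1" using assms by (auto simp: r0_def)
  have "a * r0\<^sup>2 \<le> a" using assms r0 by (simp add: mult_left_le power_le_one)
  then have "\<sigma> \<le> Sig A a r0" by (simp add: Sig_def r0_def)
  moreover have "Sig A a 1 < \<sigma>" using assms by (simp add: Sig_def)
  moreover have "\<forall>x. r0 \<le> x \<and> x \<le> 1 \<longrightarrow> isCont (Sig A a) x"
    using Sig_DERIV r0 by (meson DERIV_isCont less_le_trans)
  ultimately obtain x where "r0 \<le> x" "x \<le> 1" "Sig A a x = \<sigma>"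
    using IVT2[of "Sig A a" 1 \<sigma> r0] r0 by auto
  moreover then have "x \<noteq> 1" using \<open>Sig A a 1 < \<sigma>\<close> by auto
  ultimately show ?thesis using that[of x] r0 by auto
qed

lemma has_derivative_norm_scale:
  fixes x :: "'a::euclidean_space"
  assumes "x \<noteq> 0" "(g has_real_derivative g') (at (norm x))"
  shows "((\<lambda>x. g (norm x) *\<^sub>R x) has_derivative (\<lambda>h. g (norm x) *\<^sub>R h + (g' / norm x * (x \<bullet> h)) *\<^sub>R x)) (at x)"
proof -
  have "((\<lambda>x. g (norm x)) has_derivative (\<lambda>h. g' * (h \<bullet> sgn x))) (at x)"
    using has_derivative_compose[OF has_derivative_norm[OF assms(1)]] assms(2)
    unfolding has_field_derivative_def by blast
  from has_derivative_scaleR[OF this has_derivative_ident]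
  show ?thesis
    by (rule has_derivative_eq_rhs) (auto simp: sgn_div_norm inner_commute divide_inverse fun_eq_iff algebra_simps)
qed

locale ymap =
  fixes L A a :: real
  assumes L: "0 < L" and a: "0 \<le> a" and A: "a < A"
begin

abbreviation "S \<equiv> Sig A a"
abbreviation "Y \<equiv> Ymap L A a"

lemma S_pos: "x \<in> pball \<Longrightarrow> 0 < S (norm x)"
  using Sig_pos[of a A "norm x"] a A by auto

lemma norm_Y: "x \<in> pball \<Longrightarrow> norm (Y x) = L / S (norm x)"
  using S_pos[of x] L by (auto simp: Ymap_def)

lemma Y_inj: "inj_on Y pball"
proof (rule inj_onI)
  fix x y assume xy: "x \<in> pball" "y \<in> pball" "Y x = Y y"
  then have "L / S (norm x) = L / S (norm y)" using norm_Y by metis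
  then have "S (norm x) = S (norm y)" using L S_pos[OF xy(1)] S_pos[OF xy(2)] by (simp add: field_simps)
  then have n: "norm x = norm y" using Sig_inj[OF a] xy by auto
  have "L / (norm x * S (norm x)) \<noteq> 0" using xy L S_pos[OF xy(1)] by auto
  then show "x = y" using xy(3) n by (simp add: Ymap_def)
qed

lemma Y_range: "Y ` pball = ball 0 (L / (A - a)) - {0}"
proof (intro equalityI subsetI)
  fix y assume "y \<in> Y ` pball"
  then obtain x where x: "x \<in> pball" "y = Y x" by blast
  have "0 < L / S (norm x)" "L / S (norm x) < L / (A - a)"
    using L A S_pos[OF x(1)] Sig_pos[of a A "norm x"] a x(1) by (auto intro!: divide_strict_left_mono)
  then show "y \<in> ball 0 (L / (A - a)) - {0}"
    using norm_Y[OF x(1)] x(2) by auto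
next
  fix y assume y: "y \<in> ball 0 (L / (A - a)) - {0::real^3}"
  then have "A - a < L / norm y" using A L by (auto simp: field_simps)
  from Sig_surj[OF a this] obtain r where r: "0 < r" "r < 1" "S r = L / norm y" .
  define x where "x = (r / norm y) *\<^sub>R y"
  have nx: "norm x = r" using r y by (auto simp: x_def)
  have "Y x = y" unfolding Ymap_def nx r(3) using r y L by (auto simp: x_def)
  moreover have "x \<in> pball" using nx r by auto
  ultimately show "y \<in> Y ` pball" by force
qed

text \<open>
\<open>lt\<close> and \<open>lr\<close> are the tangential and radial stretching factors of \<open>Y\<close>.
\<close>

definition "kk x = 1 + 2 * a * (norm x)\<^sup>2"
definition "lt x = L / (norm x * S (norm x))"
definition "lr x = L * kk x / (norm x * (S (norm x))\<^sup>2)"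

lemma kk_pos: "0 < kk x"
  using a by (simp add: kk_def add_pos_nonneg)

lemma lr_pos: "x \<in> pball \<Longrightarrow> 0 < lr x"
  using L S_pos[of x] kk_pos[of x] unfolding lr_def by (intro divide_pos_pos mult_pos_pos zero_less_power) auto

lemma Y_deriv:
  assumes x: "x \<in> pball"
  shows "(Y has_derivative (\<lambda>h. lt x *\<^sub>R h + ((lr x - lt x) / (norm x)\<^sup>2 * (x \<bullet> h)) *\<^sub>R x)) (at x)"
proof -
  define r where "r = norm x"
  have r: "0 < r" "S r > 0" using x S_pos[OF x] by (auto simp: r_def)
  have "((\<lambda>r. L / (r * S r)) has_real_derivative (lr x - lt x) / r) (at r)"
  proof (rule DERIV_cong)
    show "((\<lambda>r. L / (r * S r)) has_real_derivative (0 * (r * S r) - L * (1 * S r + - ((1 + 2 * a * r\<^sup>2) / r) * r)) / (r * S r * (r * S r))) (at r)"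
      by (intro DERIV_divide DERIV_mult Sig_DERIV DERIV_ident DERIV_const) (use r in auto)
    show "(0 * (r * S r) - L * (1 * S r + - ((1 + 2 * a * r\<^sup>2) / r) * r)) / (r * S r * (r * S r)) = (lr x - lt x) / r"
      unfolding lr_def lt_def kk_def r_def[symmetric] using r by (simp add: field_simps power2_eq_square)
  qed
  then have "((\<lambda>x. (L / (norm x * S (norm x))) *\<^sub>R x) has_derivative
      (\<lambda>h. (L / (norm x * S (norm x))) *\<^sub>R h + ((lr x - lt x) / r / norm x * (x \<bullet> h)) *\<^sub>R x)) (at x)"
    using x unfolding r_def by (intro has_derivative_norm_scale) auto
  then show ?thesis
    unfolding Ymap_def[abs_def] lt_def r_def[symmetric] by (simp add: power2_eq_square)
qed

lemma cont_S: "continuous_on pball (\<lambda>x. S (norm x))"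
  unfolding Sig_def by (auto intro!: continuous_intros)

lemma Y_det:
  assumes x: "x \<in> pball"
  shows "\<bar>det (matrix (\<lambda>h. lt x *\<^sub>R h + ((lr x - lt x) / (norm x)\<^sup>2 * (x \<bullet> h)) *\<^sub>R x))\<bar> = (lt x)\<^sup>2 * lr x"
proof -
  have "lt x + (lr x - lt x) / (norm x)\<^sup>2 * (x \<bullet> x) = lr x"
    using x by (simp add: power2_norm_eq_inner[symmetric])
  then show ?thesis
    unfolding det_rank_one using lr_pos[OF x] by simp
qed

lemma cont_lt: "continuous_on pball lt" and cont_lr: "continuous_on pball lr"
  unfolding lt_def[abs_def] lr_def[abs_def] kk_def
  using S_pos by (auto intro!: continuous_intros cont_S simp: less_imp_neq[symmetric])

lemma Y_integral:
  assumes "f \<in> borel_measurable borel" "\<And>y. y \<notin> Y ` pball \<Longrightarrow> f y = 0"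
  shows "(LINT y|lborel. f y) = (LINT x|lborel. indicator pball x * ((lt x)\<^sup>2 * lr x * f (Y x)))"
    and "integrable lborel f \<longleftrightarrow> integrable lborel (\<lambda>x. indicator pball x * ((lt x)\<^sup>2 * lr x * f (Y x)))"
proof -
  have c: "continuous_on pball (\<lambda>x. (lt x)\<^sup>2 * lr x)"
    by (intro continuous_intros cont_lt cont_lr)
  note cov = change_of_variables_lborel[OF open_pball Y_deriv Y_inj assms Y_det c]
  show "(LINT y|lborel. f y) = (LINT x|lborel. indicator pball x * ((lt x)\<^sup>2 * lr x * f (Y x)))"
    by (rule cov(2))
  show "integrable lborel f \<longleftrightarrow> integrable lborel (\<lambda>x. indicator pball x * ((lt x)\<^sup>2 * lr x * f (Y x)))"
    by (rule cov(1))
qed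

text \<open>In the quotient lt^2 / lr the logarithm cancels and L / (kk r) remains. Hence the radial
  energy keeps no trace of \<open>S\<close>, and only the tangential energy carries 1 / S^2.\<close>

lemma Y_grad_energy:
  assumes x: "x \<in> pball" and u: "u differentiable (at (Y x))"
  shows "(lt x)\<^sup>2 * lr x * (norm (grad u (Y x)))\<^sup>2 =
    lr x * ((norm (grad (\<lambda>x. u (Y x)) x))\<^sup>2 - (x \<bullet> grad (\<lambda>x. u (Y x)) x)\<^sup>2 / (norm x)\<^sup>2)
    + L / (kk x * norm x) * ((x \<bullet> grad (\<lambda>x. u (Y x)) x)\<^sup>2 / (norm x)\<^sup>2)"
proof -
  have D: "grad (\<lambda>x. u (Y x)) x = lt x *\<^sub>R grad u (Y x) + ((lr x - lt x) / (norm x)\<^sup>2 * (x \<bullet> grad u (Y x))) *\<^sub>R x"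
    by (rule grad_eqI[OF GDERIV_compose_rank_one[OF Y_deriv[OF x] u]])
  have t: "(norm x)\<^sup>2 = x \<bullet> x" "(norm x)\<^sup>2 \<noteq> 0" using x by (auto simp: power2_norm_eq_inner)
  have l: "lr x = lt x + (lr x - lt x) / (norm x)\<^sup>2 * (norm x)\<^sup>2" using t(2) by simp
  have "(lt x)\<^sup>2 / lr x = L / (kk x * norm x)"
    unfolding lt_def lr_def using x S_pos[OF x] kk_pos[of x] L by (simp add: field_simps power2_eq_square)
  then show ?thesis
    using rank_one_energy[OF D t l] lr_pos[OF x] by simp
qed

lemma Y_dirichlet:
  assumes u: "u \<in> Cc_smooth (Y ` pball)" 
  defines "w \<equiv> \<lambda>x. u (Y x)"
  shows "(LINT y|lborel. (norm (grad u y))\<^sup>2) =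
    (LINT x|lborel. indicator pball x * (lr x * ((norm (grad w x))\<^sup>2 - (x \<bullet> grad w x)\<^sup>2 / (norm x)\<^sup>2)
    + L / (kk x * norm x) * ((x \<bullet> grad w x)\<^sup>2 / (norm x)\<^sup>2)))"
proof -
  have sm: "smooth_on UNIV u" using u by (rule Cc_smooth_smooth)
  obtain K where K: "compact K" "K \<subseteq> Y ` pball" "\<And>x. x \<notin> K \<Longrightarrow> u x = 0" using Cc_smoothD[OF u] by metis
  have "(LINT y|lborel. (norm (grad u y))\<^sup>2) = (LINT x|lborel. indicator pball x * ((lt x)\<^sup>2 * lr x * (norm (grad u (Y x)))\<^sup>2))"
  proof (rule Y_integral(1))
    show "(\<lambda>y. (norm (grad u y))\<^sup>2) \<in> borel_measurable borel"
      by (intro borel_measurable_continuous_onI continuous_intros smooth_on_grad_continuous[OF sm])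
    show "(norm (grad u y))\<^sup>2 = 0" if "y \<notin> Y ` pball" for y
      using grad_zero_outside[OF compact_imp_closed[OF K(1)], of u y] that K(2,3) by auto
  qed
  also have "\<dots> = (LINT x|lborel. indicator pball x * (lr x * ((norm (grad w x))\<^sup>2 - (x \<bullet> grad w x)\<^sup>2 / (norm x)\<^sup>2)
    + L / (kk x * norm x) * ((x \<bullet> grad w x)\<^sup>2 / (norm x)\<^sup>2)))"
    unfolding w_def
    by (rule Bochner_Integration.integral_cong[OF refl])
      (use Y_grad_energy smooth_on_differentiable[OF sm] in \<open>auto simp: indicator_def\<close>)
  finally show ?thesis .
qed

lemma Y_smooth: "smooth_on pball (\<lambda>x. Y x \<bullet> b)"
proof -
  have n: "smooth_on pball (norm :: real^3 \<Rightarrow> real)"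
    by (rule smooth_on_subset[OF _ smooth_on_norm]) auto
  have "smooth_on pball (\<lambda>x. S (norm x))"
    unfolding Sig_def
    by (intro smooth_on_diff smooth_on_const smooth_on_mult smooth_on_power n smooth_on_compose[OF _ _ smooth_on_ln n])
      (auto simp: open_delete)
  then show ?thesis
    unfolding Ymap_def inner_scaleR_left
    by (intro smooth_on_mult smooth_on_divide smooth_on_const smooth_on_inner n)
      (use S_pos in \<open>auto simp: open_delete less_imp_neq[symmetric]\<close>)
qed

section \<open>The inverse of the radial map\<close>

definition "Sinv = inv_into {0<..<1} S"

lemma Sinv_S: "0 < r \<Longrightarrow> r < 1 \<Longrightarrow> Sinv (S r) = r"
  unfolding Sinv_def by (rule inv_into_f_f) (use Sig_inj[OF a] in \<open>auto simp: inj_on_def\<close>)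

lemma Sinv_bounds: "A - a < \<sigma> \<Longrightarrow> 0 < Sinv \<sigma>" "A - a < \<sigma> \<Longrightarrow> Sinv \<sigma> < 1" "A - a < \<sigma> \<Longrightarrow> S (Sinv \<sigma>) = \<sigma>"
  using Sig_surj[OF a, of A \<sigma>] Sinv_S by metis+

text \<open>The derivative of \<open>S\<close> is rational in the radius, so the inverse solves an
  autonomous equation with a smooth right-hand side, which is the form that
  \<open>smooth_on_ode\<close> takes.\<close>

lemma Sinv_DERIV:
  assumes "A - a < \<sigma>"
  shows "(Sinv has_real_derivative - (Sinv \<sigma> / (1 + 2 * a * (Sinv \<sigma>)\<^sup>2))) (at \<sigma>)"
proof -
  define r where "r = Sinv \<sigma>"
  have r: "0 < r" "r < 1" "S r = \<sigma>" using Sinv_bounds[OF assms] by (auto simp: r_def)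
  have p: "0 < 1 + 2 * a * r\<^sup>2" using a by (simp add: add_pos_nonneg)
  have "(Sinv has_derivative (*) (inverse (- ((1 + 2 * a * r\<^sup>2) / r)))) (at (S r))"
  proof (rule has_derivative_inverse_strong[where S="{0<..<1}" and f=S and x=r and f'="(*) (- ((1 + 2 * a * r\<^sup>2) / r))"])
    show "continuous_on {0<..<1} S"
      using Sig_DERIV by (auto intro!: continuous_at_imp_continuous_on DERIV_isCont)
    show "(S has_derivative (*) (- ((1 + 2 * a * r\<^sup>2) / r))) (at r)"
      using Sig_DERIV[OF r(1)] by (simp add: has_field_derivative_def)
    show "(*) (- ((1 + 2 * a * r\<^sup>2) / r)) \<circ> (*) (inverse (- ((1 + 2 * a * r\<^sup>2) / r))) = id"
      using r p by (auto simp: fun_eq_iff)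
  qed (use r Sinv_S in auto)
  then have "(Sinv has_real_derivative inverse (- ((1 + 2 * a * r\<^sup>2) / r))) (at (S r))"
    by (simp add: has_field_derivative_def)
  then show ?thesis using r p unfolding r_def[symmetric] by simp
qed

lemma Sinv_smooth: "smooth_on {A - a<..} Sinv"
proof (rule smooth_on_ode[where \<Phi>="\<lambda>r. - (r / (1 + 2 * a * r\<^sup>2))" and V=UNIV])
  have "1 + 2 * a * r\<^sup>2 \<noteq> 0" for r
    using a by (metis add_pos_nonneg less_irrefl mult_nonneg_nonneg zero_le_numeral zero_le_power2 zero_less_one)
  then show "smooth_on UNIV (\<lambda>r. - (r / (1 + 2 * a * r\<^sup>2)))"
    by (intro smooth_on_minus smooth_on_divide smooth_on_add smooth_on_const smooth_on_mult smooth_on_power smooth_on_id) auto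
qed (use Sinv_DERIV in auto)

text \<open>Inverse of \<open>Y\<close>: a point at distance L / S r from the origin comes from the
  radius \<open>r\<close> in the same direction.\<close>

definition Zmap :: "real^3 \<Rightarrow> real^3" where
  "Zmap y = (Sinv (L / norm y) / norm y) *\<^sub>R y"

lemma range_bound: "y \<in> ball 0 (L / (A - a)) - {0::real^3} \<Longrightarrow> A - a < L / norm y"
  using A L by (auto simp: field_simps)

lemma Z_Y: "x \<in> pball \<Longrightarrow> Zmap (Y x) = x"
  using norm_Y[of x] S_pos[of x] L Sinv_S[of "norm x"] by (auto simp: Zmap_def Ymap_def)

lemma Z_smooth: "smooth_on (ball 0 (L / (A - a)) - {0}) (\<lambda>y. Zmap y \<bullet> b)"
proof -
  let ?B = "ball 0 (L / (A - a)) - {0::real^3}"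
  have n: "smooth_on ?B norm"
    by (rule smooth_on_subset[OF _ smooth_on_norm]) auto
  have im: "(\<lambda>y. L / norm y) ` ?B \<subseteq> {A - a<..}"
    by (intro image_subsetI) (metis greaterThan_iff range_bound)
  have "smooth_on ?B (\<lambda>y. Sinv (L / norm y))"
    by (rule smooth_on_compose[OF _ _ Sinv_smooth _ im])
      (auto intro!: smooth_on_divide smooth_on_const n simp: open_delete)
  then show ?thesis
    unfolding Zmap_def inner_scaleR_left
    by (intro smooth_on_mult smooth_on_divide smooth_on_inner n) (auto simp: open_delete)
qed

text \<open>The support of \<open>w\<close> stays away from both the origin and the unit sphere, so
  its image under \<open>Y\<close> is compact in the open image, and \<open>w \<circ> Zmap\<close>
  extended by zero is a test function.\<close>

lemma transplant_exists:
  assumes w: "w \<in> Cc_smooth pball"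
  obtains u where "u \<in> Cc_smooth (Y ` pball)" "\<And>x. x \<in> pball \<Longrightarrow> u (Y x) = w x"
proof -
  obtain K where K: "compact K" "K \<subseteq> pball" "\<And>x. x \<notin> K \<Longrightarrow> w x = 0" using Cc_smoothD[OF w] by metis
  define u where "u y = (if y \<in> Y ` pball then w (Zmap y) else 0)" for y
  have YB: "Y ` pball = ball 0 (L / (A - a)) - {0}" by (rule Y_range)
  have "u \<in> Cc_smooth (Y ` pball)"
  proof (rule Cc_smoothI)
    show o: "open (Y ` pball)" unfolding YB by (simp add: open_delete)
    have "continuous_on pball Y"
      using Y_deriv by (meson continuous_at_imp_continuous_on has_derivative_continuous)
    then show "compact (Y ` K)" using K by (meson compact_continuous_image continuous_on_subset)
    show "Y ` K \<subseteq> Y ` pball" using K by auto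
    have "smooth_on (Y ` pball) (\<lambda>y. w (Zmap y))"
      by (rule smooth_on_compose_vec[OF o open_UNIV subset_UNIV Cc_smooth_smooth[OF w]])
        (use Z_smooth YB in auto)
    then show "smooth_on (Y ` pball) u"
      by (rule smooth_on_cong[OF o, rotated]) (auto simp: u_def)
    show "u y = 0" if "y \<notin> Y ` K" for y
      using that K(3) Z_Y by (force simp: u_def)
  qed
  moreover have "u (Y x) = w x" if "x \<in> pball" for x
    using that Z_Y by (auto simp: u_def)
  ultimately show ?thesis using that by blast
qed

end

subsection \<open>The Euclidean best constant\<close>

abbreviation Edir :: "(real^3 \<Rightarrow> real) \<Rightarrow> real" where
  "Edir u \<equiv> LINT x|lborel. (norm (grad u x))\<^sup>2"

abbreviation Nw :: "real \<Rightarrow> (real^3 \<Rightarrow> real) \<Rightarrow> real" where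
  "Nw p u \<equiv> LINT x|lborel. norm x powr ((p - 6) / 2) * \<bar>u x\<bar> powr p"

lemma Cc_smooth_mono: "U \<subseteq> V \<Longrightarrow> f \<in> Cc_smooth U \<Longrightarrow> f \<in> Cc_smooth V"
  by (auto simp: Cc_smooth_def)

lemma continuous_on_abs_powr:
  "continuous_on A u \<Longrightarrow> 0 < p \<Longrightarrow> continuous_on A (\<lambda>x. \<bar>u x :: real\<bar> powr p)"
  by (intro continuous_on_powr' continuous_intros) auto

lemma powr_subadditive:
  fixes x y s :: real
  assumes "0 \<le> x" "0 \<le> y" "0 < s" "s \<le> 1"
  shows "(x + y) powr s \<le> x powr s + y powr s"
proof (cases "x + y = 0")
  case False
  then have t: "0 < x + y" using assms by simp
  have *: "z / (x + y) \<le> (z / (x + y)) powr s" if "0 \<le> z" "z \<le> x + y" for z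
    using powr_mono'[of s 1 "z / (x + y)"] assms that t by simp
  have "1 = x / (x + y) + y / (x + y)" using t by (simp add: add_divide_distrib[symmetric])
  also have "\<dots> \<le> (x / (x + y)) powr s + (y / (x + y)) powr s"
    using *[of x] *[of y] assms by simp
  finally have "1 \<le> (x powr s + y powr s) / (x + y) powr s"
    using assms t by (simp add: powr_divide add_divide_distrib)
  then show ?thesis using t by (simp add: field_simps)
qed simp

text \<open>A bump of radius 1 about a point at distance 2 from the origin avoids the singularity of
  the weight. Such a function bounds the admissible constants from above.\<close>

lemma Nw_pos_exists: "0 < p \<Longrightarrow> \<exists>u \<in> Cc_smooth UNIV. Nw p u > 0"
proof -
  define c :: "real^3" where "c = 2 *\<^sub>R axis 1 1"
  have nc: "norm c = 2" by (simp add: c_def norm_axis_1)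
  define u where "u x = flat 1 (1 - (norm (x - c))\<^sup>2)" for x
  have sm: "smooth_on UNIV u"
  proof -
    have "smooth_on UNIV (\<lambda>x. (norm (x - c))\<^sup>2)"
      by (rule smooth_on_compose_vec[OF _ _ _ smooth_on_norm_sq[of UNIV]])
        (auto simp: inner_diff_left intro!: smooth_on_diff smooth_on_inner smooth_on_const)
    then show ?thesis unfolding u_def[abs_def]
      by (intro smooth_on_compose[OF _ _ smooth_on_flat] smooth_on_diff smooth_on_const) auto
  qed
  have z: "u x = 0" if "x \<notin> cball c 1" for x
    using that by (auto simp: u_def flat_1_0 dist_norm norm_minus_commute)
  have pos: "u x > 0" if "x \<in> ball c 1" for x
  proof -
    have "norm (x - c) < 1" using that by (simp add: dist_norm norm_minus_commute)
    then have "(norm (x - c))\<^sup>2 < 1" by (simp add: power_less_one_iff)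
    then show ?thesis by (simp add: u_def flat_1_pos)
  qed
  have away: "norm x \<ge> 1" if "x \<in> cball c 1" for x
    using that norm_triangle_ineq2[of c "c - x"] nc by (simp add: dist_norm)
  have uC: "u \<in> Cc_smooth UNIV"
    by (rule Cc_smoothI[of _ "cball c 1"]) (use sm z in auto)
  define f where "f x = norm x powr ((p - 6) / 2) * \<bar>u x\<bar> powr p" for x
  assume p: "0 < p"
  have cu: "continuous_on A u" for A
    using smooth_on_continuous[OF sm] continuous_on_subset by blast
  have f0: "f x = 0" if "x \<notin> cball c 1" for x using z[OF that] by (simp add: f_def)
  have i: "integrable lborel f"
  proof (rule integrable_compact_support[of "cball c 1"])
    have "norm x \<noteq> 0" if "x \<in> cball c 1" for x using away[OF that] by linarith
    then show "continuous_on (cball c 1) f" unfolding f_def[abs_def]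
      using p by (intro continuous_intros continuous_on_abs_powr cu) auto
  qed (use f0 in auto)
  have "integral\<^sup>L lborel f \<noteq> 0"
  proof
    assume "integral\<^sup>L lborel f = 0"
    then have "AE x in lborel. f x = 0"
      using integral_nonneg_eq_0_iff_AE[OF i] by (simp add: f_def)
    moreover have "{x \<in> space lborel. f x \<noteq> 0} \<in> sets lborel"
      using borel_measurable_integrable[OF i] by measurable
    ultimately have "{x. f x \<noteq> 0} \<in> null_sets lborel"
      by (subst AE_iff_null_sets) auto
    then have "negligible {x. f x \<noteq> 0}"
      by (simp add: negligible_iff_null_sets null_sets_completionI)
    moreover have "ball c 1 \<subseteq> {x. f x \<noteq> 0}"
    proof
      fix x assume x: "x \<in> ball c 1"
      then have "norm x \<noteq> 0" using away[of x] by auto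
      then show "x \<in> {x. f x \<noteq> 0}" using pos[OF x] by (simp add: f_def)
    qed
    ultimately have "negligible (ball c 1)" using negligible_subset by blast
    then show False using open_not_negligible[of "ball c 1"] by simp
  qed
  moreover have "integral\<^sup>L lborel f \<ge> 0" by (simp add: f_def)
  moreover have "Nw p u = integral\<^sup>L lborel f" by (simp add: f_def[abs_def])
  ultimately show ?thesis using uC by (intro bexI[of _ u]) linarith+
qed

text \<open>The set whose supremum is \<open>S3 p\<close> contains 0 and is bounded above by the
  quotient of one function with positive norm. The rest of the proof uses \<open>S3 p\<close> only
  through these three facts.\<close>

lemma S3_properties:
  assumes p: "2 < p"
  shows "0 \<le> S3 p"
    and "u \<in> Cc_smooth UNIV \<Longrightarrow> S3 p * Nw p u powr (2 / p) \<le> Edir u"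
    and "S3 p < C \<Longrightarrow> \<exists>u \<in> Cc_smooth UNIV. Edir u < C * Nw p u powr (2 / p)"
proof -
  define W where "W = {S. \<forall>u \<in> Cc_smooth UNIV. Edir u \<ge> S * Nw p u powr (2 / p)}"
  have S3: "S3 p = Sup W" by (simp add: S3_def W_def)
  obtain u0 where u0: "u0 \<in> Cc_smooth UNIV" "Nw p u0 > 0" using Nw_pos_exists[of p] p by auto
  have bdd: "bdd_above W"
  proof (rule bdd_aboveI)
    fix S assume "S \<in> W"
    then have "S * Nw p u0 powr (2 / p) \<le> Edir u0" using u0 by (simp add: W_def)
    then show "S \<le> Edir u0 / Nw p u0 powr (2 / p)" using u0 by (simp add: field_simps)
  qed
  have W0: "0 \<in> W" by (simp add: W_def)
  show "0 \<le> S3 p" unfolding S3 by (rule cSup_upper[OF W0 bdd])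
  show "S3 p * Nw p u powr (2 / p) \<le> Edir u" if u: "u \<in> Cc_smooth UNIV"
  proof (cases "Nw p u = 0")
    case False
    then have N: "Nw p u powr (2 / p) > 0" by (simp add: less_le)
    have "S3 p \<le> Edir u / Nw p u powr (2 / p)"
      unfolding S3
    proof (rule cSup_least)
      show "W \<noteq> {}" using W0 by auto
      fix S assume "S \<in> W"
      then have "S * Nw p u powr (2 / p) \<le> Edir u" using u by (simp add: W_def)
      then show "S \<le> Edir u / Nw p u powr (2 / p)" using N by (simp add: field_simps)
    qed
    then show ?thesis using N by (simp add: field_simps)
  qed simp
  show "\<exists>u \<in> Cc_smooth UNIV. Edir u < C * Nw p u powr (2 / p)" if "S3 p < C"
  proof (rule ccontr)
    assume "\<not> ?thesis"
    then have "C \<in> W" by (force simp: W_def not_less)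
    then show False using cSup_upper[OF _ bdd] that unfolding S3 by fastforce
  qed
qed

subsection \<open>The inequality on the punctured ball\<close>

text \<open>Here \<open>R\<close> is the radial derivative of \<psi>, \<open>T\<close> the squared
  tangential gradient and \<open>P\<close> the squared gradient. The left side is the transported
  Euclidean energy density of (1 - q^2) \<psi> plus the third kept in reserve. The denominator
  \<open>k\<close> in the radial term absorbs the loss from the cross term; in the tangential term
  \<open>k\<close> is beaten by \<Sigma>^2 \<ge> 8 k, and 1/2 + 1/3 \<le> 1 leaves room for the
  reserve.\<close>

lemma radial_tangential_bound:
  fixes q R \<psi> P r a \<Sigma> k T :: real
  assumes r: "0 < r" "r < 1" "q = r\<^sup>2" and a: "32 \<le> a" and S: "a \<le> \<Sigma>" and k: "k = 1 + 2 * a * q"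
    and T: "0 \<le> T" "P = T + R\<^sup>2"
  shows "k / (r * \<Sigma>\<^sup>2) * ((1 - q\<^sup>2)\<^sup>2 * T) + 1 / (k * r) * ((1 - q\<^sup>2) * R - 4 * q * r * \<psi>)\<^sup>2
    + 1 / 3 * (r * (1 - q) * P + \<psi>\<^sup>2 / r) \<le> (1 - q) / r * P + \<psi>\<^sup>2 / r"
proof -
  have q: "0 < q" "q < 1" using r by (auto simp: power_less_one_iff)
  have kp: "0 < k" using a q by (simp add: k add_pos_pos)
  have Sp: "0 < \<Sigma>" using a S by simp
  have tang: "k / \<Sigma>\<^sup>2 * (1 - q\<^sup>2)\<^sup>2 + q * (1 - q) / 3 \<le> 1 - q"
  proof -
    have "k \<le> 1 + 2 * a" using a q by (simp add: k mult_left_le)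
    moreover have "a\<^sup>2 \<le> \<Sigma>\<^sup>2" using a S by (intro power_mono) auto
    moreover have "8 * (1 + 2 * a) \<le> a\<^sup>2"
    proof -
      \<comment> \<open>The right side expands to a^2 - 16 a - 8, which is where
        \<open>32 \<le> a\<close> enters.\<close>
      have "0 \<le> (a - 32) * (a + 16) + 504" using a by (intro add_nonneg_nonneg mult_nonneg_nonneg) auto
      then show ?thesis by (simp add: power2_eq_square algebra_simps)
    qed
    ultimately have "8 * k \<le> \<Sigma>\<^sup>2"
      by (meson mult_left_mono order_trans zero_le_numeral)
    then have kS: "k / \<Sigma>\<^sup>2 \<le> 1 / 8" using Sp by (simp add: field_simps)
    have "(1 - q\<^sup>2)\<^sup>2 = (1 - q) * ((1 - q) * (1 + q)\<^sup>2)" by (simp add: power2_eq_square algebra_simps)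
    also have "\<dots> \<le> (1 - q) * (1 * 2\<^sup>2)"
      using q by (intro mult_left_mono mult_mono power_mono) auto
    finally have "k / \<Sigma>\<^sup>2 * (1 - q\<^sup>2)\<^sup>2 \<le> 1 / 8 * ((1 - q) * 4)"
      using kS q kp by (intro mult_mono) auto
    moreover have "q * (1 - q) / 3 \<le> (1 - q) / 3" using q by (simp add: mult_left_le_one_le)
    ultimately have "k / \<Sigma>\<^sup>2 * (1 - q\<^sup>2)\<^sup>2 + q * (1 - q) / 3 \<le> 1 / 8 * ((1 - q) * 4) + (1 - q) / 3"
      by (rule add_mono)
    also have "\<dots> \<le> 1 - q" using q by (simp add: field_simps)
    finally show ?thesis .
  qed
  have rad: "1 / k * ((1 - q\<^sup>2) * R - 4 * q * r * \<psi>)\<^sup>2 + q * (1 - q) * R\<^sup>2 / 3 + \<psi>\<^sup>2 / 3 \<le> (1 - q) * R\<^sup>2 + \<psi>\<^sup>2"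
  proof -
    define U where "U = (1 - q\<^sup>2) * R"
    define Z where "Z = 4 * q * r * \<psi>"
    \<comment> \<open>Young's inequality with weight \<open>q\<close>: the loss on U^2 disappears at
      the origin, and Z^2 contains q^3, which pays for the factor 1 + 1/q.\<close>
    have young: "(U - Z)\<^sup>2 \<le> (1 + q) * U\<^sup>2 + (1 + 1 / q) * Z\<^sup>2"
    proof -
      have "0 \<le> (q * U + Z)\<^sup>2 / q" using q by simp
      also have "\<dots> = q * U\<^sup>2 + 2 * U * Z + Z\<^sup>2 / q" using q by (simp add: field_simps power2_eq_square)
      finally show ?thesis by (simp add: power2_eq_square algebra_simps)
    qed
    have U: "(1 + q) * U\<^sup>2 / k \<le> (1 - q) * (1 - q / 3) * R\<^sup>2"
    proof -
      have "(1 + q) * (1 - q\<^sup>2)\<^sup>2 \<le> (1 - q) * (1 + 2 * q)"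
      proof -
        \<comment> \<open>In the product (1 - q) (1 + q)^3 the terms of order q^2 cancel; the
          remaining cubic and quartic terms are negative.\<close>
        have "(1 + q) * (1 - q\<^sup>2)\<^sup>2 = (1 - q) * ((1 + 2 * q) - q ^ 3 * (2 + q))"
          by (simp add: eval_nat_numeral algebra_simps)
        also have "\<dots> \<le> (1 - q) * (1 + 2 * q)" using q by (intro mult_left_mono) auto
        finally show ?thesis .
      qed
      also have "1 + 2 * q \<le> (1 - q / 3) * k"
      proof -
        have "0 \<le> q * (2 * a * (1 - q / 3) - 7 / 3)"
        proof (intro mult_nonneg_nonneg)
          have "2 * 32 * (2 / 3) \<le> 2 * a * (1 - q / 3)" using a q by (intro mult_mono) auto
          then show "0 \<le> 2 * a * (1 - q / 3) - 7 / 3" by simp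
        qed (use q in simp)
        then show ?thesis unfolding k by (simp add: algebra_simps power2_eq_square)
      qed
      finally have "(1 + q) * (1 - q\<^sup>2)\<^sup>2 \<le> (1 - q) * (1 - q / 3) * k"
        using q by (simp add: mult_left_mono mult.assoc)
      then have "(1 + q) * (1 - q\<^sup>2)\<^sup>2 * R\<^sup>2 \<le> (1 - q) * (1 - q / 3) * k * R\<^sup>2" by (rule mult_right_mono) simp
      then have "(1 + q) * U\<^sup>2 \<le> (1 - q) * (1 - q / 3) * R\<^sup>2 * k"
        by (simp only: U_def power_mult_distrib ac_simps)
      then show ?thesis using kp by (simp only: pos_divide_le_eq)
    qed
    have Z: "(1 + 1 / q) * Z\<^sup>2 / k \<le> 2 / 3 * \<psi>\<^sup>2"
    proof -
      have "(1 + 1 / q) * Z\<^sup>2 = 16 * q\<^sup>2 * (1 + q) * \<psi>\<^sup>2"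
        using q r by (simp add: Z_def power_mult_distrib field_simps power2_eq_square)
      also have "16 * q\<^sup>2 * (1 + q) \<le> 2 / 3 * k"
      proof -
        have "q * (1 + q) \<le> 1 * 2" using q by (intro mult_mono) auto
        then have "q * (q * (1 + q)) \<le> q * 2" using q by (intro mult_left_mono) auto
        then have "q\<^sup>2 * (1 + q) \<le> q * 2" by (simp add: power2_eq_square mult.assoc)
        moreover have "32 * q \<le> a * q" using a q by (intro mult_right_mono) auto
        moreover have "k = 1 + 2 * (a * q)" by (simp add: k)
        moreover have "16 * q\<^sup>2 * (1 + q) = 16 * (q\<^sup>2 * (1 + q))" by simp
        ultimately show ?thesis using q by linarith
      qed
      finally show ?thesis using kp by (simp add: field_simps mult_right_mono)
    qed
    have "1 / k * (U - Z)\<^sup>2 \<le> (1 + q) * U\<^sup>2 / k + (1 + 1 / q) * Z\<^sup>2 / k"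
      using divide_right_mono[OF young, of k] kp by (simp add: add_divide_distrib)
    moreover have "(1 - q) * (1 - q / 3) * R\<^sup>2 = (1 - q) * R\<^sup>2 - q * (1 - q) * R\<^sup>2 / 3"
      by (simp add: field_simps)
    ultimately show ?thesis using U Z unfolding U_def[symmetric] Z_def[symmetric] by linarith
  qed
  have "k / \<Sigma>\<^sup>2 * (1 - q\<^sup>2)\<^sup>2 * T + q * (1 - q) / 3 * T \<le> (1 - q) * T"
    using mult_right_mono[OF tang T(1)] by (simp add: distrib_right)
  moreover have "1 / 3 * (q * (1 - q) * P + \<psi>\<^sup>2) = q * (1 - q) / 3 * T + q * (1 - q) * R\<^sup>2 / 3 + \<psi>\<^sup>2 / 3"
    "(1 - q) * P = (1 - q) * T + (1 - q) * R\<^sup>2"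
    unfolding T(2) by (simp_all add: field_simps)
  ultimately have "k / \<Sigma>\<^sup>2 * (1 - q\<^sup>2)\<^sup>2 * T + 1 / k * ((1 - q\<^sup>2) * R - 4 * q * r * \<psi>)\<^sup>2
    + 1 / 3 * (q * (1 - q) * P + \<psi>\<^sup>2) \<le> (1 - q) * P + \<psi>\<^sup>2"
    using rad by linarith
  then have "(k / \<Sigma>\<^sup>2 * (1 - q\<^sup>2)\<^sup>2 * T + 1 / k * ((1 - q\<^sup>2) * R - 4 * q * r * \<psi>)\<^sup>2
    + 1 / 3 * (q * (1 - q) * P + \<psi>\<^sup>2)) / r \<le> ((1 - q) * P + \<psi>\<^sup>2) / r"
    by (rule divide_right_mono) (use r in simp)
  moreover have rr: "r * (1 - q) * P = q * (1 - q) * P / r" using r by (simp add: power2_eq_square)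
  ultimately show ?thesis unfolding rr by (simp add: add_divide_distrib ac_simps)
qed

lemma transplant_inequality:
  assumes p: "2 < p" and a32: "32 \<le> a" and A2: "2 * a \<le> A" and psi: "\<psi> \<in> Cc_smooth pball"
  shows "S3 p * (LINT x|lborel. (1 + 2 * a * (norm x)\<^sup>2) * (norm x powr (- 3) * Sig A a (norm x) powr (- ((p + 2) / 2)) *
        \<bar>(1 - (norm x) ^ 4) * \<psi> x\<bar> powr p)) powr (2 / p)
    + 1 / 3 * (LINT x|lborel. norm x * (1 - (norm x)\<^sup>2) * (norm (grad \<psi> x))\<^sup>2 + (\<psi> x)\<^sup>2 / norm x)
    \<le> (LINT x|lborel. (1 - (norm x)\<^sup>2) / norm x * (norm (grad \<psi> x))\<^sup>2 + (\<psi> x)\<^sup>2 / norm x)"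
proof -
  interpret ymap 1 A a by standard (use a32 A2 in auto)
  have sm: "smooth_on V \<psi>" for V using psi by (rule Cc_smooth_smooth)
  have cpsi: "continuous_on V \<psi>" for V using smooth_on_continuous[OF sm] .
  have cgpsi: "continuous_on V (grad \<psi>)" for V using smooth_on_grad_continuous[OF sm] .
  obtain K where K: "compact K" "K \<subseteq> pball" "\<And>x. x \<notin> K \<Longrightarrow> \<psi> x = 0" using Cc_smoothD[OF psi] by metis
  have gpsi: "grad \<psi> x = 0" if "x \<notin> K" for x
    using grad_zero_outside[OF compact_imp_closed[OF K(1)] K(3) that] .
  define w where "w x = (1 - ((norm x)\<^sup>2)\<^sup>2) * \<psi> x" for x
  have smw: "smooth_on V w" if "open V" for V
    unfolding w_def[abs_def] using that
    by (intro smooth_on_mult smooth_on_diff smooth_on_const smooth_on_power[OF _ smooth_on_norm_sq] sm)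
  have wK: "w x = 0" if "x \<notin> K" for x using K(3)[OF that] by (simp add: w_def)
  have wC: "w \<in> Cc_smooth pball"
    by (rule Cc_smoothI[OF open_pball K(1,2) smw[OF open_pball] wK])
  obtain u where u: "u \<in> Cc_smooth (Y ` pball)" "\<And>x. x \<in> pball \<Longrightarrow> u (Y x) = w x"
    using transplant_exists[OF wC] by blast
  have uU: "u \<in> Cc_smooth UNIV" using u(1) Cc_smooth_mono by blast
  have gw: "grad w x = (1 - ((norm x)\<^sup>2)\<^sup>2) *\<^sub>R grad \<psi> x - (4 * (norm x)\<^sup>2 * \<psi> x) *\<^sub>R x" for x
  proof (rule grad_eqI)
    have 1: "GDERIV (\<lambda>x. 1 - ((norm x)\<^sup>2)\<^sup>2) x :> (2 * (- 2 * (norm x)\<^sup>2)) *\<^sub>R x"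
      by (rule GDERIV_compose_normsq[of "\<lambda>t. 1 - t^2"]) (auto intro!: derivative_eq_intros)
    show "GDERIV w x :> (1 - ((norm x)\<^sup>2)\<^sup>2) *\<^sub>R grad \<psi> x - (4 * (norm x)\<^sup>2 * \<psi> x) *\<^sub>R x"
      unfolding w_def[abs_def]
      by (rule GDERIV_subst[OF GDERIV_mult[OF 1 GDERIV_grad[OF smooth_on_differentiable[OF sm[of UNIV]]]]])
        (simp_all add: algebra_simps)
  qed
  have guY: "grad (\<lambda>x. u (Y x)) x = grad w x" if "x \<in> pball" for x
  proof -
    have "(w has_derivative frechet_derivative w (at x)) (at x)"
      using smooth_on_differentiable[OF smw[OF open_UNIV]] frechet_derivative_works by blast
    then have "((\<lambda>x. u (Y x)) has_derivative frechet_derivative w (at x)) (at x)"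
      by (rule has_derivative_transform_within_open[OF _ open_pball that]) (simp add: u(2))
    then show ?thesis unfolding grad_def using frechet_derivative_at by metis
  qed
  define T where "T x = (norm (grad \<psi> x))\<^sup>2 - (x \<bullet> grad \<psi> x)\<^sup>2 / (norm x)\<^sup>2" for x
  define I1 where "I1 x = lr x * ((1 - ((norm x)\<^sup>2)\<^sup>2)\<^sup>2 * T x) + 1 / (kk x * norm x) *
      ((1 - ((norm x)\<^sup>2)\<^sup>2) * (x \<bullet> grad \<psi> x / norm x) - 4 * (norm x)\<^sup>2 * norm x * \<psi> x)\<^sup>2" for x
  define I2 where "I2 x = norm x * (1 - (norm x)\<^sup>2) * (norm (grad \<psi> x))\<^sup>2 + (\<psi> x)\<^sup>2 / norm x" for x
  define I3 where "I3 x = (1 - (norm x)\<^sup>2) / norm x * (norm (grad \<psi> x))\<^sup>2 + (\<psi> x)\<^sup>2 / norm x" for x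
  note int = integrable_compact_support[OF K(1)]
  have Kn: "\<forall>x\<in>K. norm x \<noteq> 0" "\<forall>x\<in>K. (norm x)\<^sup>2 \<noteq> 0" using K(2) by auto
  have kk: "\<forall>x\<in>K. kk x * norm x \<noteq> 0" using kk_pos Kn by (metis less_irrefl mult_eq_0_iff)
  have "continuous_on K lr" using cont_lr K(2) continuous_on_subset by blast
  moreover have "continuous_on K kk" unfolding kk_def[abs_def] by (intro continuous_intros)
  ultimately have i1: "integrable lborel I1"
    unfolding I1_def[abs_def] T_def
    using K(3) gpsi by (intro int continuous_intros cgpsi cpsi Kn kk) auto
  have i2: "integrable lborel I2" unfolding I2_def[abs_def]
    using K(3) gpsi by (intro int continuous_intros cgpsi cpsi Kn) auto
  have i3: "integrable lborel I3" unfolding I3_def[abs_def]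
    using K(3) gpsi by (intro int continuous_intros cgpsi cpsi Kn) auto
  have "Edir u = integral\<^sup>L lborel I1"
    unfolding Y_dirichlet[OF u(1)]
  proof (rule Bochner_Integration.integral_cong[OF refl])
    fix x
    show "indicator pball x * (lr x * ((norm (grad (\<lambda>x. u (Y x)) x))\<^sup>2 - (x \<bullet> grad (\<lambda>x. u (Y x)) x)\<^sup>2 / (norm x)\<^sup>2) +
      1 / (kk x * norm x) * ((x \<bullet> grad (\<lambda>x. u (Y x)) x)\<^sup>2 / (norm x)\<^sup>2)) = I1 x"
    proof (cases "x \<in> pball")
      case True
      define r where "r = norm x"
      define m where "m = x \<bullet> grad \<psi> x"
      define X where "X = 1 - (r\<^sup>2)\<^sup>2"
      have r: "r \<noteq> 0" "x \<bullet> x = r\<^sup>2" using True by (auto simp: r_def power2_norm_eq_inner)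
      have 1: "x \<bullet> grad w x = X * m - 4 * r\<^sup>2 * \<psi> x * r\<^sup>2"
        unfolding gw by (simp add: inner_diff_right r r_def[symmetric] m_def X_def)
      have 2: "(norm (grad w x))\<^sup>2 = X\<^sup>2 * (norm (grad \<psi> x))\<^sup>2 - 2 * X * (4 * r\<^sup>2 * \<psi> x) * m + (4 * r\<^sup>2 * \<psi> x)\<^sup>2 * r\<^sup>2"
        unfolding power2_norm_eq_inner gw r_def[symmetric] X_def[symmetric]
        by (simp add: inner_diff_left inner_diff_right inner_commute[of "grad \<psi> x" x] m_def[symmetric] r power2_eq_square algebra_simps)
      have 3: "(norm (grad w x))\<^sup>2 - (x \<bullet> grad w x)\<^sup>2 / r\<^sup>2 = X\<^sup>2 * ((norm (grad \<psi> x))\<^sup>2 - m\<^sup>2 / r\<^sup>2)"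
        unfolding 1 2 using r by (simp add: field_simps power2_eq_square)
      have 4: "(x \<bullet> grad w x)\<^sup>2 / r\<^sup>2 = (X * (m / r) - 4 * r\<^sup>2 * r * \<psi> x)\<^sup>2"
        unfolding 1 using r by (simp add: field_simps power2_eq_square)
      show ?thesis
        using True 3 4 unfolding guY[OF True] I1_def T_def r_def m_def X_def by simp
    next
      case False
      then have "x \<notin> K" using K by auto
      then show ?thesis using False by (simp add: I1_def T_def K(3) gpsi)
    qed
  qed
  moreover have "integral\<^sup>L lborel I1 + 1 / 3 * integral\<^sup>L lborel I2 \<le> integral\<^sup>L lborel I3"
  proof -
    have "integral\<^sup>L lborel I1 + 1 / 3 * integral\<^sup>L lborel I2 = (LINT x|lborel. I1 x + 1 / 3 * I2 x)"
      using i1 i2 by simp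
    also have "\<dots> \<le> integral\<^sup>L lborel I3"
    proof (rule integral_mono)
      fix x
      show "I1 x + 1 / 3 * I2 x \<le> I3 x"
      proof (cases "x \<in> pball")
        case True
        have "A - a < S (norm x)" using Sig_pos[of a A "norm x"] True a32 A2 by auto
        then have Sa: "a \<le> S (norm x)" using A2 by simp
        have T0: "0 \<le> T x"
        proof -
          have "(x \<bullet> grad \<psi> x)\<^sup>2 \<le> (norm x)\<^sup>2 * (norm (grad \<psi> x))\<^sup>2"
            using Cauchy_Schwarz_ineq[of x "grad \<psi> x"] by (simp add: power2_norm_eq_inner)
          then show ?thesis using True by (simp add: T_def field_simps)
        qed
        have lrx: "lr x = kk x / (norm x * (S (norm x))\<^sup>2)" by (simp add: lr_def)
        show ?thesis
          unfolding I1_def I2_def I3_def lrx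
          by (rule radial_tangential_bound[OF _ _ refl a32 Sa _ T0]) (use True in \<open>auto simp: kk_def T_def power_divide\<close>)
      next
        case False
        then have "x \<notin> K" using K by auto
        then show ?thesis by (simp add: I1_def I2_def I3_def T_def K(3) gpsi)
      qed
    qed (use i1 i2 i3 in auto)
    finally show ?thesis .
  qed
  moreover have "Nw p u = (LINT x|lborel. (1 + 2 * a * (norm x)\<^sup>2) * (norm x powr (- 3) * S (norm x) powr (- ((p + 2) / 2)) *
        \<bar>(1 - (norm x) ^ 4) * \<psi> x\<bar> powr p))"
  proof -
    have mu: "u \<in> borel_measurable borel"
      by (rule borel_measurable_continuous_onI[OF smooth_on_continuous[OF Cc_smooth_smooth[OF uU]]])
    have z: "u y = 0" if "y \<notin> Y ` pball" for y
      using Cc_smoothD[OF u(1)] that by (metis subsetD)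
    have "Nw p u = (LINT x|lborel. indicator pball x * ((lt x)\<^sup>2 * lr x * (norm (Y x) powr ((p - 6) / 2) * \<bar>u (Y x)\<bar> powr p)))"
      using mu z by (intro Y_integral(1)) auto
    also have "\<dots> = (LINT x|lborel. (1 + 2 * a * (norm x)\<^sup>2) * (norm x powr (- 3) * S (norm x) powr (- ((p + 2) / 2)) *
        \<bar>(1 - (norm x) ^ 4) * \<psi> x\<bar> powr p))"
    proof (rule Bochner_Integration.integral_cong[OF refl])
      fix x
      show "indicator pball x * ((lt x)\<^sup>2 * lr x * (norm (Y x) powr ((p - 6) / 2) * \<bar>u (Y x)\<bar> powr p)) =
        (1 + 2 * a * (norm x)\<^sup>2) * (norm x powr (- 3) * S (norm x) powr (- ((p + 2) / 2)) * \<bar>(1 - (norm x) ^ 4) * \<psi> x\<bar> powr p)"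
      proof (cases "x \<in> pball")
        case True
        have r: "0 < norm x" using True by auto
        note Sp = S_pos[OF True]
        \<comment> \<open>The Jacobian contributes the power -4 of \<open>S\<close> and the
          Euclidean weight the power -(p - 6)/2. Their sum is the origin of the exponent (p + 2)/2
          of \<open>X\<close>.\<close>
        have "(lt x)\<^sup>2 * lr x * norm (Y x) powr ((p - 6) / 2) = kk x * (norm x powr (- 3) * S (norm x) powr (- ((p + 2) / 2)))"
        proof -
          have e: "(lt x)\<^sup>2 * lr x = kk x * (norm x powr (- 3) * S (norm x) powr (- 4))"
            unfolding lt_def lr_def using r Sp
            by (simp add: powr_minus powr_numeral field_simps eval_nat_numeral)
          have "norm (Y x) powr ((p - 6) / 2) = S (norm x) powr (- ((p - 6) / 2))"
            unfolding norm_Y[OF True] using Sp by (simp add: powr_divide powr_minus_divide)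
          then have "(lt x)\<^sup>2 * lr x * norm (Y x) powr ((p - 6) / 2)
            = kk x * (norm x powr (- 3) * (S (norm x) powr (- 4) * S (norm x) powr (- ((p - 6) / 2))))"
            unfolding e by simp
          also have "S (norm x) powr (- 4) * S (norm x) powr (- ((p - 6) / 2)) = S (norm x) powr (- ((p + 2) / 2))"
            unfolding powr_add[symmetric] by (rule arg_cong2[where f="(powr)"]) (auto simp: field_simps)
          finally show ?thesis .
        qed
        moreover have "u (Y x) = (1 - (norm x) ^ 4) * \<psi> x"
          unfolding u(2)[OF True] w_def by simp
        ultimately show ?thesis using True by (simp add: kk_def mult.assoc)
      next
        case False
        then have "x \<notin> K" using K by blast
        then have "\<psi> x = 0" by (rule K(3))
        then show ?thesis using False by simp
      qed
    qed
    finally show ?thesis .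
  qed
  moreover note S3_properties(2)[OF p uU]
  ultimately show ?thesis unfolding I2_def I3_def by simp
qed

lemma power2_powr: "0 < z \<Longrightarrow> (z\<^sup>2) powr s = (z::real) powr (2 * s)"
  using powr_powr[of z 2 s] powr_numeral[of z "num.Bit0 num.One"] by simp

lemma powr_mult_power6: "0 < z \<Longrightarrow> z powr (s - 6) * z ^ 6 = (z::real) powr s"
  using powr_add[of z "s - 6" 6] powr_numeral[of z "num.Bit0 (num.Bit1 num.One)"] by simp

text \<open>The bound 64 gives a = A/2 \<ge> 32. The constant 27648 is 32 * 288 * 3: the factor 32
  bounds r^(-(3 + p)) for r^2 > 1/2, 288 is 144 from the weighted Sobolev inequality times 2 from Q'
  \<le> 2 D, and 3 comes from the third of \<open>D\<close> that pays for the region near the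
  sphere. The volume of the ball enters through a truncation.\<close>

lemma key_inequality:
  assumes p: "2 < p" "p \<le> 6" and psi: "\<psi> \<in> Cc_smooth pball"
    and A: "64 \<le> A" "27648 * (1 + measure lborel (ball (0::real^3) 1)) * S3 p \<le> A"
  shows "S3 p * (LINT x|lborel. norm x powr (- 3) * (1 - (norm x)\<^sup>2) powr (p / 2) *
      (A - ln (norm x)) powr (- ((p + 2) / 2)) * \<bar>\<psi> x\<bar> powr p) powr (2 / p)
    \<le> (LINT x|lborel. (1 - (norm x)\<^sup>2) / norm x * (norm (grad \<psi> x))\<^sup>2 + (\<psi> x)\<^sup>2 / norm x)"
proof -
  define a where "a = A / 2"
  define V where "V = measure lborel (ball (0::real^3) 1)"
  have V0: "V \<ge> 0" by (simp add: V_def)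
  have S0: "S3 p \<ge> 0" using S3_properties(1)[OF p(1)] .
  have sm: "smooth_on U \<psi>" for U using psi by (rule Cc_smooth_smooth)
  have cpsi: "continuous_on U \<psi>" for U using smooth_on_continuous[OF sm] .
  have cgpsi: "continuous_on U (grad \<psi>)" for U using smooth_on_grad_continuous[OF sm] .
  obtain K where K: "compact K" "K \<subseteq> pball" "\<And>x. x \<notin> K \<Longrightarrow> \<psi> x = 0" using Cc_smoothD[OF psi] by metis
  have gpsi: "grad \<psi> x = 0" if "x \<notin> K" for x
    using grad_zero_outside[OF compact_imp_closed[OF K(1)] K(3) that] .
  have Kn: "\<forall>x\<in>K. norm x \<noteq> 0" "\<forall>x\<in>K. (norm x)\<^sup>2 \<noteq> 0" using K(2) by auto
  note int = integrable_compact_support[OF K(1)]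
  \<comment> \<open>Multiplication by |x| makes the reserve \<open>D\<close> control the energy
    \<open>Q'\<close> of the weighted Sobolev inequality: the factor 1/r disappears, and r^2 \<le>
    r.\<close>
  define \<theta> where "\<theta> x = norm x * \<psi> x" for x
  have \<theta>C: "\<theta> \<in> Cc_smooth (ball 0 1)"
  proof -
    have "smooth_on pball \<theta>" unfolding \<theta>_def[abs_def]
      by (intro smooth_on_mult open_pball sm smooth_on_subset[OF _ smooth_on_norm]) auto
    then have "\<theta> \<in> Cc_smooth pball"
      by (rule Cc_smoothI[OF open_pball K(1,2)]) (simp add: \<theta>_def K(3))
    then show ?thesis by (rule Cc_smooth_mono[rotated]) auto
  qed
  define D where "D = (LINT x|lborel. norm x * (1 - (norm x)\<^sup>2) * (norm (grad \<psi> x))\<^sup>2 + (\<psi> x)\<^sup>2 / norm x)"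
  define Q where "Q = (LINT x|lborel. (1 - (norm x)\<^sup>2) / norm x * (norm (grad \<psi> x))\<^sup>2 + (\<psi> x)\<^sup>2 / norm x)"
  have iD: "integrable lborel (\<lambda>x. norm x * (1 - (norm x)\<^sup>2) * (norm (grad \<psi> x))\<^sup>2 + (\<psi> x)\<^sup>2 / norm x)"
    using K(3) gpsi by (intro int continuous_intros cgpsi cpsi Kn) auto
  define M where "M x = (1 + 2 * a * (norm x)\<^sup>2) * (norm x powr (- 3) * Sig A a (norm x) powr (- ((p + 2) / 2)) *
        \<bar>(1 - (norm x) ^ 4) * \<psi> x\<bar> powr p)" for x
  define H where "H x = norm x powr (- 3) * (1 - (norm x)\<^sup>2) powr (p / 2) *
      (A - ln (norm x)) powr (- ((p + 2) / 2)) * \<bar>\<psi> x\<bar> powr p" for x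
  have trans: "S3 p * (integral\<^sup>L lborel M) powr (2 / p) + 1 / 3 * D \<le> Q"
    unfolding M_def D_def Q_def
    by (rule transplant_inequality[OF p(1) _ _ psi]) (use A in \<open>auto simp: a_def\<close>)
  define F where "F = (LINT x|lborel. (1 - (norm x)\<^sup>2) ^ 3 * \<theta> x ^ 6)"
  define Q' where "Q' = (LINT x|lborel. (1 - (norm x)\<^sup>2) * (norm (grad \<theta> x))\<^sup>2 + (\<theta> x)\<^sup>2)"
  have F: "F \<le> (144 * Q') ^ 3" and iF: "integrable lborel (\<lambda>x. (1 - (norm x)\<^sup>2) ^ 3 * \<theta> x ^ 6)"
    unfolding F_def Q'_def by (rule weighted_sobolev_ball[OF \<theta>C])+
  have s\<theta>: "smooth_on U \<theta>" for U using \<theta>C by (rule Cc_smooth_smooth)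
  have z\<theta>: "\<theta> x = 0" "grad \<theta> x = 0" if "x \<notin> K" for x
    using grad_zero_outside[OF compact_imp_closed[OF K(1)], of \<theta> x] that K(3) by (auto simp: \<theta>_def)
  have Q'D: "0 \<le> Q'" "Q' \<le> 2 * D"
  proof -
    have iQ': "integrable lborel (\<lambda>x. (1 - (norm x)\<^sup>2) * (norm (grad \<theta> x))\<^sup>2 + (\<theta> x)\<^sup>2)"
      using z\<theta> by (intro int continuous_intros smooth_on_grad_continuous[OF s\<theta>] smooth_on_continuous[OF s\<theta>]) auto
    have pw: "0 \<le> (1 - (norm x)\<^sup>2) * (norm (grad \<theta> x))\<^sup>2 + (\<theta> x)\<^sup>2 \<and>
      (1 - (norm x)\<^sup>2) * (norm (grad \<theta> x))\<^sup>2 + (\<theta> x)\<^sup>2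
        \<le> 2 * (norm x * (1 - (norm x)\<^sup>2) * (norm (grad \<psi> x))\<^sup>2 + (\<psi> x)\<^sup>2 / norm x)" for x
    proof (cases "x \<in> K")
      case True
      define r where "r = norm x"
      have r: "0 < r" "r < 1" using True K(2) by (auto simp: r_def)
      have r2: "0 < r\<^sup>2" "r\<^sup>2 < 1" "r\<^sup>2 \<le> r" using r by (auto simp: power_less_one_iff) (simp add: power2_eq_square)
      have g: "grad \<theta> x = r *\<^sub>R grad \<psi> x + (\<psi> x / r) *\<^sub>R x"
      proof (rule grad_eqI)
        have "GDERIV norm x :> sgn x" using r by (intro GDERIV_norm) (auto simp: r_def)
        from GDERIV_mult[OF this GDERIV_grad[OF smooth_on_differentiable[OF sm[of UNIV]]]]
        show "GDERIV \<theta> x :> r *\<^sub>R grad \<psi> x + (\<psi> x / r) *\<^sub>R x"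
          by (simp add: \<theta>_def[abs_def] r_def sgn_div_norm divide_inverse)
      qed
      define P where "P = (norm (grad \<psi> x))\<^sup>2"
      have "norm (grad \<theta> x) \<le> r * norm (grad \<psi> x) + \<bar>\<psi> x\<bar>"
        unfolding g using norm_triangle_ineq[of "r *\<^sub>R grad \<psi> x" "(\<psi> x / r) *\<^sub>R x"] r by (simp add: r_def)
      then have "(norm (grad \<theta> x))\<^sup>2 \<le> (r * norm (grad \<psi> x) + \<bar>\<psi> x\<bar>)\<^sup>2" by (rule power_mono) simp
      also have "\<dots> \<le> 2 * (r * norm (grad \<psi> x))\<^sup>2 + 2 * \<bar>\<psi> x\<bar>\<^sup>2"
        using sum_squares_bound[of "r * norm (grad \<psi> x)" "\<bar>\<psi> x\<bar>"] by (simp add: power2_sum)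
      finally have "(norm (grad \<theta> x))\<^sup>2 \<le> 2 * (r\<^sup>2 * P) + 2 * (\<psi> x)\<^sup>2" by (simp add: P_def power_mult_distrib)
      then have "(1 - r\<^sup>2) * (norm (grad \<theta> x))\<^sup>2 \<le> (1 - r\<^sup>2) * (2 * (r\<^sup>2 * P) + 2 * (\<psi> x)\<^sup>2)"
        using r2 by (intro mult_left_mono) auto
      also have "\<dots> = 2 * (r\<^sup>2 * ((1 - r\<^sup>2) * P)) + 2 * (\<psi> x)\<^sup>2 - 2 * (r\<^sup>2 * (\<psi> x)\<^sup>2)" by (simp add: algebra_simps)
      finally have *: "(1 - r\<^sup>2) * (norm (grad \<theta> x))\<^sup>2 \<le> 2 * (r\<^sup>2 * ((1 - r\<^sup>2) * P)) + 2 * (\<psi> x)\<^sup>2 - 2 * (r\<^sup>2 * (\<psi> x)\<^sup>2)" .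
      have 1: "(1 - r\<^sup>2) * (norm (grad \<theta> x))\<^sup>2 + (\<theta> x)\<^sup>2 \<le> 2 * (r\<^sup>2 * ((1 - r\<^sup>2) * P)) + 2 * (\<psi> x)\<^sup>2"
      proof -
        have "(\<theta> x)\<^sup>2 = r\<^sup>2 * (\<psi> x)\<^sup>2" by (simp add: \<theta>_def r_def[symmetric] power_mult_distrib)
        moreover have "0 \<le> r\<^sup>2 * (\<psi> x)\<^sup>2" by simp
        ultimately show ?thesis using * by linarith
      qed
      have "r\<^sup>2 * ((1 - r\<^sup>2) * P) \<le> r * ((1 - r\<^sup>2) * P)"
        using r2 by (intro mult_right_mono) (auto simp: P_def)
      moreover have "(\<psi> x)\<^sup>2 \<le> (\<psi> x)\<^sup>2 / r" 
      proof -
        have "(\<psi> x)\<^sup>2 * r \<le> (\<psi> x)\<^sup>2" using r mult_left_le[of r "(\<psi> x)\<^sup>2"] by simp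
        then show ?thesis using r by (simp add: pos_le_divide_eq)
      qed
      ultimately have "2 * (r\<^sup>2 * ((1 - r\<^sup>2) * P)) + 2 * (\<psi> x)\<^sup>2 \<le> 2 * (r * (1 - r\<^sup>2) * P + (\<psi> x)\<^sup>2 / r)" by (simp add: mult.assoc)
      then show ?thesis using 1 r2 unfolding r_def P_def by auto
    qed (simp add: z\<theta> K(3) gpsi)
    show "0 \<le> Q'" unfolding Q'_def using pw by (intro integral_nonneg_AE) auto
    have "Q' \<le> (LINT x|lborel. 2 * (norm x * (1 - (norm x)\<^sup>2) * (norm (grad \<psi> x))\<^sup>2 + (\<psi> x)\<^sup>2 / norm x))"
      unfolding Q'_def using iQ' integrable_mult_right[OF iD, of 2] pw by (intro integral_mono) blast+
    then show "Q' \<le> 2 * D" unfolding D_def by (simp only: integral_mult_right_zero)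
  qed
  have lnpos: "A \<le> A - ln (norm x)" "0 < A - ln (norm x)" if "x \<in> pball" for x
  proof -
    have "0 < norm x" "norm x < 1" using that by auto
    then have "ln (norm x) < 0" by (rule ln_less_zero)
    then show "A \<le> A - ln (norm x)" "0 < A - ln (norm x)" using A(1) by linarith+
  qed
  have Spos: "0 < Sig A a (norm x)" "Sig A a (norm x) \<le> A - ln (norm x)" if "x \<in> pball" for x
  proof -
    have "0 < norm x" "norm x < 1" using that by auto
    then have "A - a < Sig A a (norm x)" using A(1) by (intro Sig_pos) (auto simp: a_def)
    then show "0 < Sig A a (norm x)" using A(1) by (simp add: a_def)
    show "Sig A a (norm x) \<le> A - ln (norm x)" using A(1) by (simp add: Sig_def a_def)
  qed
  have pK: "x \<in> pball" if "x \<in> K" for x using that K by auto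
  have iM: "integrable lborel M"
  proof (rule int)
    have nS: "\<forall>x\<in>K. Sig A a (norm x) \<noteq> 0" using Spos(1)[OF pK] by (metis less_irrefl)
    have cS: "continuous_on K (\<lambda>x. Sig A a (norm x))"
      unfolding Sig_def by (intro continuous_intros) (use Kn in auto)
    have "0 < p" using p by simp
    then show "continuous_on K M"
      unfolding M_def[abs_def] by (intro continuous_intros continuous_on_abs_powr cpsi cS nS Kn)
  qed (simp add: M_def K(3))
  have iH: "integrable lborel H"
  proof (rule int)
    have n: "\<forall>x\<in>K. 1 - (norm x)\<^sup>2 \<noteq> 0" "\<forall>x\<in>K. A - ln (norm x) \<noteq> 0"
    proof safe
      fix x assume x: "x \<in> K"
      show False if "1 - (norm x)\<^sup>2 = 0"
      proof -
        have "(norm x)\<^sup>2 < 1" using pK[OF x] by (auto simp: power_less_one_iff)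
        then show False using that by simp
      qed
      show False if "A - ln (norm x) = 0" using lnpos(2)[OF pK[OF x]] that by simp
    qed
    have "0 < p" using p by simp
    then show "continuous_on K H"
      unfolding H_def[abs_def] by (intro continuous_intros continuous_on_abs_powr cpsi n Kn)
  qed (simp add: H_def K(3))
  define B where "B = A powr (- ((p + 2) / 2))"
  have B0: "0 \<le> B" by (simp add: B_def)
  define g where "g x = sqrt (1 - (norm x)\<^sup>2) * \<bar>\<theta> x\<bar>" for x
  \<comment> \<open>For r^2 \<le> 1/2 one has 1 - r^2 \<le> (1 - r^4)^2, so \<open>M\<close>
    dominates \<open>H\<close> with constant one; this preserves the sharp constant. For r^2 > 1/2
    the singular powers of r are bounded by 2^((3 + p)/2) \<le> 32, since p \<le> 6, and
    \<open>B\<close> bounds the logarithmic weight.\<close>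
  have HM: "H x \<le> M x + 32 * B * g x powr p" if x: "x \<in> pball" for x
  proof -
    define r where "r = norm x"
    have r: "0 < r" "r < 1" using x by (auto simp: r_def)
    have q: "0 < r\<^sup>2" "r\<^sup>2 < 1" using r by (auto simp: power_less_one_iff)
    have M0: "0 \<le> M x" using A by (auto simp: M_def a_def)
    have g0: "0 \<le> B * g x powr p" using B0 by simp
    show ?thesis
    proof (cases "r\<^sup>2 \<le> 1 / 2")
      case True
      have "1 - r\<^sup>2 \<le> (1 - r ^ 4)\<^sup>2"
      proof -
        have "0 \<le> r\<^sup>2 * ((1 - r\<^sup>2) * (1 - r\<^sup>2 - (r\<^sup>2)\<^sup>2))"
        proof (intro mult_nonneg_nonneg)
          have "(r\<^sup>2)\<^sup>2 \<le> (1 / 2)\<^sup>2" using True by (intro power_mono) auto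
          then show "0 \<le> 1 - r\<^sup>2 - (r\<^sup>2)\<^sup>2" using True by (simp add: power2_eq_square[of "1/2"])
        qed (use q in auto)
        then show ?thesis by (simp add: eval_nat_numeral algebra_simps)
      qed
      then have "(1 - r\<^sup>2) powr (p / 2) \<le> ((1 - r ^ 4)\<^sup>2) powr (p / 2)"
        using q p by (intro powr_mono2) auto
      also have "\<dots> = (1 - r ^ 4) powr p"
      proof -
        have "0 < 1 - r ^ 4" using r by (simp add: power_less_one_iff)
        from power2_powr[OF this, of "p / 2"] show ?thesis by simp
      qed
      finally have 1: "(1 - r\<^sup>2) powr (p / 2) \<le> (1 - r ^ 4) powr p" .
      have 2: "(A - ln r) powr (- ((p + 2) / 2)) \<le> Sig A a r powr (- ((p + 2) / 2))"
        using Spos[OF x] p by (intro powr_mono2') (auto simp: r_def)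
      have "H x \<le> r powr (- 3) * (1 - r ^ 4) powr p * Sig A a r powr (- ((p + 2) / 2)) * \<bar>\<psi> x\<bar> powr p"
        unfolding H_def r_def[symmetric] using 1 2 by (intro mult_mono mult_nonneg_nonneg) auto
      also have "\<dots> = r powr (- 3) * Sig A a r powr (- ((p + 2) / 2)) * \<bar>(1 - r ^ 4) * \<psi> x\<bar> powr p"
        using r by (simp add: abs_mult powr_mult power_le_one)
      also have "\<dots> \<le> M x"
      proof -
        have "1 * (r powr (- 3) * Sig A a r powr (- ((p + 2) / 2)) * \<bar>(1 - r ^ 4) * \<psi> x\<bar> powr p) \<le> M x"
          unfolding M_def r_def[symmetric] using A by (intro mult_right_mono) (auto simp: a_def)
        then show ?thesis by simp
      qed
      finally show ?thesis using g0 by simp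
    next
      case False
      have "H x \<le> r powr (- 3) * (1 - r\<^sup>2) powr (p / 2) * B * \<bar>\<psi> x\<bar> powr p"
      proof -
        have "(A - ln r) powr (- ((p + 2) / 2)) \<le> B"
          unfolding B_def using lnpos[OF x] A(1) p(1) by (intro powr_mono2') (auto simp: r_def)
        then show ?thesis
          unfolding H_def r_def[symmetric] by (intro mult_right_mono mult_left_mono mult_nonneg_nonneg) auto
      qed
      also have "\<dots> = r powr (- (3 + p)) * B * g x powr p"
      proof -
        have "g x powr p = (1 - r\<^sup>2) powr (p / 2) * (r powr p * \<bar>\<psi> x\<bar> powr p)"
          unfolding g_def \<theta>_def r_def[symmetric] using r q
          by (simp add: powr_mult abs_mult powr_half_sqrt[symmetric] powr_powr)
        moreover have "r powr (- 3) = r powr (- (3 + p)) * r powr p"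
          by (simp add: powr_add[symmetric])
        ultimately show ?thesis by simp
      qed
      also have "\<dots> \<le> 32 * B * g x powr p"
      proof -
        have "r powr (- (3 + p)) = (r\<^sup>2) powr (- ((3 + p) / 2))"
        proof -
          have e: "2 * (- ((3 + p) / 2)) = - (3 + p)" by (simp add: field_simps)
          show ?thesis unfolding power2_powr[OF r(1)] e ..
        qed
        also have "\<dots> \<le> (1 / 2) powr (- ((3 + p) / 2))"
          using False p by (intro powr_mono2') auto
        also have "\<dots> = 2 powr ((3 + p) / 2)" by (simp add: powr_minus powr_divide field_simps)
        also have "\<dots> \<le> 2 powr 5" using p by (intro powr_mono) auto
        also have "\<dots> = 32" by (simp add: powr_numeral)
        finally show ?thesis using B0 by (intro mult_right_mono) auto
      qed
      finally show ?thesis using M0 by simp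
    qed
  qed
  \<comment> \<open>The slack \<open>e\<close> keeps the level \<open>l\<close> positive even when D
    = 0. A third of E = D + 3 e is exactly the reserve plus the slack.\<close>
  have main: "S3 p * (integral\<^sup>L lborel H) powr (2 / p) \<le> Q + e" if e: "0 < e" for e
  proof -
    define E where "E = D + 3 * e"
    have E: "0 < E" "D \<le> E" using Q'D e by (auto simp: E_def)
    define l where "l = sqrt (288 * E)"
    have l: "0 < l" "l\<^sup>2 = 288 * E" using E by (auto simp: l_def)
    have Fl: "F \<le> l ^ 6"
    proof -
      have "144 * Q' \<le> l\<^sup>2" using Q'D E l by simp
      then have "(144 * Q') ^ 3 \<le> (l\<^sup>2) ^ 3" using Q'D by (intro power_mono) auto
      then show ?thesis using F by (simp add: power_mult[symmetric])
    qed
    \<comment> \<open>Cutting at the level \<open>l\<close> reduces the exponent p to 6. With l^2 of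
      the order of the energy, both terms integrate to a multiple of l^p, since F \<le> l^6.\<close>
    have gp: "g x powr p \<le> l powr (p - 6) * ((1 - (norm x)\<^sup>2) ^ 3 * \<theta> x ^ 6) + l powr p" if x: "x \<in> pball" for x
    proof -
      have q: "(norm x)\<^sup>2 < 1" using x by (auto simp: power_less_one_iff)
      have g0: "0 \<le> g x" using q by (simp add: g_def)
      have "sqrt (1 - (norm x)\<^sup>2) ^ 6 = (sqrt (1 - (norm x)\<^sup>2) ^ 2) ^ 3"
        using power_mult[of "sqrt (1 - (norm x)\<^sup>2)" 2 3] by simp
      then have g6: "g x ^ 6 = (1 - (norm x)\<^sup>2) ^ 3 * \<theta> x ^ 6"
        using q unfolding g_def by (simp add: power_mult_distrib)
      show ?thesis
      proof (cases "g x \<le> l")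
        case True
        then have "g x powr p \<le> l powr p" using g0 p by (intro powr_mono2) auto
        moreover have "0 \<le> l powr (p - 6) * ((1 - (norm x)\<^sup>2) ^ 3 * \<theta> x ^ 6)"
          unfolding g6[symmetric] using g0 by simp
        ultimately show ?thesis by linarith
      next
        case False
        then have "g x powr p = g x powr (p - 6) * g x ^ 6"
          using l powr_mult_power6[of "g x" p] by simp
        also have "\<dots> \<le> l powr (p - 6) * g x ^ 6"
          using False l p by (intro mult_right_mono powr_mono2') auto
        finally have "g x powr p \<le> l powr (p - 6) * g x ^ 6" .
        moreover have "0 \<le> l powr p" by simp
        ultimately show ?thesis unfolding g6 by linarith
      qed
    qed
    have iV: "integrable lborel (indicator (ball (0::real^3) 1) :: _ \<Rightarrow> real)"
      using emeasure_lborel_ball_finite by (intro integrable_real_indicator) auto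
    have "integral\<^sup>L lborel H \<le> (LINT x|lborel. M x + 32 * B * (l powr (p - 6) * ((1 - (norm x)\<^sup>2) ^ 3 * \<theta> x ^ 6) + l powr p * indicator (ball 0 1) x))"
    proof (rule integral_mono[OF iH])
      show "integrable lborel (\<lambda>x. M x + 32 * B * (l powr (p - 6) * ((1 - (norm x)\<^sup>2) ^ 3 * \<theta> x ^ 6) + l powr p * indicator (ball 0 1) x))"
        by (intro Bochner_Integration.integrable_add integrable_mult_right iM iF iV)
      fix x :: "real^3"
      show "H x \<le> M x + 32 * B * (l powr (p - 6) * ((1 - (norm x)\<^sup>2) ^ 3 * \<theta> x ^ 6) + l powr p * indicator (ball 0 1) x)"
      proof (cases "x \<in> pball")
        case True
        have "32 * B * g x powr p \<le> 32 * B * (l powr (p - 6) * ((1 - (norm x)\<^sup>2) ^ 3 * \<theta> x ^ 6) + l powr p)"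
          using gp[OF True] B0 by (intro mult_left_mono) auto
        then show ?thesis using HM[OF True] True by simp
      next
        case False
        then have "x \<notin> K" using K by auto
        then show ?thesis using B0 by (simp add: H_def M_def K(3) z\<theta>)
      qed
    qed
    also have "\<dots> = integral\<^sup>L lborel M + 32 * B * (l powr (p - 6) * F + l powr p * V)"
      unfolding F_def V_def
      by (subst Bochner_Integration.integral_add Bochner_Integration.integral_add
            | intro iM integrable_mult_right Bochner_Integration.integrable_add iF iV
            | simp only: integral_mult_right_zero)+
        (simp add: lmeasurable_ball)
    also have "\<dots> \<le> integral\<^sup>L lborel M + 32 * B * (l powr p + l powr p * V)"
    proof -
      have "l powr (p - 6) * F \<le> l powr (p - 6) * l ^ 6" using Fl by (intro mult_left_mono) auto
      also have "\<dots> = l powr p" using l powr_mult_power6[of l p] by simp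
      finally show ?thesis using B0 by (intro add_left_mono mult_left_mono) auto
    qed
    finally have 1: "integral\<^sup>L lborel H \<le> integral\<^sup>L lborel M + (32 * (1 + V)) * (B * l powr p)"
      by (simp add: algebra_simps)
    have H0: "0 \<le> integral\<^sup>L lborel H" by (simp add: H_def)
    have M0: "0 \<le> integral\<^sup>L lborel M" using A by (intro integral_nonneg_AE) (auto simp: M_def a_def)
    have s: "0 < 2 / p" "2 / p \<le> 1" using p by auto
    have "(integral\<^sup>L lborel H) powr (2 / p) \<le> (integral\<^sup>L lborel M + (32 * (1 + V)) * (B * l powr p)) powr (2 / p)"
      using 1 H0 s by (intro powr_mono2) auto
    also have "\<dots> \<le> (integral\<^sup>L lborel M) powr (2 / p) + ((32 * (1 + V)) * (B * l powr p)) powr (2 / p)"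
      using M0 V0 B0 s by (intro powr_subadditive) auto
    also have "((32 * (1 + V)) * (B * l powr p)) powr (2 / p) = (32 * (1 + V)) powr (2 / p) * (B powr (2 / p) * l\<^sup>2)"
      using l p V0 B0 by (simp add: powr_mult powr_powr powr_numeral)
    \<comment> \<open>The logarithmic weight contributes A^(-(p + 2)/p) \<le> 1/A. This smallness
      lets a large \<open>A\<close> absorb the error into the reserve.\<close>
    also have "\<dots> \<le> (32 * (1 + V)) * (1 / A * l\<^sup>2)"
    proof (intro mult_mono)
      have "(32 * (1 + V)) powr (2 / p) \<le> (32 * (1 + V)) powr 1" using s V0 by (intro powr_mono) auto
      then show "(32 * (1 + V)) powr (2 / p) \<le> 32 * (1 + V)" using V0 by simp
      have "B powr (2 / p) = A powr (- ((p + 2) / p))" 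
      proof -
        have e: "- ((p + 2) / 2) * (2 / p) = - ((p + 2) / p)" using p by (simp add: field_simps)
        show ?thesis unfolding B_def powr_powr e ..
      qed
      also have "\<dots> \<le> A powr (- 1)" using A p by (intro powr_mono) (auto simp: field_simps)
      finally show "B powr (2 / p) \<le> 1 / A" using A by (simp add: powr_minus_divide)
    qed (use V0 A in auto)
    finally have 2: "(integral\<^sup>L lborel H) powr (2 / p) \<le> (integral\<^sup>L lborel M) powr (2 / p) + (32 * (1 + V)) * (1 / A * l\<^sup>2)"
      by simp
    have "S3 p * (integral\<^sup>L lborel H) powr (2 / p) \<le> S3 p * ((integral\<^sup>L lborel M) powr (2 / p) + (32 * (1 + V)) * (1 / A * l\<^sup>2))"
      by (rule mult_left_mono[OF 2 S0])
    also have "\<dots> = S3 p * (integral\<^sup>L lborel M) powr (2 / p) + (27648 * (1 + V) * S3 p) / A * E / 3"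
      unfolding l(2) using A by (simp add: field_simps)
    also have "(27648 * (1 + V) * S3 p) / A * E / 3 \<le> 1 * E / 3"
      using A E by (intro divide_right_mono mult_right_mono) (auto simp: V_def)
    also have "S3 p * (integral\<^sup>L lborel M) powr (2 / p) + 1 * E / 3 \<le> Q + e"
      using trans by (simp add: E_def add_divide_distrib)
    finally show ?thesis by simp
  qed
  have "S3 p * (integral\<^sup>L lborel H) powr (2 / p) \<le> Q"
    by (rule field_le_epsilon) (rule main)
  then show ?thesis unfolding H_def Q_def .
qed

subsection \<open>Hyperbolic ground state\<close>

lemma sinh_hdist_0: "x \<in> hspace \<Longrightarrow> sinh (hdist 0 x) = hfactor x * norm x"
proof -
  assume x: "x \<in> hspace"
  define r where "r = norm x"
  have r: "0 \<le> r" "r < 1" using x by (auto simp: r_def)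
  have e: "exp (hdist 0 x) = (1 + r) / (1 - r)"
    unfolding hdist_0[OF x] r_def[symmetric] using r by (intro exp_ln) auto
  have "(1 - r) * (1 + r) = 1 - r\<^sup>2" by (simp add: power2_eq_square algebra_simps)
  then have h: "hfactor x = 2 / ((1 - r) * (1 + r))" by (simp add: hfactor_def r_def)
  show ?thesis
    unfolding sinh_def exp_minus e h r_def[symmetric] using r by (simp add: field_simps)
qed

lemma tanh_hdist_0: "x \<in> hspace \<Longrightarrow> tanh (hdist 0 x / 2) = norm x"
proof -
  assume x: "x \<in> hspace"
  define r where "r = norm x"
  have r: "0 \<le> r" "r < 1" using x by (auto simp: r_def)
  have e: "exp (hdist 0 x) = (1 + r) / (1 - r)"
    unfolding hdist_0[OF x] r_def[symmetric] using r by (intro exp_ln) auto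
  have "tanh (hdist 0 x / 2) = (1 - inverse (exp (hdist 0 x))) / (1 + inverse (exp (hdist 0 x)))"
    by (simp add: tanh_real_altdef exp_minus)
  also have "\<dots> = r" unfolding e using r by (simp add: field_simps)
  finally show ?thesis by (simp add: r_def)
qed

lemma X_scaled: "0 < \<alpha> \<Longrightarrow> 0 < r \<Longrightarrow> X (\<alpha> * r) = 1 / ((1 - ln \<alpha>) - ln r)"
  by (simp add: X_def ln_mult algebra_simps)

lemma hfactor_pos: "x \<in> hspace \<Longrightarrow> 0 < hfactor x"
  by (simp add: hfactor_def power_less_one_iff)

text \<open>In terms of the distance the factor is sqrt (sinh \<rho>) cosh (\<rho>/2). Pointwise the
  two sides differ by the divergence of \<open>g x *\<^sub>R x\<close>: the function
  \<open>c\<close> is chosen to cancel the cross term v (x \<bullet> grad v), see \<open>e4\<close>,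
  and then the coefficient of v^2 cancels as well, see \<open>e5\<close>. The term \<psi>^2/r is the
  surplus over the two Hardy terms.\<close>

lemma ground_state:
  fixes v :: "real^3 \<Rightarrow> real"
  assumes v: "v \<in> Cc_smooth pball"
  defines "\<psi> \<equiv> \<lambda>x. sqrt (2 * norm x) / (1 - (norm x)\<^sup>2) * v x"
  shows "\<psi> \<in> Cc_smooth pball"
    and "(LINT x|lborel. hfactor x * (norm (grad v x))\<^sup>2) =
      (LINT x|lborel. hfactor x ^ 3 * (v x)\<^sup>2) + 1 / 4 * (LINT x|lborel. hfactor x ^ 3 * ((v x)\<^sup>2 / (hfactor x * norm x)\<^sup>2))
      + (LINT x|lborel. (1 - (norm x)\<^sup>2) / norm x * (norm (grad \<psi> x))\<^sup>2 + (\<psi> x)\<^sup>2 / norm x)"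
proof -
  have sm: "smooth_on U v" for U using v by (rule Cc_smooth_smooth)
  have cv: "continuous_on U v" for U using smooth_on_continuous[OF sm] .
  have cgv: "continuous_on U (grad v)" for U using smooth_on_grad_continuous[OF sm] .
  obtain K where K: "compact K" "K \<subseteq> pball" "\<And>x. x \<notin> K \<Longrightarrow> v x = 0" using Cc_smoothD[OF v] by metis
  have gv: "grad v x = 0" if "x \<notin> K" for x
    using grad_zero_outside[OF compact_imp_closed[OF K(1)] K(3) that] .
  have q1: "(norm x)\<^sup>2 < 1" "1 - (norm x)\<^sup>2 \<noteq> 0" "norm x \<noteq> 0" if "x \<in> pball" for x
  proof -
    show "(norm x)\<^sup>2 < 1" using that by (auto simp: power_less_one_iff)
    then show "1 - (norm x)\<^sup>2 \<noteq> 0" by simp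
    show "norm x \<noteq> 0" using that by simp
  qed
  have sn: "smooth_on pball (norm :: real^3 \<Rightarrow> real)" by (rule smooth_on_subset[OF _ smooth_on_norm]) auto
  have s\<psi>: "smooth_on pball \<psi>"
    unfolding \<psi>_def
    by (intro smooth_on_mult smooth_on_divide smooth_on_diff smooth_on_const smooth_on_norm_sq sm open_pball
        smooth_on_compose[OF _ _ smooth_on_sqrt] sn) (use q1 in \<open>auto\<close>)
  show \<psi>C: "\<psi> \<in> Cc_smooth pball"
    by (rule Cc_smoothI[OF open_pball K(1,2) s\<psi>]) (simp add: \<psi>_def K(3))
  have s\<psi>': "smooth_on U \<psi>" for U using \<psi>C by (rule Cc_smooth_smooth)
  have z\<psi>: "\<psi> x = 0" "grad \<psi> x = 0" if "x \<notin> K" for x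
    using grad_zero_outside[OF compact_imp_closed[OF K(1)], of \<psi> x] that K(3) by (auto simp: \<psi>_def)
  define c where "c q = - ((1 + 3 * q) / (q * (1 - q)\<^sup>2))" for q :: real
  define c' where "c' q = - (3 / (q * (1 - q)\<^sup>2) - (1 + 3 * q) / (q\<^sup>2 * (1 - q)\<^sup>2) + 2 * (1 + 3 * q) / (q * (1 - q) ^ 3))" for q :: real
  define g where "g x = c ((norm x)\<^sup>2) * (v x)\<^sup>2" for x
  have smg: "smooth_on pball g"
    unfolding g_def[abs_def] c_def
    by (intro smooth_on_mult smooth_on_minus smooth_on_divide smooth_on_add smooth_on_diff smooth_on_const
        smooth_on_power[OF _ smooth_on_diff] smooth_on_power[OF _ sm] smooth_on_norm_sq open_pball)
      (use q1 in auto)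
  have gC: "g \<in> Cc_smooth UNIV"
    by (rule Cc_smooth_mono[OF subset_UNIV Cc_smoothI[OF open_pball K(1,2) smg]]) (simp add: g_def K(3))
  have smg': "smooth_on U g" for U using gC by (rule Cc_smooth_smooth)
  have zg: "g x = 0" "grad g x = 0" if "x \<notin> K" for x
    using grad_zero_outside[OF compact_imp_closed[OF K(1)], of g x] that K(3) by (auto simp: g_def)
  note int = integrable_compact_support[OF K(1)]
  have Kn: "\<forall>x\<in>K. norm x \<noteq> 0" "\<forall>x\<in>K. 1 - (norm x)\<^sup>2 \<noteq> 0" using K(2) q1 by blast+
  have ch: "continuous_on K hfactor" unfolding hfactor_def[abs_def] by (intro continuous_intros Kn)
  have nh: "\<forall>x\<in>K. (hfactor x * norm x)\<^sup>2 \<noteq> 0" using Kn by (simp add: hfactor_def)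
  have i1: "integrable lborel (\<lambda>x. hfactor x * (norm (grad v x))\<^sup>2)"
    by (intro int continuous_intros ch cgv) (simp add: gv)
  have i2: "integrable lborel (\<lambda>x. hfactor x ^ 3 * (v x)\<^sup>2)"
    by (intro int continuous_intros ch cv) (simp add: K(3))
  have i3: "integrable lborel (\<lambda>x. hfactor x ^ 3 * ((v x)\<^sup>2 / (hfactor x * norm x)\<^sup>2))"
    by (intro int continuous_intros ch cv nh) (simp add: K(3))
  have i4: "integrable lborel (\<lambda>x. (1 - (norm x)\<^sup>2) / norm x * (norm (grad \<psi> x))\<^sup>2 + (\<psi> x)\<^sup>2 / norm x)"
    by (intro int continuous_intros smooth_on_continuous[OF s\<psi>'] smooth_on_grad_continuous[OF s\<psi>'] Kn) (simp add: z\<psi>)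
  have i5: "integrable lborel (\<lambda>x. 3 * g x + grad g x \<bullet> x)"
    by (intro int continuous_intros smooth_on_continuous[OF smg'] smooth_on_grad_continuous[OF smg']) (simp add: zg)
  have div0: "(LINT x|lborel. 3 * g x + grad g x \<bullet> x) = 0"
    using integral_radial_divergence[OF gC] by simp
  have pw: "hfactor x * (norm (grad v x))\<^sup>2 = (hfactor x ^ 3 * (v x)\<^sup>2 + 1 / 4 * (hfactor x ^ 3 * ((v x)\<^sup>2 / (hfactor x * norm x)\<^sup>2)))
      + ((1 - (norm x)\<^sup>2) / norm x * (norm (grad \<psi> x))\<^sup>2 + (\<psi> x)\<^sup>2 / norm x) + (3 * g x + grad g x \<bullet> x)" for x
  proof (cases "x \<in> K")
    case True
    then have x: "x \<in> pball" using K by blast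
    define r q s where "r = norm x" and "q = r\<^sup>2" and "s = 1 - q"
    have r: "0 < r" using x by (simp add: r_def)
    have q: "0 < q" using r by (simp add: q_def)
    have s: "0 < s" using q1[OF x] by (simp add: s_def q_def r_def)
    have xx: "x \<bullet> x = q" by (simp add: q_def r_def power2_norm_eq_inner)
    define m where "m = sqrt (2 * r) / s"
    define m' where "m' = (1 + 3 * q) / (sqrt (2 * r) * s\<^sup>2)"
    define P where "P = (norm (grad v x))\<^sup>2"
    define R where "R = x \<bullet> grad v x"
    define V where "V = v x"
    have sr: "sqrt (2 * r) * sqrt (2 * r) = 2 * r" "sqrt (2 * r) \<noteq> 0" using r by auto
    have "((\<lambda>r. sqrt (2 * r) / (1 - r\<^sup>2)) has_real_derivative m') (at r)"
    proof -
      have "((\<lambda>r. sqrt (2 * r) / (1 - r\<^sup>2)) has_real_derivative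
          ((inverse (sqrt (2 * r)) / 2 * 2) * (1 - r\<^sup>2) - sqrt (2 * r) * (- (2 * r))) / ((1 - r\<^sup>2) * (1 - r\<^sup>2))) (at r)"
        using r s by (auto intro!: derivative_eq_intros simp: s_def q_def)
      also have "((inverse (sqrt (2 * r)) / 2 * 2) * (1 - r\<^sup>2) - sqrt (2 * r) * (- (2 * r))) / ((1 - r\<^sup>2) * (1 - r\<^sup>2)) = m'"
      proof -
        have "((inverse (sqrt (2 * r)) / 2 * 2) * s - sqrt (2 * r) * (- (2 * r))) = (s + (sqrt (2 * r) * sqrt (2 * r)) * (2 * r)) / sqrt (2 * r)"
          using sr by (simp add: field_simps)
        also have "\<dots> = (1 + 3 * q) / sqrt (2 * r)" unfolding sr(1) by (simp add: s_def q_def power2_eq_square)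
        finally show ?thesis unfolding m'_def s_def[symmetric] q_def[symmetric] by (simp add: power2_eq_square)
      qed
      finally show ?thesis .
    qed
    from GDERIV_DERIV_compose[OF GDERIV_norm, of x, OF _ this[unfolded r_def]]
    have dm: "GDERIV (\<lambda>x. sqrt (2 * norm x) / (1 - (norm x)\<^sup>2)) x :> (m' / r) *\<^sub>R x"
      using r by (simp add: sgn_div_norm r_def divide_inverse)
    have g\<psi>: "grad \<psi> x = m *\<^sub>R grad v x + (V * (m' / r)) *\<^sub>R x"
    proof (rule grad_eqI)
      show "GDERIV \<psi> x :> m *\<^sub>R grad v x + (V * (m' / r)) *\<^sub>R x"
        using GDERIV_mult[OF dm GDERIV_grad[OF smooth_on_differentiable[OF sm[of UNIV]]]]
        unfolding \<psi>_def by (simp add: m_def s_def q_def r_def V_def)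
    qed
    have n1: "(norm (grad \<psi> x))\<^sup>2 = m\<^sup>2 * P + 2 * (m * m') * V * R / r + V\<^sup>2 * m'\<^sup>2"
      unfolding power2_norm_eq_inner g\<psi> P_def R_def
      using r by (simp add: inner_add_left inner_add_right xx inner_commute[of "grad v x" x] q_def power2_eq_square field_simps)
    have n2: "m\<^sup>2 = 2 * r / s\<^sup>2" "m * m' = (1 + 3 * q) / s ^ 3" "m'\<^sup>2 = (1 + 3 * q)\<^sup>2 / (2 * r * s ^ 4)"
      unfolding m_def m'_def using r s sr by (simp_all add: power_divide power_mult_distrib eval_nat_numeral)
    have e1: "s / r * (norm (grad \<psi> x))\<^sup>2 = 2 / s * P + 2 * (1 + 3 * q) / (q * s\<^sup>2) * V * R + V\<^sup>2 * ((1 + 3 * q)\<^sup>2 / (2 * q * s ^ 3))"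
      unfolding n1 n2 using r s unfolding q_def by (simp add: field_simps eval_nat_numeral)
    have e2: "(\<psi> x)\<^sup>2 / r = 2 * V\<^sup>2 / s\<^sup>2"
      unfolding \<psi>_def r_def[symmetric] q_def[symmetric] s_def[symmetric] V_def[symmetric]
      using r by (simp add: power_mult_distrib power_divide)
    have dc: "(c has_real_derivative c' q) (at q)"
    proof -
      have "(c has_real_derivative - ((3 * (q * (1 - q)\<^sup>2) - (1 + 3 * q) * ((1 - q)\<^sup>2 - 2 * q * (1 - q))) / ((q * (1 - q)\<^sup>2) * (q * (1 - q)\<^sup>2)))) (at q)"
        unfolding c_def[abs_def] using q s
        by (auto intro!: derivative_eq_intros simp: s_def power2_eq_square) (simp add: algebra_simps)
      also have "- ((3 * (q * (1 - q)\<^sup>2) - (1 + 3 * q) * ((1 - q)\<^sup>2 - 2 * q * (1 - q))) / ((q * (1 - q)\<^sup>2) * (q * (1 - q)\<^sup>2))) = c' q"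
        unfolding c'_def s_def[symmetric] using q s by (simp add: field_simps eval_nat_numeral)
      finally show ?thesis .
    qed
    have gg: "grad g x = (2 * c q * V) *\<^sub>R grad v x + (V\<^sup>2 * (2 * c' q)) *\<^sub>R x"
    proof (rule grad_eqI)
      have 1: "GDERIV (\<lambda>x. c ((norm x)\<^sup>2)) x :> (2 * c' q) *\<^sub>R x"
        using dc unfolding q_def r_def by (rule GDERIV_compose_normsq)
      have 2: "GDERIV (\<lambda>x. (v x)\<^sup>2) x :> (2 * V) *\<^sub>R grad v x"
        using GDERIV_power[OF GDERIV_grad[OF smooth_on_differentiable[OF sm[of UNIV]]], of x 2] by (simp add: V_def)
      show "GDERIV g x :> (2 * c q * V) *\<^sub>R grad v x + (V\<^sup>2 * (2 * c' q)) *\<^sub>R x"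
        unfolding g_def[abs_def] by (rule GDERIV_subst[OF GDERIV_mult[OF 1 2]]) (simp add: V_def q_def r_def)
    qed
    have e3: "3 * g x + grad g x \<bullet> x = 3 * c q * V\<^sup>2 + 2 * c q * V * R + 2 * q * c' q * V\<^sup>2"
      unfolding gg g_def r_def[symmetric] q_def[symmetric] V_def[symmetric]
      by (simp add: inner_add_left xx R_def inner_commute[of "grad v x" x])
    have e4: "2 * (1 + 3 * q) / (q * s\<^sup>2) * V * R + 2 * c q * V * R = 0"
      unfolding c_def s_def[symmetric] by (simp add: field_simps)
    have e5: "(1 + 3 * q)\<^sup>2 / (2 * q * s ^ 3) + 2 / s\<^sup>2 + 3 * c q + 2 * q * c' q + 8 / s ^ 3 + 1 / (2 * q * s) = 0"
    proof -
      have s1: "s = 1 - q" by (simp add: s_def)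
      have "(1 + 3 * q)\<^sup>2 / (2 * q * s ^ 3) + 2 / s\<^sup>2 + 3 * c q + 2 * q * c' q + 8 / s ^ 3 + 1 / (2 * q * s)
        = ((1 + 3 * q)\<^sup>2 + 4 * q * s - 6 * (1 + 3 * q) * s - 12 * q * s + 4 * (1 + 3 * q) * s - 8 * q * (1 + 3 * q) + 16 * q + s\<^sup>2) / (2 * q * s ^ 3)"
        unfolding c_def c'_def s_def[symmetric] using q s by (simp add: field_simps eval_nat_numeral)
      also have "(1 + 3 * q)\<^sup>2 + 4 * q * s - 6 * (1 + 3 * q) * s - 12 * q * s + 4 * (1 + 3 * q) * s - 8 * q * (1 + 3 * q) + 16 * q + s\<^sup>2 = 0"
        unfolding s1 by (simp add: power2_eq_square algebra_simps)
      finally show ?thesis by simp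
    qed
    have hf: "hfactor x = 2 / s" by (simp add: hfactor_def s_def q_def r_def)
    have e6: "hfactor x ^ 3 * V\<^sup>2 = 8 / s ^ 3 * V\<^sup>2" "1 / 4 * (hfactor x ^ 3 * (V\<^sup>2 / (hfactor x * r)\<^sup>2)) = 1 / (2 * q * s) * V\<^sup>2"
      unfolding hf q_def using r s by (simp_all add: field_simps eval_nat_numeral)
    have "(hfactor x ^ 3 * V\<^sup>2 + 1 / 4 * (hfactor x ^ 3 * (V\<^sup>2 / (hfactor x * r)\<^sup>2)))
      + (s / r * (norm (grad \<psi> x))\<^sup>2 + (\<psi> x)\<^sup>2 / r) + (3 * g x + grad g x \<bullet> x)
      = 2 / s * P + (2 * (1 + 3 * q) / (q * s\<^sup>2) * V * R + 2 * c q * V * R)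
        + V\<^sup>2 * ((1 + 3 * q)\<^sup>2 / (2 * q * s ^ 3) + 2 / s\<^sup>2 + 3 * c q + 2 * q * c' q + 8 / s ^ 3 + 1 / (2 * q * s))"
      unfolding e1 e2 e3 e6 by (simp add: algebra_simps)
    also have "\<dots> = hfactor x * P" unfolding e4 e5 hf by simp
    finally show ?thesis unfolding P_def V_def s_def q_def r_def by simp
  qed (simp add: K(3) gv z\<psi> zg)
  show "(LINT x|lborel. hfactor x * (norm (grad v x))\<^sup>2) =
      (LINT x|lborel. hfactor x ^ 3 * (v x)\<^sup>2) + 1 / 4 * (LINT x|lborel. hfactor x ^ 3 * ((v x)\<^sup>2 / (hfactor x * norm x)\<^sup>2))
      + (LINT x|lborel. (1 - (norm x)\<^sup>2) / norm x * (norm (grad \<psi> x))\<^sup>2 + (\<psi> x)\<^sup>2 / norm x)"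
    unfolding pw
    by (subst Bochner_Integration.integral_add[OF Bochner_Integration.integrable_add[OF Bochner_Integration.integrable_add[OF i2 integrable_mult_right[OF i3]] i4] i5],
        subst Bochner_Integration.integral_add[OF Bochner_Integration.integrable_add[OF i2 integrable_mult_right[OF i3]] i4],
        subst Bochner_Integration.integral_add[OF i2 integrable_mult_right[OF i3]])
      (simp only: div0 integral_mult_right_zero add_0_right)
qed

subsection \<open>Cutting off near the origin\<close>

lemma smooth_step_deriv:
  obtains D M where "\<And>t. (smooth_step has_real_derivative D t) (at t)" "0 < M" "\<And>t. \<bar>D t\<bar> \<le> M"
    "\<And>t. t \<notin> {0..1} \<Longrightarrow> D t = 0"
proof -
  define D where "D t = frechet_derivative smooth_step (at t) 1" for t
  have fd: "(smooth_step has_derivative frechet_derivative smooth_step (at t)) (at t)" for t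
    using smooth_on_differentiable[OF smooth_on_smooth_step] frechet_derivative_works by blast
  have d: "(smooth_step has_real_derivative D t) (at t)" for t
  proof -
    have "frechet_derivative smooth_step (at t) h = D t * h" for h
      using linear_scale[OF has_derivative_linear[OF fd], of t h 1] by (simp add: D_def)
    then have "frechet_derivative smooth_step (at t) = (*) (D t)" by auto
    then show ?thesis using fd[of t] by (simp add: has_field_derivative_def)
  qed
  have z: "D t = 0" if "t \<notin> {0..1}" for t
  proof (cases "t < 0")
    case True
    have "((\<lambda>_. 0) has_real_derivative 0) (at t)" by simp
    then have "(smooth_step has_real_derivative 0) (at t)"
      by (rule has_field_derivative_transform_within_open[of _ _ _ "{..<0}"]) (use True smooth_step_0 in auto)
    then show ?thesis using d DERIV_unique by blast
  next
    case False
    have "((\<lambda>_. 1) has_real_derivative 0) (at t)" by simp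
    then have "(smooth_step has_real_derivative 0) (at t)"
      by (rule has_field_derivative_transform_within_open[of _ _ _ "{1<..}"]) (use False that smooth_step_1 in auto)
    then show ?thesis using d DERIV_unique by blast
  qed
  have "continuous_on {0..1} D"
    unfolding D_def[abs_def]
    by (rule continuous_on_subset[OF smooth_on_continuous[OF smooth_on_frechet[OF smooth_on_smooth_step]]]) auto
  then obtain M where "0 < M" "\<And>t. \<bar>D t\<bar> \<le> M"
    using compact_support_bounded[of "{0..1}" D] z by auto
  then show ?thesis using that d z by blast
qed

text \<open>Written through the squared norm to stay smooth at the origin. The transition takes
  place for 1 \<le> n |x| \<le> sqrt 2.\<close>

definition eta :: "nat \<Rightarrow> 'a::euclidean_space \<Rightarrow> real" where
  "eta n x = smooth_step ((real n)\<^sup>2 * (norm x)\<^sup>2 - 1)"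

lemma eta_bounds: "0 \<le> eta n x" "eta n x \<le> 1"
  by (auto simp: eta_def smooth_step_bounds)

lemma eta_0: "norm x \<le> 1 / real n \<Longrightarrow> eta n x = 0"
proof (cases "n = 0")
  case False
  assume "norm x \<le> 1 / real n"
  then have "real n * norm x \<le> 1" using False by (simp add: field_simps)
  then have "(real n * norm x)\<^sup>2 \<le> 1" by (simp add: power_le_one)
  then show ?thesis by (simp add: eta_def power_mult_distrib smooth_step_0)
qed (simp add: eta_def smooth_step_0)

lemma smooth_on_eta: "smooth_on UNIV (eta n)"
  unfolding eta_def[abs_def]
  by (rule smooth_on_compose[OF _ _ smooth_on_smooth_step])
    (auto intro!: smooth_on_diff smooth_on_mult smooth_on_const smooth_on_norm_sq)

lemma eta_tendsto: "x \<noteq> 0 \<Longrightarrow> (\<lambda>n. eta n x) \<longlonglongrightarrow> 1"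
proof -
  assume x: "x \<noteq> 0"
  obtain N where N: "real N > 2 / norm x" using reals_Archimedean2 by blast
  have "eta n x = 1" if "n \<ge> N" for n
  proof -
    have "2 / norm x \<le> real n" using N that by linarith
    then have "2 \<le> real n * norm x" using x by (simp add: field_simps)
    then have "2\<^sup>2 \<le> (real n * norm x)\<^sup>2" by (rule power_mono) simp
    then show ?thesis by (simp add: eta_def power_mult_distrib smooth_step_1)
  qed
  then have "eventually (\<lambda>n. eta n x = 1) sequentially" by (auto simp: eventually_sequentially)
  then show ?thesis by (rule tendsto_eventually)
qed

lemma cutoff_Cc_smooth:
  assumes u: "u \<in> Cc_smooth U" "open U" "n \<ge> 1"
  shows "(\<lambda>x. eta n x * u x) \<in> Cc_smooth (U - {0})"
proof -
  obtain K where K: "compact K" "K \<subseteq> U" "\<And>x. x \<notin> K \<Longrightarrow> u x = 0" using Cc_smoothD[OF u(1)] by metis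
  show ?thesis
  proof (rule Cc_smoothI)
    show "compact (K - ball 0 (1 / real n))" using K by (simp add: compact_diff)
    show "K - ball 0 (1 / real n) \<subseteq> U - {0}" using K u(3) by auto
    show "smooth_on (U - {0}) (\<lambda>x. eta n x * u x)"
      by (intro smooth_on_mult Cc_smooth_smooth[OF u(1)] smooth_on_subset[OF _ smooth_on_eta]) (use u in \<open>auto simp: open_delete\<close>)
    show "eta n x * u x = 0" if "x \<notin> K - ball 0 (1 / real n)" for x
    proof (cases "x \<in> K")
      case True
      then have "norm x < 1 / real n" using that by simp
      then show ?thesis by (simp add: eta_0)
    qed (simp add: K)
  qed (use u in \<open>auto simp: open_delete\<close>)
qed

text \<open>A point has zero capacity in dimension three: the gradient of \<open>eta n\<close> is of
  size n on a ball of volume n^(-3), up to constants, so its squared contribution is of order 1/n.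
  The parameter \<delta> separates it from the gradient of \<open>u\<close>.\<close>

lemma cutoff_energy:
  fixes u \<omega> :: "real^3 \<Rightarrow> real"
  assumes u: "smooth_on UNIV u" and K: "compact K" "\<And>x. x \<notin> K \<Longrightarrow> u x = 0"
    and w: "continuous_on K \<omega>" "\<And>x. x \<in> K \<Longrightarrow> 0 \<le> \<omega> x"
  obtains C where "0 \<le> C" "\<And>n \<delta>. 1 \<le> n \<Longrightarrow> 0 < \<delta> \<Longrightarrow>
    (LINT x|lborel. \<omega> x * (norm (grad (\<lambda>x. eta n x * u x) x))\<^sup>2)
      \<le> (1 + \<delta>) * (LINT x|lborel. \<omega> x * (norm (grad u x))\<^sup>2) + (1 + 1 / \<delta>) * (C / real n)"
proof -
  obtain D M where D: "\<And>t. (smooth_step has_real_derivative D t) (at t)" "0 < M" "\<And>t. \<bar>D t\<bar> \<le> M"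
    "\<And>t. t \<notin> {0..1} \<Longrightarrow> D t = 0" using smooth_step_deriv by metis
  have cu: "continuous_on U u" for U using smooth_on_continuous[OF u] continuous_on_subset by blast
  have cgu: "continuous_on U (grad u)" for U using smooth_on_grad_continuous[OF u] continuous_on_subset by blast
  have gu: "grad u x = 0" if "x \<notin> K" for x
    using grad_zero_outside[OF compact_imp_closed[OF K(1)] K(2) that] .
  obtain V where V: "0 < V" "\<And>x. \<bar>u x\<bar> \<le> V" using compact_support_bounded[OF K(1) cu K(2)] by metis
  have "bounded (\<omega> ` K)" using compact_continuous_image[OF w(1) K(1)] compact_imp_bounded by blast
  then obtain W where W: "0 < W" "\<And>x. x \<in> K \<Longrightarrow> \<omega> x \<le> W" unfolding bounded_pos by (auto simp: abs_le_iff)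
  define C where "C = W * (V\<^sup>2 * (8 * M\<^sup>2)) * (8 * unit_ball_vol 3)"
  have C0: "0 \<le> C" using W V by (simp add: C_def)
  have "(LINT x|lborel. \<omega> x * (norm (grad (\<lambda>x. eta n x * u x) x))\<^sup>2)
      \<le> (1 + \<delta>) * (LINT x|lborel. \<omega> x * (norm (grad u x))\<^sup>2) + (1 + 1 / \<delta>) * (C / real n)"
    if n: "1 \<le> n" and d: "0 < \<delta>" for n \<delta>
  proof -
    define N where "N = real n"
    have N: "1 \<le> N" using n by (simp add: N_def)
    define T where "T = W * (V\<^sup>2 * (8 * M\<^sup>2 * N\<^sup>2))"
    have T0: "0 \<le> T" using W by (simp add: T_def)
    have smp: "smooth_on UNIV (\<lambda>x. eta n x * u x)" by (intro smooth_on_mult smooth_on_eta u) auto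
    have ge: "GDERIV (eta n) x :> (2 * (D (N\<^sup>2 * (norm x)\<^sup>2 - 1) * N\<^sup>2)) *\<^sub>R x" for x :: "real^3"
      unfolding eta_def[abs_def] N_def[symmetric]
      by (rule GDERIV_compose_normsq[of "\<lambda>t. smooth_step (N\<^sup>2 * t - 1)"])
        (auto intro!: derivative_eq_intros DERIV_chain2[OF D(1)])
    have gp: "grad (\<lambda>x. eta n x * u x) x = eta n x *\<^sub>R grad u x + (u x * (2 * (D (N\<^sup>2 * (norm x)\<^sup>2 - 1) * N\<^sup>2))) *\<^sub>R x" for x
      using grad_eqI[OF GDERIV_mult[OF ge[of x] GDERIV_grad[OF smooth_on_differentiable[OF u, of x]]]] by simp
    have i1: "integrable lborel (\<lambda>x. \<omega> x * (norm (grad u x))\<^sup>2)"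
      by (intro integrable_compact_support[OF K(1)] continuous_intros w cgu) (simp add: gu)
    have gpz: "grad (\<lambda>x. eta n x * u x) x = 0" if "x \<notin> K" for x
      by (simp add: gp gu K that)
    have i2: "integrable lborel (\<lambda>x. \<omega> x * (norm (grad (\<lambda>x. eta n x * u x) x))\<^sup>2)"
      by (intro integrable_compact_support[OF K(1)] continuous_intros w continuous_on_subset[OF smooth_on_grad_continuous[OF smp]])
        (simp_all add: gpz)
    have i3: "integrable lborel (indicator (cball 0 (2 / N)) :: real^3 \<Rightarrow> real)"
      using emeasure_lborel_cball_finite by (intro integrable_real_indicator) auto
    have pw: "\<omega> x * (norm (grad (\<lambda>x. eta n x * u x) x))\<^sup>2
      \<le> (1 + \<delta>) * (\<omega> x * (norm (grad u x))\<^sup>2) + (1 + 1 / \<delta>) * (T * indicator (cball 0 (2 / N)) x)" for x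
    proof (cases "x \<in> K")
      case True
      define a where "a = norm (grad u x)"
      define b where "b = \<bar>u x\<bar> * (2 * (\<bar>D (N\<^sup>2 * (norm x)\<^sup>2 - 1)\<bar> * N\<^sup>2)) * norm x"
      have ab: "0 \<le> a" "0 \<le> b" by (auto simp: a_def b_def)
      have "norm (grad (\<lambda>x. eta n x * u x) x) \<le> eta n x * a + b"
        unfolding gp a_def b_def
        by (rule order_trans[OF norm_triangle_ineq]) (simp add: abs_mult eta_bounds)
      also have "\<dots> \<le> a + b" using eta_bounds[of n x] ab by (simp add: mult_left_le_one_le)
      finally have "(norm (grad (\<lambda>x. eta n x * u x) x))\<^sup>2 \<le> (a + b)\<^sup>2" by (rule power_mono) simp
      also have "\<dots> \<le> (1 + \<delta>) * a\<^sup>2 + (1 + 1 / \<delta>) * b\<^sup>2"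
      proof -
        have "0 \<le> (\<delta> * a - b)\<^sup>2 / \<delta>" using d by simp
        also have "\<dots> = \<delta> * a\<^sup>2 - 2 * a * b + b\<^sup>2 / \<delta>" using d by (simp add: field_simps power2_eq_square)
        finally show ?thesis by (simp add: power2_eq_square algebra_simps)
      qed
      also have "b\<^sup>2 \<le> V\<^sup>2 * (8 * M\<^sup>2 * N\<^sup>2) * indicator (cball 0 (2 / N)) x"
      proof (cases "D (N\<^sup>2 * (norm x)\<^sup>2 - 1) = 0")
        case False
        then have "N\<^sup>2 * (norm x)\<^sup>2 - 1 \<in> {0..1}" using D(4) by blast
        then have nx: "N\<^sup>2 * (norm x)\<^sup>2 \<le> 2" by simp
        then have "(N * norm x)\<^sup>2 \<le> 2\<^sup>2" by (simp add: power_mult_distrib)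
        then have "N * norm x \<le> 2" using N by (subst (asm) power_mono_iff) auto
        then have "x \<in> cball 0 (2 / N)" using N by (simp add: field_simps)
        moreover have "b\<^sup>2 = (u x)\<^sup>2 * (4 * (D (N\<^sup>2 * (norm x)\<^sup>2 - 1))\<^sup>2 * N\<^sup>2 * (N\<^sup>2 * (norm x)\<^sup>2))"
          by (simp add: b_def power_mult_distrib)
        moreover have "\<dots> \<le> V\<^sup>2 * (4 * M\<^sup>2 * N\<^sup>2 * 2)"
          using V(2)[of x] D(3) nx V(1) D(2)
          by (intro mult_mono mult_nonneg_nonneg) (auto simp: abs_le_square_iff[symmetric] abs_of_pos)
        ultimately show ?thesis by (simp add: ac_simps)
      qed (use V D N in \<open>auto simp: b_def\<close>)
      finally have "(norm (grad (\<lambda>x. eta n x * u x) x))\<^sup>2 \<le> (1 + \<delta>) * a\<^sup>2 + (1 + 1 / \<delta>) * (V\<^sup>2 * (8 * M\<^sup>2 * N\<^sup>2) * indicator (cball 0 (2 / N)) x)"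
        using d by (simp add: mult_left_mono)
      then have "\<omega> x * (norm (grad (\<lambda>x. eta n x * u x) x))\<^sup>2 \<le> \<omega> x * ((1 + \<delta>) * a\<^sup>2 + (1 + 1 / \<delta>) * (V\<^sup>2 * (8 * M\<^sup>2 * N\<^sup>2) * indicator (cball 0 (2 / N)) x))"
        using w(2)[OF True] by (rule mult_left_mono)
      also have "\<dots> = (1 + \<delta>) * (\<omega> x * a\<^sup>2) + \<omega> x * ((1 + 1 / \<delta>) * (V\<^sup>2 * (8 * M\<^sup>2 * N\<^sup>2) * indicator (cball 0 (2 / N)) x))"
        by (simp add: algebra_simps)
      also have "\<omega> x * ((1 + 1 / \<delta>) * (V\<^sup>2 * (8 * M\<^sup>2 * N\<^sup>2) * indicator (cball 0 (2 / N)) x))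
        \<le> W * ((1 + 1 / \<delta>) * (V\<^sup>2 * (8 * M\<^sup>2 * N\<^sup>2) * indicator (cball 0 (2 / N)) x))"
        using W(2)[OF True] d by (intro mult_right_mono) auto
      finally show ?thesis by (simp add: T_def a_def ac_simps)
    qed (use T0 d in \<open>auto simp: gpz gu\<close>)
    have "(LINT x|lborel. \<omega> x * (norm (grad (\<lambda>x. eta n x * u x) x))\<^sup>2)
      \<le> (LINT x|lborel. (1 + \<delta>) * (\<omega> x * (norm (grad u x))\<^sup>2) + (1 + 1 / \<delta>) * (T * indicator (cball 0 (2 / N)) x))"
      by (rule integral_mono[OF i2 Bochner_Integration.integrable_add[OF integrable_mult_right[OF i1] integrable_mult_right[OF integrable_mult_right[OF i3]]] pw])
    also have "\<dots> = (1 + \<delta>) * (LINT x|lborel. \<omega> x * (norm (grad u x))\<^sup>2) + (1 + 1 / \<delta>) * (T * measure lborel (cball (0::real^3) (2 / N)))"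
      by (subst Bochner_Integration.integral_add[OF integrable_mult_right[OF i1] integrable_mult_right[OF integrable_mult_right[OF i3]]])
        (simp only: integral_mult_right_zero integral_indicator space_lborel Int_UNIV_right sets_lborel, simp)
    also have "T * measure lborel (cball (0::real^3) (2 / N)) = C / N"
      using N content_cball[of "2 / N" "0::real^3"]
      by (simp add: T_def C_def field_simps power3_eq_cube power2_eq_square)
    finally show ?thesis by (simp add: N_def)
  qed
  then show ?thesis using that C0 by blast
qed

text \<open>For integrable \<open>G\<close> the integrals with cut-off converge to the full one.
  Otherwise the integral is 0 by convention and the zero sequence serves; the sequence
  \<open>a\<close> unites the two cases.\<close>

lemma cutoff_limit:
  fixes G :: "'a::euclidean_space \<Rightarrow> real"
  assumes G: "G \<in> borel_measurable borel" "\<And>x. 0 \<le> G x" and s: "0 < s"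
  obtains a where "a \<longlonglongrightarrow> integral\<^sup>L lborel G" "\<And>n. 0 \<le> a n" "\<And>n. a n \<le> (LINT x|lborel. eta n x powr s * G x)"
proof (cases "integrable lborel G")
  case True
  have [measurable]: "(eta n :: 'a \<Rightarrow> real) \<in> borel_measurable borel" for n
    by (rule borel_measurable_continuous_onI[OF smooth_on_continuous[OF smooth_on_eta]])
  have "(\<lambda>n. LINT x|lborel. eta n x powr s * G x) \<longlonglongrightarrow> integral\<^sup>L lborel G"
  proof (rule integral_dominated_convergence[where w=G])
    show "AE x in lborel. (\<lambda>n. eta n x powr s * G x) \<longlonglongrightarrow> G x"
    proof (rule AE_mp[OF AE_lborel_singleton[of 0]], rule AE_I2, rule impI)
      fix x :: 'a assume "x \<noteq> 0"
      then have "(\<lambda>n. eta n x powr s * G x) \<longlonglongrightarrow> 1 powr s * G x"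
        by (intro tendsto_mult tendsto_powr eta_tendsto tendsto_const) auto
      then show "(\<lambda>n. eta n x powr s * G x) \<longlonglongrightarrow> G x" by simp
    qed
    show "AE x in lborel. norm (eta n x powr s * G x) \<le> G x" for n
    proof (rule AE_I2)
      fix x :: 'a
      have "eta n x powr s \<le> 1" using powr_mono2[of s "eta n x" 1] eta_bounds[of n x] s by simp
      then show "norm (eta n x powr s * G x) \<le> G x" using G(2)[of x] by (simp add: mult_left_le_one_le)
    qed
  qed (use G True in auto)
  then show ?thesis using G by (intro that[of "\<lambda>n. LINT x|lborel. eta n x powr s * G x"]) auto
next
  case False
  then show ?thesis using G by (intro that[of "\<lambda>_. 0"]) (auto simp: not_integrable_integral_eq)
qed

subsection \<open>The hyperbolic inequality centred at the origin\<close>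

text \<open>The four hyperbolic integrals centred at the origin, written over Lebesgue measure. The
  squared gradient contributes hfactor^(-2) and the volume hfactor^3; moreover sinh \<rho> = hfactor
  |x| and tanh (\<rho>/2) = |x|. Outside the ball the integrands vanish with the test
  function.\<close>

abbreviation HE :: "(real^3 \<Rightarrow> real) \<Rightarrow> real" where
  "HE v \<equiv> LINT x|lborel. hfactor x * (norm (grad v x))\<^sup>2"

abbreviation H1 :: "(real^3 \<Rightarrow> real) \<Rightarrow> real" where
  "H1 v \<equiv> LINT x|lborel. hfactor x ^ 3 * (v x)\<^sup>2"

abbreviation H2 :: "(real^3 \<Rightarrow> real) \<Rightarrow> real" where
  "H2 v \<equiv> LINT x|lborel. hfactor x ^ 3 * ((v x)\<^sup>2 / (hfactor x * norm x)\<^sup>2)"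

abbreviation HN :: "real \<Rightarrow> real \<Rightarrow> (real^3 \<Rightarrow> real) \<Rightarrow> real" where
  "HN p \<alpha> v \<equiv> LINT x|lborel. hfactor x ^ 3 * ((hfactor x * norm x) powr ((p - 6) / 2) *
      X (\<alpha> * norm x) powr ((p + 2) / 2) * \<bar>v x\<bar> powr p)"

text \<open>With s = 1 - r^2 the bracket on the right is s^(p/2) |\<psi>/v|^p for the ground state
  substitution, so the hyperbolic norm of \<open>v\<close> becomes the norm of \<psi> in
  \<open>key_inequality\<close>.\<close>

lemma hyperbolic_weight_identity:
  fixes r s e p :: real
  assumes "0 < r" "0 < s"
  shows "(2 / s) ^ 3 * (2 / s * r) powr ((p - 6) / 2) = r powr (- 3) * ((2 * r) powr (p / 2) * s powr (- (p / 2)))"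
proof -
  define u where "u = 2 * r"
  have u: "0 < u" using assms by (simp add: u_def)
  have "(2 / s) ^ 3 = 8 * s powr (- 3)"
    using assms by (simp add: powr_minus powr_numeral field_simps power3_eq_cube)
  moreover have "(2 / s * r) powr ((p - 6) / 2) = u powr ((p - 6) / 2) * s powr (- ((p - 6) / 2))"
    using assms by (simp add: u_def powr_divide powr_minus field_simps)
  moreover have "r powr (- 3) = 8 * u powr (- 3)"
    using assms by (simp add: u_def powr_minus powr_numeral field_simps power3_eq_cube)
  moreover have "s powr (- 3) * s powr (- ((p - 6) / 2)) = s powr (- (p / 2))"
    unfolding powr_add[symmetric] by (rule arg_cong2[where f="(powr)"]) (auto simp: field_simps)
  moreover have "u powr (- 3) * u powr (p / 2) = u powr ((p - 6) / 2)"
    unfolding powr_add[symmetric] by (rule arg_cong2[where f="(powr)"]) (auto simp: field_simps)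
  ultimately have "(2 / s) ^ 3 * (2 / s * r) powr ((p - 6) / 2) = 8 * (s powr (- 3) * s powr (- ((p - 6) / 2))) * u powr ((p - 6) / 2)"
    by simp
  also have "\<dots> = 8 * s powr (- (p / 2)) * (u powr (- 3) * u powr (p / 2))"
    unfolding \<open>s powr (- 3) * s powr (- ((p - 6) / 2)) = s powr (- (p / 2))\<close> \<open>u powr (- 3) * u powr (p / 2) = u powr ((p - 6) / 2)\<close> ..
  also have "\<dots> = r powr (- 3) * ((2 * r) powr (p / 2) * s powr (- (p / 2)))"
    unfolding \<open>r powr (- 3) = 8 * u powr (- 3)\<close> u_def by simp
  finally show ?thesis .
qed

lemma X_scaled_powr:
  assumes "0 < \<alpha>" "0 < r" "0 < (1 - ln \<alpha>) - ln r"
  shows "X (\<alpha> * r) powr e = ((1 - ln \<alpha>) - ln r) powr (- e)"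
  unfolding X_scaled[OF assms(1,2)] using assms(3) by (simp add: powr_divide powr_minus_divide)

lemma hyperbolic_inequality_punctured:
  assumes p: "2 < p" "p \<le> 6" and v: "v \<in> Cc_smooth pball" and \<alpha>: "0 < \<alpha>"
    and A: "64 \<le> 1 - ln \<alpha>" "27648 * (1 + measure lborel (ball (0::real^3) 1)) * S3 p \<le> 1 - ln \<alpha>"
  shows "H1 v + 1 / 4 * H2 v + S3 p * HN p \<alpha> v powr (2 / p) \<le> HE v"
proof -
  define \<psi> where "\<psi> x = sqrt (2 * norm x) / (1 - (norm x)\<^sup>2) * v x" for x
  note gs = ground_state[OF v, folded \<psi>_def]
  have "HN p \<alpha> v = (LINT x|lborel. norm x powr (- 3) * (1 - (norm x)\<^sup>2) powr (p / 2) *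
      ((1 - ln \<alpha>) - ln (norm x)) powr (- ((p + 2) / 2)) * \<bar>\<psi> x\<bar> powr p)"
  proof (rule Bochner_Integration.integral_cong[OF refl])
    fix x :: "real^3"
    show "hfactor x ^ 3 * ((hfactor x * norm x) powr ((p - 6) / 2) * X (\<alpha> * norm x) powr ((p + 2) / 2) * \<bar>v x\<bar> powr p)
      = norm x powr (- 3) * (1 - (norm x)\<^sup>2) powr (p / 2) * ((1 - ln \<alpha>) - ln (norm x)) powr (- ((p + 2) / 2)) * \<bar>\<psi> x\<bar> powr p"
    proof (cases "x \<in> pball")
      case True
      define r s where "r = norm x" and "s = 1 - r\<^sup>2"
      have r: "0 < r" "r < 1" using True by (auto simp: r_def)
      have s: "0 < s" using r by (simp add: s_def power_less_one_iff)
      have "ln r < 0" using r by simp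
      then have L: "0 < (1 - ln \<alpha>) - ln r" using A(1) by linarith
      have h: "hfactor x = 2 / s" by (simp add: hfactor_def s_def r_def)
      have "\<bar>\<psi> x\<bar> powr p = (2 * r) powr (p / 2) * s powr (- p) * \<bar>v x\<bar> powr p"
        unfolding \<psi>_def r_def[symmetric] s_def[symmetric] using r s
        by (simp add: abs_mult powr_mult powr_divide powr_half_sqrt[symmetric] powr_powr powr_minus_divide)
      then have 1: "\<bar>\<psi> x\<bar> powr p = (2 * r) powr (p / 2) * s powr (- p) * \<bar>v x\<bar> powr p" .
      have 2: "s powr (- (p / 2)) = s powr (p / 2) * s powr (- p)"
        unfolding powr_add[symmetric] by simp
      have "r powr (- 3) * s powr (p / 2) * ((1 - ln \<alpha>) - ln r) powr (- ((p + 2) / 2)) * \<bar>\<psi> x\<bar> powr p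
        = (r powr (- 3) * ((2 * r) powr (p / 2) * s powr (- (p / 2)))) * ((1 - ln \<alpha>) - ln r) powr (- ((p + 2) / 2)) * \<bar>v x\<bar> powr p"
        unfolding 1 2 by (simp only: ac_simps)
      then show ?thesis
        unfolding h r_def[symmetric] s_def[symmetric] X_scaled_powr[OF \<alpha> r(1) L] hyperbolic_weight_identity[OF r(1) s, symmetric]
        by (auto dest: sym)
    next
      case False
      then have "v x = 0" using Cc_smoothD[OF v] by (metis subsetD)
      then show ?thesis by (simp add: \<psi>_def)
    qed
  qed
  then show ?thesis
    using key_inequality[OF p gs(1) A] gs(2) by simp
qed

lemma eta_square: "(eta n x * t)\<^sup>2 = eta n x powr 2 * t\<^sup>2"
  using eta_bounds[of n x] by (cases "eta n x = 0") (auto simp: power_mult_distrib powr_numeral)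

lemma hyperbolic_inequality_origin:
  assumes p: "2 < p" "p \<le> 6" and v: "v \<in> Cc_smooth hspace" and \<alpha>: "0 < \<alpha>"
    and A: "64 \<le> 1 - ln \<alpha>" "27648 * (1 + measure lborel (ball (0::real^3) 1)) * S3 p \<le> 1 - ln \<alpha>"
  shows "H1 v + 1 / 4 * H2 v + S3 p * HN p \<alpha> v powr (2 / p) \<le> HE v"
proof -
  have sm: "smooth_on UNIV v" using v by (rule Cc_smooth_smooth)
  have cv: "continuous_on U v" for U using smooth_on_continuous[OF sm] continuous_on_subset by blast
  have vm[measurable]: "v \<in> borel_measurable borel" using cv by (rule borel_measurable_continuous_onI)
  have hm[measurable]: "hfactor \<in> borel_measurable borel" unfolding hfactor_def[abs_def] by measurable
  have Xm[measurable]: "X \<in> borel_measurable borel" unfolding X_def[abs_def] by measurable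
  obtain K where K: "compact K" "K \<subseteq> hspace" "\<And>x. x \<notin> K \<Longrightarrow> v x = 0" using Cc_smoothD[OF v] by metis
  have h: "0 < hfactor x" if "x \<in> K" for x using hfactor_pos K(2) that by blast
  have nn: "0 \<le> hfactor x ^ 3 * g x" if "0 \<le> g x" "x \<notin> K \<Longrightarrow> g x = 0" for g :: "real^3 \<Rightarrow> real" and x
    using h[of x] that by (cases "x \<in> K") auto
  have ch: "continuous_on K hfactor"
  proof -
    have "\<forall>x\<in>K. 1 - (norm x)\<^sup>2 \<noteq> 0"
    proof
      fix x assume "x \<in> K"
      then have "norm x < 1" using K(2) by auto
      then have "(norm x)\<^sup>2 < 1" by (simp add: power_less_one_iff)
      then show "1 - (norm x)\<^sup>2 \<noteq> 0" by simp
    qed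
    then show ?thesis unfolding hfactor_def[abs_def] by (intro continuous_intros)
  qed
  have h': "0 \<le> hfactor x" if "x \<in> K" for x using h[OF that] by simp
  from cutoff_energy[OF sm K(1) K(3) ch h']
  obtain C where C: "0 \<le> C" "\<And>n \<delta>. 1 \<le> n \<Longrightarrow> 0 < \<delta> \<Longrightarrow>
    HE (\<lambda>x. eta n x * v x) \<le> (1 + \<delta>) * HE v + (1 + 1 / \<delta>) * (C / real n)"
    by blast
  have Gm: "(\<lambda>x. hfactor x ^ 3 * (v x)\<^sup>2) \<in> borel_measurable borel"
    "(\<lambda>x. hfactor x ^ 3 * ((v x)\<^sup>2 / (hfactor x * norm x)\<^sup>2)) \<in> borel_measurable borel"
    "(\<lambda>x. hfactor x ^ 3 * ((hfactor x * norm x) powr ((p - 6) / 2) * X (\<alpha> * norm x) powr ((p + 2) / 2) * \<bar>v x\<bar> powr p)) \<in> borel_measurable borel"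
    by measurable
  have Gn: "0 \<le> hfactor x ^ 3 * (v x)\<^sup>2" "0 \<le> hfactor x ^ 3 * ((v x)\<^sup>2 / (hfactor x * norm x)\<^sup>2)"
    "0 \<le> hfactor x ^ 3 * ((hfactor x * norm x) powr ((p - 6) / 2) * X (\<alpha> * norm x) powr ((p + 2) / 2) * \<bar>v x\<bar> powr p)" for x
    by (rule nn; simp add: K(3))+
  obtain a1 where a1: "a1 \<longlonglongrightarrow> H1 v" "\<And>n. 0 \<le> a1 n" "\<And>n. a1 n \<le> (LINT x|lborel. eta n x powr 2 * (hfactor x ^ 3 * (v x)\<^sup>2))"
    using cutoff_limit[OF Gm(1) Gn(1), of 2] by auto
  obtain a2 where a2: "a2 \<longlonglongrightarrow> H2 v" "\<And>n. 0 \<le> a2 n" "\<And>n. a2 n \<le> (LINT x|lborel. eta n x powr 2 * (hfactor x ^ 3 * ((v x)\<^sup>2 / (hfactor x * norm x)\<^sup>2)))"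
    using cutoff_limit[OF Gm(2) Gn(2), of 2] by auto
  obtain a3 where a3: "a3 \<longlonglongrightarrow> HN p \<alpha> v" "\<And>n. 0 \<le> a3 n" "\<And>n. a3 n \<le> (LINT x|lborel. eta n x powr p * (hfactor x ^ 3 * ((hfactor x * norm x) powr ((p - 6) / 2) *
      X (\<alpha> * norm x) powr ((p + 2) / 2) * \<bar>v x\<bar> powr p)))"
    using cutoff_limit[OF Gm(3) Gn(3), of p] p by auto
  \<comment> \<open>With \<delta> = n^(-1/2) both the factor 1 + \<delta> and the error (1 +
    1/\<delta>) C / n reach their limits along one sequence.\<close>
  define t where "t n = inverse (sqrt (real n))" for n
  have t: "t \<longlonglongrightarrow> 0" unfolding t_def
    by (rule tendsto_inverse_0_at_top[OF filterlim_compose[OF sqrt_at_top filterlim_real_sequentially]])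
  have le: "a1 n + 1 / 4 * a2 n + S3 p * a3 n powr (2 / p) \<le> (1 + t n) * HE v + (C * (t n)\<^sup>2 + C * t n)" if n: "1 \<le> n" for n
  proof -
    define vn where "vn x = eta n x * v x" for x
    have vn: "vn \<in> Cc_smooth pball" unfolding vn_def[abs_def] by (rule cutoff_Cc_smooth[OF v _ n]) simp
    have "a1 n \<le> H1 vn" using a1(3)[of n] unfolding vn_def eta_square by (simp add: ac_simps)
    moreover have "a2 n \<le> H2 vn" using a2(3)[of n] unfolding vn_def eta_square by (simp add: ac_simps)
    moreover have "a3 n \<le> HN p \<alpha> vn"
    proof -
      have "\<bar>vn x\<bar> powr p = eta n x powr p * \<bar>v x\<bar> powr p" for x
        using eta_bounds[of n x] by (simp add: vn_def abs_mult powr_mult)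
      then show ?thesis using a3(3)[of n] by (simp add: ac_simps)
    qed
    then have "S3 p * a3 n powr (2 / p) \<le> S3 p * HN p \<alpha> vn powr (2 / p)"
      using a3(2) p S3_properties(1)[OF p(1)] by (intro mult_left_mono powr_mono2) auto
    moreover have "HE vn \<le> (1 + t n) * HE v + (1 + 1 / t n) * (C / real n)"
      unfolding vn_def by (rule C(2)[OF n]) (use n in \<open>simp add: t_def\<close>)
    moreover have "(1 + 1 / t n) * (C / real n) = C * (t n)\<^sup>2 + C * t n"
    proof -
      have "real n = sqrt (real n) * sqrt (real n)" by simp
      then show ?thesis using n unfolding t_def by (simp add: field_simps power2_eq_square)
    qed
    ultimately show ?thesis using hyperbolic_inequality_punctured[OF p vn \<alpha> A] by linarith
  qed
  have lim1: "(\<lambda>n. a1 n + 1 / 4 * a2 n + S3 p * a3 n powr (2 / p)) \<longlonglongrightarrow> H1 v + 1 / 4 * H2 v + S3 p * HN p \<alpha> v powr (2 / p)"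
    using a3(2) p by (intro tendsto_intros a1 a2 tendsto_powr'[OF a3(1) tendsto_const]) auto
  have "(\<lambda>n. (1 + t n) * HE v + (C * (t n)\<^sup>2 + C * t n)) \<longlonglongrightarrow> (1 + 0) * HE v + (C * 0\<^sup>2 + C * 0)"
    by (intro tendsto_intros t)
  then have lim2: "(\<lambda>n. (1 + t n) * HE v + (C * (t n)\<^sup>2 + C * t n)) \<longlonglongrightarrow> HE v" by simp
  show ?thesis
    using le by (intro LIMSEQ_le[OF lim1 lim2]) blast
qed

subsection \<open>Moving the centre by an isometric inversion\<close>

lemma integral_hvol:
  fixes F :: "real^3 \<Rightarrow> real"
  assumes "F \<in> borel_measurable (restrict_space borel hspace)"
  shows "(LINT x|hvol. F x) = (LINT x|lborel. indicator hspace x * (hfactor x ^ 3 * F x))"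
proof -
  have hm: "hfactor \<in> borel_measurable borel" unfolding hfactor_def[abs_def] by measurable
  have r: "restrict_space lborel hspace = restrict_space lborel hspace \<and> sets (restrict_space lborel hspace) = sets (restrict_space borel hspace)"
    by (simp add: sets_restrict_space)
  have m: "borel_measurable (restrict_space lborel hspace) = borel_measurable (restrict_space borel hspace)"
    by (rule measurable_cong_sets) (simp_all add: sets_restrict_space)
  have "(LINT x|hvol. F x) = (LINT x|restrict_space lborel hspace. hfactor x ^ 3 *\<^sub>R F x)"
    unfolding hvol_def
  proof (rule integral_density)
    show "F \<in> borel_measurable (restrict_space lborel hspace)" using assms m by simp
    show "(\<lambda>x. hfactor x ^ 3) \<in> borel_measurable (restrict_space lborel hspace)"
      using hm by (intro measurable_restrict_space1) auto
    show "AE x in restrict_space lborel hspace. 0 \<le> hfactor x ^ 3"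
      by (rule AE_I2) (use hfactor_pos in \<open>auto simp: space_restrict_space less_imp_le\<close>)
  qed
  also have "\<dots> = (LINT x|lborel. indicator hspace x *\<^sub>R (hfactor x ^ 3 *\<^sub>R F x))"
    by (rule integral_restrict_space) auto
  finally show ?thesis by simp
qed

lemma space_hvol: "space hvol = hspace"
  by (simp add: hvol_def space_restrict_space)

lemma hdist_continuous: "x0 \<in> hspace \<Longrightarrow> continuous_on hspace (hdist x0)"
proof -
  assume x0: "x0 \<in> hspace"
  have n: "0 < 1 - (norm x)\<^sup>2" if "x \<in> hspace" for x :: "real^3"
    using that by (simp add: power_less_one_iff)
  have "continuous_on hspace (\<lambda>x. 1 + 2 * (norm (x0 - x))\<^sup>2 / ((1 - (norm x0)\<^sup>2) * (1 - (norm x)\<^sup>2)))"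
    using n n[OF x0] by (intro continuous_intros) (auto simp: less_imp_neq[symmetric])
  moreover have "1 + 2 * (norm (x0 - x))\<^sup>2 / ((1 - (norm x0)\<^sup>2) * (1 - (norm x)\<^sup>2)) \<ge> 1" if "x \<in> hspace" for x
    using n[OF that] n[OF x0] by (simp add: divide_nonneg_pos)
  ultimately show ?thesis
    unfolding hdist_def[abs_def]
    by (intro continuous_on_compose2[OF continuous_on_arcosh[of "{1..}"]]) auto
qed

locale inversion =
  fixes a :: "real^3"
  assumes a: "a \<in> hspace" "a \<noteq> 0"
begin

text \<open>
\<open>iota\<close> is the inversion in the sphere of centre \<open>c\<close> and squared radius \<open>R2\<close>, which is orthogonal to the
  unit sphere and exchanges \<open>0\<close> and \<open>a\<close>.
\<close>

definition "R2 = 1 / (norm a)\<^sup>2 - 1"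
definition "c = (1 / (norm a)\<^sup>2) *\<^sub>R a"
definition "kap x = R2 / (norm (x - c))\<^sup>2"
definition "iota x = c + kap x *\<^sub>R (x - c)"

lemma R2_pos: "0 < R2"
  using a by (simp add: R2_def power_less_one_iff)

lemma norm_c: "(norm c)\<^sup>2 = 1 + R2"
  using a by (simp add: c_def R2_def power_divide power2_eq_square)

lemma ne_c: "x \<in> hspace \<Longrightarrow> x \<noteq> c"
proof
  assume "x \<in> hspace" "x = c"
  then have "(norm c)\<^sup>2 < 1" by (simp add: power_less_one_iff)
  then show False using norm_c R2_pos by simp
qed

lemma d_pos: "x \<in> hspace \<Longrightarrow> 0 < (norm (x - c))\<^sup>2"
  using ne_c by simp

lemma kap_pos: "x \<in> hspace \<Longrightarrow> 0 < kap x"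
  using d_pos R2_pos by (simp add: kap_def)

text \<open>The inversion stretches all lengths at \<open>x\<close> by \<open>kap x\<close>, so this
  identity is its isometry property for the hyperbolic metric, stated in
  \<open>hfactor_iota\<close>. It rests on |c|^2 = 1 + R2, the orthogonality of the two
  spheres.\<close>

lemma norm_iota: "x \<in> hspace \<Longrightarrow> 1 - (norm (iota x))\<^sup>2 = (1 - (norm x)\<^sup>2) * kap x"
proof -
  assume x: "x \<in> hspace"
  define d where "d = (norm (x - c))\<^sup>2"
  have d: "0 < d" using d_pos[OF x] by (simp add: d_def)
  have k: "kap x = R2 / d" by (simp add: kap_def d_def)
  have dx: "d = (norm x)\<^sup>2 - 2 * (c \<bullet> x) + (1 + R2)"
    unfolding d_def norm_c[symmetric] power2_norm_eq_inner by (simp add: inner_diff_left inner_diff_right inner_commute)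
  have "(norm (iota x))\<^sup>2 = (1 + R2) + 2 * (kap x * (c \<bullet> x - (1 + R2))) + (kap x)\<^sup>2 * d"
    unfolding iota_def d_def norm_c[symmetric] power2_norm_eq_inner
    by (simp add: inner_add_left inner_add_right inner_diff_left inner_diff_right inner_commute power2_eq_square algebra_simps)
  also have "c \<bullet> x - (1 + R2) = ((norm x)\<^sup>2 - (1 + R2) - d) / 2" using dx by simp
  finally have "(norm (iota x))\<^sup>2 = (1 + R2) + R2 / d * ((norm x)\<^sup>2 - (1 + R2) - d) + (R2 / d)\<^sup>2 * d" unfolding k by simp
  also have "\<dots> = 1 + R2 / d * ((norm x)\<^sup>2 - 1)" using d by (simp add: field_simps power2_eq_square)
  finally show ?thesis unfolding k by (simp add: algebra_simps)
qed

lemma iota_hspace: "x \<in> hspace \<Longrightarrow> iota x \<in> hspace"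
proof -
  assume x: "x \<in> hspace"
  have "0 < (1 - (norm x)\<^sup>2) * kap x" using x kap_pos[OF x] by (simp add: power_less_one_iff)
  then have "(norm (iota x))\<^sup>2 < 1" using norm_iota[OF x] by simp
  then show ?thesis by (simp add: power_less_one_iff abs_square_less_1)
qed

lemma iota_iota: "x \<in> hspace \<Longrightarrow> iota (iota x) = x"
proof -
  assume x: "x \<in> hspace"
  have d: "0 < (norm (x - c))\<^sup>2" using d_pos[OF x] .
  have e: "iota x - c = kap x *\<^sub>R (x - c)" by (simp add: iota_def)
  define d where "d = (norm (x - c))\<^sup>2"
  have k: "kap x = R2 / d" by (simp add: kap_def d_def)
  have "kap (iota x) = R2 / ((kap x)\<^sup>2 * d)"
    unfolding kap_def[of "iota x"] e d_def by (simp add: power_mult_distrib)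
  then have "kap (iota x) * kap x = 1"
    using d R2_pos unfolding k d_def[symmetric] by (simp add: field_simps power2_eq_square)
  then show ?thesis unfolding iota_def[of "iota x"] e by simp
qed

lemma hfactor_iota: "x \<in> hspace \<Longrightarrow> hfactor (iota x) * kap x = hfactor x"
  using kap_pos[of x] unfolding hfactor_def by (simp add: norm_iota)

text \<open>The derivative is \<open>kap x\<close> times the reflection in the plane orthogonal to
  \<open>x - c\<close>; hence its determinant is -(kap x)^3.\<close>

lemma iota_deriv:
  assumes x: "x \<in> hspace"
  shows "(iota has_derivative (\<lambda>h. kap x *\<^sub>R h + (- (2 * kap x / (norm (x - c))\<^sup>2) * ((x - c) \<bullet> h)) *\<^sub>R (x - c))) (at x)"
proof -
  have nz: "x - c \<noteq> 0" using ne_c[OF x] by simp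
  then have n: "0 < norm (x - c)" by simp
  have "((\<lambda>r. R2 / r\<^sup>2) has_real_derivative - (2 * R2 / norm (x - c) ^ 3)) (at (norm (x - c)))"
    using n by (auto intro!: derivative_eq_intros simp: field_simps eval_nat_numeral)
  from has_derivative_norm_scale[OF nz this]
  have "((\<lambda>y. (R2 / (norm y)\<^sup>2) *\<^sub>R y) has_derivative (\<lambda>h. (R2 / (norm (x - c))\<^sup>2) *\<^sub>R h + (- (2 * R2 / norm (x - c) ^ 3) / norm (x - c) * ((x - c) \<bullet> h)) *\<^sub>R (x - c))) (at (x - c))" .
  moreover have "((\<lambda>x. x - c) has_derivative (\<lambda>h. h)) (at x)" by (auto intro!: derivative_eq_intros)
  ultimately have "((\<lambda>x. (R2 / (norm (x - c))\<^sup>2) *\<^sub>R (x - c)) has_derivative (\<lambda>h. (R2 / (norm (x - c))\<^sup>2) *\<^sub>R h + (- (2 * R2 / norm (x - c) ^ 3) / norm (x - c) * ((x - c) \<bullet> h)) *\<^sub>R (x - c))) (at x)"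
    using has_derivative_compose[of "\<lambda>x. x - c" "\<lambda>h. h" x UNIV] by blast
  from has_derivative_add[OF has_derivative_const[of c] this]
  have f: "((\<lambda>x. c + (R2 / (norm (x - c))\<^sup>2) *\<^sub>R (x - c)) has_derivative (\<lambda>h. (R2 / (norm (x - c))\<^sup>2) *\<^sub>R h + (- (2 * R2 / norm (x - c) ^ 3) / norm (x - c) * ((x - c) \<bullet> h)) *\<^sub>R (x - c))) (at x)"
    by simp
  have e: "- (2 * R2 / norm (x - c) ^ 3) / norm (x - c) = - (2 * kap x / (norm (x - c))\<^sup>2)"
    using n by (simp add: kap_def field_simps eval_nat_numeral)
  show ?thesis using f[unfolded e kap_def] unfolding iota_def[abs_def] kap_def .
qed

lemma iota_det:
  assumes x: "x \<in> hspace"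
  shows "\<bar>det (matrix (\<lambda>h. kap x *\<^sub>R h + (- (2 * kap x / (norm (x - c))\<^sup>2) * ((x - c) \<bullet> h)) *\<^sub>R (x - c)))\<bar> = kap x ^ 3"
proof -
  have "kap x + - (2 * kap x / (norm (x - c))\<^sup>2) * ((x - c) \<bullet> (x - c)) = - kap x"
    using d_pos[OF x] by (simp add: power2_norm_eq_inner[symmetric])
  then show ?thesis
    unfolding det_rank_one using kap_pos[OF x] by (simp add: abs_mult power3_eq_cube power2_eq_square)
qed

lemma iota_inj: "inj_on iota hspace"
  by (rule inj_on_inverseI[where g=iota]) (simp add: iota_iota)

lemma iota_image: "iota ` hspace = hspace"
  using iota_hspace iota_iota by (metis image_subsetI imageI subsetI subset_antisym)

lemma iota_cont: "continuous_on hspace iota"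
  using iota_deriv by (meson continuous_at_imp_continuous_on has_derivative_continuous)

lemma kap_cont: "continuous_on hspace kap"
  unfolding kap_def[abs_def] using ne_c by (intro continuous_intros) auto

lemma hvol_iota:
  fixes F :: "real^3 \<Rightarrow> real"
  assumes F: "F \<in> borel_measurable (restrict_space borel hspace)"
  shows "(LINT x|hvol. F (iota x)) = (LINT x|hvol. F x)"
proof -
  define f where "f y = indicator hspace y * (hfactor y ^ 3 * F y)" for y
  have hm: "hfactor \<in> borel_measurable borel" unfolding hfactor_def[abs_def] by measurable
  have "(\<lambda>y. hfactor y ^ 3 * F y) \<in> borel_measurable (restrict_space borel hspace)"
    using F measurable_restrict_space1[OF hm] by measurable
  then have fm: "f \<in> borel_measurable borel"
    unfolding f_def by (subst (asm) borel_measurable_restrict_space_iff) auto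
  have im: "iota \<in> measurable (restrict_space borel hspace) (restrict_space borel hspace)"
    using iota_cont iota_hspace by (intro measurable_restrict_space2) (auto simp: space_restrict_space intro: borel_measurable_continuous_on_restrict)
  have "(LINT y|lborel. f y) = (LINT x|lborel. indicator hspace x * (kap x ^ 3 * f (iota x)))"
    by (rule change_of_variables_lborel(2)[OF open_ball iota_deriv iota_inj fm _ iota_det])
      (auto simp: iota_image f_def intro!: continuous_intros kap_cont)
  also have "\<dots> = (LINT x|lborel. indicator hspace x * (hfactor x ^ 3 * F (iota x)))"
  proof (rule Bochner_Integration.integral_cong[OF refl])
    fix x
    show "indicator hspace x * (kap x ^ 3 * f (iota x)) = indicator hspace x * (hfactor x ^ 3 * F (iota x))"
      using hfactor_iota[of x, symmetric] iota_hspace[of x] by (auto simp: f_def indicator_def power_mult_distrib)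
  qed
  also have "\<dots> = (LINT x|hvol. F (iota x))"
    by (rule integral_hvol[symmetric]) (rule measurable_compose[OF im F])
  finally show ?thesis using integral_hvol[OF F] by (simp add: f_def)
qed

text \<open>Equality is checked on the arguments of \<open>arcosh\<close>. Distance 0 to
  \<open>iota x\<close> depends only on 1 - |iota x|^2, which \<open>norm_iota\<close> gives in
  terms of \<open>d\<close>, and \<open>B * d\<close> differs from |a - x|^2 by (1 - B) (1 -
  |x|^2).\<close>

lemma hdist_iota: "x \<in> hspace \<Longrightarrow> hdist 0 (iota x) = hdist a x"
proof -
  assume x: "x \<in> hspace"
  define d where "d = (norm (x - c))\<^sup>2"
  define B where "B = (norm a)\<^sup>2"
  have B: "0 < B" "B < 1" using a by (auto simp: B_def power_less_one_iff)
  have d: "0 < d" using d_pos[OF x] by (simp add: d_def)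
  have n: "0 < 1 - (norm x)\<^sup>2" using x by (simp add: power_less_one_iff)
  have R: "R2 = (1 - B) / B" using B by (simp add: R2_def B_def[symmetric] field_simps)
  have k: "kap x = R2 / d" by (simp add: kap_def d_def)
  have "d = (norm x)\<^sup>2 - 2 * (c \<bullet> x) + (norm c)\<^sup>2"
    unfolding d_def power2_norm_eq_inner by (simp add: inner_diff_left inner_diff_right inner_commute)
  moreover have "c \<bullet> x = (a \<bullet> x) / B" by (simp add: c_def B_def)
  moreover have "(norm c)\<^sup>2 = 1 / B" unfolding norm_c R using B by (simp add: field_simps)
  ultimately have dd: "B * d = B * (norm x)\<^sup>2 - 2 * (a \<bullet> x) + 1"
    using B by (simp add: field_simps)
  have "(norm (a - x))\<^sup>2 = B - 2 * (a \<bullet> x) + (norm x)\<^sup>2"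
    unfolding B_def power2_norm_eq_inner by (simp add: inner_diff_left inner_diff_right inner_commute)
  then have ax: "(norm (a - x))\<^sup>2 = B * d - (1 - B) * (1 - (norm x)\<^sup>2)" unfolding dd by (simp add: algebra_simps)
  have i: "1 - (norm (iota x))\<^sup>2 = (1 - (norm x)\<^sup>2) * ((1 - B) / B / d)" using norm_iota[OF x] k R by simp
  have "(norm (iota x))\<^sup>2 / (1 - (norm (iota x))\<^sup>2) = 1 / (1 - (norm (iota x))\<^sup>2) - 1"
    using iota_hspace[OF x] by (simp add: field_simps power_less_one_iff abs_square_eq_1)
  also have "\<dots> = (norm (a - x))\<^sup>2 / ((1 - B) * (1 - (norm x)\<^sup>2))"
  proof -
    define z where "z = (1 - B) * (1 - (norm x)\<^sup>2)"
    have z: "0 < z" using n B by (simp add: z_def)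
    have "1 / (1 - (norm (iota x))\<^sup>2) = B * d / z" unfolding i using B d by (simp add: z_def)
    then show ?thesis unfolding ax z_def[symmetric] using z by (simp add: diff_divide_distrib)
  qed
  finally have "2 * (norm (iota x))\<^sup>2 / (1 - (norm (iota x))\<^sup>2) = 2 * (norm (a - x))\<^sup>2 / ((1 - B) * (1 - (norm x)\<^sup>2))"
    by (simp only: times_divide_eq_right[symmetric])
  then show ?thesis
    unfolding hdist_def by (simp add: B_def)
qed

text \<open>The pole \<open>c\<close> of the inversion lies outside the ball, where the value 0 is
  prescribed. With this convention \<open>pull\<close> is an involution on the test functions of the
  ball.\<close>

definition "pull v x = (if x \<in> hspace then v (iota x) else 0)" for v :: "real^3 \<Rightarrow> real"

lemma iota_smooth: "smooth_on hspace (\<lambda>x. iota x \<bullet> b)"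
proof -
  have 1: "smooth_on hspace (\<lambda>x. (x - c) \<bullet> b)" for b
    unfolding inner_diff_left by (intro smooth_on_diff smooth_on_inner smooth_on_const) auto
  have "smooth_on hspace (\<lambda>x. (norm (x - c))\<^sup>2)"
    by (rule smooth_on_compose_vec[OF _ open_UNIV _ smooth_on_norm_sq]) (use 1 in auto)
  then have "smooth_on hspace kap" unfolding kap_def[abs_def]
    by (intro smooth_on_divide smooth_on_const) (use ne_c in auto)
  then show ?thesis
    unfolding iota_def inner_add_left inner_scaleR_left
    by (intro smooth_on_add smooth_on_mult smooth_on_const 1) auto
qed

lemma pull_Cc: "v \<in> Cc_smooth hspace \<Longrightarrow> pull v \<in> Cc_smooth hspace"
proof -
  assume v: "v \<in> Cc_smooth hspace"
  obtain K where K: "compact K" "K \<subseteq> hspace" "\<And>x. x \<notin> K \<Longrightarrow> v x = 0" using Cc_smoothD[OF v] by metis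
  show ?thesis
  proof (rule Cc_smoothI[OF open_ball])
    show "compact (iota ` K)" using K iota_cont by (meson compact_continuous_image continuous_on_subset)
    show "iota ` K \<subseteq> hspace" using K iota_hspace by blast
    have "smooth_on hspace (\<lambda>x. v (iota x))"
      by (rule smooth_on_compose_vec[OF open_ball open_UNIV subset_UNIV Cc_smooth_smooth[OF v] iota_smooth])
    then show "smooth_on hspace (pull v)"
      by (rule smooth_on_cong[OF open_ball, rotated]) (auto simp: pull_def)
    show "pull v x = 0" if "x \<notin> iota ` K" for x
    proof (cases "x \<in> hspace")
      case True
      then have "iota x \<notin> K" using that iota_iota by (metis imageI)
      then show ?thesis using K(3) by (simp add: pull_def)
    qed (simp add: pull_def)
  qed
qed

lemma pull_pull: "v \<in> Cc_smooth hspace \<Longrightarrow> pull (pull v) = v"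
proof
  fix x assume v: "v \<in> Cc_smooth hspace"
  show "pull (pull v) x = v x"
  proof (cases "x \<in> hspace")
    case False
    then have "v x = 0" using Cc_smoothD[OF v] by (metis subsetD)
    then show ?thesis using False by (simp only: pull_def if_False)
  next
    case True
    then show ?thesis using iota_hspace[OF True] iota_iota[OF True] by (simp only: pull_def if_True)
  qed
qed

lemma pull_hgrad:
  assumes v: "v \<in> Cc_smooth hspace" and x: "x \<in> hspace"
  shows "hmetric x (hgrad (pull v) x) (hgrad (pull v) x) = hmetric (iota x) (hgrad v (iota x)) (hgrad v (iota x))"
proof -
  have dv: "v differentiable at y" for y using smooth_on_differentiable[OF Cc_smooth_smooth[OF v, of UNIV]] by auto
  define G where "G = grad v (iota x)"
  define w where "w = x - c"
  define d where "d = (norm w)\<^sup>2"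
  have d: "0 < d" "w \<bullet> w = d" using d_pos[OF x] by (auto simp: d_def w_def power2_norm_eq_inner)
  have "GDERIV (\<lambda>x. v (iota x)) x :> kap x *\<^sub>R G + (- (2 * kap x / d) * (w \<bullet> G)) *\<^sub>R w"
    unfolding G_def w_def d_def by (rule GDERIV_compose_rank_one[OF iota_deriv[OF x] dv])
  then have "GDERIV (pull v) x :> kap x *\<^sub>R G + (- (2 * kap x / d) * (w \<bullet> G)) *\<^sub>R w"
    unfolding gderiv_def
    by (rule has_derivative_transform_within_open[OF _ open_ball x]) (simp add: pull_def)
  then have g: "grad (pull v) x = kap x *\<^sub>R G + (- (2 * kap x / d) * (w \<bullet> G)) *\<^sub>R w" by (rule grad_eqI)
  have "grad (pull v) x \<bullet> grad (pull v) x = (kap x)\<^sup>2 * (G \<bullet> G)"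
  proof -
    define t where "t = - (2 * kap x / d) * (w \<bullet> G)"
    have "grad (pull v) x \<bullet> grad (pull v) x = (kap x)\<^sup>2 * (G \<bullet> G) + t * (2 * kap x * (w \<bullet> G) + t * d)"
      unfolding g t_def[symmetric]
      by (simp add: inner_add_left inner_add_right inner_commute[of G w] d(2) power2_eq_square algebra_simps)
    also have "2 * kap x * (w \<bullet> G) + t * d = 0" unfolding t_def using d by simp
    finally show ?thesis by simp
  qed
  moreover have "hmetric y (hgrad u y) (hgrad u y) = (grad u y \<bullet> grad u y) / (hfactor y)\<^sup>2" if "y \<in> hspace" for u y
    using hfactor_pos[OF that] by (simp add: hmetric_def hgrad_def field_simps power2_eq_square)
  ultimately show ?thesis
    using x iota_hspace[OF x] kap_pos[OF x] hfactor_pos[OF iota_hspace[OF x]]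
    unfolding hfactor_iota[OF x, symmetric] by (simp add: G_def power_mult_distrib hfactor_iota[OF x, symmetric])
qed

end

section \<open>Transfer of the hyperbolic integrals to the centre 0\<close>

lemma continuous_on_hfactor: "continuous_on hspace hfactor"
  unfolding hfactor_def[abs_def]
proof (intro continuous_intros ballI)
  fix x :: "real^3" assume "x \<in> hspace"
  then have "(norm x)\<^sup>2 < 1" by (simp add: power_less_one_iff)
  then show "1 - (norm x)\<^sup>2 \<noteq> 0" by simp
qed

lemma hmetric_measurable:
  assumes "v \<in> Cc_smooth hspace"
  shows "(\<lambda>x. hmetric x (hgrad v x) (hgrad v x)) \<in> borel_measurable (restrict_space borel hspace)"
  unfolding hmetric_def hgrad_def
  by (intro borel_measurable_continuous_on_restrict continuous_intros continuous_on_hfactor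
      smooth_on_grad_continuous[OF Cc_smooth_smooth[OF assms]]) (use hfactor_pos in \<open>auto simp: less_imp_neq[symmetric]\<close>)

lemma hdist_compose_measurable:
  assumes x0: "x0 \<in> hspace" and v: "v \<in> Cc_smooth hspace"
    and \<Phi>: "(\<lambda>z. \<Phi> (fst z) (snd z)) \<in> borel_measurable (borel :: (real \<times> real) measure)"
  shows "(\<lambda>x. \<Phi> (hdist x0 x) (v x) :: real) \<in> borel_measurable (restrict_space borel hspace)"
proof -
  have "(\<lambda>x. (hdist x0 x, v x)) \<in> borel_measurable (restrict_space borel hspace)"
    by (intro borel_measurable_continuous_on_restrict continuous_on_Pair hdist_continuous[OF x0]
        smooth_on_continuous[OF Cc_smooth_smooth[OF v]])
  from measurable_compose[OF this \<Phi>] show ?thesis by simp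
qed

text \<open>\<open>\<Phi>\<close> is an arbitrary measurable function of distance and value, so one
  fact moves every term of order zero. The involution property gives the transfer in both
  directions, and sharpness needs the backward one. For \<open>x0 = 0\<close>, where no inversion is
  available, \<open>T\<close> is the identity.\<close>

lemma move_to_origin:
  assumes x0: "x0 \<in> hspace"
  obtains T :: "(real^3 \<Rightarrow> real) \<Rightarrow> (real^3 \<Rightarrow> real)" where
    "\<And>v. v \<in> Cc_smooth hspace \<Longrightarrow> T v \<in> Cc_smooth hspace"
    "\<And>v. v \<in> Cc_smooth hspace \<Longrightarrow> T (T v) = v"
    "\<And>v. v \<in> Cc_smooth hspace \<Longrightarrow>
      (LINT x|hvol. hmetric x (hgrad (T v) x) (hgrad (T v) x)) = (LINT x|hvol. hmetric x (hgrad v x) (hgrad v x))"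
    "\<And>v \<Phi>. v \<in> Cc_smooth hspace \<Longrightarrow> (\<lambda>z. \<Phi> (fst z) (snd z)) \<in> borel_measurable (borel :: (real \<times> real) measure) \<Longrightarrow>
      (LINT x|hvol. \<Phi> (hdist 0 x) (T v x)) = (LINT x|hvol. \<Phi> (hdist x0 x) (v x) :: real)"
proof (cases "x0 = 0")
  case True
  then show ?thesis using that[of "\<lambda>v. v"] by simp
next
  case False
  interpret inversion x0 by (rule inversion.intro[OF x0 False])
  show ?thesis
  proof (rule that[of pull])
    fix v assume v: "v \<in> Cc_smooth hspace"
    show "pull v \<in> Cc_smooth hspace" by (rule pull_Cc[OF v])
    show "pull (pull v) = v" by (rule pull_pull[OF v])
    have "(LINT x|hvol. hmetric x (hgrad (pull v) x) (hgrad (pull v) x)) = (LINT x|hvol. hmetric (iota x) (hgrad v (iota x)) (hgrad v (iota x)))"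
      by (rule Bochner_Integration.integral_cong[OF refl]) (use pull_hgrad[OF v] in \<open>simp add: space_hvol\<close>)
    also have "\<dots> = (LINT x|hvol. hmetric x (hgrad v x) (hgrad v x))"
      by (rule hvol_iota[OF hmetric_measurable[OF v]])
    finally show "(LINT x|hvol. hmetric x (hgrad (pull v) x) (hgrad (pull v) x)) = (LINT x|hvol. hmetric x (hgrad v x) (hgrad v x))" .
  next
    fix v and \<Phi> :: "real \<Rightarrow> real \<Rightarrow> real"
    assume v: "v \<in> Cc_smooth hspace" and \<Phi>: "(\<lambda>z. \<Phi> (fst z) (snd z)) \<in> borel_measurable borel"
    have "(LINT x|hvol. \<Phi> (hdist 0 x) (pull v x)) = (LINT x|hvol. \<Phi> (hdist 0 (iota x)) (pull v (iota x)))"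
      by (rule hvol_iota[OF hdist_compose_measurable[OF _ pull_Cc[OF v] \<Phi>], symmetric]) simp
    also have "\<dots> = (LINT x|hvol. \<Phi> (hdist x0 x) (v x))"
      by (rule Bochner_Integration.integral_cong[OF refl])
        (simp only: space_hvol hdist_iota pull_def iota_hspace iota_iota if_True)
    finally show "(LINT x|hvol. \<Phi> (hdist 0 x) (pull v x)) = (LINT x|hvol. \<Phi> (hdist x0 x) (v x))" .
  qed
qed

lemma hyperbolic_integrals_origin:
  assumes v: "v \<in> Cc_smooth hspace"
  shows "(LINT x|hvol. hmetric x (hgrad v x) (hgrad v x)) = HE v"
    and "(LINT x|hvol. (v x)\<^sup>2) = H1 v"
    and "(LINT x|hvol. (v x)\<^sup>2 / (sinh (hdist 0 x))\<^sup>2) = H2 v"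
    and "0 < p \<Longrightarrow> (LINT x|hvol. sinh (hdist 0 x) powr ((p - 6) / 2) * X (\<alpha> * tanh (hdist 0 x / 2)) powr ((p + 2) / 2) * \<bar>v x\<bar> powr p) = HN p \<alpha> v"
proof -
  obtain K where K: "compact K" "K \<subseteq> hspace" "\<And>x. x \<notin> K \<Longrightarrow> v x = 0" using Cc_smoothD[OF v] by metis
  have z: "v x = 0" "grad v x = 0" if "x \<notin> hspace" for x
    using grad_zero_outside[OF compact_imp_closed[OF K(1)], of v x] K(2,3) that by blast+
  have Xm[measurable]: "X \<in> borel_measurable borel" unfolding X_def[abs_def] by measurable
  have cm[measurable]: "(\<lambda>t::real. sinh t) \<in> borel_measurable borel" "(\<lambda>t::real. tanh t) \<in> borel_measurable borel"
    "(\<lambda>t::real. tanh (t / 2)) \<in> borel_measurable borel"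
    by (auto intro!: borel_measurable_continuous_onI continuous_intros)
  have fs[measurable]: "(fst :: real \<times> real \<Rightarrow> real) \<in> borel_measurable borel" "(snd :: real \<times> real \<Rightarrow> real) \<in> borel_measurable borel"
    by (auto intro!: borel_measurable_continuous_onI continuous_intros)
  note m = hdist_compose_measurable[of 0, OF _ v]
  show "(LINT x|hvol. hmetric x (hgrad v x) (hgrad v x)) = HE v"
    unfolding integral_hvol[OF hmetric_measurable[OF v]]
  proof (rule Bochner_Integration.integral_cong[OF refl])
    fix x
    show "indicator hspace x * (hfactor x ^ 3 * hmetric x (hgrad v x) (hgrad v x)) = hfactor x * (norm (grad v x))\<^sup>2"
    proof (cases "x \<in> hspace")
      case True
      then show ?thesis using hfactor_pos[OF True]
        by (simp add: hmetric_def hgrad_def dot_square_norm field_simps eval_nat_numeral)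
    qed (simp add: z)
  qed
  have "(LINT x|hvol. (v x)\<^sup>2) = (LINT x|lborel. indicator hspace x * (hfactor x ^ 3 * (v x)\<^sup>2))"
    by (rule integral_hvol) (rule m[of "\<lambda>t s. s\<^sup>2"], simp, measurable)
  also have "\<dots> = H1 v"
    by (rule Bochner_Integration.integral_cong[OF refl]) (auto simp: indicator_def z)
  finally show "(LINT x|hvol. (v x)\<^sup>2) = H1 v" .
  have "(LINT x|hvol. (v x)\<^sup>2 / (sinh (hdist 0 x))\<^sup>2) = (LINT x|lborel. indicator hspace x * (hfactor x ^ 3 * ((v x)\<^sup>2 / (sinh (hdist 0 x))\<^sup>2)))"
    by (rule integral_hvol) (rule m[of "\<lambda>t s. s\<^sup>2 / (sinh t)\<^sup>2"], simp, measurable)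
  also have "\<dots> = H2 v"
    by (rule Bochner_Integration.integral_cong[OF refl]) (auto simp: indicator_def z sinh_hdist_0)
  finally show "(LINT x|hvol. (v x)\<^sup>2 / (sinh (hdist 0 x))\<^sup>2) = H2 v" .
  assume p: "0 < p"
  have "(LINT x|hvol. sinh (hdist 0 x) powr ((p - 6) / 2) * X (\<alpha> * tanh (hdist 0 x / 2)) powr ((p + 2) / 2) * \<bar>v x\<bar> powr p)
    = (LINT x|lborel. indicator hspace x * (hfactor x ^ 3 * (sinh (hdist 0 x) powr ((p - 6) / 2) * X (\<alpha> * tanh (hdist 0 x / 2)) powr ((p + 2) / 2) * \<bar>v x\<bar> powr p)))"
    by (rule integral_hvol) (rule m[of "\<lambda>t s. sinh t powr ((p - 6) / 2) * X (\<alpha> * tanh (t / 2)) powr ((p + 2) / 2) * \<bar>s\<bar> powr p"], simp, measurable)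
  also have "\<dots> = HN p \<alpha> v"
    by (rule Bochner_Integration.integral_cong[OF refl]) (auto simp: indicator_def z sinh_hdist_0 tanh_hdist_0)
  finally show "(LINT x|hvol. sinh (hdist 0 x) powr ((p - 6) / 2) * X (\<alpha> * tanh (hdist 0 x / 2)) powr ((p + 2) / 2) * \<bar>v x\<bar> powr p) = HN p \<alpha> v" .
qed

subsection \<open>Reflections and polarization\<close>

definition refl :: "'a::real_inner \<Rightarrow> 'a \<Rightarrow> 'a \<Rightarrow> 'a" where
  "refl m n x = x - (2 * ((x - m) \<bullet> n)) *\<^sub>R n"

lemma norm_add_unit:
  fixes v n :: "'a::real_inner"
  assumes "norm n = 1"
  shows "(norm (v + t *\<^sub>R n))\<^sup>2 = (norm v)\<^sup>2 + 2 * t * (v \<bullet> n) + t\<^sup>2"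
proof -
  have "n \<bullet> n = 1" using assms by (simp add: norm_eq_1)
  then show ?thesis
    unfolding power2_norm_eq_inner
    by (simp add: inner_add_left inner_add_right inner_commute[of n v] power2_eq_square algebra_simps)
qed

lemma refl_side: "norm n = 1 \<Longrightarrow> (refl m n x - m) \<bullet> n = - ((x - m) \<bullet> n)"
  by (simp add: refl_def inner_diff_left norm_eq_1)

lemma refl_refl: "norm n = 1 \<Longrightarrow> refl m n (refl m n x) = x"
  unfolding refl_def[of m n "refl m n x"] by (simp add: refl_side) (simp add: refl_def)

lemma dist_refl: "norm n = 1 \<Longrightarrow> norm (refl m n x - refl m n y) = norm (x - y)"
proof -
  assume n: "norm n = 1"
  have e: "refl m n x - refl m n y = (x - y) + (- (2 * ((x - y) \<bullet> n))) *\<^sub>R n"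
    by (simp add: refl_def inner_diff_left algebra_simps)
  have "(norm (refl m n x - refl m n y))\<^sup>2 = (norm (x - y))\<^sup>2"
    unfolding e norm_add_unit[OF n] by (simp add: power2_eq_square)
  then show ?thesis by (simp add: power2_eq_iff_nonneg)
qed

text \<open>The sign of the product of the two signed distances to the plane decides whether
  reflecting one point increases or decreases the distance. This is the geometric input for
  polarization.\<close>

lemma dist_refl_right:
  assumes n: "norm n = 1"
  shows "(norm (x - refl m n y))\<^sup>2 = (norm (x - y))\<^sup>2 + 4 * ((x - m) \<bullet> n) * ((y - m) \<bullet> n)"
proof -
  define s where "s = (y - m) \<bullet> n"
  have e: "x - refl m n y = (x - y) + (2 * s) *\<^sub>R n" by (simp add: refl_def s_def)
  have d: "(x - y) \<bullet> n = (x - m) \<bullet> n - s" by (simp add: s_def inner_diff_left)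
  show ?thesis
    unfolding e norm_add_unit[OF n] d s_def[symmetric] by (simp add: power2_eq_square algebra_simps)
qed

lemma norm_refl:
  assumes n: "norm n = 1"
  shows "(norm (refl m n x))\<^sup>2 = (norm x)\<^sup>2 - 4 * ((x - m) \<bullet> n) * (m \<bullet> n)"
  using dist_refl_right[OF n, of 0 m x] by simp

text \<open>The derivative of a reflection has determinant -1. Equality of the two measures is
  tested on boxes, whose indicators go through the change of variables.\<close>

lemma distr_refl:
  fixes n m :: "real^3"
  assumes n: "norm n = 1"
  shows "distr lborel borel (refl m n) = lborel"
proof -
  have der: "(refl m n has_derivative (\<lambda>h. 1 *\<^sub>R h + ((- 2) * (n \<bullet> h)) *\<^sub>R n)) (at x)" for x
    unfolding refl_def[abs_def] by (auto intro!: derivative_eq_intros simp: inner_commute)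
  have cont: "continuous_on UNIV (refl m n)"
    unfolding refl_def[abs_def] by (intro continuous_intros)
  then have ms[measurable]: "refl m n \<in> borel_measurable borel" by (rule borel_measurable_continuous_onI)
  have inj: "inj (refl m n)" using refl_refl[OF n] by (metis injI)
  have J: "\<bar>det (matrix (\<lambda>h. 1 *\<^sub>R h + ((- 2) * (n \<bullet> h)) *\<^sub>R n))\<bar> = 1"
    unfolding det_rank_one using n by (simp add: dot_square_norm)
  have surj: "y \<in> range (refl m n)" for y using refl_refl[OF n] by (metis rangeI)
  show ?thesis
  proof (rule lborel_eqI[symmetric])
    fix l u :: "real^3"
    assume lu: "\<And>b. b \<in> Basis \<Longrightarrow> l \<bullet> b \<le> u \<bullet> b"
    define f where "f = (indicator (box l u) :: real^3 \<Rightarrow> real)"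
    have fm: "f \<in> borel_measurable borel" by (simp add: f_def)
    have fi: "integrable lborel f" unfolding f_def
      using emeasure_lborel_box_finite by (intro integrable_real_indicator) auto
    have c: "integrable lborel f \<longleftrightarrow> integrable lborel (\<lambda>x. indicator UNIV x * (1 * f (refl m n x)))"
      "integral\<^sup>L lborel f = (LINT x|lborel. indicator UNIV x * (1 * f (refl m n x)))"
      by (rule change_of_variables_lborel[OF open_UNIV der inj fm _ J]; use surj in simp)+
    define B where "B = refl m n -` box l u"
    have Bm: "B \<in> sets lborel" using measurable_sets[OF ms, of "box l u"] by (simp add: B_def)
    have iB: "(indicator B :: _ \<Rightarrow> real) = (\<lambda>x. indicator UNIV x * (1 * f (refl m n x)))"
      by (auto simp: B_def f_def indicator_def)
    have "integrable lborel (indicator B :: _ \<Rightarrow> real)" using c(1) fi unfolding iB by simp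
    then have Bf: "emeasure lborel B < \<infinity>" using Bm by (simp add: integrable_indicator_iff)
    have "measure lborel B = integral\<^sup>L lborel (indicator B :: _ \<Rightarrow> real)" using Bm by simp
    also have "\<dots> = integral\<^sup>L lborel f" unfolding iB using c(2) by simp
    also have "\<dots> = (\<Prod>b\<in>Basis. (u - l) \<bullet> b)" unfolding f_def using lu by (simp add: measure_lborel_box_eq)
    finally have "emeasure lborel B = ennreal (\<Prod>b\<in>Basis. (u - l) \<bullet> b)"
      using Bf by (simp add: emeasure_eq_ennreal_measure)
    then show "emeasure (distr lborel borel (refl m n)) (box l u) = (\<Prod>b\<in>Basis. (u - l) \<bullet> b)"
      by (simp add: emeasure_distr B_def)
  qed simp
qed

lemma refl_measurable[measurable]: "refl m n \<in> borel_measurable (borel :: (real^3) measure)"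
  unfolding refl_def[abs_def] by (intro borel_measurable_continuous_onI continuous_intros)

lemma nn_integral_refl:
  fixes n m :: "real^3"
  assumes n: "norm n = 1" and f: "f \<in> borel_measurable borel"
  shows "(\<integral>\<^sup>+x. f (refl m n x) \<partial>lborel) = (\<integral>\<^sup>+x. f x \<partial>lborel)"
proof -
  have "(\<integral>\<^sup>+x. f x \<partial>lborel) = (\<integral>\<^sup>+x. f x \<partial>distr lborel borel (refl m n))"
    by (simp add: distr_refl[OF n])
  also have "\<dots> = (\<integral>\<^sup>+x. f (refl m n x) \<partial>lborel)"
    using f by (intro nn_integral_distr) auto
  finally show ?thesis by simp
qed

lemma integral_refl:
  fixes n m :: "real^3" and f :: "real^3 \<Rightarrow> real"
  assumes n: "norm n = 1" and f: "f \<in> borel_measurable borel"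
  shows "(LINT x|lborel. f (refl m n x)) = (LINT x|lborel. f x)"
    and "integrable lborel (\<lambda>x. f (refl m n x)) \<longleftrightarrow> integrable lborel f"
proof -
  have "(LINT x|lborel. f x) = (LINT x|distr lborel borel (refl m n). f x)"
    by (simp add: distr_refl[OF n])
  also have "\<dots> = (LINT x|lborel. f (refl m n x))"
    using f by (intro integral_distr) auto
  finally show "(LINT x|lborel. f (refl m n x)) = (LINT x|lborel. f x)" by simp
  show "integrable lborel (\<lambda>x. f (refl m n x)) \<longleftrightarrow> integrable lborel f"
    using integrable_distr_eq[of "refl m n" lborel borel f] f by (simp add: distr_refl[OF n])
qed

text \<open>The plane is the perpendicular bisector of \<open>a\<close> and \<open>b\<close>. The
  sign of \<open>m \<bullet> n\<close> tells which of the two is nearer to the origin; for equal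
  norms the plane passes through it.\<close>

lemma exists_refl:
  fixes a b :: "'a::real_inner"
  assumes "a \<noteq> b"
  defines "n \<equiv> (1 / norm (b - a)) *\<^sub>R (b - a)" and "m \<equiv> (1 / 2) *\<^sub>R (a + b)"
  shows "norm n = 1" "refl m n a = b" "refl m n b = a" "(a - m) \<bullet> n < 0" "m \<bullet> n = ((norm b)\<^sup>2 - (norm a)\<^sup>2) / (2 * norm (b - a))"
proof -
  define d where "d = norm (b - a)"
  have d: "0 < d" using assms(1) by (simp add: d_def)
  have dd: "(b - a) \<bullet> (b - a) = d * d" by (simp add: d_def dot_square_norm power2_eq_square)
  show n: "norm n = 1" using d by (simp add: n_def d_def[symmetric])
  have am: "a - m = - (1 / 2) *\<^sub>R (b - a)"
    unfolding m_def by (simp add: algebra_simps) (metis scaleR_half_double scaleR_add_right)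
  have s: "(a - m) \<bullet> n = - (d / 2)"
    unfolding am n_def d_def[symmetric] using dd d by simp
  show "(a - m) \<bullet> n < 0" using s d by simp
  show r: "refl m n a = b" unfolding refl_def s using d by (simp add: n_def d_def[symmetric])
  show "refl m n b = a" using refl_refl[OF n, of m a] r by simp
  show "m \<bullet> n = ((norm b)\<^sup>2 - (norm a)\<^sup>2) / (2 * norm (b - a))"
  proof -
    have "(a + b) \<bullet> (b - a) = (norm b)\<^sup>2 - (norm a)\<^sup>2"
      unfolding power2_norm_eq_inner by (simp add: inner_add_left inner_diff_right inner_commute[of a b])
    then show ?thesis unfolding m_def n_def by simp
  qed
qed

text \<open>Two-point symmetrization: of the values at two mirror points the larger one goes to the
  half-space opposite to \<open>n\<close>. That half-space contains the origin when
  \<open>0 < m \<bullet> n\<close>.\<close>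

definition polar :: "'a::real_inner \<Rightarrow> 'a \<Rightarrow> ('a \<Rightarrow> real) \<Rightarrow> 'a \<Rightarrow> real" where
  "polar m n w x = (if (x - m) \<bullet> n \<le> 0 then max (w x) (w (refl m n x)) else min (w x) (w (refl m n x)))"

text \<open>The pure squares have equal weights on both sides, so only mixed products matter. When
  the two pairs are ordered oppositely, aligning them gains 2 (K1 - K2) |a' - a| |b' - b|.\<close>

lemma four_point:
  fixes a a' b b' K1 K2 :: real
  assumes "0 \<le> K2" "K2 \<le> K1"
  shows "K1 * ((max a a' - max b b')\<^sup>2 + (min a a' - min b b')\<^sup>2) + K2 * ((max a a' - min b b')\<^sup>2 + (min a a' - max b b')\<^sup>2)
    \<le> K1 * ((a - b)\<^sup>2 + (a' - b')\<^sup>2) + K2 * ((a - b')\<^sup>2 + (a' - b)\<^sup>2)"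
proof -
  have cross: "0 \<le> (K1 - K2) * (t * u)" if "0 \<le> t" "0 \<le> u" for t u :: real
    using assms that by simp
  consider "a \<le> a' \<and> b \<le> b' \<or> a' \<le> a \<and> b' \<le> b" | "a \<le> a'" "b' \<le> b" | "a' \<le> a" "b \<le> b'" by linarith
  then show ?thesis
  proof cases
    case 1
    then show ?thesis by (auto simp: max_def min_def algebra_simps)
  next
    case 2
    then show ?thesis using cross[of "a' - a" "b - b'"]
      by (simp add: max_def min_def power2_eq_square algebra_simps)
  next
    case 3
    then show ?thesis using cross[of "a - a'" "b' - b"]
      by (simp add: max_def min_def power2_eq_square algebra_simps)
  qed
qed

text \<open>
A derivative-free substitute for the Dirichlet energy: \<open>Jh h w \<le> h\<^sup>5 K0 E\<close> for all \<open>h > 0\<close> is, for test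
  functions, equivalent to energy at most \<open>E\<close>; see \<open>Jh_le_Edir\<close> and \<open>Edir_le_of_Jh\<close>.
\<close>

definition Jh :: "real \<Rightarrow> (real^3 \<Rightarrow> real) \<Rightarrow> ennreal" where
  "Jh h w = (\<integral>\<^sup>+x. \<integral>\<^sup>+y. ennreal (of_bool (norm (x - y) < h) * (w x - w y)\<^sup>2) \<partial>lborel \<partial>lborel)"

lemma measurable_pair_kernel:
  fixes w1 w2 :: "real^3 \<Rightarrow> real" and g1 g2 :: "real^3 \<Rightarrow> real^3"
  assumes [measurable]: "w1 \<in> borel_measurable borel" "w2 \<in> borel_measurable borel" "g1 \<in> borel_measurable borel" "g2 \<in> borel_measurable borel"
  shows "(\<lambda>z. ennreal (of_bool (norm (g1 (fst z) - g2 (snd z)) < h) * (w1 (fst z) - w2 (snd z))\<^sup>2)) \<in> borel_measurable borel"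
proof -
  have [measurable]: "(fst :: (real^3) \<times> (real^3) \<Rightarrow> real^3) \<in> borel_measurable borel" "(snd :: (real^3) \<times> (real^3) \<Rightarrow> real^3) \<in> borel_measurable borel"
    by (auto intro!: borel_measurable_continuous_onI continuous_intros)
  show ?thesis by measurable
qed

text \<open>Four copies of the double integral, with none, either or both variables reflected, bring
  the values of \<open>w\<close> at x, y and their mirror images under one integral sign
  (\<open>sum4\<close>). There \<open>four_point\<close> applies with the kernels of the pairs (x,
  y) and (x, mirror of y), which change roles when x and y lie on different sides of the
  plane.\<close>

lemma Jh_polar:
  fixes w :: "real^3 \<Rightarrow> real"
  assumes n: "norm n = 1" and wm[measurable]: "w \<in> borel_measurable borel"
  shows "Jh h (polar m n w) \<le> Jh h w"
proof -
  let ?s = "refl m n"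
  define k where "k x y = (of_bool (norm (x - y) < h) :: real)" for x y :: "real^3"
  define F where "F v x y = ennreal (k x y * (v x - v y)\<^sup>2)" for v :: "real^3 \<Rightarrow> real" and x y
  have pm[measurable]: "polar m n w \<in> borel_measurable borel"
    unfolding polar_def[abs_def] by measurable
  have Fm: "(\<lambda>z. F v (fst z) (snd z)) \<in> borel_measurable borel"
    and Fm': "(\<lambda>y. F v x y) \<in> borel_measurable borel"
    if v[measurable]: "v \<in> borel_measurable borel" for v x
  proof -
    show "(\<lambda>z. F v (fst z) (snd z)) \<in> borel_measurable borel"
      using measurable_pair_kernel[OF v v measurable_ident measurable_ident] unfolding F_def k_def by simp
    show "(\<lambda>y. F v x y) \<in> borel_measurable borel" unfolding F_def k_def by measurable
  qed
  have Gm: "(\<lambda>x. \<integral>\<^sup>+y. F v x y \<partial>lborel) \<in> borel_measurable borel" if v: "v \<in> borel_measurable borel" for v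
    using borel_measurable_nn_integral_lborel[OF Fm[OF v]] by simp
  have sum4: "4 * Jh h v = (\<integral>\<^sup>+x. \<integral>\<^sup>+y. (F v x y + F v (?s x) (?s y)) + (F v x (?s y) + F v (?s x) y) \<partial>lborel \<partial>lborel)"
    if v[measurable]: "v \<in> borel_measurable borel" for v
  proof -
    have m1: "(\<lambda>y. F v x (?s y)) \<in> borel_measurable borel" for x
      by (rule measurable_compose[OF refl_measurable Fm'[OF v]])
    have inner: "(\<integral>\<^sup>+y. F v x (?s y) \<partial>lborel) = (\<integral>\<^sup>+y. F v x y \<partial>lborel)" for x
      by (rule nn_integral_refl[OF n Fm'[OF v]])
    have outer: "(\<integral>\<^sup>+x. \<integral>\<^sup>+y. F v (?s x) y \<partial>lborel \<partial>lborel) = Jh h v"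
      using nn_integral_refl[OF n Gm[OF v]] by (simp add: Jh_def F_def k_def)
    have J: "(\<integral>\<^sup>+x. \<integral>\<^sup>+y. F v x y \<partial>lborel \<partial>lborel) = Jh h v" by (simp add: Jh_def F_def k_def)
    have m2: "(\<lambda>x. \<integral>\<^sup>+y. F v (?s x) y \<partial>lborel) \<in> borel_measurable borel"
      by (rule measurable_compose[OF refl_measurable Gm[OF v]])
    have "(\<integral>\<^sup>+x. \<integral>\<^sup>+y. (F v x y + F v (?s x) (?s y)) + (F v x (?s y) + F v (?s x) y) \<partial>lborel \<partial>lborel)
      = (\<integral>\<^sup>+x. ((\<integral>\<^sup>+y. F v x y \<partial>lborel) + (\<integral>\<^sup>+y. F v (?s x) y \<partial>lborel)) + ((\<integral>\<^sup>+y. F v x y \<partial>lborel) + (\<integral>\<^sup>+y. F v (?s x) y \<partial>lborel)) \<partial>lborel)"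
    proof (rule nn_integral_cong)
      fix x
      show "(\<integral>\<^sup>+y. (F v x y + F v (?s x) (?s y)) + (F v x (?s y) + F v (?s x) y) \<partial>lborel)
        = ((\<integral>\<^sup>+y. F v x y \<partial>lborel) + (\<integral>\<^sup>+y. F v (?s x) y \<partial>lborel)) + ((\<integral>\<^sup>+y. F v x y \<partial>lborel) + (\<integral>\<^sup>+y. F v (?s x) y \<partial>lborel))"
        using Fm'[OF v] m1 by (simp add: nn_integral_add inner)
    qed
    also have "\<dots> = (Jh h v + Jh h v) + (Jh h v + Jh h v)"
      using Gm[OF v] m2 by (simp add: nn_integral_add outer J)
    also have "\<dots> = 4 * Jh h v" by (metis (no_types) add.assoc mult_2 numeral_Bit0 distrib_right)
    finally show ?thesis by simp
  qed
  have pw: "(F (polar m n w) x y + F (polar m n w) (?s x) (?s y)) + (F (polar m n w) x (?s y) + F (polar m n w) (?s x) y)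
    \<le> (F w x y + F w (?s x) (?s y)) + (F w x (?s y) + F w (?s x) y)" for x y
  proof -
    define K1 where "K1 = k x y"
    define K2 where "K2 = k x (?s y)"
    have kk: "k (?s x) (?s y) = K1" "k (?s x) y = K2"
      using dist_refl[OF n, of m x y] dist_refl[OF n, of m x "?s y"] by (simp_all add: K1_def K2_def k_def refl_refl[OF n])
    have K0: "0 \<le> K1" "0 \<le> K2" by (auto simp: K1_def K2_def k_def)
    define ux where "ux = (x - m) \<bullet> n"
    define uy where "uy = (y - m) \<bullet> n"
    have dd: "(norm (x - ?s y))\<^sup>2 = (norm (x - y))\<^sup>2 + 4 * ux * uy"
      unfolding ux_def uy_def by (rule dist_refl_right[OF n])
    have mono: "K2 \<le> K1" if "0 \<le> ux * uy"
    proof -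
      have "(norm (x - y))\<^sup>2 \<le> (norm (x - ?s y))\<^sup>2" using dd that by simp
      then have "norm (x - y) \<le> norm (x - ?s y)" by (simp add: abs_le_square_iff[symmetric])
      then show ?thesis by (auto simp: K1_def K2_def k_def)
    qed
    have mono': "K1 \<le> K2" if "ux * uy \<le> 0"
    proof -
      have "(norm (x - ?s y))\<^sup>2 \<le> (norm (x - y))\<^sup>2" using dd that by simp
      then have "norm (x - ?s y) \<le> norm (x - y)" by (simp add: abs_le_square_iff[symmetric])
      then show ?thesis by (auto simp: K1_def K2_def k_def)
    qed
    define a a' b b' where "a = w x" and "a' = w (?s x)" and "b = w y" and "b' = w (?s y)"
    have sx: "(?s x - m) \<bullet> n = - ux" "(?s y - m) \<bullet> n = - uy"
      unfolding ux_def uy_def by (rule refl_side[OF n])+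
    have px: "(polar m n w x = max a a' \<and> polar m n w (?s x) = min a a') \<or> ux = 0" if "ux \<le> 0"
      using that sx unfolding polar_def refl_refl[OF n] ux_def[symmetric] a_def a'_def by (auto simp: min.commute max.commute)
    have fixp: "?s z = z" if "(z - m) \<bullet> n = 0" for z using that by (simp add: refl_def)
    have px: "polar m n w x = (if ux \<le> 0 then max a a' else min a a')" "polar m n w (?s x) = (if ux \<le> 0 then min a a' else max a a')"
    proof -
      show "polar m n w x = (if ux \<le> 0 then max a a' else min a a')"
        by (simp add: polar_def ux_def a_def a'_def)
      show "polar m n w (?s x) = (if ux \<le> 0 then min a a' else max a a')"
        using fixp[of x] unfolding polar_def sx refl_refl[OF n] a_def a'_def ux_def
        by (auto simp: min.commute max.commute)
    qed
    have py: "polar m n w y = (if uy \<le> 0 then max b b' else min b b')" "polar m n w (?s y) = (if uy \<le> 0 then min b b' else max b b')"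
    proof -
      show "polar m n w y = (if uy \<le> 0 then max b b' else min b b')"
        by (simp add: polar_def uy_def b_def b'_def)
      show "polar m n w (?s y) = (if uy \<le> 0 then min b b' else max b b')"
        using fixp[of y] unfolding polar_def sx refl_refl[OF n] b_def b'_def uy_def
        by (auto simp: min.commute max.commute)
    qed
    have e: "(F v x y + F v (?s x) (?s y)) + (F v x (?s y) + F v (?s x) y)
      = ennreal (K1 * ((v x - v y)\<^sup>2 + (v (?s x) - v (?s y))\<^sup>2) + K2 * ((v x - v (?s y))\<^sup>2 + (v (?s x) - v y)\<^sup>2))" for v
      unfolding F_def kk K1_def[symmetric] K2_def[symmetric] using K0
      by (simp add: ennreal_plus[symmetric] distrib_left del: ennreal_plus)
    show ?thesis
    proof (cases "(ux \<le> 0) = (uy \<le> 0)")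
      case True
      then have "0 \<le> ux * uy" by (cases "ux \<le> 0") (auto simp: mult_nonpos_nonpos)
      then have K: "K2 \<le> K1" by (rule mono)
      show ?thesis unfolding e px py using four_point[OF K0(2) K, of a a' b b'] True
        unfolding a_def[symmetric] a'_def[symmetric] b_def[symmetric] b'_def[symmetric]
        by (intro ennreal_leI) (auto simp: add.commute)
    next
      case False
      then have "ux * uy \<le> 0" by (cases "ux \<le> 0") (auto simp: mult_nonpos_nonneg mult_nonneg_nonpos)
      then have K: "K1 \<le> K2" by (rule mono')
      show ?thesis unfolding e px py using four_point[OF K0(1) K, of a a' b' b] False
        unfolding a_def[symmetric] a'_def[symmetric] b_def[symmetric] b'_def[symmetric]
        by (intro ennreal_leI) (auto simp: add.commute max.commute min.commute)
    qed
  qed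
  have "4 * Jh h (polar m n w) \<le> 4 * Jh h w"
    unfolding sum4[OF pm] sum4[OF wm] by (intro nn_integral_mono pw)
  then show ?thesis by (simp add: ennreal_mult_le_mult_iff)
qed

subsection \<open>Radial competitors by compactness\<close>

lemma integral_continuous_pos:
  fixes f :: "'a::euclidean_space \<Rightarrow> real"
  assumes f: "continuous_on UNIV f" "\<And>x. 0 \<le> f x" "integrable lborel f" and x: "0 < f x"
  shows "0 < integral\<^sup>L lborel f"
proof (rule ccontr)
  assume "\<not> ?thesis"
  moreover have "0 \<le> integral\<^sup>L lborel f" using f(2) by (rule Bochner_Integration.integral_nonneg)
  ultimately have "integral\<^sup>L lborel f = 0" by simp
  then have "AE x in lborel. f x = 0"
    using integral_nonneg_eq_0_iff_AE[OF f(3)] f(2) by simp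
  moreover have "{x \<in> space lborel. f x \<noteq> 0} \<in> sets lborel"
    using borel_measurable_integrable[OF f(3)] by measurable
  ultimately have "{x. f x \<noteq> 0} \<in> null_sets lborel"
    by (subst AE_iff_null_sets) auto
  then have "negligible {x. f x \<noteq> 0}"
    by (simp add: negligible_iff_null_sets null_sets_completionI)
  moreover have "open {x. f x \<noteq> 0}"
    by (rule open_Collect_neq[OF f(1) continuous_on_const])
  ultimately show False using open_not_negligible x by force
qed

text \<open>
All conditions survive polarization and uniform limits, so a minimiser of the second moment \<open>M\<close> below exists
  in this class.
\<close>

definition adm :: "real \<Rightarrow> real \<Rightarrow> ennreal \<Rightarrow> (real \<Rightarrow> real) \<Rightarrow> real \<Rightarrow> real \<Rightarrow> (real^3 \<Rightarrow> real) \<Rightarrow> bool" where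
  "adm R L B W p N0 w \<longleftrightarrow> (\<forall>x. 0 \<le> w x) \<and> (\<forall>x y. \<bar>w x - w y\<bar> \<le> L * norm (x - y)) \<and> (\<forall>x. R < norm x \<longrightarrow> w x = 0)
    \<and> (\<forall>h>0. Jh h w \<le> ennreal (h ^ 5) * B) \<and> N0 \<le> (LINT x|lborel. W (norm x) * w x powr p)"

lemma Lipschitz_continuous:
  fixes w :: "'a::real_normed_vector \<Rightarrow> real"
  assumes "\<And>x y. \<bar>w x - w y\<bar> \<le> L * norm (x - y)"
  shows "continuous_on UNIV w"
proof -
  have "dist (w x) (w y) \<le> \<bar>L\<bar> * dist x y" for x y
    using assms[of x y] mult_right_mono[OF abs_ge_self[of L] norm_ge_zero[of "x - y"]] by (simp add: dist_norm)
  then have "\<bar>L\<bar>-lipschitz_on UNIV w" by (auto simp: lipschitz_on_def)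
  then show ?thesis by (rule lipschitz_on_continuous_on)
qed

text \<open>\<open>W\<close> will be the truncated weight max r d powr ((p - 6)/2). Its monotonicity
  makes the weighted norm grow under polarization towards the origin; its continuity at 0, hence
  boundedness, carries the norm through limits.\<close>

locale symmetrization =
  fixes R L p N0 :: real and B :: ennreal and W :: "real \<Rightarrow> real"
  assumes R: "0 \<le> R" and L: "0 \<le> L" and p: "0 < p"
    and W: "\<And>r. 0 \<le> W r" "\<And>r s. 0 \<le> r \<Longrightarrow> r \<le> s \<Longrightarrow> W s \<le> W r" "continuous_on {0..} W"
begin

abbreviation "ad \<equiv> adm R L B W p N0"

lemma adD:
  assumes "ad w"
  shows "0 \<le> w x" "\<bar>w x - w y\<bar> \<le> L * norm (x - y)" "R < norm x \<Longrightarrow> w x = 0" "0 < h \<Longrightarrow> Jh h w \<le> ennreal (h ^ 5) * B"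
    "N0 \<le> (LINT x|lborel. W (norm x) * w x powr p)" "continuous_on U w" "w \<in> borel_measurable borel"
proof -
  show "0 \<le> w x" "\<bar>w x - w y\<bar> \<le> L * norm (x - y)" "R < norm x \<Longrightarrow> w x = 0" "0 < h \<Longrightarrow> Jh h w \<le> ennreal (h ^ 5) * B"
    "N0 \<le> (LINT x|lborel. W (norm x) * w x powr p)" using assms by (auto simp: adm_def)
  have c: "continuous_on UNIV w" by (rule Lipschitz_continuous[of w L]) (use assms in \<open>auto simp: adm_def\<close>)
  then show "continuous_on U w" using continuous_on_subset by blast
  show "w \<in> borel_measurable borel" by (rule borel_measurable_continuous_onI[OF c])
qed

lemma W_norm_continuous: "continuous_on U (\<lambda>x::real^3. W (norm x))"
  by (rule continuous_on_compose2[OF W(3)]) (auto intro!: continuous_intros)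

lemma integrable_supported:
  fixes f :: "real^3 \<Rightarrow> real"
  assumes "continuous_on (cball 0 R) f" "\<And>x. R < norm x \<Longrightarrow> f x = 0"
  shows "integrable lborel f"
  by (rule integrable_compact_support[of "cball 0 R"]) (use assms in auto)

lemma cont_powr: "ad w \<Longrightarrow> continuous_on U (\<lambda>x. w x powr p)"
  using continuous_on_abs_powr[OF adD(6) p, of w U] adD(1)[of w] by simp

lemma ad_integrable:
  assumes w: "ad w"
  shows "integrable lborel (\<lambda>x. W (norm x) * w x powr p)" "integrable lborel (\<lambda>x. (norm x)\<^sup>2 * w x)"
  using adD(3)[OF w]
  by (intro integrable_supported continuous_intros W_norm_continuous cont_powr[OF w] adD(6)[OF w]; simp)+

definition "M w = (LINT x|lborel. (norm x)\<^sup>2 * w x)" for w :: "real^3 \<Rightarrow> real"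

text \<open>Grouping each point with its mirror image turns the integral comparisons for a
  polarization into pointwise ones.\<close>

lemma half_sum:
  fixes f :: "real^3 \<Rightarrow> real"
  assumes n: "norm n = 1" and f: "integrable lborel f"
  shows "integrable lborel (\<lambda>x. f x + f (refl m n x))" "2 * integral\<^sup>L lborel f = (LINT x|lborel. f x + f (refl m n x))"
proof -
  have fm: "f \<in> borel_measurable borel" using borel_measurable_integrable[OF f] by simp
  have "integrable lborel (\<lambda>x. f (refl m n x))" using integral_refl(2)[OF n fm] f by simp
  then show "integrable lborel (\<lambda>x. f x + f (refl m n x))" "2 * integral\<^sup>L lborel f = (LINT x|lborel. f x + f (refl m n x))"
    using f integral_refl(1)[OF n fm] by auto
qed

context
  fixes m n :: "real^3"
  assumes n: "norm n = 1" and mn: "0 < m \<bullet> n"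
begin

abbreviation "sg \<equiv> refl m n"
abbreviation "sd x \<equiv> (x - m) \<bullet> n"

lemma norm_sg: "sd x \<le> 0 \<Longrightarrow> norm x \<le> norm (sg x)" "0 \<le> sd x \<Longrightarrow> norm (sg x) \<le> norm x"
proof -
  show "norm x \<le> norm (sg x)" if "sd x \<le> 0"
  proof -
    have "sd x * (m \<bullet> n) \<le> 0" using that mn by (simp add: mult_nonpos_nonneg)
    moreover have "(norm (sg x))\<^sup>2 = (norm x)\<^sup>2 - 4 * (sd x * (m \<bullet> n))"
      using norm_refl[OF n, of m x] by (simp only: mult.assoc)
    ultimately have "(norm x)\<^sup>2 \<le> (norm (sg x))\<^sup>2" by linarith
    then show ?thesis by (simp add: abs_le_square_iff[symmetric])
  qed
  show "norm (sg x) \<le> norm x" if "0 \<le> sd x"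
  proof -
    have "0 \<le> sd x * (m \<bullet> n)" using that mn by simp
    moreover have "(norm (sg x))\<^sup>2 = (norm x)\<^sup>2 - 4 * (sd x * (m \<bullet> n))"
      using norm_refl[OF n, of m x] by (simp only: mult.assoc)
    ultimately have "(norm (sg x))\<^sup>2 \<le> (norm x)\<^sup>2" by linarith
    then show ?thesis by (simp add: abs_le_square_iff[symmetric])
  qed
qed

lemma polar_sg:
  "polar m n w x = (if sd x \<le> 0 then max (w x) (w (sg x)) else min (w x) (w (sg x)))"
  "polar m n w (sg x) = (if sd x \<le> 0 then min (w x) (w (sg x)) else max (w x) (w (sg x)))"
proof -
  have fixp: "sg x = x" if "sd x = 0" using that by (simp add: refl_def)
  show "polar m n w x = (if sd x \<le> 0 then max (w x) (w (sg x)) else min (w x) (w (sg x)))"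
    by (simp add: polar_def)
  show "polar m n w (sg x) = (if sd x \<le> 0 then min (w x) (w (sg x)) else max (w x) (w (sg x)))"
    using fixp unfolding polar_def refl_side[OF n] refl_refl[OF n] by (auto simp: min.commute max.commute)
qed

text \<open>On the same side of the plane, maxima and minima of two functions with one modulus keep
  it. On different sides the mirror image of y is at least as close to x as y is, so all four
  differences of values are bounded by \<open>D\<close>.\<close>

lemma polar_Lipschitz:
  assumes w: "\<And>x y. \<bar>w x - w y\<bar> \<le> L * norm (x - y)"
  shows "\<bar>polar m n w x - polar m n w y\<bar> \<le> L * norm (x - y)"
proof -
  define D where "D = L * norm (x - y)"
  have 1: "\<bar>w x - w y\<bar> \<le> D" "\<bar>w (sg x) - w (sg y)\<bar> \<le> D"
    using w[of x y] w[of "sg x" "sg y"] dist_refl[OF n, of m x y] by (auto simp: D_def)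
  have 2: "\<bar>w x - w (sg y)\<bar> \<le> D \<and> \<bar>w (sg x) - w y\<bar> \<le> D" if "sd x * sd y \<le> 0"
  proof -
    have "(norm (x - sg y))\<^sup>2 \<le> (norm (x - y))\<^sup>2" using dist_refl_right[OF n, of x m y] that by simp
    then have le: "norm (x - sg y) \<le> norm (x - y)" by (simp add: abs_le_square_iff[symmetric])
    have "norm (sg x - y) = norm (x - sg y)"
      using dist_refl[OF n, of m x "sg y"] refl_refl[OF n, of m y] by simp
    then show ?thesis
      using w[of x "sg y"] w[of "sg x" y] mult_left_mono[OF le L] by (auto simp: D_def)
  qed
  show ?thesis unfolding D_def[symmetric] polar_sg(1)[of w x] polar_sg(1)[of w y]
  proof (cases "(sd x \<le> 0) = (sd y \<le> 0)")
    case True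
    then show "\<bar>(if sd x \<le> 0 then max (w x) (w (sg x)) else min (w x) (w (sg x))) -
      (if sd y \<le> 0 then max (w y) (w (sg y)) else min (w y) (w (sg y)))\<bar> \<le> D"
      using 1 by (auto simp: max_def min_def abs_if split: if_splits)
  next
    case False
    then have "sd x * sd y \<le> 0" by (cases "sd x \<le> 0") (auto simp: mult_nonpos_nonneg mult_nonneg_nonpos)
    then show "\<bar>(if sd x \<le> 0 then max (w x) (w (sg x)) else min (w x) (w (sg x))) -
      (if sd y \<le> 0 then max (w y) (w (sg y)) else min (w y) (w (sg y)))\<bar> \<le> D"
      using 1 2 by (auto simp: max_def min_def abs_if split: if_splits)
  qed
qed

lemma ad_polar:
  assumes w: "ad w"
  shows "ad (polar m n w)"
proof -
  let ?P = "polar m n w"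
  have lip: "\<bar>?P x - ?P y\<bar> \<le> L * norm (x - y)" for x y
    by (rule polar_Lipschitz) (rule adD(2)[OF w])
  have nn: "0 \<le> ?P x" for x
    using adD(1)[OF w] by (auto simp: polar_def le_max_iff_disj)
  have sp: "?P x = 0" if "R < norm x" for x
  proof (cases "sd x \<le> 0")
    case True
    then have "R < norm (sg x)" using norm_sg(1)[of x] that by linarith
    then show ?thesis using that adD(3)[OF w] by (simp add: polar_def)
  next
    case False
    then show ?thesis using that adD(3)[OF w, of x] adD(1)[OF w, of "sg x"] by (simp add: polar_def)
  qed
  have cP: "continuous_on U ?P" for U
    using Lipschitz_continuous[of ?P L] lip continuous_on_subset by blast
  have cPp: "continuous_on U (\<lambda>x. ?P x powr p)" for U
    using continuous_on_abs_powr[OF cP p, of U] nn by simp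
  have iP: "integrable lborel (\<lambda>x. W (norm x) * ?P x powr p)"
    using sp by (intro integrable_supported continuous_intros W_norm_continuous cPp) simp
  have "2 * (LINT x|lborel. W (norm x) * w x powr p) \<le> 2 * (LINT x|lborel. W (norm x) * ?P x powr p)"
    unfolding half_sum(2)[OF n ad_integrable(1)[OF w], of m] half_sum(2)[OF n iP, of m]
  proof (rule integral_mono[OF half_sum(1)[OF n ad_integrable(1)[OF w]] half_sum(1)[OF n iP]])
    fix x
    define a a' where "a = w x" and "a' = w (sg x)"
    have a0: "0 \<le> a" "0 \<le> a'" using adD(1)[OF w] by (auto simp: a_def a'_def)
    have mono: "a powr p \<le> a' powr p" if "a \<le> a'" using that a0 p by (intro powr_mono2) auto
    have mono': "a' powr p \<le> a powr p" if "a' \<le> a" using that a0 p by (intro powr_mono2) auto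
    have W12: "W (norm (sg x)) \<le> W (norm x)" if "sd x \<le> 0" using W(2) norm_sg(1)[OF that] by simp
    have W21: "W (norm x) \<le> W (norm (sg x))" if "\<not> sd x \<le> 0" using W(2) norm_sg(2)[of x] that by simp
    \<comment> \<open>Rearrangement for two numbers: the larger value is moved to the point with the
      larger weight.\<close>
    have cross: "u * s + v * t \<le> u * t + v * s" if "v \<le> u" "s \<le> t" for u v s t :: real
    proof -
      have "0 \<le> (u - v) * (t - s)" using that by simp
      then show ?thesis by (simp add: algebra_simps)
    qed
    show "W (norm x) * w x powr p + W (norm (sg x)) * w (sg x) powr p \<le> W (norm x) * ?P x powr p + W (norm (sg x)) * ?P (sg x) powr p"
    proof (cases "sd x \<le> 0")
      case True
      then show ?thesis
        unfolding polar_sg(2)[of w x] polar_sg(1)[of w x] a_def[symmetric] a'_def[symmetric]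
        using cross[OF W12[OF True] mono] by (auto simp: max_def min_def)
    next
      case False
      then show ?thesis
        unfolding polar_sg(2)[of w x] polar_sg(1)[of w x] a_def[symmetric] a'_def[symmetric]
        using cross[OF W21[OF False] mono'] by (auto simp: max_def min_def add.commute)
    qed
  qed
  then have "N0 \<le> (LINT x|lborel. W (norm x) * ?P x powr p)" using adD(5)[OF w] by simp
  moreover have "Jh h ?P \<le> ennreal (h ^ 5) * B" if "0 < h" for h
    using Jh_polar[OF n adD(7)[OF w]] adD(4)[OF w that] order_trans by blast
  ultimately show ?thesis
    using nn lip sp by (simp add: adm_def)
qed

text \<open>Twice the drop of the second moment is the integral of the continuous nonnegative
  function \<open>D\<close>, which is positive wherever the farther of two mirror points carries the
  larger value. Continuity spreads one such point to a set of positive measure.\<close>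

lemma M_polar:
  assumes w: "ad w" and x: "sd x < 0" "w x < w (sg x)"
  shows "M (polar m n w) < M w"
proof -
  let ?P = "polar m n w"
  note P = ad_polar[OF w]
  define D where "D x = 4 * (m \<bullet> n) * (max 0 (- sd x) * max 0 (w (sg x) - w x) + max 0 (sd x) * max 0 (w x - w (sg x)))" for x
  have Deq: "((norm x)\<^sup>2 * w x + (norm (sg x))\<^sup>2 * w (sg x)) - ((norm x)\<^sup>2 * ?P x + (norm (sg x))\<^sup>2 * ?P (sg x)) = D x" for x
    unfolding D_def norm_refl[OF n] polar_sg(2)[of w x] polar_sg(1)[of w x]
    by (cases "w x \<le> w (sg x)"; cases "sd x \<le> 0") (simp_all add: max_def min_def algebra_simps)
  have csg: "continuous_on UNIV sg" unfolding refl_def[abs_def] by (intro continuous_intros)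
  have cD: "continuous_on UNIV D" unfolding D_def
    by (intro continuous_intros adD(6)[OF w] continuous_on_compose2[OF adD(6)[OF w, of UNIV] csg]) auto
  have D0: "0 \<le> D x" for x using mn by (simp add: D_def)
  have iD: "integrable lborel D"
    unfolding Deq[symmetric]
    by (rule Bochner_Integration.integrable_diff[OF half_sum(1)[OF n ad_integrable(2)[OF w]] half_sum(1)[OF n ad_integrable(2)[OF P]]])
  have "D x = 4 * (m \<bullet> n) * ((- sd x) * (w (sg x) - w x))" using x by (simp add: D_def)
  moreover have "0 < 4 * (m \<bullet> n) * ((- sd x) * (w (sg x) - w x))"
    using x mn by (intro mult_pos_pos) auto
  ultimately have "0 < D x" by simp
  then have "0 < integral\<^sup>L lborel D" by (rule integral_continuous_pos[OF cD D0 iD])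
  also have "integral\<^sup>L lborel D = 2 * M w - 2 * M ?P"
    unfolding Deq[symmetric] M_def half_sum(2)[OF n ad_integrable(2)[OF w], of m] half_sum(2)[OF n ad_integrable(2)[OF P], of m]
    by (rule Bochner_Integration.integral_diff[OF half_sum(1)[OF n ad_integrable(2)[OF w]] half_sum(1)[OF n ad_integrable(2)[OF P]]])
  finally show ?thesis by simp
qed

end

text \<open>Comparison with a point of norm R + 1, where \<open>w\<close> vanishes, at distance at
  most 2 R + 1.\<close>

lemma ad_bound: "ad w \<Longrightarrow> w x \<le> L * (2 * R + 1)"
proof (cases "norm x \<le> R")
  case True
  assume w: "ad w"
  define y :: "real^3" where "y = (R + 1) *\<^sub>R axis 1 1"
  have ny: "norm y = R + 1" using R by (simp add: y_def norm_axis_1)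
  then have "w y = 0" using adD(3)[OF w] by simp
  then have "w x \<le> L * norm (x - y)" using adD(2)[OF w, of x y] by simp
  also have "norm (x - y) \<le> 2 * R + 1" using norm_triangle_ineq4[of x y] ny True by simp
  finally show ?thesis using L by (simp add: mult_left_mono)
next
  case False
  assume w: "ad w"
  show ?thesis using adD(3)[OF w, of x] False L R by simp
qed

text \<open>Arzela-Ascoli on the ball of radius \<open>R\<close>; outside, all functions vanish. The
  bounds on \<open>Jh\<close> pass to the limit by Fatou's lemma on the product space, the weighted
  norm and the second moment by dominated convergence.\<close>

lemma ad_compact:
  assumes w: "\<And>n. ad (w n)"
  obtains v k where "strict_mono (k :: nat \<Rightarrow> nat)" "ad v" "(\<lambda>n. M (w (k n))) \<longlonglongrightarrow> M v"
proof -
  obtain g and k :: "nat \<Rightarrow> nat" where k: "strict_mono k" and g: "\<And>e. 0 < e \<Longrightarrow> \<exists>N. \<forall>n x. N \<le> n \<and> x \<in> cball 0 R \<longrightarrow> norm (w (k n) x - g x) < e"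
  proof (rule Arzela_Ascoli[of "cball 0 R" w "L * (2 * R + 1)"])
    show "norm (w n x) \<le> L * (2 * R + 1)" for n x using adD(1)[OF w] ad_bound[OF w] by simp
    fix x :: "real^3" and e :: real assume e: "0 < e"
    show "\<exists>d>0. \<forall>n y. y \<in> cball 0 R \<and> norm (x - y) < d \<longrightarrow> norm (w n x - w n y) < e"
    proof (intro exI[of _ "e / (L + 1)"] conjI allI impI)
      show "0 < e / (L + 1)" using e L by simp
      fix n y assume "y \<in> cball 0 R \<and> norm (x - y) < e / (L + 1)"
      then have "(L + 1) * norm (x - y) < e" using L by (simp add: field_simps)
      moreover have "L * norm (x - y) \<le> (L + 1) * norm (x - y)" by (simp add: mult_right_mono)
      ultimately show "norm (w n x - w n y) < e" using adD(2)[OF w, of n x y] by simp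
    qed
  qed (auto intro: that)
  define v where "v x = (if norm x \<le> R then g x else 0)" for x
  have lim: "(\<lambda>n. w (k n) x) \<longlonglongrightarrow> v x" for x
  proof (cases "norm x \<le> R")
    case True
    show ?thesis
    proof (rule LIMSEQ_I)
      fix e :: real assume "0 < e"
      from g[OF this] show "\<exists>N. \<forall>n\<ge>N. norm (w (k n) x - v x) < e" using True by (auto simp: v_def)
    qed
  next
    case False
    then show ?thesis using adD(3)[OF w, of x] by (simp add: v_def)
  qed
  have lip: "\<bar>v x - v y\<bar> \<le> L * norm (x - y)" for x y
    by (rule LIMSEQ_le_const2[OF tendsto_rabs[OF tendsto_diff[OF lim[of x] lim[of y]]]]) (use adD(2)[OF w] in auto)
  have nn: "0 \<le> v x" for x
    by (rule LIMSEQ_le_const[OF lim]) (use adD(1)[OF w] in auto)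
  have cv: "continuous_on U v" for U
    using Lipschitz_continuous[of v L] lip continuous_on_subset by blast
  have vm: "v \<in> borel_measurable borel" using cv by (rule borel_measurable_continuous_onI)
  have fin: "integrable lborel (\<lambda>x. C * indicator (cball (0::real^3) R) x :: real)" for C
    using emeasure_lborel_cball_finite[of "0::real^3" R] by (intro integrable_mult_right integrable_real_indicator) auto
  have Wm: "(\<lambda>x::real^3. W (norm x)) \<in> borel_measurable borel"
    using W_norm_continuous by (rule borel_measurable_continuous_onI)
  have J: "Jh h v \<le> ennreal (h ^ 5) * B" if h: "0 < h" for h
  proof -
    define F where "F u z = ennreal (of_bool (norm (fst z - snd z) < h) * (u (fst z) - u (snd z))\<^sup>2)" for u :: "real^3 \<Rightarrow> real" and z
    have Fm: "F u \<in> borel_measurable borel" if u: "u \<in> borel_measurable borel" for u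
      using measurable_pair_kernel[OF u u measurable_ident measurable_ident] by (simp add: F_def[abs_def])
    have JF: "Jh h u = (\<integral>\<^sup>+z. F u z \<partial>lborel)" if u: "u \<in> borel_measurable borel" for u
      unfolding nn_integral_lborel_pair(1)[OF Fm[OF u]] by (simp add: Jh_def F_def)
    have "Jh h v = (\<integral>\<^sup>+z. liminf (\<lambda>n. F (w (k n)) z) \<partial>lborel)"
      unfolding JF[OF vm]
    proof (rule nn_integral_cong)
      fix z
      have "(\<lambda>n. F (w (k n)) z) \<longlonglongrightarrow> F v z"
        unfolding F_def by (intro tendsto_ennrealI tendsto_intros lim)
      then show "F v z = liminf (\<lambda>n. F (w (k n)) z)" by (simp add: lim_imp_Liminf)
    qed
    also have "\<dots> \<le> liminf (\<lambda>n. \<integral>\<^sup>+z. F (w (k n)) z \<partial>lborel)"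
      by (rule nn_integral_liminf) (use Fm adD(7)[OF w] in simp)
    also have "\<dots> \<le> liminf (\<lambda>n::nat. ennreal (h ^ 5) * B)"
      using adD(4)[OF w h] by (intro Liminf_mono always_eventually allI) (simp add: JF[OF adD(7)[OF w], symmetric])
    also have "\<dots> = ennreal (h ^ 5) * B" by (simp add: Liminf_const)
    finally show ?thesis .
  qed
  have m: "(\<lambda>x. W (norm x) * u x powr p) \<in> borel_measurable borel" if "u \<in> borel_measurable borel" for u :: "real^3 \<Rightarrow> real"
    by (intro borel_measurable_times Wm powr_real_measurable that borel_measurable_const)
  have "(\<lambda>n. LINT x|lborel. W (norm x) * w (k n) x powr p) \<longlonglongrightarrow> (LINT x|lborel. W (norm x) * v x powr p)"
  proof (rule integral_dominated_convergence[where w="\<lambda>x. (W 0 * (L * (2 * R + 1)) powr p) * indicator (cball 0 R) x"])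
    show "AE x in lborel. (\<lambda>n. W (norm x) * w (k n) x powr p) \<longlonglongrightarrow> W (norm x) * v x powr p"
      using p adD(1)[OF w] by (intro AE_I2 tendsto_mult tendsto_const tendsto_powr'[OF lim tendsto_const]) auto
    show "AE x in lborel. norm (W (norm x) * w (k n) x powr p) \<le> (W 0 * (L * (2 * R + 1)) powr p) * indicator (cball 0 R) x" for n
    proof (rule AE_I2)
      fix x :: "real^3"
      have "w (k n) x powr p \<le> (L * (2 * R + 1)) powr p"
        using ad_bound[OF w] adD(1)[OF w] p by (intro powr_mono2) auto
      then have "W (norm x) * w (k n) x powr p \<le> W 0 * (L * (2 * R + 1)) powr p"
        using W by (intro mult_mono) auto
      then show "norm (W (norm x) * w (k n) x powr p) \<le> (W 0 * (L * (2 * R + 1)) powr p) * indicator (cball 0 R) x"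
        using W(1) adD(3)[OF w, of x] by (cases "norm x \<le> R") auto
    qed
  qed (use m[OF vm] m[OF adD(7)[OF w]] fin in auto)
  then have N: "N0 \<le> (LINT x|lborel. W (norm x) * v x powr p)"
    by (rule LIMSEQ_le_const) (use adD(5)[OF w] in auto)
  have adv: "ad v" using nn lip J N by (simp add: adm_def v_def)
  have "(\<lambda>n. M (w (k n))) \<longlonglongrightarrow> M v" unfolding M_def
  proof (rule integral_dominated_convergence[where w="\<lambda>x. (R\<^sup>2 * (L * (2 * R + 1))) * indicator (cball 0 R) x"])
    show "AE x in lborel. (\<lambda>n. (norm x)\<^sup>2 * w (k n) x) \<longlonglongrightarrow> (norm x)\<^sup>2 * v x"
      by (intro AE_I2 tendsto_intros lim)
    show "AE x in lborel. norm ((norm x)\<^sup>2 * w (k n) x) \<le> (R\<^sup>2 * (L * (2 * R + 1))) * indicator (cball 0 R) x" for n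
    proof (rule AE_I2)
      fix x :: "real^3"
      show "norm ((norm x)\<^sup>2 * w (k n) x) \<le> (R\<^sup>2 * (L * (2 * R + 1))) * indicator (cball 0 R) x"
      proof (cases "norm x \<le> R")
        case True
        then have "(norm x)\<^sup>2 * w (k n) x \<le> R\<^sup>2 * (L * (2 * R + 1))"
          using ad_bound[OF w] adD(1)[OF w] by (intro mult_mono power_mono) auto
        then show ?thesis using True adD(1)[OF w] by (simp add: abs_mult)
      qed (use adD(3)[OF w] in simp)
    qed
  qed (use vm adD(7)[OF w] fin in \<open>auto intro!: borel_measurable_times\<close>)
  then show ?thesis using that[OF k adv] by simp
qed

lemma M_nonneg: "ad w \<Longrightarrow> 0 \<le> M w"
  unfolding M_def using adD(1) by (intro Bochner_Integration.integral_nonneg) auto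

theorem radial_exists:
  assumes w0: "ad w0"
  obtains w where "ad w" "\<And>x y. norm x = norm y \<Longrightarrow> w x = w y"
proof -
  define S where "S = M ` {w. ad w}"
  have S: "S \<noteq> {}" "bdd_below S"
    using w0 M_nonneg by (auto simp: S_def intro!: bdd_belowI[of _ 0])
  have "\<exists>w. ad w \<and> M w < Inf S + 1 / real (Suc n)" for n
  proof -
    have "Inf S < Inf S + 1 / real (Suc n)" by simp
    then obtain s where "s \<in> S" "s < Inf S + 1 / real (Suc n)" using cInf_lessD[OF S(1)] by blast
    then show ?thesis by (auto simp: S_def)
  qed
  then obtain w where w: "\<And>n. ad (w n)" "\<And>n. M (w n) < Inf S + 1 / real (Suc n)" by metis
  obtain v and k :: "nat \<Rightarrow> nat" where k: "strict_mono k" and v: "ad v" and lim: "(\<lambda>n. M (w (k n))) \<longlonglongrightarrow> M v"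
    by (rule ad_compact[OF w(1)])
  have "(\<lambda>n. Inf S + 1 / real (Suc n)) \<longlonglongrightarrow> Inf S + 0"
    by (intro tendsto_add tendsto_const LIMSEQ_Suc[OF lim_1_over_n])
  from LIMSEQ_subseq_LIMSEQ[OF this k]
  have "M v \<le> Inf S + 0"
    by (rule LIMSEQ_le[OF lim]) (use w(2) less_imp_le in \<open>auto simp: o_def\<close>)
  then have min: "M v \<le> M u" if "ad u" for u
    using cInf_lower[OF _ S(2), of "M u"] that by (auto simp: S_def)
  \<comment> \<open>If the farther point carried the larger value, polarization in the bisecting
    plane would lower the second moment within the class and contradict minimality.\<close>
  have dec: "v b \<le> v a" if ab: "norm a < norm b" for a b
  proof -
    have ne: "a \<noteq> b" using ab by auto
    define n where "n = (1 / norm (b - a)) *\<^sub>R (b - a)"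
    define m where "m = (1 / 2) *\<^sub>R (a + b)"
    note r = exists_refl[OF ne, folded n_def m_def]
    have "(norm a)\<^sup>2 < (norm b)\<^sup>2" using ab by (simp add: power_strict_mono)
    then have mn: "0 < m \<bullet> n" unfolding r(5) using ne by (intro divide_pos_pos) auto
    show ?thesis
    proof (rule ccontr)
      assume "\<not> v b \<le> v a"
      then have "M (polar m n v) < M v" using M_polar[OF r(1) mn v r(4)] r(2) by simp
      then show False using min[OF ad_polar[OF r(1) mn v]] by simp
    qed
  qed
  \<comment> \<open>For equal norms the bisecting plane passes through the origin, where the strict
    decrease of the moment is lost. Instead \<open>y\<close> is compared with points slightly inside
    \<open>x\<close>, and continuity concludes.\<close>
  have le: "v y \<le> v x" if xy: "norm x = norm y" for x y
  proof (cases "x = 0")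
    case False
    have "(\<lambda>i. v ((1 - 1 / real (Suc i)) *\<^sub>R x)) \<longlonglongrightarrow> v x"
    proof -
      have "(\<lambda>i. (1 - 1 / real (Suc i)) *\<^sub>R x) \<longlonglongrightarrow> (1 - 0) *\<^sub>R x"
        by (intro tendsto_scaleR tendsto_diff tendsto_const LIMSEQ_Suc[OF lim_1_over_n])
      moreover have "isCont v x" using adD(6)[OF v, of UNIV] by (simp add: continuous_on_eq_continuous_at)
      ultimately show ?thesis using isCont_tendsto_compose by fastforce
    qed
    moreover have "v y \<le> v ((1 - 1 / real (Suc i)) *\<^sub>R x)" for i
    proof (rule dec)
      have "norm ((1 - 1 / real (Suc i)) *\<^sub>R x) = (1 - 1 / real (Suc i)) * norm x" by simp
      also have "\<dots> < 1 * norm x" using False by (intro mult_strict_right_mono) auto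
      finally show "norm ((1 - 1 / real (Suc i)) *\<^sub>R x) < norm y" using xy by simp
    qed
    ultimately show ?thesis using LIMSEQ_le_const by blast
  qed (use xy in auto)
  have "v x = v y" if "norm x = norm y" for x y
    using le[OF that] le[OF that[symmetric]] by simp
  then show ?thesis using that v by blast
qed

end

subsection \<open>Dirichlet energy and increments\<close>

lemma nn_integral_affine:
  fixes f :: "'a::euclidean_space \<Rightarrow> ennreal"
  assumes [measurable]: "f \<in> borel_measurable borel" and c: "c \<noteq> 0"
  shows "(\<integral>\<^sup>+x. f x \<partial>lborel) = ennreal (\<bar>c\<bar> ^ DIM('a)) * (\<integral>\<^sup>+x. f (t + c *\<^sub>R x) \<partial>lborel)"
  by (subst lborel_affine[OF c, of t])
    (simp add: nn_integral_density nn_integral_distr nn_integral_cmult)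

lemma nn_integral_translate:
  fixes f :: "'a::euclidean_space \<Rightarrow> ennreal"
  assumes "f \<in> borel_measurable borel"
  shows "(\<integral>\<^sup>+x. f (x + t) \<partial>lborel) = (\<integral>\<^sup>+x. f x \<partial>lborel)"
  using nn_integral_affine[OF assms, of 1 t] by (simp add: add.commute)

lemma integral_minus_arg:
  fixes f :: "'a::euclidean_space \<Rightarrow> real"
  assumes [measurable]: "f \<in> borel_measurable borel"
  shows "(LINT z|lborel. f (x - z)) = (LINT z|lborel. f z)"
proof -
  have "(LINT z|lborel. f z) = (LINT z|density (distr lborel borel (\<lambda>z. x + (- 1) *\<^sub>R z)) (\<lambda>_. 1). f z)"
    using lborel_affine[of "- 1" x] by simp
  also have "\<dots> = (LINT z|lborel. f (x - z))"
    by (simp add: density_1 integral_distr)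
  finally show ?thesis by simp
qed

lemma fst_snd_borel:
  "(fst :: 'a::euclidean_space \<times> 'b::euclidean_space \<Rightarrow> 'a) \<in> borel_measurable borel"
  "(snd :: 'a::euclidean_space \<times> 'b::euclidean_space \<Rightarrow> 'b) \<in> borel_measurable borel"
  by (auto intro!: borel_measurable_continuous_onI continuous_intros)

lemma nn_integral_swap:
  fixes F :: "'a::euclidean_space \<Rightarrow> 'b::euclidean_space \<Rightarrow> ennreal"
  assumes "(\<lambda>z. F (fst z) (snd z)) \<in> borel_measurable borel"
  shows "(\<integral>\<^sup>+x. \<integral>\<^sup>+y. F x y \<partial>lborel \<partial>lborel) = (\<integral>\<^sup>+y. \<integral>\<^sup>+x. F x y \<partial>lborel \<partial>lborel)"
  using nn_integral_lborel_pair[OF assms] by simp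

text \<open>The second moment of the unit ball in one direction. It enters through finiteness and
  positivity, which allow it to cancel.\<close>

definition K0 :: ennreal where
  "K0 = (\<integral>\<^sup>+z. ennreal (of_bool (norm z < 1) * (z \<bullet> (axis 1 1 :: real^3))\<^sup>2) \<partial>lborel)"

text \<open>Rotation invariance, obtained from the reflection that exchanges the direction of
  \<open>g\<close> with the first axis. That plane passes through the origin, so norms are
  preserved.\<close>

lemma K0_vec: "(\<integral>\<^sup>+z. ennreal (of_bool (norm z < 1) * (z \<bullet> g)\<^sup>2) \<partial>lborel) = K0 * ennreal ((norm g)\<^sup>2)" for g :: "real^3"
proof (cases "g = 0")
  case False
  define e1 :: "real^3" where "e1 = axis 1 1"
  define e where "e = (1 / norm g) *\<^sub>R g"
  have ne: "norm e = 1" "norm e1 = 1" using False by (auto simp: e_def e1_def norm_axis_1)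
  have unit: "(\<integral>\<^sup>+z. ennreal (of_bool (norm z < 1) * (z \<bullet> e)\<^sup>2) \<partial>lborel) = K0"
  proof (cases "e = e1")
    case True then show ?thesis by (simp add: K0_def e1_def)
  next
    case ne1: False
    define n where "n = (1 / norm (e1 - e)) *\<^sub>R (e1 - e)"
    define m where "m = (1 / 2) *\<^sub>R (e + e1)"
    note r = exists_refl[OF ne1, folded n_def m_def]
    have mn: "m \<bullet> n = 0" using r(5) ne by simp
    have nr: "norm (refl m n z) = norm z" for z
      using norm_refl[OF r(1), of m z] mn by (simp add: power2_eq_iff_nonneg)
    have ir: "refl m n z \<bullet> e1 = z \<bullet> e" for z
    proof -
      have ip: "2 * (a \<bullet> b) = (norm a)\<^sup>2 + (norm b)\<^sup>2 - (norm (a - b))\<^sup>2" for a b :: "real^3"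
        unfolding power2_norm_eq_inner by (simp add: inner_diff_left inner_diff_right inner_commute)
      have "2 * (refl m n z \<bullet> e1) = 2 * (z \<bullet> e)"
        unfolding ip using dist_refl[OF r(1), of m z e] r(2) nr ne by simp
      then show ?thesis by simp
    qed
    have "K0 = (\<integral>\<^sup>+z. ennreal (of_bool (norm (refl m n z) < 1) * (refl m n z \<bullet> e1)\<^sup>2) \<partial>lborel)"
      unfolding K0_def e1_def[symmetric] by (rule nn_integral_refl[OF r(1), symmetric]) measurable
    then show ?thesis unfolding nr ir by simp
  qed
  have "g = norm g *\<^sub>R e" using False by (simp add: e_def)
  then have "(z \<bullet> g)\<^sup>2 = (z \<bullet> e)\<^sup>2 * (norm g)\<^sup>2" for z
    by (metis inner_scaleR_right mult.commute power_mult_distrib)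
  then have "(\<integral>\<^sup>+z. ennreal (of_bool (norm z < 1) * (z \<bullet> g)\<^sup>2) \<partial>lborel)
    = (\<integral>\<^sup>+z. ennreal (of_bool (norm z < 1) * (z \<bullet> e)\<^sup>2) * ennreal ((norm g)\<^sup>2) \<partial>lborel)"
    by (simp add: ennreal_mult[symmetric] mult.assoc)
  also have "\<dots> = K0 * ennreal ((norm g)\<^sup>2)" unfolding unit[symmetric] by (rule nn_integral_multc) measurable
  finally show ?thesis .
qed simp

lemma K0_finite: "K0 < \<infinity>"
proof -
  have "K0 \<le> (\<integral>\<^sup>+z. indicator (ball (0::real^3) 1) z \<partial>lborel)"
    unfolding K0_def
  proof (rule nn_integral_mono)
    fix z :: "real^3"
    have "\<bar>z \<bullet> axis 1 1\<bar> \<le> norm z" using Cauchy_Schwarz_ineq2[of z "axis 1 1"] by (simp add: norm_axis_1)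
    then have "(z \<bullet> axis 1 1)\<^sup>2 \<le> 1" if "norm z < 1" using that by (simp add: abs_square_le_1)
    then show "ennreal (of_bool (norm z < 1) * (z \<bullet> axis 1 1)\<^sup>2) \<le> indicator (ball 0 1) z"
      by (auto simp: indicator_def ennreal_le_1)
  qed
  also have "\<dots> < \<infinity>" using emeasure_lborel_ball_finite[of "0::real^3" 1] by simp
  finally show ?thesis .
qed

lemma K0_pos: "K0 \<noteq> 0"
proof
  assume "K0 = 0"
  then have "AE z in lborel. ennreal (of_bool (norm z < 1) * (z \<bullet> (axis 1 1 :: real^3))\<^sup>2) = 0"
    unfolding K0_def by (subst (asm) nn_integral_0_iff_AE) measurable
  then have "AE z in lborel. z \<notin> {z :: real^3. norm z < 1 \<and> z \<bullet> axis 1 1 \<noteq> 0}"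
    by eventually_elim (auto split: if_splits)
  moreover have o: "open {z :: real^3. norm z < 1 \<and> z \<bullet> axis 1 1 \<noteq> 0}"
    by (intro open_Collect_conj open_Collect_less open_Collect_neq continuous_intros)
  ultimately have "{z :: real^3. norm z < 1 \<and> z \<bullet> axis 1 1 \<noteq> 0} \<in> null_sets lborel"
    by (subst AE_iff_null_sets) auto
  then have "negligible {z :: real^3. norm z < 1 \<and> z \<bullet> axis 1 1 \<noteq> 0}"
    by (simp add: negligible_iff_null_sets null_sets_completionI)
  moreover have "(1 / 2) *\<^sub>R axis 1 1 \<in> {z :: real^3. norm z < 1 \<and> z \<bullet> axis 1 1 \<noteq> 0}"
    by (simp add: norm_axis_1 dot_square_norm)
  ultimately show False using open_not_negligible[OF o] by blast
qed

text \<open>Substituting y = x + h z gives h^3 from the volume. The squared increment is of order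
  h^2, hence the power h^5 with which \<open>Jh\<close> is compared.\<close>

lemma Jh_scaled:
  fixes w :: "real^3 \<Rightarrow> real"
  assumes h: "0 < h" and w[measurable]: "w \<in> borel_measurable borel"
  shows "Jh h w = ennreal (h ^ 3) * (\<integral>\<^sup>+x. \<integral>\<^sup>+z. ennreal (of_bool (norm z < 1) * (w (x + h *\<^sub>R z) - w x)\<^sup>2) \<partial>lborel \<partial>lborel)"
proof -
  have "(\<integral>\<^sup>+y. ennreal (of_bool (norm (x - y) < h) * (w x - w y)\<^sup>2) \<partial>lborel)
    = ennreal (h ^ 3) * (\<integral>\<^sup>+z. ennreal (of_bool (norm z < 1) * (w (x + h *\<^sub>R z) - w x)\<^sup>2) \<partial>lborel)" for x
  proof -
    have "(\<integral>\<^sup>+y. ennreal (of_bool (norm (x - y) < h) * (w x - w y)\<^sup>2) \<partial>lborel)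
      = ennreal (\<bar>h\<bar> ^ DIM(real^3)) * (\<integral>\<^sup>+z. ennreal (of_bool (norm (x - (x + h *\<^sub>R z)) < h) * (w x - w (x + h *\<^sub>R z))\<^sup>2) \<partial>lborel)"
      by (rule nn_integral_affine) (use h in auto)
    moreover have "norm (x - (x + h *\<^sub>R z)) < h \<longleftrightarrow> norm z < 1" for z using h by simp
    ultimately show ?thesis using h by (simp add: power2_commute)
  qed
  moreover have "(\<lambda>x. \<integral>\<^sup>+z. ennreal (of_bool (norm z < 1) * (w (x + h *\<^sub>R z) - w x)\<^sup>2) \<partial>lborel) \<in> borel_measurable borel"
  proof -
    note fst_snd_borel[measurable]
    have "(\<lambda>z. ennreal (of_bool (norm (snd z) < 1) * (w (fst z + h *\<^sub>R snd z) - w (fst z))\<^sup>2)) \<in> borel_measurable borel"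
      by measurable
    from borel_measurable_nn_integral_lborel[OF this] show ?thesis by simp
  qed
  ultimately show ?thesis unfolding Jh_def by (simp add: nn_integral_cmult)
qed

text \<open>The fundamental theorem along the segment followed by Cauchy-Schwarz on [0, 1]. The
  indicator is written twice so that one copy plays the role of the constant function 1.\<close>

lemma increment_bound:
  fixes u :: "real^3 \<Rightarrow> real"
  assumes u: "smooth_on UNIV u"
  shows "ennreal ((u (x + h) - u x)\<^sup>2) \<le> (\<integral>\<^sup>+s. indicator {0..1} s * ennreal ((h \<bullet> grad u (x + s *\<^sub>R h))\<^sup>2) \<partial>lborel)"
proof -
  define d where "d s = grad u (x + s *\<^sub>R h) \<bullet> h" for s
  have cg: "continuous_on UNIV (grad u)" using smooth_on_grad_continuous[OF u] .
  have cd: "continuous_on V d" for V unfolding d_def by (intro continuous_intros continuous_on_compose2[OF cg]) auto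
  have dm[measurable]: "d \<in> borel_measurable borel" using cd by (rule borel_measurable_continuous_onI)
  have i: "integrable lborel (\<lambda>s. indicator {0..1} s *\<^sub>R d s)"
    using cd by (intro borel_integrable_compact) auto
  have "integral\<^sup>L lborel (\<lambda>s. indicator {0..1} s *\<^sub>R d s) = u (x + 1 *\<^sub>R h) - u (x + 0 *\<^sub>R h)"
  proof (rule integral_FTC_Icc)
    show "((\<lambda>s. u (x + s *\<^sub>R h)) has_vector_derivative d s) (at s within {0..1})" for s
      using DERIV_line[OF smooth_on_differentiable[OF u], of x s h "{0..1}"]
      by (simp add: d_def has_real_derivative_iff_has_vector_derivative)
  qed (use cd in auto)
  then have "ennreal \<bar>u (x + h) - u x\<bar> = ennreal (norm (integral\<^sup>L lborel (\<lambda>s. indicator {0..1} s *\<^sub>R d s)))" by simp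
  also have "\<dots> \<le> (\<integral>\<^sup>+s. ennreal (norm (indicator {0..1} s *\<^sub>R d s)) \<partial>lborel)"
    by (rule integral_norm_bound_ennreal[OF i])
  also have "\<dots> = (\<integral>\<^sup>+s. indicator {0..1} s * (indicator {0..1} s * ennreal \<bar>d s\<bar>) \<partial>lborel)"
    by (intro nn_integral_cong) (auto simp: indicator_def)
  finally have "(ennreal \<bar>u (x + h) - u x\<bar>)\<^sup>2 \<le> (\<integral>\<^sup>+s. indicator {0..1} s * (indicator {0..1} s * ennreal \<bar>d s\<bar>) \<partial>lborel)\<^sup>2"
    by (rule power_mono) simp
  also have "\<dots> \<le> (\<integral>\<^sup>+s. (indicator {0..1::real} s)\<^sup>2 \<partial>lborel) * (\<integral>\<^sup>+s. (indicator {0..1} s * ennreal \<bar>d s\<bar>)\<^sup>2 \<partial>lborel)"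
    by (rule Cauchy_Schwarz_nn_integral) measurable
  also have "(\<integral>\<^sup>+s. (indicator {0..1::real} s)\<^sup>2 \<partial>lborel) = (\<integral>\<^sup>+s. indicator {0..1::real} s \<partial>lborel)"
    by (intro nn_integral_cong) (auto simp: indicator_def)
  also have "\<dots> = 1" by simp
  also have "(\<integral>\<^sup>+s. (indicator {0..1} s * ennreal \<bar>d s\<bar>)\<^sup>2 \<partial>lborel) = (\<integral>\<^sup>+s. indicator {0..1} s * ennreal ((h \<bullet> grad u (x + s *\<^sub>R h))\<^sup>2) \<partial>lborel)"
    by (intro nn_integral_cong) (auto simp: indicator_def ennreal_power d_def inner_commute)
  finally show ?thesis by (simp add: ennreal_power)
qed

lemma nn_Edir:
  fixes u :: "real^3 \<Rightarrow> real"
  assumes u: "u \<in> Cc_smooth UNIV"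
  shows "(\<integral>\<^sup>+x. ennreal ((norm (grad u x))\<^sup>2) \<partial>lborel) = ennreal (Edir u)"
proof (rule nn_integral_eq_integral)
  obtain K where K: "compact K" "\<And>x. x \<notin> K \<Longrightarrow> u x = 0" using Cc_smoothD[OF u] by metis
  show "integrable lborel (\<lambda>x. (norm (grad u x))\<^sup>2)"
    by (intro integrable_compact_support[OF K(1)] continuous_intros smooth_on_grad_continuous[OF Cc_smooth_smooth[OF u]])
      (simp add: grad_zero_outside[OF compact_imp_closed[OF K(1)] K(2)])
qed simp

text \<open>Integrated over x, the average over the segment in \<open>increment_bound\<close>
  becomes the integral at the base point by translation invariance, so no constant is lost.
  Integrating over the directions then gives \<open>K0\<close> by \<open>K0_vec\<close>.\<close>

lemma Jh_le_Edir:
  fixes u :: "real^3 \<Rightarrow> real"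
  assumes u: "u \<in> Cc_smooth UNIV" and h: "0 < h"
  shows "Jh h u \<le> ennreal (h ^ 5) * (K0 * ennreal (Edir u))"
proof -
  note fst_snd_borel[measurable]
  have sm: "smooth_on UNIV u" using u by (rule Cc_smooth_smooth)
  have um[measurable]: "u \<in> borel_measurable borel" using smooth_on_continuous[OF sm] by (rule borel_measurable_continuous_onI)
  have gm[measurable]: "grad u \<in> borel_measurable borel" using smooth_on_grad_continuous[OF sm] by (rule borel_measurable_continuous_onI)
  have inner: "(\<integral>\<^sup>+x. ennreal ((u (x + k) - u x)\<^sup>2) \<partial>lborel) \<le> (\<integral>\<^sup>+x. ennreal ((k \<bullet> grad u x)\<^sup>2) \<partial>lborel)" for k
  proof -
    have "(\<integral>\<^sup>+x. ennreal ((u (x + k) - u x)\<^sup>2) \<partial>lborel)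
      \<le> (\<integral>\<^sup>+x. \<integral>\<^sup>+s. indicator {0..1::real} s * ennreal ((k \<bullet> grad u (x + s *\<^sub>R k))\<^sup>2) \<partial>lborel \<partial>lborel)"
      by (intro nn_integral_mono increment_bound[OF sm])
    also have "\<dots> = (\<integral>\<^sup>+s. \<integral>\<^sup>+x. indicator {0..1::real} s * ennreal ((k \<bullet> grad u (x + s *\<^sub>R k))\<^sup>2) \<partial>lborel \<partial>lborel)"
      by (rule nn_integral_swap) measurable
    also have "\<dots> = (\<integral>\<^sup>+s. indicator {0..1::real} s * (\<integral>\<^sup>+x. ennreal ((k \<bullet> grad u x)\<^sup>2) \<partial>lborel) \<partial>lborel)"
    proof (rule nn_integral_cong)
      fix s :: real
      have "(\<integral>\<^sup>+x. indicator {0..1} s * ennreal ((k \<bullet> grad u (x + s *\<^sub>R k))\<^sup>2) \<partial>lborel) = indicator {0..1} s * (\<integral>\<^sup>+x. ennreal ((k \<bullet> grad u (x + s *\<^sub>R k))\<^sup>2) \<partial>lborel)"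
        by (rule nn_integral_cmult) measurable
      also have "(\<integral>\<^sup>+x. ennreal ((k \<bullet> grad u (x + s *\<^sub>R k))\<^sup>2) \<partial>lborel) = (\<integral>\<^sup>+x. ennreal ((k \<bullet> grad u x)\<^sup>2) \<partial>lborel)"
        by (rule nn_integral_translate[of "\<lambda>x. ennreal ((k \<bullet> grad u x)\<^sup>2)"]) measurable
      finally show "(\<integral>\<^sup>+x. indicator {0..1} s * ennreal ((k \<bullet> grad u (x + s *\<^sub>R k))\<^sup>2) \<partial>lborel) = indicator {0..1} s * (\<integral>\<^sup>+x. ennreal ((k \<bullet> grad u x)\<^sup>2) \<partial>lborel)" .
    qed
    also have "\<dots> = (\<integral>\<^sup>+x. ennreal ((k \<bullet> grad u x)\<^sup>2) \<partial>lborel)"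
      by (subst nn_integral_multc) auto
    finally show ?thesis .
  qed
  have "(\<integral>\<^sup>+x. \<integral>\<^sup>+z. ennreal (of_bool (norm z < 1) * (u (x + h *\<^sub>R z) - u x)\<^sup>2) \<partial>lborel \<partial>lborel)
    = (\<integral>\<^sup>+z. \<integral>\<^sup>+x. ennreal (of_bool (norm z < 1) * (u (x + h *\<^sub>R z) - u x)\<^sup>2) \<partial>lborel \<partial>lborel)"
    by (rule nn_integral_swap) measurable
  also have "\<dots> \<le> (\<integral>\<^sup>+z. \<integral>\<^sup>+x. ennreal (of_bool (norm z < 1) * (h *\<^sub>R z \<bullet> grad u x)\<^sup>2) \<partial>lborel \<partial>lborel)"
  proof (rule nn_integral_mono)
    fix z :: "real^3"
    show "(\<integral>\<^sup>+x. ennreal (of_bool (norm z < 1) * (u (x + h *\<^sub>R z) - u x)\<^sup>2) \<partial>lborel) \<le> (\<integral>\<^sup>+x. ennreal (of_bool (norm z < 1) * (h *\<^sub>R z \<bullet> grad u x)\<^sup>2) \<partial>lborel)"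
      using inner[of "h *\<^sub>R z"] by (cases "norm z < 1") auto
  qed
  also have "\<dots> = (\<integral>\<^sup>+x. \<integral>\<^sup>+z. ennreal (of_bool (norm z < 1) * (h *\<^sub>R z \<bullet> grad u x)\<^sup>2) \<partial>lborel \<partial>lborel)"
    by (rule nn_integral_swap) measurable
  also have "\<dots> = (\<integral>\<^sup>+x. ennreal (h\<^sup>2) * K0 * ennreal ((norm (grad u x))\<^sup>2) \<partial>lborel)"
  proof (rule nn_integral_cong)
    fix x
    have "(\<integral>\<^sup>+z. ennreal (of_bool (norm z < 1) * (h *\<^sub>R z \<bullet> grad u x)\<^sup>2) \<partial>lborel) = (\<integral>\<^sup>+z. ennreal (of_bool (norm z < 1) * (z \<bullet> (h *\<^sub>R grad u x))\<^sup>2) \<partial>lborel)"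
      by simp
    also have "\<dots> = K0 * ennreal ((norm (h *\<^sub>R grad u x))\<^sup>2)" by (rule K0_vec)
    finally show "(\<integral>\<^sup>+z. ennreal (of_bool (norm z < 1) * (h *\<^sub>R z \<bullet> grad u x)\<^sup>2) \<partial>lborel) = ennreal (h\<^sup>2) * K0 * ennreal ((norm (grad u x))\<^sup>2)"
      by (simp add: power_mult_distrib ennreal_mult ac_simps)
  qed
  also have "\<dots> = ennreal (h\<^sup>2) * K0 * ennreal (Edir u)"
    unfolding nn_Edir[OF u, symmetric] by (rule nn_integral_cmult) measurable
  finally have "Jh h u \<le> ennreal (h ^ 3) * (ennreal (h\<^sup>2) * K0 * ennreal (Edir u))"
    unfolding Jh_scaled[OF h um] by (rule mult_left_mono) simp
  also have "\<dots> = ennreal (h ^ 5) * (K0 * ennreal (Edir u))"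
  proof -
    have "ennreal (h ^ 3) * ennreal (h\<^sup>2) = ennreal (h ^ 5)"
      using h by (simp add: ennreal_mult[symmetric] power_add[symmetric])
    then show ?thesis unfolding mult.assoc[symmetric] by simp
  qed
  finally show ?thesis .
qed

text \<open>Lets |u| start the minimisation: the class \<open>adm\<close> contains only nonnegative
  functions, and |u| is in general merely Lipschitz, a case that \<open>Jh\<close> covers.\<close>

lemma Jh_abs: "Jh h (\<lambda>x. \<bar>u x\<bar>) \<le> Jh h u"
  unfolding Jh_def
proof (intro nn_integral_mono ennreal_leI mult_left_mono)
  fix x y
  have "\<bar>\<bar>u x\<bar> - \<bar>u y\<bar>\<bar> \<le> \<bar>u x - u y\<bar>" by (rule abs_triangle_ineq3)
  then show "(\<bar>u x\<bar> - \<bar>u y\<bar>)\<^sup>2 \<le> (u x - u y)\<^sup>2" by (simp add: abs_le_square_iff[symmetric])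
qed simp

text \<open>
Fatou's lemma applied to difference quotients along \<open>h = 1/n\<close>.
\<close>

lemma Edir_le_of_Jh:
  fixes f :: "real^3 \<Rightarrow> real"
  assumes f: "f \<in> Cc_smooth UNIV" and E: "0 \<le> E"
    and J: "\<And>h. 0 < h \<Longrightarrow> Jh h f \<le> ennreal (h ^ 5) * (K0 * ennreal E)"
  shows "Edir f \<le> E"
proof -
  note fst_snd_borel[measurable]
  have sm: "smooth_on UNIV f" using f by (rule Cc_smooth_smooth)
  have fm[measurable]: "f \<in> borel_measurable borel" using smooth_on_continuous[OF sm] by (rule borel_measurable_continuous_onI)
  have gm[measurable]: "grad f \<in> borel_measurable borel" using smooth_on_grad_continuous[OF sm] by (rule borel_measurable_continuous_onI)
  define h where "h n = 1 / real (Suc n)" for n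
  have h: "0 < h n" for n by (simp add: h_def)
  define G where "G n z = ennreal (of_bool (norm (snd z) < 1) * ((f (fst z + h n *\<^sub>R snd z) - f (fst z)) / h n)\<^sup>2)" for n and z :: "(real^3) \<times> (real^3)"
  define H where "H z = ennreal (of_bool (norm (snd z) < 1) * (snd z \<bullet> grad f (fst z))\<^sup>2)" for z :: "(real^3) \<times> (real^3)"
  have Gm: "G n \<in> borel_measurable borel" for n unfolding G_def[abs_def] by measurable
  have Hm: "H \<in> borel_measurable borel" unfolding H_def[abs_def] by measurable
  have lim: "(\<lambda>n. G n z) \<longlonglongrightarrow> H z" for z
  proof -
    define x k where "x = fst z" and "k = snd z"
    have "((\<lambda>s. f (x + s *\<^sub>R k)) has_real_derivative (grad f (x + 0 *\<^sub>R k) \<bullet> k)) (at 0)"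
      by (rule DERIV_line) (use smooth_on_differentiable[OF sm] in auto)
    then have *: "((\<lambda>s. (f (x + s *\<^sub>R k) - f x) / s) \<longlongrightarrow> k \<bullet> grad f x) (at 0)"
      by (simp add: has_field_derivative_iff inner_commute)
    have "filterlim h (at 0) sequentially"
      unfolding filterlim_at h_def using LIMSEQ_Suc[OF lim_1_over_n] by (auto intro: always_eventually)
    from filterlim_compose[OF * this]
    have "(\<lambda>n. (f (x + h n *\<^sub>R k) - f x) / h n) \<longlonglongrightarrow> k \<bullet> grad f x" .
    then show ?thesis unfolding G_def H_def x_def[symmetric] k_def[symmetric]
      by (intro tendsto_ennrealI tendsto_intros)
  qed
  have Gint: "(\<integral>\<^sup>+z. G n z \<partial>lborel) \<le> K0 * ennreal E" for n
  proof -
    define I where "I = (\<integral>\<^sup>+x. \<integral>\<^sup>+z. ennreal (of_bool (norm z < 1) * (f (x + h n *\<^sub>R z) - f x)\<^sup>2) \<partial>lborel \<partial>lborel)"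
    have "(\<integral>\<^sup>+z. G n z \<partial>lborel) = (\<integral>\<^sup>+x. \<integral>\<^sup>+z. ennreal (1 / (h n)\<^sup>2) * ennreal (of_bool (norm z < 1) * (f (x + h n *\<^sub>R z) - f x)\<^sup>2) \<partial>lborel \<partial>lborel)"
      unfolding nn_integral_lborel_pair(1)[OF Gm]
      by (intro nn_integral_cong) (simp add: G_def ennreal_mult[symmetric] power_divide)
    also have "\<dots> = (\<integral>\<^sup>+x. ennreal (1 / (h n)\<^sup>2) * (\<integral>\<^sup>+z. ennreal (of_bool (norm z < 1) * (f (x + h n *\<^sub>R z) - f x)\<^sup>2) \<partial>lborel) \<partial>lborel)"
      by (intro nn_integral_cong nn_integral_cmult) measurable
    also have "\<dots> = ennreal (1 / (h n)\<^sup>2) * I"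
    proof -
      have "(\<lambda>z. ennreal (of_bool (norm (snd z) < 1) * (f (fst z + h n *\<^sub>R snd z) - f (fst z))\<^sup>2)) \<in> borel_measurable borel"
        by measurable
      from borel_measurable_nn_integral_lborel[OF this] show ?thesis unfolding I_def by (intro nn_integral_cmult) simp
    qed
    also have "\<dots> = ennreal (1 / h n ^ 5) * Jh (h n) f"
    proof -
      have "1 / h n ^ 5 * h n ^ 3 = 1 / (h n)\<^sup>2" using h[of n] by (simp add: field_simps eval_nat_numeral)
      then have "ennreal (1 / h n ^ 5) * ennreal (h n ^ 3) = ennreal (1 / (h n)\<^sup>2)"
        using h[of n] by (simp add: ennreal_mult[symmetric])
      then show ?thesis unfolding Jh_scaled[OF h fm] I_def[symmetric] by (metis mult.assoc)
    qed
    also have "\<dots> \<le> ennreal (1 / h n ^ 5) * (ennreal (h n ^ 5) * (K0 * ennreal E))"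
      by (intro mult_left_mono J h) simp
    also have "\<dots> = K0 * ennreal E"
    proof -
      have "ennreal (1 / h n ^ 5) * ennreal (h n ^ 5) = 1" using h[of n] by (simp add: ennreal_mult[symmetric])
      then show ?thesis by (metis mult.assoc mult_1)
    qed
    finally show ?thesis .
  qed
  have "K0 * ennreal (Edir f) = (\<integral>\<^sup>+x. K0 * ennreal ((norm (grad f x))\<^sup>2) \<partial>lborel)"
    unfolding nn_Edir[OF f, symmetric] by (rule nn_integral_cmult[symmetric]) measurable
  also have "\<dots> = (\<integral>\<^sup>+z. H z \<partial>lborel)"
    unfolding nn_integral_lborel_pair(1)[OF Hm] K0_vec[symmetric] by (simp add: H_def)
  also have "\<dots> = (\<integral>\<^sup>+z. liminf (\<lambda>n. G n z) \<partial>lborel)"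
    by (intro nn_integral_cong lim_imp_Liminf[symmetric] lim) simp
  also have "\<dots> \<le> liminf (\<lambda>n. \<integral>\<^sup>+z. G n z \<partial>lborel)"
    by (rule nn_integral_liminf) (use Gm in simp)
  also have "\<dots> \<le> liminf (\<lambda>n::nat. K0 * ennreal E)"
    using Gint by (intro Liminf_mono always_eventually allI)
  also have "\<dots> = K0 * ennreal E" by (simp add: Liminf_const)
  finally have "K0 * ennreal (Edir f) \<le> K0 * ennreal E" .
  then have "ennreal (Edir f) \<le> ennreal E"
    using K0_pos K0_finite by (simp add: ennreal_mult_le_mult_iff)
  then show ?thesis using E by (simp add: ennreal_le_iff)
qed

subsection \<open>Mollification\<close>

lemma Cc_smooth_frechet:
  assumes f: "f \<in> Cc_smooth UNIV"
  shows "(\<lambda>x. frechet_derivative f (at x) h) \<in> Cc_smooth UNIV"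
proof -
  obtain K where K: "compact K" "\<And>x. x \<notin> K \<Longrightarrow> f x = 0" using Cc_smoothD[OF f] by metis
  show ?thesis
    by (rule Cc_smoothI[OF open_UNIV K(1) _ smooth_on_frechet[OF Cc_smooth_smooth[OF f]]])
      (simp_all add: deriv_zero_outside[OF compact_imp_closed[OF K(1)] K(2)])
qed

lemma frechet_sum_Basis:
  fixes f :: "'a::euclidean_space \<Rightarrow> real"
  assumes "f differentiable (at x)"
  shows "frechet_derivative f (at x) h = (\<Sum>b\<in>Basis. (h \<bullet> b) * frechet_derivative f (at x) b)"
  unfolding grad_inner[OF assms, symmetric] by (subst euclidean_inner) (simp add: mult.commute)

lemma Cc_smooth_Lipschitz:
  fixes f :: "'a::euclidean_space \<Rightarrow> real"
  assumes f: "f \<in> Cc_smooth UNIV"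
  obtains L where "0 \<le> L" "\<And>x y. \<bar>f x - f y\<bar> \<le> L * norm (x - y)"
proof -
  have sm: "smooth_on UNIV f" using f by (rule Cc_smooth_smooth)
  obtain K where K: "compact K" "\<And>x. x \<notin> K \<Longrightarrow> f x = 0" using Cc_smoothD[OF f] by metis
  have cg: "continuous_on K (\<lambda>x. norm (grad f x))"
    using continuous_on_subset[OF smooth_on_grad_continuous[OF sm], of K] by (intro continuous_intros) auto
  have "norm (grad f x) = 0" if "x \<notin> K" for x
    using grad_zero_outside[OF compact_imp_closed[OF K(1)] K(2) that] by simp
  then obtain L where L: "0 < L" "\<And>x. \<bar>norm (grad f x)\<bar> \<le> L"
    using compact_support_bounded[OF K(1) cg] by metis
  have "\<bar>f x - f y\<bar> \<le> L * norm (x - y)" for x y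
  proof -
    have "\<bar>f (y + 1 *\<^sub>R (x - y)) - f y\<bar> \<le> (L * norm (x - y)) * 1"
    proof (rule line_bound)
      show d: "f differentiable (at z)" for z using smooth_on_differentiable[OF sm] by simp
      show "\<bar>frechet_derivative f (at z) (x - y)\<bar> \<le> L * norm (x - y)" for z
        unfolding grad_inner[OF d, symmetric]
        by (rule order_trans[OF Cauchy_Schwarz_ineq2]) (use L(2)[of z] in \<open>auto intro: mult_right_mono\<close>)
    qed simp
    then show ?thesis by simp
  qed
  then show ?thesis using that[of L] L(1) by auto
qed

text \<open>The mean value theorem along the segment, with Lipschitz bounds for the partial
  derivatives, which are test functions themselves. The bound is uniform in \<open>x\<close>, so it
  survives integration against \<open>w\<close>.\<close>

lemma quadratic_remainder:
  fixes f :: "'a::euclidean_space \<Rightarrow> real"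
  assumes f: "f \<in> Cc_smooth UNIV"
  obtains L where "0 \<le> L" "\<And>x h. \<bar>f (x + h) - f x - frechet_derivative f (at x) h\<bar> \<le> L * (norm h)\<^sup>2"
proof -
  have sm: "smooth_on UNIV f" using f by (rule Cc_smooth_smooth)
  have d: "f differentiable (at z)" for z using smooth_on_differentiable[OF sm] by simp
  have "\<exists>L\<ge>0. \<forall>x y. \<bar>frechet_derivative f (at x) b - frechet_derivative f (at y) b\<bar> \<le> L * norm (x - y)" for b
    using Cc_smooth_Lipschitz[OF Cc_smooth_frechet[OF f, of b]] by metis
  then obtain L where L: "\<And>b. 0 \<le> L b"
    "\<And>b x y. \<bar>frechet_derivative f (at x) b - frechet_derivative f (at y) b\<bar> \<le> L b * norm (x - y)" by metis
  have "\<bar>f (x + h) - f x - frechet_derivative f (at x) h\<bar> \<le> sum L Basis * (norm h)\<^sup>2" for x h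
  proof -
    have der: "((\<lambda>s. f (x + s *\<^sub>R h)) has_real_derivative (grad f (x + s *\<^sub>R h) \<bullet> h)) (at s)" for s
      by (rule DERIV_line[OF d])
    obtain s where s: "0 < s" "s < 1" "f (x + 1 *\<^sub>R h) - f (x + 0 *\<^sub>R h) = (1 - 0) * (grad f (x + s *\<^sub>R h) \<bullet> h)"
      using MVT2[of 0 1 "\<lambda>s. f (x + s *\<^sub>R h)" "\<lambda>s. grad f (x + s *\<^sub>R h) \<bullet> h"] der by auto
    have "f (x + h) - f x - frechet_derivative f (at x) h
      = (\<Sum>b\<in>Basis. (h \<bullet> b) * (frechet_derivative f (at (x + s *\<^sub>R h)) b - frechet_derivative f (at x) b))"
      using s(3) frechet_sum_Basis[OF d, of x h] frechet_sum_Basis[OF d, of "x + s *\<^sub>R h" h]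
      by (simp add: grad_inner[OF d] sum_subtractf right_diff_distrib)
    also have "\<bar>\<dots>\<bar> \<le> (\<Sum>b\<in>Basis. \<bar>(h \<bullet> b) * (frechet_derivative f (at (x + s *\<^sub>R h)) b - frechet_derivative f (at x) b)\<bar>)"
      by (rule sum_abs)
    also have "\<dots> \<le> (\<Sum>b\<in>Basis. L b * (norm h)\<^sup>2)"
    proof (rule sum_mono)
      fix b :: 'a assume b: "b \<in> Basis"
      have "L b * norm (x + s *\<^sub>R h - x) \<le> L b * norm h"
        using s L(1)[of b] by (intro mult_left_mono) (auto simp: mult_left_le_one_le)
      then have "\<bar>frechet_derivative f (at (x + s *\<^sub>R h)) b - frechet_derivative f (at x) b\<bar> \<le> L b * norm h"
        using L(2)[where b=b and x="x + s *\<^sub>R h" and y=x] by linarith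
      then have "\<bar>h \<bullet> b\<bar> * \<bar>frechet_derivative f (at (x + s *\<^sub>R h)) b - frechet_derivative f (at x) b\<bar> \<le> norm h * (L b * norm h)"
        using Basis_le_norm[OF b, of h] by (intro mult_mono) auto
      then show "\<bar>(h \<bullet> b) * (frechet_derivative f (at (x + s *\<^sub>R h)) b - frechet_derivative f (at x) b)\<bar> \<le> L b * (norm h)\<^sup>2"
        by (simp add: abs_mult power2_eq_square mult_ac)
    qed
    finally show ?thesis by (simp add: sum_distrib_right)
  qed
  then show ?thesis using that[of "sum L Basis"] L(1) by (simp add: sum_nonneg)
qed

definition conv :: "('a::euclidean_space \<Rightarrow> real) \<Rightarrow> ('a \<Rightarrow> real) \<Rightarrow> 'a \<Rightarrow> real" where
  "conv w f x = (LINT z|lborel. w z * f (x - z))"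

locale mollification =
  fixes w :: "'a::euclidean_space \<Rightarrow> real" and R :: real
  assumes w: "continuous_on UNIV w" "\<And>x. R < norm x \<Longrightarrow> w x = 0"
begin

lemma w_continuous: "continuous_on U w"
  using w(1) continuous_on_subset by blast

lemma w_measurable[measurable]: "w \<in> borel_measurable borel"
  using w(1) by (rule borel_measurable_continuous_onI)

lemma integrable_w_mult: "continuous_on UNIV g \<Longrightarrow> integrable lborel (\<lambda>z. w z * g z)"
  by (rule integrable_compact_support[of "cball 0 R"])
    (auto intro!: continuous_intros w_continuous w(2) intro: continuous_on_subset)

text \<open>The derivative falls on the smooth factor \<open>f\<close>. The uniform quadratic
  remainder integrated against |w| bounds the error by a multiple of |y - x|^2.\<close>

lemma conv_has_derivative:
  assumes f: "f \<in> Cc_smooth UNIV"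
  shows "(conv w f has_derivative (\<lambda>h. conv w (\<lambda>y. frechet_derivative f (at y) h) x)) (at x)"
proof -
  have sm: "smooth_on UNIV f" using f by (rule Cc_smooth_smooth)
  have d: "f differentiable (at z)" for z using smooth_on_differentiable[OF sm] by simp
  have cf: "continuous_on UNIV (\<lambda>z. f (y - z))" for y
    by (intro continuous_on_compose2[OF smooth_on_continuous[OF sm]] continuous_intros) auto
  have cd: "continuous_on UNIV (\<lambda>z. frechet_derivative f (at (y - z)) h)" for y h
    by (intro continuous_on_compose2[OF smooth_on_continuous[OF smooth_on_frechet[OF sm, of h]]] continuous_intros) auto
  note i = integrable_w_mult[OF cf] and id = integrable_w_mult[OF cd]
  define D where "D h = conv w (\<lambda>y. frechet_derivative f (at y) h) x" for h
  have lin: "linear (frechet_derivative f (at z))" for z using d by (rule linear_frechet_derivative)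
  have "linear D"
  proof (rule linearI)
    show "D (h + k) = D h + D k" for h k
      unfolding D_def conv_def linear_add[OF lin] distrib_left by (rule Bochner_Integration.integral_add[OF id id])
    show "D (c *\<^sub>R h) = c *\<^sub>R D h" for c h
      unfolding D_def conv_def linear_scale[OF lin] by (simp add: mult.left_commute)
  qed
  then have bl: "bounded_linear D" by (simp add: linear_conv_bounded_linear)
  obtain L where L: "0 \<le> L" "\<And>x h. \<bar>f (x + h) - f x - frechet_derivative f (at x) h\<bar> \<le> L * (norm h)\<^sup>2"
    using quadratic_remainder[OF f] by metis
  define I where "I = (LINT z|lborel. \<bar>w z\<bar>)"
  have iw: "integrable lborel (\<lambda>z. \<bar>w z\<bar>)"
    using integrable_abs[OF integrable_w_mult[of "\<lambda>z. 1"]] by simp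
  have bound: "\<bar>conv w f y - conv w f x - D (y - x)\<bar> \<le> L * I * (norm (y - x))\<^sup>2" for y
  proof -
    have eq: "conv w f y - conv w f x - D (y - x)
      = (LINT z|lborel. w z * f (y - z) - w z * f (x - z) - w z * frechet_derivative f (at (x - z)) (y - x))"
      unfolding conv_def D_def by (simp only: Bochner_Integration.integral_diff i id Bochner_Integration.integrable_diff)
    have "\<bar>conv w f y - conv w f x - D (y - x)\<bar> \<le> (LINT z|lborel. \<bar>w z * f (y - z) - w z * f (x - z) - w z * frechet_derivative f (at (x - z)) (y - x)\<bar>)"
      unfolding eq by (rule integral_abs_bound)
    also have "\<dots> \<le> (LINT z|lborel. (L * (norm (y - x))\<^sup>2) * \<bar>w z\<bar>)"
    proof (rule integral_mono)
      fix z
      have "\<bar>f (x - z + (y - x)) - f (x - z) - frechet_derivative f (at (x - z)) (y - x)\<bar> \<le> L * (norm (y - x))\<^sup>2"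
        by (rule L(2))
      then have "\<bar>w z\<bar> * \<bar>f (y - z) - f (x - z) - frechet_derivative f (at (x - z)) (y - x)\<bar> \<le> \<bar>w z\<bar> * (L * (norm (y - x))\<^sup>2)"
        by (intro mult_left_mono) auto
      then show "\<bar>w z * f (y - z) - w z * f (x - z) - w z * frechet_derivative f (at (x - z)) (y - x)\<bar> \<le> (L * (norm (y - x))\<^sup>2) * \<bar>w z\<bar>"
        unfolding right_diff_distrib[symmetric] abs_mult by (simp only: mult_ac)
    qed (intro integrable_abs Bochner_Integration.integrable_diff i id integrable_mult_right iw)+
    also have "\<dots> = L * I * (norm (y - x))\<^sup>2" by (simp add: I_def)
    finally show ?thesis .
  qed
  have "(conv w f has_derivative D) (at x within UNIV)"
  proof (rule has_derivativeI_sandwich[where e=1 and H="\<lambda>y. L * I * norm (y - x)"])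
    show "norm (conv w f y - conv w f x - D (y - x)) / norm (y - x) \<le> L * I * norm (y - x)" if "y \<noteq> x" for y
      using bound[of y] that by (simp add: divide_le_eq power2_eq_square mult.assoc)
    show "((\<lambda>y. L * I * norm (y - x)) \<longlongrightarrow> 0) (at x within UNIV)"
      by (rule tendsto_eq_intros refl)+ simp
  qed (use bl in auto)
  then show ?thesis by (simp add: D_def[abs_def])
qed

lemma conv_smooth:
  assumes "f \<in> Cc_smooth UNIV" shows "smooth_on UNIV (conv w f)"
proof -
  have "Ck_on k UNIV (conv w f)" for k using assms
  proof (induction k arbitrary: f)
    case 0
    have "isCont (conv w f) x" for x using has_derivative_continuous[OF conv_has_derivative[OF 0]] .
    then show ?case by (simp add: continuous_at_imp_continuous_on)
  next
    case (Suc k)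
    show ?case
      by (rule Ck_on_SucI[OF open_UNIV conv_has_derivative[OF Suc.prems]]) (rule Suc.IH[OF Cc_smooth_frechet[OF Suc.prems]])
  qed
  then show ?thesis by (simp add: smooth_on_def)
qed

lemma conv_outside:
  assumes "\<And>x. e < norm x \<Longrightarrow> f x = 0" "R + e < norm x"
  shows "conv w f x = 0"
proof -
  have z: "w z * f (x - z) = 0" for z
  proof (cases "R < norm z")
    case False
    then have "e < norm (x - z)" using assms(2) norm_triangle_ineq2[of x z] by linarith
    then show ?thesis using assms(1) by simp
  qed (simp add: w(2))
  show ?thesis unfolding conv_def z by simp
qed

lemma conv_Cc_smooth:
  assumes "f \<in> Cc_smooth UNIV" "\<And>x. e < norm x \<Longrightarrow> f x = 0"
  shows "conv w f \<in> Cc_smooth UNIV"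
  by (rule Cc_smoothI[of _ "cball 0 (R + e)"]) (use conv_smooth[OF assms(1)] conv_outside[OF assms(2)] in auto)

lemma conv_commute:
  assumes "f \<in> Cc_smooth UNIV"
  shows "conv w f x = (LINT z|lborel. w (x - z) * f z)"
proof -
  have [measurable]: "f \<in> borel_measurable borel"
    using smooth_on_continuous[OF Cc_smooth_smooth[OF assms]] by (rule borel_measurable_continuous_onI)
  have "(\<lambda>z. w (x - z) * f z) \<in> borel_measurable borel" by measurable
  from integral_minus_arg[OF this, of x] show ?thesis by (simp add: conv_def)
qed

end

text \<open>Substitute the reflection that exchanges \<open>x\<close> and \<open>y\<close>. Since
  the two have equal norms its plane passes through the origin, so it preserves the norm of the
  variable and carries distances to \<open>x\<close> into distances to \<open>y\<close>.\<close>

lemma conv_radial: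
  fixes w f :: "real^3 \<Rightarrow> real"
  assumes "mollification w R" "f \<in> Cc_smooth UNIV"
    and wr: "\<And>x y. norm x = norm y \<Longrightarrow> w x = w y" and fr: "\<And>x y. norm x = norm y \<Longrightarrow> f x = f y"
    and xy: "norm x = norm y"
  shows "conv w f x = conv w f y"
proof (cases "x = y")
  case False
  interpret mollification w R by fact
  define n where "n = (1 / norm (y - x)) *\<^sub>R (y - x)"
  define m where "m = (1 / 2) *\<^sub>R (x + y)"
  note r = exists_refl[OF False, folded n_def m_def]
  have mn: "m \<bullet> n = 0" using r(5) xy by simp
  have nr: "norm (refl m n z) = norm z" for z
    using norm_refl[OF r(1), of m z] mn by (simp add: power2_eq_iff_nonneg)
  have [measurable]: "f \<in> borel_measurable borel"
    using smooth_on_continuous[OF Cc_smooth_smooth[OF assms(2)]] by (rule borel_measurable_continuous_onI)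
  have "(\<lambda>z. w z * f (x - z)) \<in> borel_measurable borel" by measurable
  from integral_refl(1)[OF r(1) this, of m]
  have "conv w f x = (LINT z|lborel. w (refl m n z) * f (x - refl m n z))" by (simp add: conv_def)
  also have "\<dots> = conv w f y" unfolding conv_def
  proof (intro Bochner_Integration.integral_cong refl arg_cong2[where f="(*)"] wr fr nr)
    show "norm (x - refl m n z) = norm (y - z)" for z
      using dist_refl[OF r(1), of m y z] r(3) by simp
  qed
  finally show ?thesis .
qed simp

section \<open>Averaging against a probability density\<close>

locale mollifier = mollification w R for w :: "'a::euclidean_space \<Rightarrow> real" and R +
  fixes f :: "'a \<Rightarrow> real" and e :: real
  assumes f: "f \<in> Cc_smooth UNIV" "\<And>x. 0 \<le> f x" "\<And>x. e < norm x \<Longrightarrow> f x = 0" "integral\<^sup>L lborel f = 1"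
begin

lemma f_continuous: "continuous_on U f"
  using smooth_on_continuous[OF Cc_smooth_smooth[OF f(1)]] continuous_on_subset by blast

lemma f_measurable[measurable]: "f \<in> borel_measurable borel"
  using f_continuous by (rule borel_measurable_continuous_onI)

lemma integrable_mult_f: "continuous_on UNIV g \<Longrightarrow> integrable lborel (\<lambda>z. g z * f z)"
  by (rule integrable_compact_support[of "cball 0 e"])
    (auto intro!: continuous_intros f_continuous f(3) intro: continuous_on_subset)

lemma shift_continuous: "continuous_on UNIV (\<lambda>z. w (x - z))"
  by (intro continuous_on_compose2[OF w(1)] continuous_intros) auto

lemma integrable_f: "integrable lborel f"
  using integrable_mult_f[of "\<lambda>z. 1"] by simp

lemma conv_close:
  assumes L: "0 \<le> L" "\<And>x y. \<bar>w x - w y\<bar> \<le> L * norm (x - y)"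
  shows "\<bar>conv w f x - w x\<bar> \<le> L * e"
proof -
  have eq: "conv w f x - w x = (LINT z|lborel. w (x - z) * f z) - (LINT z|lborel. w x * f z)"
    by (simp add: conv_commute[OF f(1)] f(4))
  have eq2: "(LINT z|lborel. w (x - z) * f z) - (LINT z|lborel. w x * f z) = (LINT z|lborel. (w (x - z) - w x) * f z)"
    unfolding left_diff_distrib
    by (rule Bochner_Integration.integral_diff[symmetric]) (intro integrable_mult_f shift_continuous continuous_on_const)+
  have "\<bar>conv w f x - w x\<bar> \<le> (LINT z|lborel. \<bar>(w (x - z) - w x) * f z\<bar>)" unfolding eq eq2 by (rule integral_abs_bound)
  also have "\<dots> \<le> (LINT z|lborel. (L * e) * f z)"
  proof (rule integral_mono)
    fix z
    show "\<bar>(w (x - z) - w x) * f z\<bar> \<le> (L * e) * f z"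
    proof (cases "e < norm z")
      case False
      have "\<bar>w (x - z) - w x\<bar> \<le> L * norm z" using L(2)[of "x - z" x] by simp
      also have "\<dots> \<le> L * e" using False L(1) by (intro mult_left_mono) auto
      finally show ?thesis using f(2)[of z] by (simp add: abs_mult mult_right_mono)
    qed (simp add: f(3))
  qed (intro integrable_abs integrable_mult_f continuous_intros shift_continuous integrable_mult_right integrable_f)+
  finally show ?thesis by (simp add: f(4))
qed

text \<open>
Jensen's inequality for the probability density \<open>f\<close>.
\<close>

lemma conv_square:
  "ennreal ((conv w f x - conv w f y)\<^sup>2) \<le> (\<integral>\<^sup>+z. ennreal ((w (x - z) - w (y - z))\<^sup>2 * f z) \<partial>lborel)"
proof -
  define g where "g z = w (x - z) - w (y - z)" for z
  have g: "continuous_on UNIV g" unfolding g_def by (intro continuous_intros shift_continuous)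
  define c where "c = (LINT z|lborel. g z * f z)"
  have c: "conv w f x - conv w f y = c"
    unfolding c_def g_def conv_commute[OF f(1)] left_diff_distrib
    by (rule Bochner_Integration.integral_diff[symmetric]) (intro integrable_mult_f shift_continuous)+
  have i2: "integrable lborel (\<lambda>z. (g z)\<^sup>2 * f z)" by (intro integrable_mult_f continuous_intros g)
  have i1: "integrable lborel (\<lambda>z. (2 * c * g z) * f z)" by (intro integrable_mult_f continuous_intros g)
  have i0: "integrable lborel (\<lambda>z. c\<^sup>2 * f z)" by (intro integrable_mult_right integrable_f)
  have "0 \<le> (LINT z|lborel. (g z - c)\<^sup>2 * f z)" using f(2) by (intro Bochner_Integration.integral_nonneg) auto
  also have "\<dots> = (LINT z|lborel. (g z)\<^sup>2 * f z - (2 * c * g z) * f z + c\<^sup>2 * f z)"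
    by (intro Bochner_Integration.integral_cong refl) (simp add: power2_eq_square algebra_simps)
  also have "\<dots> = (LINT z|lborel. (g z)\<^sup>2 * f z) - (LINT z|lborel. (2 * c * g z) * f z) + (LINT z|lborel. c\<^sup>2 * f z)"
    by (simp only: Bochner_Integration.integral_add Bochner_Integration.integral_diff Bochner_Integration.integrable_diff i0 i1 i2)
  also have "(LINT z|lborel. (2 * c * g z) * f z) = 2 * c * c"
    unfolding mult.assoc c_def by simp
  also have "(LINT z|lborel. c\<^sup>2 * f z) = c\<^sup>2" by (simp add: f(4))
  finally have "c\<^sup>2 \<le> (LINT z|lborel. (g z)\<^sup>2 * f z)" by (simp add: power2_eq_square)
  then have "ennreal (c\<^sup>2) \<le> ennreal (LINT z|lborel. (g z)\<^sup>2 * f z)" by (rule ennreal_leI)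
  also have "\<dots> = (\<integral>\<^sup>+z. ennreal ((g z)\<^sup>2 * f z) \<partial>lborel)"
    by (rule nn_integral_eq_integral[OF i2, symmetric]) (simp add: f(2))
  finally show ?thesis by (simp add: c g_def)
qed

end

lemma Jh_pair:
  fixes w :: "real^3 \<Rightarrow> real"
  assumes "w \<in> borel_measurable borel"
  shows "Jh h w = (\<integral>\<^sup>+q. ennreal (of_bool (norm (fst q - snd q) < h) * (w (fst q) - w (snd q))\<^sup>2) \<partial>lborel)"
  using nn_integral_lborel_pair(1)[OF measurable_pair_kernel[OF assms assms measurable_ident measurable_ident, of h]]
  by (simp add: Jh_def)

text \<open>A convolution is an average of translates of \<open>w\<close>, all with the same value
  of \<open>Jh\<close>. Convexity of the square (\<open>conv_square\<close>) and Tonelli give the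
  claim.\<close>

lemma Jh_conv:
  fixes w f :: "real^3 \<Rightarrow> real"
  assumes "mollifier w R f e"
  shows "Jh h (conv w f) \<le> Jh h w"
proof -
  interpret mollifier w R f e by fact
  note fst_snd_borel[measurable]
  define k :: "(real^3) \<times> (real^3) \<Rightarrow> real" where "k q = of_bool (norm (fst q - snd q) < h)" for q
  have [measurable]: "k \<in> borel_measurable borel" unfolding k_def[abs_def] by measurable
  have k: "0 \<le> k q" for q by (simp add: k_def)
  define H where "H q z = ennreal (k q * ((w (fst q - z) - w (snd q - z))\<^sup>2 * f z))" for q z
  have Hm: "(\<lambda>z. H (fst z) (snd z)) \<in> borel_measurable borel" unfolding H_def by measurable
  have cm: "conv w f \<in> borel_measurable borel"
    using smooth_on_continuous[OF conv_smooth[OF f(1)]] by (rule borel_measurable_continuous_onI)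
  have "Jh h (conv w f) = (\<integral>\<^sup>+q. ennreal (k q) * ennreal ((conv w f (fst q) - conv w f (snd q))\<^sup>2) \<partial>lborel)"
    unfolding Jh_pair[OF cm] by (simp add: k_def ennreal_mult[symmetric])
  also have "\<dots> \<le> (\<integral>\<^sup>+q. ennreal (k q) * (\<integral>\<^sup>+z. ennreal ((w (fst q - z) - w (snd q - z))\<^sup>2 * f z) \<partial>lborel) \<partial>lborel)"
    by (intro nn_integral_mono mult_left_mono conv_square) simp
  also have "\<dots> = (\<integral>\<^sup>+q. \<integral>\<^sup>+z. H q z \<partial>lborel \<partial>lborel)"
  proof (rule nn_integral_cong)
    fix q :: "(real^3) \<times> (real^3)"
    have "(\<integral>\<^sup>+z. H q z \<partial>lborel) = (\<integral>\<^sup>+z. ennreal (k q) * ennreal ((w (fst q - z) - w (snd q - z))\<^sup>2 * f z) \<partial>lborel)"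
      using k f(2) by (simp add: H_def ennreal_mult)
    also have "\<dots> = ennreal (k q) * (\<integral>\<^sup>+z. ennreal ((w (fst q - z) - w (snd q - z))\<^sup>2 * f z) \<partial>lborel)"
      by (rule nn_integral_cmult) measurable
    finally show "ennreal (k q) * (\<integral>\<^sup>+z. ennreal ((w (fst q - z) - w (snd q - z))\<^sup>2 * f z) \<partial>lborel) = (\<integral>\<^sup>+z. H q z \<partial>lborel)" by simp
  qed
  also have "\<dots> = (\<integral>\<^sup>+z. \<integral>\<^sup>+q. H q z \<partial>lborel \<partial>lborel)"
    by (rule nn_integral_swap[OF Hm])
  also have "\<dots> = (\<integral>\<^sup>+z. Jh h w * ennreal (f z) \<partial>lborel)"
  proof (rule nn_integral_cong)
    fix z :: "real^3"
    define P where "P q = ennreal (k q * (w (fst q) - w (snd q))\<^sup>2)" for q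
    have Pm[measurable]: "P \<in> borel_measurable borel" unfolding P_def[abs_def] by measurable
    have "(\<integral>\<^sup>+q. H q z \<partial>lborel) = (\<integral>\<^sup>+q. P (q + (- z, - z)) * ennreal (f z) \<partial>lborel)"
      by (intro nn_integral_cong) (simp add: H_def P_def k_def ennreal_mult[symmetric] f(2) mult.assoc)
    also have "\<dots> = (\<integral>\<^sup>+q. P (q + (- z, - z)) \<partial>lborel) * ennreal (f z)"
      by (rule nn_integral_multc) measurable
    also have "(\<integral>\<^sup>+q. P (q + (- z, - z)) \<partial>lborel) = (\<integral>\<^sup>+q. P q \<partial>lborel)"
      by (rule nn_integral_translate[OF Pm])
    also have "\<dots> = Jh h w"
      unfolding Jh_pair[OF w_measurable] by (simp add: P_def k_def)
    finally show "(\<integral>\<^sup>+q. H q z \<partial>lborel) = Jh h w * ennreal (f z)" .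
  qed
  also have "\<dots> = Jh h w * (\<integral>\<^sup>+z. ennreal (f z) \<partial>lborel)" by (rule nn_integral_cmult) measurable
  also have "(\<integral>\<^sup>+z. ennreal (f z) \<partial>lborel) = 1"
    using nn_integral_eq_integral[OF integrable_f] f(2,4) by simp
  finally show ?thesis by simp
qed

lemma radial_mollifier_exists:
  assumes e: "0 < e"
  obtains f :: "real^3 \<Rightarrow> real" where "f \<in> Cc_smooth UNIV" "\<And>x. 0 \<le> f x" "\<And>x. e < norm x \<Longrightarrow> f x = 0"
    "integral\<^sup>L lborel f = 1" "\<And>x y. norm x = norm y \<Longrightarrow> f x = f y"
proof -
  define g where "g x = flat 1 (1 - (1 / e\<^sup>2) * (norm x)\<^sup>2)" for x :: "real^3"
  have sm: "smooth_on UNIV g" unfolding g_def[abs_def]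
    by (rule smooth_on_compose[OF _ _ smooth_on_flat])
      (auto intro!: smooth_on_diff smooth_on_mult smooth_on_const smooth_on_norm_sq simp del: times_divide_eq_left)
  have out: "g x = 0" if "e < norm x" for x
  proof -
    have "e\<^sup>2 \<le> (norm x)\<^sup>2" using that e by (intro power_mono) auto
    then have "1 - (1 / e\<^sup>2) * (norm x)\<^sup>2 \<le> 0" using e by (simp add: field_simps)
    then show ?thesis unfolding g_def by (rule flat_1_0)
  qed
  have nn: "0 \<le> g x" for x by (simp add: g_def flat_1_nonneg)
  have cg: "continuous_on U g" for U using smooth_on_continuous[OF sm] continuous_on_subset by blast
  have i: "integrable lborel g"
    by (rule integrable_compact_support[of "cball 0 e", OF _ cg]) (auto intro: out)
  define c where "c = integral\<^sup>L lborel g"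
  have c: "0 < c" unfolding c_def
    by (rule integral_continuous_pos[OF cg nn i, of 0]) (simp add: g_def flat_1_pos)
  show ?thesis
  proof (rule that[of "\<lambda>x. (1 / c) * g x"])
    show "(\<lambda>x. (1 / c) * g x) \<in> Cc_smooth UNIV"
      by (rule Cc_smoothI[of _ "cball 0 e"]) (use out in \<open>auto intro!: smooth_on_mult smooth_on_const sm simp del: times_divide_eq_left\<close>)
    show "integral\<^sup>L lborel (\<lambda>x. (1 / c) * g x) = 1" using c by (simp add: c_def)
  qed (use c nn out in \<open>auto simp: g_def\<close>)
qed

theorem radial_mollification:
  fixes w :: "real^3 \<Rightarrow> real"
  assumes u: "\<And>x. 0 \<le> w x" "\<And>x. R < norm x \<Longrightarrow> w x = 0" "\<And>x y. norm x = norm y \<Longrightarrow> w x = w y"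
    and Lip: "0 \<le> L" "\<And>x y. \<bar>w x - w y\<bar> \<le> L * norm (x - y)" and e: "0 < e"
  obtains f where "f \<in> Cc_smooth UNIV" "\<And>x. 0 \<le> f x" "\<And>x. R + e < norm x \<Longrightarrow> f x = 0"
    "\<And>x y. norm x = norm y \<Longrightarrow> f x = f y" "\<And>x. \<bar>f x - w x\<bar> \<le> L * e" "\<And>h. Jh h f \<le> Jh h w"
proof -
  obtain \<rho> :: "real^3 \<Rightarrow> real" where \<rho>: "\<rho> \<in> Cc_smooth UNIV" "\<And>x. 0 \<le> \<rho> x" "\<And>x. e < norm x \<Longrightarrow> \<rho> x = 0"
    "integral\<^sup>L lborel \<rho> = 1" "\<And>x y. norm x = norm y \<Longrightarrow> \<rho> x = \<rho> y"
    using radial_mollifier_exists[OF e] by blast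
  interpret mollifier w R \<rho> e
    by unfold_locales (use u(2) \<rho> in \<open>blast intro: Lipschitz_continuous[OF Lip(2)]\<close>)+
  show ?thesis
  proof (rule that[of "conv w \<rho>"])
    show "conv w \<rho> \<in> Cc_smooth UNIV" by (rule conv_Cc_smooth[OF \<rho>(1) \<rho>(3)])
    show "0 \<le> conv w \<rho> x" for x unfolding conv_def using u(1) \<rho>(2) by (intro Bochner_Integration.integral_nonneg) auto
    show "conv w \<rho> x = 0" if "R + e < norm x" for x by (rule conv_outside[OF \<rho>(3) that])
    show "conv w \<rho> x = conv w \<rho> y" if "norm x = norm y" for x y
      by (rule conv_radial[OF mollification_axioms \<rho>(1) u(3) \<rho>(5) that])
    show "\<bar>conv w \<rho> x - w x\<bar> \<le> L * e" for x by (rule conv_close[OF Lip])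
    show "Jh h (conv w \<rho>) \<le> Jh h w" for h by (rule Jh_conv[OF mollifier_axioms])
  qed
qed

subsection \<open>Reduction to radial test functions\<close>

text \<open>The strict inequality leaves room for three approximations, each made fine enough in
  turn: truncating the weight at \<open>d\<close>, mollifying the radial minimiser, and cutting off
  near the origin. Up to the last one the energy stays below \<open>Edir u\<close>.\<close>

theorem radial_reduction:
  fixes u :: "real^3 \<Rightarrow> real"
  assumes p: "2 < p" "p \<le> 6" and u: "u \<in> Cc_smooth UNIV" and C: "0 \<le> C"
    and less: "Edir u < C * Nw p u powr (2 / p)"
  obtains g where "g \<in> Cc_smooth (UNIV - {0})" "\<And>x y. norm x = norm y \<Longrightarrow> g x = g y"
    "Edir g < C * Nw p g powr (2 / p)"
proof -
  define s where "s = (p - 6) / 2"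
  have s: "s \<le> 0" using p by (simp add: s_def)
  have sm: "smooth_on UNIV u" using u by (rule Cc_smooth_smooth)
  obtain K where K: "compact K" "\<And>x. x \<notin> K \<Longrightarrow> u x = 0" using Cc_smoothD[OF u] by metis
  obtain R where R: "0 < R" "\<And>x. x \<in> K \<Longrightarrow> norm x \<le> R"
    using compact_imp_bounded[OF K(1)] unfolding bounded_pos by blast
  have out: "u x = 0" if "R < norm x" for x using R(2)[of x] K(2)[of x] that by fastforce
  obtain L where L: "0 \<le> L" "\<And>x y. \<bar>u x - u y\<bar> \<le> L * norm (x - y)"
    using Cc_smooth_Lipschitz[OF u] by metis
  have cu: "continuous_on U u" for U using smooth_on_continuous[OF sm] continuous_on_subset by blast
  have um[measurable]: "u \<in> borel_measurable borel" using cu by (rule borel_measurable_continuous_onI)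
  have E0: "0 \<le> Edir f" for f :: "real^3 \<Rightarrow> real" by (simp add: Bochner_Integration.integral_nonneg)
  have "0 < C * Nw p u powr (2 / p)" using less E0[of u] by linarith
  then have N0: "Nw p u \<noteq> 0" and C: "0 < C" using C by (auto simp: zero_less_mult_iff)
  \<comment> \<open>A Bochner integral different from 0 certifies integrability.\<close>
  have int: "integrable lborel (\<lambda>x. norm x powr s * \<bar>u x\<bar> powr p)"
    using N0 not_integrable_integral_eq unfolding s_def by blast
  \<comment> \<open>Truncation makes the weight bounded and continuous at the origin and keeps it
    decreasing. \<open>W\<close> lies below the true weight off the origin, so a strict inequality
    for \<open>W\<close> yields one for the true weight.\<close>
  define W where "W d r = max r d powr s" for d r :: real
  have Wle: "W d r \<le> r powr s" if "0 < r" for d r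
    unfolding W_def using that s by (intro powr_mono2') auto
  have W0: "0 \<le> W d r" for d r by (simp add: W_def)
  have Wanti: "W d r' \<le> W d r" if "0 < d" "0 \<le> r" "r \<le> r'" for d r r'
    unfolding W_def using that s by (intro powr_mono2') auto
  have Wc: "continuous_on {0..} (W d)" if "0 < d" for d
    unfolding W_def[abs_def] using that by (intro continuous_on_powr' continuous_intros) auto
  have Wnc: "continuous_on U (\<lambda>x::real^3. W d (norm x))" if "0 < d" for d U
    by (rule continuous_on_compose2[OF Wc[OF that]]) (auto intro!: continuous_intros)
  have Wm: "(\<lambda>x::real^3. W d (norm x)) \<in> borel_measurable borel" if "0 < d" for d
    using Wnc[OF that] by (rule borel_measurable_continuous_onI)
  define I where "I d f = (LINT x|lborel. W d (norm x) * \<bar>f x\<bar> powr p)" for d and f :: "real^3 \<Rightarrow> real"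
  have meas: "(\<lambda>x. W d (norm x) * \<bar>f x\<bar> powr p) \<in> borel_measurable borel"
    if "0 < d" "f \<in> borel_measurable borel" for d and f :: "real^3 \<Rightarrow> real"
    by (intro borel_measurable_times Wm powr_real_measurable borel_measurable_abs that borel_measurable_const)
  have I0: "0 \<le> I d f" for d f unfolding I_def using W0 by (intro Bochner_Integration.integral_nonneg) auto
  have "(\<lambda>n. I (1 / real (Suc n)) u) \<longlonglongrightarrow> (LINT x|lborel. norm x powr s * \<bar>u x\<bar> powr p)"
    unfolding I_def
  proof (rule integral_dominated_convergence[OF _ _ int])
    show "AE x in lborel. (\<lambda>n. W (1 / real (Suc n)) (norm x) * \<bar>u x\<bar> powr p) \<longlonglongrightarrow> norm x powr s * \<bar>u x\<bar> powr p"
    proof (rule AE_mp[OF AE_lborel_singleton[of 0]], rule AE_I2, rule impI)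
      fix x :: "real^3" assume "x \<noteq> 0"
      then have "(\<lambda>n. max (norm x) (1 / real (Suc n)) powr s * \<bar>u x\<bar> powr p) \<longlonglongrightarrow> max (norm x) 0 powr s * \<bar>u x\<bar> powr p"
        by (intro tendsto_intros LIMSEQ_Suc[OF lim_1_over_n]) auto
      then show "(\<lambda>n. W (1 / real (Suc n)) (norm x) * \<bar>u x\<bar> powr p) \<longlonglongrightarrow> norm x powr s * \<bar>u x\<bar> powr p"
        by (simp add: W_def)
    qed
    show "AE x in lborel. norm (W (1 / real (Suc n)) (norm x) * \<bar>u x\<bar> powr p) \<le> norm x powr s * \<bar>u x\<bar> powr p" for n
    proof (rule AE_mp[OF AE_lborel_singleton[of 0]], rule AE_I2, rule impI)
      fix x :: "real^3" assume "x \<noteq> 0"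
      then have "W (1 / real (Suc n)) (norm x) * \<bar>u x\<bar> powr p \<le> norm x powr s * \<bar>u x\<bar> powr p"
        by (intro mult_right_mono Wle) auto
      then show "norm (W (1 / real (Suc n)) (norm x) * \<bar>u x\<bar> powr p) \<le> norm x powr s * \<bar>u x\<bar> powr p"
        using W0 by simp
    qed
  qed (use int meas[OF _ um] in auto)
  then have "(\<lambda>n. C * I (1 / real (Suc n)) u powr (2 / p)) \<longlonglongrightarrow> C * Nw p u powr (2 / p)"
    unfolding s_def using p I0 by (intro tendsto_mult tendsto_const tendsto_powr') auto
  from order_tendstoD(1)[OF this less]
  obtain n where "Edir u < C * I (1 / real (Suc n)) u powr (2 / p)"
    using eventually_happens[of _ sequentially] by auto
  then obtain d where d: "0 < d" "Edir u < C * I d u powr (2 / p)"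
    by (metis of_nat_0_less_iff zero_less_Suc zero_less_divide_1_iff)
  define B where "B = K0 * ennreal (Edir u)"
  interpret S: symmetrization R L p "I d u" B "W d"
    by unfold_locales (use R L p W0 Wanti[OF d(1)] Wc[OF d(1)] in auto)
  have "S.ad (\<lambda>x. \<bar>u x\<bar>)"
    unfolding adm_def
  proof (intro conjI allI impI)
    show "\<bar>\<bar>u x\<bar> - \<bar>u y\<bar>\<bar> \<le> L * norm (x - y)" for x y using L(2)[of x y] by linarith
    show "Jh h (\<lambda>x. \<bar>u x\<bar>) \<le> ennreal (h ^ 5) * B" if "0 < h" for h
      unfolding B_def using Jh_abs Jh_le_Edir[OF u that] by (rule order_trans)
  qed (use out in \<open>auto simp: I_def\<close>)
  then obtain w where w: "S.ad w" and wr: "\<And>x y. norm x = norm y \<Longrightarrow> w x = w y"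
    using S.radial_exists by metis
  note wD = S.adD[OF w]
  have "\<exists>f. f \<in> Cc_smooth UNIV \<and> (\<forall>x. 0 \<le> f x) \<and> (\<forall>x. R + 1 / real (Suc n) < norm x \<longrightarrow> f x = 0)
    \<and> (\<forall>x y. norm x = norm y \<longrightarrow> f x = f y) \<and> (\<forall>x. \<bar>f x - w x\<bar> \<le> L * (1 / real (Suc n))) \<and> (\<forall>h. Jh h f \<le> Jh h w)" for n
  proof -
    have "0 < 1 / real (Suc n)" by simp
    from radial_mollification[OF wD(1) wD(3) wr L(1) wD(2) this] show ?thesis by metis
  qed
  then obtain f where f: "\<And>n. f n \<in> Cc_smooth UNIV" "\<And>n x. 0 \<le> f n x" "\<And>n x. R + 1 / real (Suc n) < norm x \<Longrightarrow> f n x = 0"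
    "\<And>n x y. norm x = norm y \<Longrightarrow> f n x = f n y" "\<And>n x. \<bar>f n x - w x\<bar> \<le> L * (1 / real (Suc n))" "\<And>n h. Jh h (f n) \<le> Jh h w"
    by metis
  have Ef: "Edir (f n) \<le> Edir u" for n
  proof (rule Edir_le_of_Jh[OF f(1) E0])
    show "Jh h (f n) \<le> ennreal (h ^ 5) * (K0 * ennreal (Edir u))" if "0 < h" for h
      using f(6) wD(4)[OF that] unfolding B_def by (rule order_trans)
  qed
  have cf: "continuous_on U (f n)" for n U
    using smooth_on_continuous[OF Cc_smooth_smooth[OF f(1)]] continuous_on_subset by blast
  have fm: "f n \<in> borel_measurable borel" for n using cf by (rule borel_measurable_continuous_onI)
  have lim: "(\<lambda>n. f n x) \<longlonglongrightarrow> w x" for x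
  proof -
    have "(\<lambda>n. f n x - w x) \<longlonglongrightarrow> 0"
    proof (rule tendsto_0_le[where K=L and f="\<lambda>n. 1 / real (Suc n)"])
      show "\<forall>\<^sub>F n in sequentially. norm (f n x - w x) \<le> norm (1 / real (Suc n)) * L"
        using f(5)[of _ x] by (simp add: mult.commute)
    qed (rule LIMSEQ_Suc[OF lim_1_over_n])
    then show ?thesis by (simp add: LIM_zero_iff)
  qed
  \<comment> \<open>A common bound for all \<open>f n\<close>: the bound of \<open>ad_bound\<close>
    for \<open>w\<close> plus a mollification error of at most \<open>L\<close>.\<close>
  define M where "M = L * (2 * R + 1) + L"
  have "(\<lambda>n. I d (f n)) \<longlonglongrightarrow> I d w"
    unfolding I_def
  proof (rule integral_dominated_convergence[where w="\<lambda>x. (W d 0 * M powr p) * indicator (cball 0 (R + 1)) x"])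
    show "integrable lborel (\<lambda>x. (W d 0 * M powr p) * indicator (cball (0::real^3) (R + 1)) x)"
      using emeasure_lborel_cball_finite[of "0::real^3" "R + 1"] by (intro integrable_mult_right integrable_real_indicator) auto
    show "AE x in lborel. (\<lambda>n. W d (norm x) * \<bar>f n x\<bar> powr p) \<longlonglongrightarrow> W d (norm x) * \<bar>w x\<bar> powr p"
      using p by (intro AE_I2 tendsto_mult tendsto_const tendsto_powr' tendsto_rabs lim) auto
    show "AE x in lborel. norm (W d (norm x) * \<bar>f n x\<bar> powr p) \<le> (W d 0 * M powr p) * indicator (cball 0 (R + 1)) x" for n
    proof (rule AE_I2)
      fix x :: "real^3"
      have n1: "1 / real (Suc n) \<le> 1" by simp
      show "norm (W d (norm x) * \<bar>f n x\<bar> powr p) \<le> (W d 0 * M powr p) * indicator (cball 0 (R + 1)) x"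
      proof (cases "norm x \<le> R + 1")
        case True
        have "L * (1 / real (Suc n)) \<le> L * 1" by (intro mult_left_mono n1 L)
        then have "\<bar>f n x\<bar> \<le> M" using f(5)[of n x] f(2)[of n x] S.ad_bound[OF w, of x] by (simp add: M_def)
        then have "W d (norm x) * \<bar>f n x\<bar> powr p \<le> W d 0 * M powr p"
          using p by (intro mult_mono powr_mono2 Wanti[OF d(1)] W0) auto
        then show ?thesis using True W0 by simp
      next
        case False
        then have "R + 1 / real (Suc n) < norm x" using n1 by linarith
        then show ?thesis using False p f(3) by simp
      qed
    qed
  qed (use meas[OF d(1) wD(7)] meas[OF d(1) fm] in auto)
  then have "(\<lambda>n. C * I d (f n) powr (2 / p)) \<longlonglongrightarrow> C * I d w powr (2 / p)"
    using p I0 by (intro tendsto_mult tendsto_const tendsto_powr') auto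
  moreover have "Edir u < C * I d w powr (2 / p)"
  proof -
    have "I d u \<le> I d w" using wD(5) wD(1) by (simp add: I_def)
    then have "C * I d u powr (2 / p) \<le> C * I d w powr (2 / p)"
      using p I0 C by (intro mult_left_mono powr_mono2) auto
    then show ?thesis using d(2) by linarith
  qed
  ultimately have "eventually (\<lambda>n. Edir u < C * I d (f n) powr (2 / p)) sequentially" by (rule order_tendstoD(1))
  then obtain n where "Edir u < C * I d (f n) powr (2 / p)"
    using eventually_happens[of _ sequentially] by auto
  then have En: "Edir (f n) < C * I d (f n) powr (2 / p)" using Ef[of n] by linarith
  define k where "k = f n"
  have k: "k \<in> Cc_smooth UNIV" "\<And>x y. norm x = norm y \<Longrightarrow> k x = k y" "Edir k < C * I d k powr (2 / p)"
    using f(1)[of n] f(4)[of _ _ n] En unfolding k_def by blast+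
  have ck: "continuous_on U k" for U unfolding k_def by (rule cf)
  obtain Kk where Kk: "compact Kk" "\<And>x. x \<notin> Kk \<Longrightarrow> k x = 0" using Cc_smoothD[OF k(1)] by metis
  define G where "G m x = 1 * (norm (grad (\<lambda>x. eta m x * k x) x))\<^sup>2" for m x
  have "\<exists>c\<ge>0. \<forall>m \<delta>. 1 \<le> m \<longrightarrow> 0 < \<delta> \<longrightarrow> integral\<^sup>L lborel (G m) \<le> (1 + \<delta>) * Edir k + (1 + 1 / \<delta>) * (c / real m)"
  proof (rule cutoff_energy[OF Cc_smooth_smooth[OF k(1)] Kk continuous_on_const[of Kk "1::real"]])
    show "0 \<le> (1::real)" if "x \<in> Kk" for x by simp
    fix c assume c: "0 \<le> c" and b: "\<And>m \<delta>. 1 \<le> m \<Longrightarrow> 0 < \<delta> \<Longrightarrow>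
      (LINT x|lborel. 1 * (norm (grad (\<lambda>x. eta m x * k x) x))\<^sup>2) \<le> (1 + \<delta>) * (LINT x|lborel. 1 * (norm (grad k x))\<^sup>2) + (1 + 1 / \<delta>) * (c / real m)"
    show ?thesis
      by (intro exI[of _ c] conjI allI impI c) (use b in \<open>simp add: G_def[abs_def]\<close>)
  qed
  then obtain c where c: "0 \<le> c" "\<And>m \<delta>. 1 \<le> m \<Longrightarrow> 0 < \<delta> \<Longrightarrow>
    integral\<^sup>L lborel (G m) \<le> (1 + \<delta>) * Edir k + (1 + 1 / \<delta>) * (c / real m)" by blast
  obtain a where a: "a \<longlonglongrightarrow> I d k" "\<And>m. 0 \<le> a m" "\<And>m. a m \<le> (LINT x|lborel. eta m x powr p * (W d (norm x) * \<bar>k x\<bar> powr p))"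
  proof (rule cutoff_limit[of "\<lambda>x. W d (norm x) * \<bar>k x\<bar> powr p" p])
    show "(\<lambda>x. W d (norm x) * \<bar>k x\<bar> powr p) \<in> borel_measurable borel"
      using meas[OF d(1) fm[of n]] by (simp add: k_def)
  qed (use W0 p in \<open>auto simp: I_def\<close>)
  define Q where "Q = C * I d k powr (2 / p)"
  define E e where "E = Edir k" and "e = E + 1"
  have e: "0 < e" using E0[of k] unfolding e_def E_def by linarith
  have QE: "E < Q" using k(3) by (simp add: Q_def E_def)
  \<comment> \<open>With this choice \<delta> (E + 1) is half of the gap Q - E, so (1 + \<delta>) E
    stays below \<open>Q\<close>. Using E + 1 avoids a vanishing denominator.\<close>
  define \<delta> where "\<delta> = (Q - E) / (2 * e)"
  have \<delta>: "0 < \<delta>" unfolding \<delta>_def using QE e by simp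
  have "\<delta> * e = (Q - E) / 2" unfolding \<delta>_def using e by simp
  then have "(1 + \<delta>) * E < Q" using QE \<delta> by (simp add: e_def algebra_simps)
  then have "(1 + \<delta>) * Edir k < Q" unfolding E_def .
  moreover have "(\<lambda>m. (1 + \<delta>) * Edir k + (1 + 1 / \<delta>) * (c / real m)) \<longlonglongrightarrow> (1 + \<delta>) * Edir k + (1 + 1 / \<delta>) * 0"
    by (intro tendsto_intros tendsto_divide_0[OF tendsto_const] filterlim_at_top_imp_at_infinity filterlim_real_sequentially)
  moreover have "(\<lambda>m. C * a m powr (2 / p)) \<longlonglongrightarrow> Q"
    unfolding Q_def using p a by (intro tendsto_mult tendsto_const tendsto_powr') auto
  ultimately have "(\<lambda>m. C * a m powr (2 / p) - ((1 + \<delta>) * Edir k + (1 + 1 / \<delta>) * (c / real m))) \<longlonglongrightarrow> Q - ((1 + \<delta>) * Edir k + (1 + 1 / \<delta>) * 0)"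
    "0 < Q - ((1 + \<delta>) * Edir k + (1 + 1 / \<delta>) * 0)" by (auto intro!: tendsto_diff)
  then have "eventually (\<lambda>m. 0 < C * a m powr (2 / p) - ((1 + \<delta>) * Edir k + (1 + 1 / \<delta>) * (c / real m))) sequentially"
    by (rule order_tendstoD(1))
  then obtain m where m: "1 \<le> m" "(1 + \<delta>) * Edir k + (1 + 1 / \<delta>) * (c / real m) < C * a m powr (2 / p)"
    using eventually_happens[OF eventually_conj[OF _ eventually_ge_at_top[of 1]]] by (metis (no_types, lifting) diff_gt_0_iff_gt trivial_limit_sequentially)
  define g where "g x = eta m x * k x" for x
  have gC: "g \<in> Cc_smooth (UNIV - {0})" unfolding g_def[abs_def] by (rule cutoff_Cc_smooth[OF k(1) open_UNIV m(1)])
  have gr: "g x = g y" if "norm x = norm y" for x y using that k(2)[OF that] by (simp add: g_def eta_def)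
  have "Edir g \<le> (1 + \<delta>) * Edir k + (1 + 1 / \<delta>) * (c / real m)"
    using c(2)[OF m(1) \<delta>] by (simp add: g_def[abs_def] G_def[abs_def])
  also have "\<dots> < C * a m powr (2 / p)" by (rule m(2))
  also have "\<dots> \<le> C * Nw p g powr (2 / p)"
  proof -
    obtain Kg where Kg: "compact Kg" "Kg \<subseteq> UNIV - {0}" "\<And>x. x \<notin> Kg \<Longrightarrow> g x = 0" using Cc_smoothD[OF gC] by metis
    have cg: "continuous_on U g" for U unfolding g_def
      using continuous_on_subset[OF smooth_on_continuous[OF smooth_on_eta, of m]] by (intro continuous_on_mult ck) auto
    have "a m \<le> (LINT x|lborel. W d (norm x) * \<bar>g x\<bar> powr p)"
    proof -
      have e: "W d (norm x) * \<bar>g x\<bar> powr p = eta m x powr p * (W d (norm x) * \<bar>k x\<bar> powr p)" for x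
        by (simp add: g_def abs_mult powr_mult eta_bounds abs_of_nonneg)
      show ?thesis unfolding e by (rule a(3))
    qed
    also have "\<dots> \<le> (LINT x|lborel. norm x powr s * \<bar>g x\<bar> powr p)"
    proof (rule integral_mono)
      have ca: "continuous_on Kg (\<lambda>x. \<bar>g x\<bar> powr p)" using p cg by (intro continuous_on_abs_powr) auto
      show "integrable lborel (\<lambda>x. W d (norm x) * \<bar>g x\<bar> powr p)"
        by (rule integrable_compact_support[OF Kg(1) continuous_on_mult[OF Wnc[OF d(1)] ca]]) (use p Kg(3) in simp)
      have "continuous_on Kg (\<lambda>x. norm x powr s)" using Kg(2) by (intro continuous_on_powr' continuous_intros) auto
      from continuous_on_mult[OF this ca]
      show "integrable lborel (\<lambda>x. norm x powr s * \<bar>g x\<bar> powr p)"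
        by (rule integrable_compact_support[OF Kg(1)]) (use p Kg(3) in simp)
      show "W d (norm x) * \<bar>g x\<bar> powr p \<le> norm x powr s * \<bar>g x\<bar> powr p" for x
      proof (cases "x = 0")
        case True
        then have "g x = 0" using Kg by blast
        then show ?thesis using p by simp
      qed (auto intro!: mult_right_mono Wle)
    qed
    finally show ?thesis using p a(2) C unfolding s_def by (intro mult_left_mono powr_mono2) auto
  qed
  finally show ?thesis using that[OF gC gr] by simp
qed

subsection \<open>Sharpness\<close>

text \<open>For \<open>h\<close> orthogonal to \<open>x\<close> the function s -> f (x + s h) is
  even, so its derivative at 0 vanishes and the gradient is parallel to \<open>x\<close>.\<close>

lemma radial_gradient:
  fixes f :: "'a::euclidean_space \<Rightarrow> real"
  assumes f: "f differentiable (at x)" "\<And>y z. norm y = norm z \<Longrightarrow> f y = f z" and x: "x \<noteq> 0"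
  shows "(norm (grad f x))\<^sup>2 = (x \<bullet> grad f x)\<^sup>2 / (norm x)\<^sup>2"
proof -
  have orth: "grad f x \<bullet> h = 0" if h: "x \<bullet> h = 0" for h
  proof -
    have d: "((\<lambda>s. f (x + s *\<^sub>R h)) has_real_derivative (grad f x \<bullet> h)) (at 0)"
      using DERIV_line[of f x 0 h UNIV] f(1) by simp
    have even: "f (x + (- s) *\<^sub>R h) = f (x + s *\<^sub>R h)" for s
    proof (rule f(2))
      have "(norm (x + (- s) *\<^sub>R h))\<^sup>2 = (norm (x + s *\<^sub>R h))\<^sup>2"
        unfolding power2_norm_eq_inner using h by (simp add: inner_add_left inner_add_right inner_commute algebra_simps)
      then show "norm (x + (- s) *\<^sub>R h) = norm (x + s *\<^sub>R h)" by (simp only: power2_eq_iff_nonneg norm_ge_zero)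
    qed
    have "((\<lambda>s. f (x + (- s) *\<^sub>R h)) has_real_derivative - (grad f x \<bullet> h)) (at 0)"
    proof -
      have "((\<lambda>s. f (x + s *\<^sub>R h)) has_real_derivative (grad f x \<bullet> h)) (at (- 0))" using d by simp
      from iffD1[OF DERIV_mirror this] show ?thesis .
    qed
    then have "((\<lambda>s. f (x + s *\<^sub>R h)) has_real_derivative - (grad f x \<bullet> h)) (at 0)" unfolding even .
    from DERIV_unique[OF d this] show ?thesis by simp
  qed
  define c where "c = (x \<bullet> grad f x) / (norm x)\<^sup>2"
  have "x \<bullet> (grad f x - c *\<^sub>R x) = 0"
    using x by (simp add: inner_diff_right c_def power2_norm_eq_inner)
  from orth[OF this] have "grad f x \<bullet> grad f x = c * (x \<bullet> grad f x)"
    by (simp add: inner_diff_right inner_commute)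
  then have "(norm (grad f x))\<^sup>2 = c * (x \<bullet> grad f x)" by (simp only: power2_norm_eq_inner)
  then show ?thesis by (simp add: c_def power2_eq_square)
qed

text \<open>The field \<open>g x *\<^sub>R x\<close> with c = 1/(r (1 - r^2)) matches the cross term
  \<phi> (x \<bullet> grad \<phi>). After this the two sides differ pointwise by \<phi>^2/(r (1 -
  r^2)^2) and a divergence, and the former is dropped as nonnegative.\<close>

lemma ground_state_upper:
  fixes \<phi> :: "real^3 \<Rightarrow> real"
  assumes \<phi>: "\<phi> \<in> Cc_smooth pball"
  defines "\<psi> \<equiv> \<lambda>x. 1 / sqrt (1 - (norm x)\<^sup>2) * \<phi> x"
  assumes \<psi>C: "\<psi> \<in> Cc_smooth pball"
  shows "(LINT x|lborel. (1 - (norm x)\<^sup>2) / norm x * (norm (grad \<psi> x))\<^sup>2 + (\<psi> x)\<^sup>2 / norm x)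
    \<le> (LINT x|lborel. (norm (grad \<phi> x))\<^sup>2 / norm x)"
proof -
  have sm: "smooth_on U \<phi>" for U using \<phi> by (rule Cc_smooth_smooth)
  have c\<phi>: "continuous_on U \<phi>" for U using smooth_on_continuous[OF sm] .
  have cg\<phi>: "continuous_on U (grad \<phi>)" for U using smooth_on_grad_continuous[OF sm] .
  obtain K where K: "compact K" "K \<subseteq> pball" "\<And>x. x \<notin> K \<Longrightarrow> \<phi> x = 0" using Cc_smoothD[OF \<phi>] by metis
  have g\<phi>: "grad \<phi> x = 0" if "x \<notin> K" for x
    using grad_zero_outside[OF compact_imp_closed[OF K(1)] K(3) that] .
  have q1: "(norm x)\<^sup>2 < 1" "1 - (norm x)\<^sup>2 \<noteq> 0" "norm x \<noteq> 0" if "x \<in> pball" for x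
  proof -
    show "(norm x)\<^sup>2 < 1" using that by (auto simp: power_less_one_iff)
    then show "1 - (norm x)\<^sup>2 \<noteq> 0" by simp
    show "norm x \<noteq> 0" using that by simp
  qed
  have sn: "smooth_on pball (norm :: real^3 \<Rightarrow> real)" by (rule smooth_on_subset[OF _ smooth_on_norm]) auto
  have s\<psi>: "smooth_on U \<psi>" for U using \<psi>C by (rule Cc_smooth_smooth)
  have z\<psi>: "\<psi> x = 0" "grad \<psi> x = 0" if "x \<notin> K" for x
    using grad_zero_outside[OF compact_imp_closed[OF K(1)], of \<psi> x] that K(3) by (auto simp: \<psi>_def)
  define c where "c r = 1 / (r * (1 - r\<^sup>2))" for r :: real
  define g where "g x = c (norm x) * (\<phi> x)\<^sup>2" for x
  have smg: "smooth_on pball g"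
    unfolding g_def[abs_def] c_def
    by (intro smooth_on_mult smooth_on_divide smooth_on_diff smooth_on_const sn
        smooth_on_power[OF _ sm] smooth_on_norm_sq open_pball) (use q1 in auto)
  have gC: "g \<in> Cc_smooth UNIV"
    by (rule Cc_smooth_mono[OF subset_UNIV Cc_smoothI[OF open_pball K(1,2) smg]]) (simp add: g_def K(3))
  have smg': "smooth_on U g" for U using gC by (rule Cc_smooth_smooth)
  have zg: "g x = 0" "grad g x = 0" if "x \<notin> K" for x
    using grad_zero_outside[OF compact_imp_closed[OF K(1)], of g x] that K(3) by (auto simp: g_def)
  note int = integrable_compact_support[OF K(1)]
  have Kn: "\<forall>x\<in>K. norm x \<noteq> 0" using K(2) q1 by blast
  have i1: "integrable lborel (\<lambda>x. (norm (grad \<phi> x))\<^sup>2 / norm x)"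
    by (intro int continuous_intros cg\<phi> Kn) (simp add: g\<phi>)
  have i2: "integrable lborel (\<lambda>x. (1 - (norm x)\<^sup>2) / norm x * (norm (grad \<psi> x))\<^sup>2 + (\<psi> x)\<^sup>2 / norm x)"
    by (intro int continuous_intros smooth_on_continuous[OF s\<psi>] smooth_on_grad_continuous[OF s\<psi>] Kn) (simp add: z\<psi>)
  have i3: "integrable lborel (\<lambda>x. 3 * g x + grad g x \<bullet> x)"
    by (intro int continuous_intros smooth_on_continuous[OF smg'] smooth_on_grad_continuous[OF smg']) (simp add: zg)
  have div0: "(LINT x|lborel. 3 * g x + grad g x \<bullet> x) = 0"
    using integral_radial_divergence[OF gC] by simp
  have pw: "(1 - (norm x)\<^sup>2) / norm x * (norm (grad \<psi> x))\<^sup>2 + (\<psi> x)\<^sup>2 / norm x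
      \<le> (norm (grad \<phi> x))\<^sup>2 / norm x + (3 * g x + grad g x \<bullet> x)" for x
  proof (cases "x \<in> K")
    case True
    then have x: "x \<in> pball" using K by blast
    define r q s where "r = norm x" and "q = r\<^sup>2" and "s = 1 - q"
    have r: "0 < r" using x by (simp add: r_def)
    have s: "0 < s" using q1[OF x] by (simp add: s_def q_def r_def)
    have xx: "x \<bullet> x = q" by (simp add: q_def r_def power2_norm_eq_inner)
    define m where "m = 1 / sqrt s"
    define m' where "m' = 1 / (s * sqrt s)"
    define P where "P = (norm (grad \<phi> x))\<^sup>2"
    define R where "R = x \<bullet> grad \<phi> x"
    define V where "V = \<phi> x"
    have sr: "sqrt s * sqrt s = s" "sqrt s \<noteq> 0" using s by auto
    have "((\<lambda>q. 1 / sqrt (1 - q)) has_real_derivative m' / 2) (at q)"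
    proof -
      have "((\<lambda>q. 1 / sqrt (1 - q)) has_real_derivative - (inverse (sqrt (1 - q)) / 2 * (- 1)) / (sqrt (1 - q) * sqrt (1 - q))) (at q)"
        using s by (auto intro!: derivative_eq_intros simp: s_def)
      also have "- (inverse (sqrt (1 - q)) / 2 * (- 1)) / (sqrt (1 - q) * sqrt (1 - q)) = m' / 2"
        unfolding m'_def s_def[symmetric] sr(1) using s by (simp add: field_simps)
      finally show ?thesis .
    qed
    from GDERIV_compose_normsq[OF this[unfolded q_def r_def]]
    have dm: "GDERIV (\<lambda>x. 1 / sqrt (1 - (norm x)\<^sup>2)) x :> m' *\<^sub>R x" by simp
    have g\<psi>: "grad \<psi> x = m *\<^sub>R grad \<phi> x + (V * m') *\<^sub>R x"
    proof (rule grad_eqI)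
      show "GDERIV \<psi> x :> m *\<^sub>R grad \<phi> x + (V * m') *\<^sub>R x"
        using GDERIV_mult[OF dm GDERIV_grad[OF smooth_on_differentiable[OF sm[of UNIV]]]]
        unfolding \<psi>_def by (simp add: m_def s_def q_def r_def V_def)
    qed
    have n1: "(norm (grad \<psi> x))\<^sup>2 = m\<^sup>2 * P + 2 * (m * m') * V * R + V\<^sup>2 * m'\<^sup>2 * q"
      unfolding power2_norm_eq_inner g\<psi> P_def R_def
      by (simp add: inner_add_left inner_add_right xx inner_commute[of "grad \<phi> x" x] power2_eq_square algebra_simps)
    have n2: "m\<^sup>2 = 1 / s" "m * m' = 1 / s\<^sup>2" "m'\<^sup>2 = 1 / s ^ 3"
      unfolding m_def m'_def using s sr by (simp_all add: power_divide power_mult_distrib eval_nat_numeral)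
    have e1: "s / r * (norm (grad \<psi> x))\<^sup>2 = P / r + 2 * V * R / (r * s) + V\<^sup>2 * q / (r * s\<^sup>2)"
      unfolding n1 n2 using r s by (simp add: field_simps eval_nat_numeral)
    have e2: "(\<psi> x)\<^sup>2 / r = V\<^sup>2 / (s * r)"
      unfolding \<psi>_def r_def[symmetric] q_def[symmetric] s_def[symmetric] V_def[symmetric]
      using s by (simp add: power_divide)
    define c' where "c' = - ((1 - 3 * q) / (q * s\<^sup>2))"
    have "(c has_real_derivative c') (at r)"
    proof -
      have "(c has_real_derivative - (1 - 3 * r\<^sup>2) / ((r * (1 - r\<^sup>2)) * (r * (1 - r\<^sup>2)))) (at r)"
        unfolding c_def[abs_def] using r s
        by (auto intro!: derivative_eq_intros simp: s_def q_def) (simp add: power2_eq_square algebra_simps)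
      moreover have "- (1 - 3 * r\<^sup>2) / ((r * (1 - r\<^sup>2)) * (r * (1 - r\<^sup>2))) = c'"
        unfolding c'_def s_def q_def minus_divide_left by (simp add: power2_eq_square mult_ac)
      ultimately show ?thesis by simp
    qed
    from GDERIV_DERIV_compose[OF GDERIV_norm, of x, OF _ this[unfolded r_def]]
    have dc: "GDERIV (\<lambda>x. c (norm x)) x :> (c' / r) *\<^sub>R x"
      using r by (simp add: sgn_div_norm r_def divide_inverse)
    have gg: "grad g x = (2 * c r * V) *\<^sub>R grad \<phi> x + (V\<^sup>2 * (c' / r)) *\<^sub>R x"
    proof (rule grad_eqI)
      have 2: "GDERIV (\<lambda>x. (\<phi> x)\<^sup>2) x :> (2 * V) *\<^sub>R grad \<phi> x"
        using GDERIV_power[OF GDERIV_grad[OF smooth_on_differentiable[OF sm[of UNIV]]], of x 2] by (simp add: V_def)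
      show "GDERIV g x :> (2 * c r * V) *\<^sub>R grad \<phi> x + (V\<^sup>2 * (c' / r)) *\<^sub>R x"
        unfolding g_def[abs_def] by (rule GDERIV_subst[OF GDERIV_mult[OF dc 2]]) (simp add: V_def r_def)
    qed
    have "3 * g x + grad g x \<bullet> x = 3 * c r * V\<^sup>2 + 2 * c r * V * R + V\<^sup>2 * (c' / r) * q"
      unfolding gg g_def r_def[symmetric] V_def[symmetric]
      by (simp add: inner_add_left xx R_def inner_commute[of "grad \<phi> x" x])
    also have "V\<^sup>2 * (c' / r) * q = V\<^sup>2 * (- ((1 - 3 * q) / (r * s\<^sup>2)))"
      unfolding c'_def using r by (simp add: q_def)
    also have "c r = 1 / (r * s)" by (simp add: c_def s_def q_def)
    finally have e3: "3 * g x + grad g x \<bullet> x = 2 * V * R / (r * s) + V\<^sup>2 * (3 / (r * s) - (1 - 3 * q) / (r * s\<^sup>2))"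
      by (simp add: right_diff_distrib)
    have e4: "V\<^sup>2 * (3 / (r * s) - (1 - 3 * q) / (r * s\<^sup>2)) = V\<^sup>2 * q / (r * s\<^sup>2) + V\<^sup>2 / (s * r) + V\<^sup>2 / (r * s\<^sup>2)"
    proof -
      have "3 / (r * s) - (1 - 3 * q) / (r * s\<^sup>2) = (3 * s - (1 - 3 * q)) / (r * s\<^sup>2)"
        using r s by (simp add: field_simps power2_eq_square)
      also have "3 * s - (1 - 3 * q) = q + s + 1" by (simp add: s_def)
      also have "(q + s + 1) / (r * s\<^sup>2) = q / (r * s\<^sup>2) + 1 / (s * r) + 1 / (r * s\<^sup>2)"
        using r s by (simp add: field_simps power2_eq_square)
      finally show ?thesis by (simp add: distrib_left)
    qed
    have "0 \<le> V\<^sup>2 / (r * s\<^sup>2)" using r by simp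
    then have "s / r * (norm (grad \<psi> x))\<^sup>2 + (\<psi> x)\<^sup>2 / r \<le> P / r + (3 * g x + grad g x \<bullet> x)"
      unfolding e1 e2 e3 e4 by linarith
    then show ?thesis unfolding P_def s_def q_def r_def .
  qed (simp add: g\<phi> z\<psi> zg)
  have "(LINT x|lborel. (1 - (norm x)\<^sup>2) / norm x * (norm (grad \<psi> x))\<^sup>2 + (\<psi> x)\<^sup>2 / norm x)
    \<le> (LINT x|lborel. (norm (grad \<phi> x))\<^sup>2 / norm x + (3 * g x + grad g x \<bullet> x))"
    by (rule integral_mono[OF i2 Bochner_Integration.integrable_add[OF i1 i3] pw])
  also have "\<dots> = (LINT x|lborel. (norm (grad \<phi> x))\<^sup>2 / norm x)"
    unfolding Bochner_Integration.integral_add[OF i1 i3] div0 by simp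
  finally show ?thesis .
qed

lemma sharpness_origin:
  assumes p: "2 < p" "p \<le> 6" and \<alpha>: "0 < \<alpha>" "0 < 1 - ln \<alpha>" and C: "S3 p < C"
  shows "\<exists>v \<in> Cc_smooth hspace. HE v < H1 v + 1 / 4 * H2 v + C * HN p \<alpha> v powr (2 / p)"
proof -
  have C0: "0 \<le> C" using S3_properties(1)[OF p(1)] C by linarith
  obtain u where u: "u \<in> Cc_smooth UNIV" "Edir u < C * Nw p u powr (2 / p)"
    using S3_properties(3)[OF p(1) C] by blast
  obtain g where g: "g \<in> Cc_smooth (UNIV - {0})" "\<And>x y. norm x = norm y \<Longrightarrow> g x = g y"
    and less: "Edir g < C * Nw p g powr (2 / p)"
    using radial_reduction[OF p u(1) C0 u(2)] by blast
  obtain K where K: "compact K" "K \<subseteq> UNIV - {0}" "\<And>x. x \<notin> K \<Longrightarrow> g x = 0" using Cc_smoothD[OF g(1)] by metis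
  obtain R where R: "0 < R" "\<And>x. x \<in> K \<Longrightarrow> norm x \<le> R"
    using compact_imp_bounded[OF K(1)] unfolding bounded_pos by blast
  have "open (- K)" "0 \<in> - K" using K compact_imp_closed by auto
  then obtain r1 where r1: "0 < r1" "ball 0 r1 \<subseteq> - K" by (meson open_contains_ball)
  have supp: "r1 \<le> norm y \<and> norm y \<le> R" if "g y \<noteq> 0" for y
  proof -
    have y: "y \<in> K" using K(3) that by blast
    then have "y \<notin> ball 0 r1" using r1 by blast
    then show ?thesis using R(2)[OF y] by simp
  qed
  \<comment> \<open>The scale makes the image of \<open>Y\<close> the punctured ball of radius R +
    1, which contains the support of \<open>g\<close>.\<close>
  define A L where "A = 1 - ln \<alpha>" and "L = A * (R + 1)"
  have A: "0 < A" using \<alpha> by (simp add: A_def)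
  have L: "0 < L" unfolding L_def using A R by (intro mult_pos_pos) auto
  interpret ym: ymap L A 0 by unfold_locales (use L A in auto)
  have YB: "ym.Y ` pball = ball 0 (R + 1) - {0}" unfolding ym.Y_range using A by (simp add: L_def)
  have gC: "g \<in> Cc_smooth (ym.Y ` pball)"
    unfolding YB
  proof (rule Cc_smoothI[OF _ K(1) _ Cc_smooth_smooth[OF g(1)] K(3)])
    show "K \<subseteq> ball 0 (R + 1) - {0}" using K(2) R(2) by fastforce
  qed (auto simp: open_delete)
  have Sg: "Sig A 0 r = A - ln r" for r by (simp add: Sig_def)
  define \<phi> where "\<phi> x = (if x \<in> pball then g (ym.Y x) else 0)" for x
  \<comment> \<open>The radii that \<open>Y\<close> maps to the spheres of radius \<open>r1\<close>
    and \<open>R\<close>: they solve L / (A - ln r) = r1 and = R. The second is below 1 because L /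
    R exceeds A.\<close>
  define a b where "a = exp (A - L / r1)" and "b = exp (A - L / R)"
  have "A < L / R" using A R by (simp add: L_def field_simps)
  then have b: "b < 1" by (simp add: b_def)
  have a: "0 < a" by (simp add: a_def)
  define K' where "K' = cball (0::real^3) b - ball 0 a"
  have K': "compact K'" "K' \<subseteq> pball" using a b by (auto simp: K'_def compact_diff)
  have \<phi>0: "\<phi> x = 0" if "x \<notin> K'" for x
  proof (rule ccontr)
    assume ne: "\<phi> x \<noteq> 0"
    then have x: "x \<in> pball" by (rule contrapos_np) (simp only: \<phi>_def if_False)
    then have r: "0 < norm x" by auto
    have S: "0 < A - ln (norm x)" using ym.S_pos[OF x] by (simp add: Sg)
    have "g (ym.Y x) \<noteq> 0" using ne x by (simp add: \<phi>_def)
    from supp[OF this] have y: "r1 \<le> L / (A - ln (norm x))" "L / (A - ln (norm x)) \<le> R"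
      unfolding ym.norm_Y[OF x] Sg by auto
    have "A - L / r1 \<le> ln (norm x)" "ln (norm x) \<le> A - L / R"
      using y S r1 R by (auto simp: field_simps)
    then have "a \<le> norm x" "norm x \<le> b" 
      using exp_le_cancel_iff[of "A - L / r1" "ln (norm x)"] exp_le_cancel_iff[of "ln (norm x)" "A - L / R"] exp_ln[OF r]
      by (simp_all add: a_def b_def)
    then show False using that by (auto simp: K'_def)
  qed
  have smw: "smooth_on pball (\<lambda>x. g (ym.Y x))"
    by (rule smooth_on_compose_vec[OF open_pball open_UNIV _ Cc_smooth_smooth[OF g(1)]]) (use ym.Y_smooth in auto)
  have \<phi>C: "\<phi> \<in> Cc_smooth pball"
    by (rule Cc_smoothI[OF open_pball K' smooth_on_cong[OF open_pball _ smw] \<phi>0]) (auto simp: \<phi>_def)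
  have \<phi>r: "\<phi> x = \<phi> y" if "norm x = norm y" for x y
  proof -
    have e: "x \<in> pball \<longleftrightarrow> y \<in> pball" using that by auto
    have "norm (ym.Y x) = norm (ym.Y y)" if "x \<in> pball" "y \<in> pball"
      using ym.norm_Y[OF that(1)] ym.norm_Y[OF that(2)] \<open>norm x = norm y\<close> by simp
    then have "g (ym.Y x) = g (ym.Y y)" if "x \<in> pball" using e g(2) that by blast
    then show ?thesis unfolding \<phi>_def e by simp
  qed
  have gw: "grad (\<lambda>x. g (ym.Y x)) x = grad \<phi> x" if x: "x \<in> pball" for x
    unfolding grad_def
    using frechet_derivative_transform_within_open[OF smooth_on_differentiable[OF smw x] open_pball x, of \<phi>] by (simp add: \<phi>_def)
  define D where "D = (LINT x|lborel. (norm (grad \<phi> x))\<^sup>2 / norm x)"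
  \<comment> \<open>The tangential part vanishes on the radial function, and \<open>kk\<close> is 1
    since a = 0, so the energy is transported exactly up to the scale \<open>L\<close>.\<close>
  have ED: "Edir g = L * D"
  proof -
    have pt: "indicator pball x * (ym.lr x * ((norm (grad (\<lambda>x. g (ym.Y x)) x))\<^sup>2 - (x \<bullet> grad (\<lambda>x. g (ym.Y x)) x)\<^sup>2 / (norm x)\<^sup>2)
      + L / (ym.kk x * norm x) * ((x \<bullet> grad (\<lambda>x. g (ym.Y x)) x)\<^sup>2 / (norm x)\<^sup>2)) = L * ((norm (grad \<phi> x))\<^sup>2 / norm x)" for x
    proof (cases "x \<in> pball")
      case True
      have "(norm (grad \<phi> x))\<^sup>2 = (x \<bullet> grad \<phi> x)\<^sup>2 / (norm x)\<^sup>2"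
        by (rule radial_gradient[OF smooth_on_differentiable[OF Cc_smooth_smooth[OF \<phi>C, of UNIV]] \<phi>r]) (use True in auto)
      from this[symmetric] show ?thesis unfolding gw[OF True] using True by (simp add: ym.kk_def)
    next
      case False
      then have "x \<notin> K'" using K' by blast
      then have "grad \<phi> x = 0" using grad_zero_outside[OF compact_imp_closed[OF K'(1)], of \<phi> x] \<phi>0 by blast
      then show ?thesis using False by simp
    qed
    show ?thesis unfolding ym.Y_dirichlet[OF gC] pt D_def by (rule integral_mult_right_zero)
  qed
  \<comment> \<open>Undoes both substitutions: \<psi> = \<phi> / sqrt (1 - r^2), and
    \<open>v\<close> is \<psi> divided by the ground state factor sqrt (2 r) / (1 - r^2).\<close>
  define v where "v x = sqrt ((1 - (norm x)\<^sup>2) / (2 * norm x)) * \<phi> x" for x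
  have q1: "0 < 1 - (norm x)\<^sup>2" "0 < norm x" if "x \<in> pball" for x
    using that by (auto simp: power_less_one_iff)
  have sn: "smooth_on pball (norm :: real^3 \<Rightarrow> real)" by (rule smooth_on_subset[OF _ smooth_on_norm]) auto
  have "smooth_on pball v"
    unfolding v_def[abs_def]
    by (intro smooth_on_mult smooth_on_divide smooth_on_diff smooth_on_const smooth_on_norm_sq Cc_smooth_smooth[OF \<phi>C] open_pball
        smooth_on_compose[OF _ _ smooth_on_sqrt] sn) (use q1 in \<open>auto intro!: divide_pos_pos\<close>)
  then have vC: "v \<in> Cc_smooth pball" by (rule Cc_smoothI[OF open_pball K']) (simp add: v_def \<phi>0)
  have \<psi>: "sqrt (2 * norm x) / (1 - (norm x)\<^sup>2) * v x = 1 / sqrt (1 - (norm x)\<^sup>2) * \<phi> x" for x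
    proof (cases "x \<in> pball")
      case True
      define s where "s = 1 - (norm x)\<^sup>2"
      have s: "0 < s" "sqrt s * sqrt s = s" "sqrt s \<noteq> 0" "sqrt (2 * norm x) \<noteq> 0" using q1[OF True] by (auto simp: s_def)
      have "sqrt (2 * norm x) / s * (sqrt s / sqrt (2 * norm x)) = 1 / sqrt s"
        using s by (simp add: field_simps)
      then show ?thesis unfolding v_def s_def[symmetric] real_sqrt_divide by (metis mult.assoc)
    next
      case False
      then have "\<phi> x = 0" by (simp only: \<phi>_def if_False)
      then show ?thesis by (simp add: v_def)
    qed
  note gs = ground_state[OF vC, unfolded \<psi>]
  have "HE v \<le> H1 v + 1 / 4 * H2 v + D"
    unfolding gs(2) D_def using ground_state_upper[OF \<phi>C gs(1)] by simp
  moreover have "D < C * HN p \<alpha> v powr (2 / p)"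
  proof -
    have HN0: "0 \<le> HN p \<alpha> v"
    proof (rule Bochner_Integration.integral_nonneg)
      fix x :: "real^3"
      show "0 \<le> hfactor x ^ 3 * ((hfactor x * norm x) powr ((p - 6) / 2) * X (\<alpha> * norm x) powr ((p + 2) / 2) * \<bar>v x\<bar> powr p)"
      proof (cases "x \<in> pball")
        case True
        then have "0 < hfactor x" using hfactor_pos by auto
        then show ?thesis by simp
      next
        case False
        then have "v x = 0" by (simp only: v_def \<phi>_def if_False mult_zero_right)
        then show ?thesis using p by simp
      qed
    qed
    have gm[measurable]: "g \<in> borel_measurable borel"
      using smooth_on_continuous[OF Cc_smooth_smooth[OF g(1)]] by (rule borel_measurable_continuous_onI)
    have g0: "g y = 0" if "y \<notin> ym.Y ` pball" for y
      using that K(2,3) R(2) unfolding YB by fastforce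
    have "Nw p g = (LINT x|lborel. indicator pball x * ((ym.lt x)\<^sup>2 * ym.lr x * (norm (ym.Y x) powr ((p - 6) / 2) * \<bar>g (ym.Y x)\<bar> powr p)))"
      by (rule ym.Y_integral(1)) (use g0 p in auto)
    also have "\<dots> = (LINT x|lborel. L powr (p / 2) * (hfactor x ^ 3 * ((hfactor x * norm x) powr ((p - 6) / 2) * X (\<alpha> * norm x) powr ((p + 2) / 2) * \<bar>v x\<bar> powr p)))"
    proof (rule Bochner_Integration.integral_cong[OF refl])
      fix x :: "real^3"
      show "indicator pball x * ((ym.lt x)\<^sup>2 * ym.lr x * (norm (ym.Y x) powr ((p - 6) / 2) * \<bar>g (ym.Y x)\<bar> powr p))
        = L powr (p / 2) * (hfactor x ^ 3 * ((hfactor x * norm x) powr ((p - 6) / 2) * X (\<alpha> * norm x) powr ((p + 2) / 2) * \<bar>v x\<bar> powr p))"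
      proof (cases "x \<in> pball")
        case True
        define r s \<sigma> where "r = norm x" and "s = 1 - r\<^sup>2" and "\<sigma> = A - ln r"
        have r: "0 < r" and s: "0 < s" using q1[OF True] by (auto simp: r_def s_def)
        have \<sigma>: "0 < \<sigma>" using ym.S_pos[OF True] by (simp add: Sg \<sigma>_def r_def)
        have h: "hfactor x = 2 / s" by (simp add: hfactor_def s_def r_def)
        have X: "X (\<alpha> * r) powr ((p + 2) / 2) = \<sigma> powr (- ((p + 2) / 2))"
          using X_scaled_powr[OF \<alpha>(1) r, of "(p + 2) / 2"] \<sigma> by (simp add: \<sigma>_def A_def)
        have J: "(ym.lt x)\<^sup>2 * ym.lr x = L ^ 3 / (r ^ 3 * \<sigma> ^ 4)"
          unfolding ym.lt_def ym.lr_def ym.kk_def Sg r_def[symmetric] \<sigma>_def[symmetric]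
          by (simp add: power_divide power_mult_distrib eval_nat_numeral mult_ac)
        have N: "norm (ym.Y x) = L / \<sigma>" using ym.norm_Y[OF True] by (simp add: Sg \<sigma>_def r_def)
        have e: "3 + (p - 6) / 2 = p / 2" "- 4 + - ((p - 6) / 2) = - ((p + 2) / 2)" by (simp_all add: field_simps)
        have a: "L ^ 3 * L powr ((p - 6) / 2) = L powr (p / 2)"
          unfolding e(1)[symmetric] powr_add using L by (simp add: powr_numeral)
        have b: "\<sigma> powr (- 4) * \<sigma> powr (- ((p - 6) / 2)) = \<sigma> powr (- ((p + 2) / 2))"
          unfolding e(2)[symmetric] powr_add ..
        have c: "1 / (r ^ 3 * \<sigma> ^ 4) = r powr (- 3) * \<sigma> powr (- 4)"
          using r \<sigma> by (simp add: powr_minus powr_numeral field_simps)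
        have d: "(L / \<sigma>) powr ((p - 6) / 2) = L powr ((p - 6) / 2) * \<sigma> powr (- ((p - 6) / 2))"
          using L \<sigma> by (simp add: powr_divide powr_minus_divide)
        have "L ^ 3 / (r ^ 3 * \<sigma> ^ 4) * (L / \<sigma>) powr ((p - 6) / 2) = L ^ 3 * (1 / (r ^ 3 * \<sigma> ^ 4)) * (L / \<sigma>) powr ((p - 6) / 2)"
          by simp
        also have "\<dots> = (L ^ 3 * L powr ((p - 6) / 2)) * (r powr (- 3) * (\<sigma> powr (- 4) * \<sigma> powr (- ((p - 6) / 2))))"
          unfolding c d by (simp only: mult_ac)
        finally have 1: "L ^ 3 / (r ^ 3 * \<sigma> ^ 4) * (L / \<sigma>) powr ((p - 6) / 2) = L powr (p / 2) * (r powr (- 3) * \<sigma> powr (- ((p + 2) / 2)))"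
          unfolding a b .
        have V: "\<bar>v x\<bar> powr p = (s powr (p / 2) / (2 * r) powr (p / 2)) * \<bar>\<phi> x\<bar> powr p"
          unfolding v_def r_def[symmetric] s_def[symmetric] using r s
          by (simp add: abs_mult powr_mult powr_divide powr_half_sqrt[symmetric] powr_powr real_sqrt_divide)
        have "s powr (- (p / 2)) * s powr (p / 2) = 1" using s unfolding powr_add[symmetric] by simp
        then have "(2 * r) powr (p / 2) * s powr (- (p / 2)) * (s powr (p / 2) / (2 * r) powr (p / 2)) = 1"
          using r by simp
        then have 2: "(2 / s) ^ 3 * (2 / s * r) powr ((p - 6) / 2) * (s powr (p / 2) / (2 * r) powr (p / 2)) = r powr (- 3)"
          unfolding hyperbolic_weight_identity[OF r s] by (metis mult.assoc mult.right_neutral)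
        have "\<phi> x = g (ym.Y x)" using True by (simp add: \<phi>_def)
        then have "indicator pball x * ((ym.lt x)\<^sup>2 * ym.lr x * (norm (ym.Y x) powr ((p - 6) / 2) * \<bar>g (ym.Y x)\<bar> powr p))
          = (L ^ 3 / (r ^ 3 * \<sigma> ^ 4) * (L / \<sigma>) powr ((p - 6) / 2)) * \<bar>\<phi> x\<bar> powr p"
          using True by (simp only: J N indicator_simps mult_1 mult.assoc)
        also have "\<dots> = L powr (p / 2) * (((2 / s) ^ 3 * (2 / s * r) powr ((p - 6) / 2) * (s powr (p / 2) / (2 * r) powr (p / 2))) * \<sigma> powr (- ((p + 2) / 2)) * \<bar>\<phi> x\<bar> powr p)"
          unfolding 1 2 by (simp only: mult.assoc)
        also have "\<dots> = L powr (p / 2) * (hfactor x ^ 3 * ((hfactor x * r) powr ((p - 6) / 2) * X (\<alpha> * r) powr ((p + 2) / 2) * \<bar>v x\<bar> powr p))"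
          unfolding h X V by (simp only: mult_ac)
        finally show ?thesis unfolding r_def .
      next
        case False
        then have "v x = 0" by (simp only: v_def \<phi>_def if_False mult_zero_right)
        then show ?thesis using False p by simp
      qed
    qed
    \<comment> \<open>Raising to the power 2/p turns the factor into \<open>L\<close>, the same as
      for the energy, so the scale cancels from the quotient.\<close>
    finally have "Nw p g = L powr (p / 2) * HN p \<alpha> v" by simp
    then have "Nw p g powr (2 / p) = L * HN p \<alpha> v powr (2 / p)"
      using p L HN0 by (simp add: powr_mult powr_powr)
    then have "L * D < L * (C * HN p \<alpha> v powr (2 / p))" using less unfolding ED by (simp add: mult.left_commute)
    then show ?thesis using L by simp
  qed
  moreover have "v \<in> Cc_smooth hspace" by (rule Cc_smooth_mono[OF _ vC]) auto
  ultimately show ?thesis by (intro bexI[of _ v]) linarith+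
qed

theorem theorem3:
  fixes p :: real and x0 :: "real^3"
  assumes "2 < p" and "p \<le> 6" and "x0 \<in> hspace"
  shows "\<exists>\<alpha>3. 0 < \<alpha>3 \<and> \<alpha>3 < exp 1 \<and>
    (\<forall>\<alpha>. 0 < \<alpha> \<and> \<alpha> \<le> \<alpha>3 \<longrightarrow>
      (\<forall>v \<in> Cc_smooth hspace.
        (LINT x|hvol. hmetric x (hgrad v x) (hgrad v x))
          \<ge> (LINT x|hvol. (v x)\<^sup>2)
            + 1 / 4 * (LINT x|hvol. (v x)\<^sup>2 / (sinh (hdist x0 x))\<^sup>2)
            + S3 p * (LINT x|hvol. sinh (hdist x0 x) powr ((p - 6) / 2)
                * X (\<alpha> * tanh (hdist x0 x / 2)) powr ((p + 2) / 2) * \<bar>v x\<bar> powr p) powr (2 / p))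
      \<and>
      (\<forall>C > S3 p. \<not> (\<forall>v \<in> Cc_smooth hspace.
        (LINT x|hvol. hmetric x (hgrad v x) (hgrad v x))
          \<ge> (LINT x|hvol. (v x)\<^sup>2)
            + 1 / 4 * (LINT x|hvol. (v x)\<^sup>2 / (sinh (hdist x0 x))\<^sup>2)
            + C * (LINT x|hvol. sinh (hdist x0 x) powr ((p - 6) / 2)
                * X (\<alpha> * tanh (hdist x0 x / 2)) powr ((p + 2) / 2) * \<bar>v x\<bar> powr p) powr (2 / p))))"
proof -
  \<comment> \<open>\<alpha> \<le> exp (1 - B) means 1 - ln \<alpha> \<ge> B, which is what the
    inequality at the origin demands. The entry 64 also gives exp (1 - B) < exp 1.\<close>
  define B where "B = max 64 (27648 * (1 + measure lborel (ball (0::real^3) 1)) * S3 p)"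
  obtain T :: "(real^3 \<Rightarrow> real) \<Rightarrow> real^3 \<Rightarrow> real" where T: "\<And>v. v \<in> Cc_smooth hspace \<Longrightarrow> T v \<in> Cc_smooth hspace"
    "\<And>v. v \<in> Cc_smooth hspace \<Longrightarrow> T (T v) = v"
    and TE: "\<And>v. v \<in> Cc_smooth hspace \<Longrightarrow>
      (LINT x|hvol. hmetric x (hgrad (T v) x) (hgrad (T v) x)) = (LINT x|hvol. hmetric x (hgrad v x) (hgrad v x))"
    and TI: "\<And>v \<Phi>. v \<in> Cc_smooth hspace \<Longrightarrow> (\<lambda>z. \<Phi> (fst z) (snd z)) \<in> borel_measurable (borel :: (real \<times> real) measure) \<Longrightarrow>
      (LINT x|hvol. \<Phi> (hdist 0 x) (T v x)) = (LINT x|hvol. \<Phi> (hdist x0 x) (v x) :: real)"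
    using move_to_origin[OF assms(3)] by blast
  have Xm[measurable]: "X \<in> borel_measurable borel" unfolding X_def[abs_def] by measurable
  have cm[measurable]: "(\<lambda>t::real. sinh t) \<in> borel_measurable borel" "(\<lambda>t::real. tanh t) \<in> borel_measurable borel"
    "(\<lambda>t::real. tanh (t / 2)) \<in> borel_measurable borel"
    by (auto intro!: borel_measurable_continuous_onI continuous_intros)
  note fst_snd_borel[measurable]
  have mv: "(LINT x|hvol. hmetric x (hgrad v x) (hgrad v x)) = HE (T v)"
      "(LINT x|hvol. (v x)\<^sup>2) = H1 (T v)"
      "(LINT x|hvol. (v x)\<^sup>2 / (sinh (hdist x0 x))\<^sup>2) = H2 (T v)"
      "(LINT x|hvol. sinh (hdist x0 x) powr ((p - 6) / 2) * X (\<alpha> * tanh (hdist x0 x / 2)) powr ((p + 2) / 2) * \<bar>v x\<bar> powr p) = HN p \<alpha> (T v)"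
    if v: "v \<in> Cc_smooth hspace" for v \<alpha>
  proof -
    note o = hyperbolic_integrals_origin[OF T(1)[OF v]]
    show "(LINT x|hvol. hmetric x (hgrad v x) (hgrad v x)) = HE (T v)"
      using TE[OF v] o(1) by simp
    have "(\<lambda>z::real \<times> real. (snd z)\<^sup>2) \<in> borel_measurable borel" by measurable
    from TI[OF v, where \<Phi>="\<lambda>t s. s\<^sup>2", OF this] show "(LINT x|hvol. (v x)\<^sup>2) = H1 (T v)"
      using o(2) by simp
    have "(\<lambda>z::real \<times> real. (snd z)\<^sup>2 / (sinh (fst z))\<^sup>2) \<in> borel_measurable borel" by measurable
    from TI[OF v, where \<Phi>="\<lambda>t s. s\<^sup>2 / (sinh t)\<^sup>2", OF this]
    show "(LINT x|hvol. (v x)\<^sup>2 / (sinh (hdist x0 x))\<^sup>2) = H2 (T v)"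
      using o(3) by simp
    have "(\<lambda>z::real \<times> real. sinh (fst z) powr ((p - 6) / 2) * X (\<alpha> * tanh (fst z / 2)) powr ((p + 2) / 2) * \<bar>snd z\<bar> powr p) \<in> borel_measurable borel"
      by measurable
    from TI[OF v, where \<Phi>="\<lambda>t s. sinh t powr ((p - 6) / 2) * X (\<alpha> * tanh (t / 2)) powr ((p + 2) / 2) * \<bar>s\<bar> powr p", OF this]
    show "(LINT x|hvol. sinh (hdist x0 x) powr ((p - 6) / 2) * X (\<alpha> * tanh (hdist x0 x / 2)) powr ((p + 2) / 2) * \<bar>v x\<bar> powr p) = HN p \<alpha> (T v)"
      using o(4)[of p \<alpha>] assms(1) by simp
  qed
  show ?thesis
  proof (intro exI[of _ "exp (1 - B)"] conjI allI impI ballI; (elim conjE)?)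
    show "0 < exp (1 - B)" by simp
    show "exp (1 - B) < exp 1" by (simp add: B_def max_def)
  next
    fix \<alpha> :: real and v assume \<alpha>: "0 < \<alpha>" "\<alpha> \<le> exp (1 - B)" and v: "v \<in> Cc_smooth hspace"
    have "ln \<alpha> \<le> 1 - B" using \<alpha> by (metis exp_gt_zero ln_exp ln_le_cancel_iff)
    then have "64 \<le> 1 - ln \<alpha>" "27648 * (1 + measure lborel (ball (0::real^3) 1)) * S3 p \<le> 1 - ln \<alpha>"
      by (auto simp: B_def)
    from hyperbolic_inequality_origin[OF assms(1,2) T(1)[OF v] \<alpha>(1) this]
    show "(LINT x|hvol. (v x)\<^sup>2) + 1 / 4 * (LINT x|hvol. (v x)\<^sup>2 / (sinh (hdist x0 x))\<^sup>2)
        + S3 p * (LINT x|hvol. sinh (hdist x0 x) powr ((p - 6) / 2) * X (\<alpha> * tanh (hdist x0 x / 2)) powr ((p + 2) / 2) * \<bar>v x\<bar> powr p) powr (2 / p)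
      \<le> (LINT x|hvol. hmetric x (hgrad v x) (hgrad v x))"
      unfolding mv[OF v] .
  next
    fix \<alpha> C :: real assume \<alpha>: "0 < \<alpha>" "\<alpha> \<le> exp (1 - B)" and C: "S3 p < C"
    have "ln \<alpha> \<le> 1 - B" using \<alpha> by (metis exp_gt_zero ln_exp ln_le_cancel_iff)
    then have "0 < 1 - ln \<alpha>" by (auto simp: B_def)
    from sharpness_origin[OF assms(1,2) \<alpha>(1) this C]
    obtain v where v: "v \<in> Cc_smooth hspace" "HE v < H1 v + 1 / 4 * H2 v + C * HN p \<alpha> v powr (2 / p)" by blast
    show "\<not> (\<forall>v \<in> Cc_smooth hspace.
        (LINT x|hvol. (v x)\<^sup>2) + 1 / 4 * (LINT x|hvol. (v x)\<^sup>2 / (sinh (hdist x0 x))\<^sup>2)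
        + C * (LINT x|hvol. sinh (hdist x0 x) powr ((p - 6) / 2) * X (\<alpha> * tanh (hdist x0 x / 2)) powr ((p + 2) / 2) * \<bar>v x\<bar> powr p) powr (2 / p)
      \<le> (LINT x|hvol. hmetric x (hgrad v x) (hgrad v x)))"
    proof
      assume "\<forall>v \<in> Cc_smooth hspace.
        (LINT x|hvol. (v x)\<^sup>2) + 1 / 4 * (LINT x|hvol. (v x)\<^sup>2 / (sinh (hdist x0 x))\<^sup>2)
        + C * (LINT x|hvol. sinh (hdist x0 x) powr ((p - 6) / 2) * X (\<alpha> * tanh (hdist x0 x / 2)) powr ((p + 2) / 2) * \<bar>v x\<bar> powr p) powr (2 / p)
      \<le> (LINT x|hvol. hmetric x (hgrad v x) (hgrad v x))"
      \<comment> \<open>The counterexample with centre \<open>x0\<close> is \<open>T v\<close>, and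
        applying \<open>T\<close> once more returns the centred function \<open>v\<close>.\<close>
      from bspec[OF this T(1)[OF v(1)], unfolded mv[OF T(1)[OF v(1)]] T(2)[OF v(1)]] v(2)
      show False by linarith
    qed
  qed
qed

end
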